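(* Let $\mathcal{A}$ be a reflexive graph, and let $X$ be a type equipped with a morphism $f:\mathsf{rGph}(\mathcal{A},\Delta(X))$ of reflexive graphs. Then the following are equivalent: (i) $f$ exhibits $X$ as a reflexive coequalizer of $\mathcal{A}$; (ii) the square $$\begin{array}{ccc}\sum_{x,y:A_0}A_1(x,y)&\xrightarrow{\ \pi_2\ }&A_0\\ {\scriptstyle\pi_1}\downarrow&&\downarrow{\scriptstyle f_0}\\ A_0&\xrightarrow{\ f_0\ }&X\end{array}$$ with $\pi_1(x,y,e)=x$, $\pi_2(x,y,e)=y$, which commutes by the homotopy $(x,y,e)\mapsto f_1(e)$, is a pushout square. In particular, every reflexive graph has a reflexive coequalizer.
   Context: Setting: Martin-Löf dependent type theory with the usual type formers (including natural numbers and identity types) and univalent universes closed under these type formers and under homotopy pushouts; $\mathcal{U}$ is such a universe, and function extensionality holds. A reflexive graph $\mathcal{A}$ (in $\mathcal{U}$) is a triple $(A_0,A_1,\mathsf{rfx}_{\mathcal{A}})$ with $A_0:\mathcal{U}$, $A_1:A_0\to A_0\to\mathcal{U}$, $\mathsf{rfx}_{\mathcal{A}}:\prod_{i:A_0}A_1(i,i)$. A morphism $f:\mathsf{rGph}(\mathcal{A},\mathcal{B})$ is a triple of $f_0:A_0\to B_0$, $f_1:\prod_{i,j}A_1(i,j)\to B_1(f_0(i),f_0(j))$ and $\mathsf{rfx}_f:\prod_{i}f_1(\mathsf{rfx}_{\mathcal{A}}(i))=\mathsf{rfx}_{\mathcal{B}}(f_0(i))$. For a type $X$ the discrete graph $\Delta(X)$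 has vertices $X$, edges $x=_Xy$, and reflexivity $\mathsf{refl}$. A map $h:X\to Y$ induces $\Delta(h):\mathsf{rGph}(\Delta X,\Delta Y)$ given by $h$, $\mathsf{ap}_h$ and the trivial reflexivity datum; morphisms compose in the evident way. $f:\mathsf{rGph}(\mathcal{A},\Delta(X))$ is a reflexive coequalizer of $\mathcal{A}$ if for every type $Y$ the map $(X\to Y)\to\mathsf{rGph}(\mathcal{A},\Delta(Y))$, $h\mapsto\Delta(h)\circ f$, is an equivalence. A commuting square $u:S\to A$, $v:S\to B$, $i:A\to X$, $j:B\to X$, $H:i\circ u\sim j\circ v$ is a pushout square if for every type $Y$ the map $(X\to Y)\to\sum_{p:A\to Y}\sum_{q:B\to Y}(p\circ u\sim q\circ v)$, $h\mapsto(h\circ i,h\circ j,\lambda s.\,\mathsf{ap}_h(H(s)))$, is an equivalence. *)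

theory Defs
  imports Main
begin

section \<open>Raw syntax\<close>

text \<open>
  The object theory is intensional Martin-Loef type theory with a cumulative hierarchy of
  Russell-style univalent universes, given by its derivation rules over de Bruijn terms.
  Its axioms (function extensionality, univalence) and the path computation rule of pushouts
  are constants without reduction behaviour, as in Appendix A.2 of the HoTT book.

  Binding structure (the number of variables a constructor binds in an argument):
    \<^item> 1 in the last argument of \<open>Pi\<close>, \<open>Lam\<close>, \<open>Sig\<close>;
    \<^item> \<open>J A C d a b p\<close>: 3 in the motive \<open>C\<close> (two endpoints, then the path), 1 in \<open>d\<close>;
    \<^item> \<open>EmptyRec C t\<close>, \<open>UnitRec C c t\<close>: 1 in \<open>C\<close>;
    \<^item> \<open>SumRec C l r t\<close>: 1 in each of \<open>C\<close>, \<open>l\<close>, \<open>r\<close>;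
    \<^item> \<open>NatRec C z s t\<close>: 1 in \<open>C\<close>, and 2 in \<open>s\<close> (predecessor, then recursive value);
    \<^item> \<open>PoRec S A B u v C l r g t\<close> and \<open>PoBeta S A B u v C l r g s\<close>:
      1 in each of \<open>C\<close>, \<open>l\<close>, \<open>r\<close>, \<open>g\<close>;
    \<^item> \<open>FunExt A B f g\<close>: 1 in \<open>B\<close>.
  \<open>Po S A B u v\<close> is the pushout of \<open>u : S \<rightarrow> A\<close> and \<open>v : S \<rightarrow> B\<close>.
\<close>

datatype tm =
    Var nat
  | U nat
  | Pi tm tm | Lam tm tm | App tm tm
  | Sig tm tm | Pair tm tm | Fst tm | Snd tm
  | Eq tm tm tm | Refl tm | J tm tm tm tm tm tm
  | EmptyT | EmptyRec tm tm
  | UnitT | Star | UnitRec tm tm tm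
  | SumT tm tm | InL tm | InR tm | SumRec tm tm tm tm
  | NatT | Zero | Succ tm | NatRec tm tm tm tm
  | Po tm tm tm tm tm | PoL tm | PoR tm | Glue tm
  | PoRec tm tm tm tm tm tm tm tm tm tm
  | PoBeta tm tm tm tm tm tm tm tm tm tm
  | FunExt tm tm tm tm
  | Univalence nat tm tm

text \<open>\<open>a ;; \<sigma>\<close> sends variable \<open>0\<close> to \<open>a\<close> and variable \<open>n + 1\<close> to \<open>\<sigma> n\<close>.\<close>

abbreviation scons :: "'a \<Rightarrow> (nat \<Rightarrow> 'a) \<Rightarrow> nat \<Rightarrow> 'a" (infixr ";;" 60)
  where "a ;; \<sigma> \<equiv> case_nat a \<sigma>"

definition lift :: "(nat \<Rightarrow> nat) \<Rightarrow> nat \<Rightarrow> nat"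
  where "lift \<rho> = (0 ;; (\<lambda>n. Suc (\<rho> n)))"

primrec ren :: "(nat \<Rightarrow> nat) \<Rightarrow> tm \<Rightarrow> tm" where
  "ren \<rho> (Var n) = Var (\<rho> n)"
| "ren \<rho> (U i) = U i"
| "ren \<rho> (Pi A B) = Pi (ren \<rho> A) (ren (lift \<rho>) B)"
| "ren \<rho> (Lam A b) = Lam (ren \<rho> A) (ren (lift \<rho>) b)"
| "ren \<rho> (App f a) = App (ren \<rho> f) (ren \<rho> a)"
| "ren \<rho> (Sig A B) = Sig (ren \<rho> A) (ren (lift \<rho>) B)"
| "ren \<rho> (Pair a b) = Pair (ren \<rho> a) (ren \<rho> b)"
| "ren \<rho> (Fst t) = Fst (ren \<rho> t)"
| "ren \<rho> (Snd t) = Snd (ren \<rho> t)"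
| "ren \<rho> (Eq A a b) = Eq (ren \<rho> A) (ren \<rho> a) (ren \<rho> b)"
| "ren \<rho> (Refl a) = Refl (ren \<rho> a)"
| "ren \<rho> (J A C d a b p) =
     J (ren \<rho> A) (ren (lift (lift (lift \<rho>))) C) (ren (lift \<rho>) d) (ren \<rho> a) (ren \<rho> b) (ren \<rho> p)"
| "ren \<rho> EmptyT = EmptyT"
| "ren \<rho> (EmptyRec C t) = EmptyRec (ren (lift \<rho>) C) (ren \<rho> t)"
| "ren \<rho> UnitT = UnitT"
| "ren \<rho> Star = Star"
| "ren \<rho> (UnitRec C c t) = UnitRec (ren (lift \<rho>) C) (ren \<rho> c) (ren \<rho> t)"
| "ren \<rho> (SumT A B) = SumT (ren \<rho> A) (ren \<rho> B)"
| "ren \<rho> (InL a) = InL (ren \<rho> a)"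
| "ren \<rho> (InR b) = InR (ren \<rho> b)"
| "ren \<rho> (SumRec C l r t) =
     SumRec (ren (lift \<rho>) C) (ren (lift \<rho>) l) (ren (lift \<rho>) r) (ren \<rho> t)"
| "ren \<rho> NatT = NatT"
| "ren \<rho> Zero = Zero"
| "ren \<rho> (Succ t) = Succ (ren \<rho> t)"
| "ren \<rho> (NatRec C z s t) =
     NatRec (ren (lift \<rho>) C) (ren \<rho> z) (ren (lift (lift \<rho>)) s) (ren \<rho> t)"
| "ren \<rho> (Po S A B u v) = Po (ren \<rho> S) (ren \<rho> A) (ren \<rho> B) (ren \<rho> u) (ren \<rho> v)"
| "ren \<rho> (PoL a) = PoL (ren \<rho> a)"
| "ren \<rho> (PoR b) = PoR (ren \<rho> b)"
| "ren \<rho> (Glue s) = Glue (ren \<rho> s)"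
| "ren \<rho> (PoRec S A B u v C l r g t) =
     PoRec (ren \<rho> S) (ren \<rho> A) (ren \<rho> B) (ren \<rho> u) (ren \<rho> v)
       (ren (lift \<rho>) C) (ren (lift \<rho>) l) (ren (lift \<rho>) r) (ren (lift \<rho>) g) (ren \<rho> t)"
| "ren \<rho> (PoBeta S A B u v C l r g s) =
     PoBeta (ren \<rho> S) (ren \<rho> A) (ren \<rho> B) (ren \<rho> u) (ren \<rho> v)
       (ren (lift \<rho>) C) (ren (lift \<rho>) l) (ren (lift \<rho>) r) (ren (lift \<rho>) g) (ren \<rho> s)"
| "ren \<rho> (FunExt A B f g) = FunExt (ren \<rho> A) (ren (lift \<rho>) B) (ren \<rho> f) (ren \<rho> g)"
| "ren \<rho> (Univalence i A B) = Univalence i (ren \<rho> A) (ren \<rho> B)"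

definition up :: "(nat \<Rightarrow> tm) \<Rightarrow> nat \<Rightarrow> tm"
  where "up \<sigma> = (Var 0 ;; (\<lambda>n. ren Suc (\<sigma> n)))"

primrec sub :: "(nat \<Rightarrow> tm) \<Rightarrow> tm \<Rightarrow> tm" where
  "sub \<sigma> (Var n) = \<sigma> n"
| "sub \<sigma> (U i) = U i"
| "sub \<sigma> (Pi A B) = Pi (sub \<sigma> A) (sub (up \<sigma>) B)"
| "sub \<sigma> (Lam A b) = Lam (sub \<sigma> A) (sub (up \<sigma>) b)"
| "sub \<sigma> (App f a) = App (sub \<sigma> f) (sub \<sigma> a)"
| "sub \<sigma> (Sig A B) = Sig (sub \<sigma> A) (sub (up \<sigma>) B)"
| "sub \<sigma> (Pair a b) = Pair (sub \<sigma> a) (sub \<sigma> b)"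
| "sub \<sigma> (Fst t) = Fst (sub \<sigma> t)"
| "sub \<sigma> (Snd t) = Snd (sub \<sigma> t)"
| "sub \<sigma> (Eq A a b) = Eq (sub \<sigma> A) (sub \<sigma> a) (sub \<sigma> b)"
| "sub \<sigma> (Refl a) = Refl (sub \<sigma> a)"
| "sub \<sigma> (J A C d a b p) =
     J (sub \<sigma> A) (sub (up (up (up \<sigma>))) C) (sub (up \<sigma>) d) (sub \<sigma> a) (sub \<sigma> b) (sub \<sigma> p)"
| "sub \<sigma> EmptyT = EmptyT"
| "sub \<sigma> (EmptyRec C t) = EmptyRec (sub (up \<sigma>) C) (sub \<sigma> t)"
| "sub \<sigma> UnitT = UnitT"
| "sub \<sigma> Star = Star"
| "sub \<sigma> (UnitRec C c t) = UnitRec (sub (up \<sigma>) C) (sub \<sigma> c) (sub \<sigma> t)"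
| "sub \<sigma> (SumT A B) = SumT (sub \<sigma> A) (sub \<sigma> B)"
| "sub \<sigma> (InL a) = InL (sub \<sigma> a)"
| "sub \<sigma> (InR b) = InR (sub \<sigma> b)"
| "sub \<sigma> (SumRec C l r t) =
     SumRec (sub (up \<sigma>) C) (sub (up \<sigma>) l) (sub (up \<sigma>) r) (sub \<sigma> t)"
| "sub \<sigma> NatT = NatT"
| "sub \<sigma> Zero = Zero"
| "sub \<sigma> (Succ t) = Succ (sub \<sigma> t)"
| "sub \<sigma> (NatRec C z s t) =
     NatRec (sub (up \<sigma>) C) (sub \<sigma> z) (sub (up (up \<sigma>)) s) (sub \<sigma> t)"
| "sub \<sigma> (Po S A B u v) = Po (sub \<sigma> S) (sub \<sigma> A) (sub \<sigma> B) (sub \<sigma> u) (sub \<sigma> v)"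
| "sub \<sigma> (PoL a) = PoL (sub \<sigma> a)"
| "sub \<sigma> (PoR b) = PoR (sub \<sigma> b)"
| "sub \<sigma> (Glue s) = Glue (sub \<sigma> s)"
| "sub \<sigma> (PoRec S A B u v C l r g t) =
     PoRec (sub \<sigma> S) (sub \<sigma> A) (sub \<sigma> B) (sub \<sigma> u) (sub \<sigma> v)
       (sub (up \<sigma>) C) (sub (up \<sigma>) l) (sub (up \<sigma>) r) (sub (up \<sigma>) g) (sub \<sigma> t)"
| "sub \<sigma> (PoBeta S A B u v C l r g s) =
     PoBeta (sub \<sigma> S) (sub \<sigma> A) (sub \<sigma> B) (sub \<sigma> u) (sub \<sigma> v)
       (sub (up \<sigma>) C) (sub (up \<sigma>) l) (sub (up \<sigma>) r) (sub (up \<sigma>) g) (sub \<sigma> s)"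
| "sub \<sigma> (FunExt A B f g) = FunExt (sub \<sigma> A) (sub (up \<sigma>) B) (sub \<sigma> f) (sub \<sigma> g)"
| "sub \<sigma> (Univalence i A B) = Univalence i (sub \<sigma> A) (sub \<sigma> B)"

definition shift :: "nat \<Rightarrow> nat \<Rightarrow> tm"
  where "shift k n = Var (n + k)"

definition wk :: "nat \<Rightarrow> tm \<Rightarrow> tm"
  where "wk k t = ren (\<lambda>n. n + k) t"

text \<open>
  \<open>wk1 k t\<close> weakens by \<open>k\<close> a term with one distinguished innermost variable, which is kept;
  \<open>inst t a\<close> replaces that variable by \<open>a\<close>.
\<close>

definition wk1 :: "nat \<Rightarrow> tm \<Rightarrow> tm"
  where "wk1 k t = ren (lift (\<lambda>n. n + k)) t"

definition inst :: "tm \<Rightarrow> tm \<Rightarrow> tm"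
  where "inst t a = sub (a ;; Var) t"


section \<open>Derived type-theoretic operations\<close>

text \<open>
  These are abbreviations for raw terms over an arbitrary context. An argument that is put under
  \<open>k\<close> binders is weakened by \<open>wk k\<close>; the variables named in the comments are listed from the
  outermost to the innermost binder, so the last one is \<open>Var 0\<close>.
\<close>

definition arr :: "tm \<Rightarrow> tm \<Rightarrow> tm"
  where "arr A B = Pi A (wk 1 B)"

definition prodT :: "tm \<Rightarrow> tm \<Rightarrow> tm"
  where "prodT A B = Sig A (wk 1 B)"

definition iffT :: "tm \<Rightarrow> tm \<Rightarrow> tm"
  where "iffT A B = prodT (arr A B) (arr B A)"

abbreviation App2 :: "tm \<Rightarrow> tm \<Rightarrow> tm \<Rightarrow> tm"
  where "App2 f a b \<equiv> App (App f a) b"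

abbreviation App3 :: "tm \<Rightarrow> tm \<Rightarrow> tm \<Rightarrow> tm \<Rightarrow> tm"
  where "App3 f a b c \<equiv> App (App (App f a) b) c"

text \<open>\<open>g \<circ> f = \<lambda>x:A. g (f x)\<close>\<close>

definition compose :: "tm \<Rightarrow> tm \<Rightarrow> tm \<Rightarrow> tm"
  where "compose A g f = Lam A (App (wk 1 g) (App (wk 1 f) (Var 0)))"

text \<open>Homotopies \<open>\<Prod>x:A. f x = g x\<close> between dependent functions, where \<open>B\<close> depends on \<open>x\<close>\<close>

definition htpy :: "tm \<Rightarrow> tm \<Rightarrow> tm \<Rightarrow> tm \<Rightarrow> tm"
  where "htpy A B f g = Pi A (Eq B (App (wk 1 f) (Var 0)) (App (wk 1 g) (Var 0)))"

text \<open>Transport of \<open>t : C a\<close> along \<open>p : a = b\<close>, where \<open>C\<close> depends on a variable of type \<open>A\<close>\<close>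

definition transport :: "tm \<Rightarrow> tm \<Rightarrow> tm \<Rightarrow> tm \<Rightarrow> tm \<Rightarrow> tm \<Rightarrow> tm" where
  "transport A C a b p t =
     App (J A (arr (sub (Var 2 ;; shift 3) C) (sub (Var 1 ;; shift 3) C)) (Lam C (Var 0)) a b p) t"

text \<open>For \<open>e : C\<close> depending on a variable of type \<open>A\<close>: the path from the transport of \<open>e[a]\<close> to \<open>e[b]\<close>\<close>

definition apd :: "tm \<Rightarrow> tm \<Rightarrow> tm \<Rightarrow> tm \<Rightarrow> tm \<Rightarrow> tm \<Rightarrow> tm" where
  "apd A C e a b p =
     J A (Eq (sub (Var 1 ;; shift 3) C)
             (transport (wk 3 A) (wk1 3 C) (Var 2) (Var 1) (Var 0) (sub (Var 2 ;; shift 3) e))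
             (sub (Var 1 ;; shift 3) e))
       (Refl e) a b p"

text \<open>\<open>ap\<close> for a function term \<open>f : A \<rightarrow> B\<close>\<close>

definition ap :: "tm \<Rightarrow> tm \<Rightarrow> tm \<Rightarrow> tm \<Rightarrow> tm \<Rightarrow> tm \<Rightarrow> tm" where
  "ap A B f a b p =
     J A (Eq (wk 3 B) (App (wk 3 f) (Var 2)) (App (wk 3 f) (Var 1)))
       (Refl (App (wk 1 f) (Var 0))) a b p"

text \<open>Concatenation of \<open>p : a = b\<close> and \<open>q : b = c\<close> in \<open>A\<close>\<close>

definition concat_path :: "tm \<Rightarrow> tm \<Rightarrow> tm \<Rightarrow> tm \<Rightarrow> tm \<Rightarrow> tm \<Rightarrow> tm"
  where "concat_path A a b c p q = transport A (Eq (wk 1 A) (wk 1 a) (Var 0)) b c q p"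

text \<open>
  Equivalences are bi-invertible maps: \<open>isequiv A B f\<close> is
  \<open>(\<Sum>g:B\<rightarrow>A. \<Prod>y:B. f (g y) = y) \<times> (\<Sum>h:B\<rightarrow>A. \<Prod>x:A. h (f x) = x)\<close>.
\<close>

definition isequiv :: "tm \<Rightarrow> tm \<Rightarrow> tm \<Rightarrow> tm" where
  "isequiv A B f =
     prodT
       (Sig (arr B A) (Pi (wk 1 B) (Eq (wk 2 B) (App (wk 2 f) (App (Var 1) (Var 0))) (Var 0))))
       (Sig (arr B A) (Pi (wk 1 A) (Eq (wk 2 A) (App (Var 1) (App (wk 2 f) (Var 0))) (Var 0))))"

definition equiv_type :: "tm \<Rightarrow> tm \<Rightarrow> tm"
  where "equiv_type A B = Sig (arr A B) (isequiv (wk 1 A) (wk 1 B) (Var 0))"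

definition id_equiv :: "tm \<Rightarrow> tm" where
  "id_equiv A =
     Pair (Lam A (Var 0))
       (Pair (Pair (Lam A (Var 0)) (Lam A (Refl (Var 0))))
             (Pair (Lam A (Var 0)) (Lam A (Refl (Var 0)))))"

definition id_to_equiv :: "nat \<Rightarrow> tm \<Rightarrow> tm \<Rightarrow> tm" where
  "id_to_equiv i A B =
     Lam (Eq (U i) A B)
       (J (U i) (equiv_type (Var 2) (Var 1)) (id_equiv (Var 0)) (wk 1 A) (wk 1 B) (Var 0))"

definition happly :: "tm \<Rightarrow> tm \<Rightarrow> tm \<Rightarrow> tm \<Rightarrow> tm" where
  "happly A B f g =
     Lam (Eq (Pi A B) f g)
       (J (wk 1 (Pi A B)) (htpy (wk 4 A) (wk1 4 B) (Var 2) (Var 1))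
          (Lam (wk 2 A) (Refl (App (Var 1) (Var 0)))) (wk 1 f) (wk 1 g) (Var 0))"

text \<open>
  The type, for a generic \<open>s : S\<close> (bound as \<open>Var 0\<close>), of the path clause of pushout induction
  into \<open>C\<close> with point clauses \<open>l\<close> and \<open>r\<close>: a path from the transport of \<open>l (u s)\<close> along
  \<open>Glue s\<close> to \<open>r (v s)\<close>.
\<close>

definition glue_clause :: "tm \<Rightarrow> tm \<Rightarrow> tm \<Rightarrow> tm \<Rightarrow> tm \<Rightarrow> tm \<Rightarrow> tm \<Rightarrow> tm \<Rightarrow> tm" where
  "glue_clause S A B u v C l r =
     (let us = App (wk 1 u) (Var 0); vs = App (wk 1 v) (Var 0)
      in Eq (sub (PoR vs ;; shift 1) C)
            (transport (wk 1 (Po S A B u v)) (wk1 1 C) (PoL us) (PoR vs) (Glue (Var 0))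
               (sub (us ;; shift 1) l))
            (sub (vs ;; shift 1) r))"


section \<open>Derivation rules\<close>

text \<open>
  Contexts list the types of the variables, the most recent one first. Being a type means being
  an element of some universe. Weakening and substitution are not rules, they are admissible.
\<close>

type_synonym ctx = "tm list"

inductive
  wf_ctx :: "ctx \<Rightarrow> bool" ("\<turnstile> _" [50] 50) and
  has_type :: "ctx \<Rightarrow> tm \<Rightarrow> tm \<Rightarrow> bool" ("_ \<turnstile> _ \<^bold>: _" [50, 50, 50] 50) and
  equal_at :: "ctx \<Rightarrow> tm \<Rightarrow> tm \<Rightarrow> tm \<Rightarrow> bool" ("_ \<turnstile> _ \<approx> _ \<^bold>: _" [50, 50, 50, 50] 50)
where
  ctx_empty: "\<turnstile> []"
| ctx_extend: "\<turnstile> \<Gamma> \<Longrightarrow> \<Gamma> \<turnstile> A \<^bold>: U i \<Longrightarrow> \<turnstile> A # \<Gamma>"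

| ty_var: "\<turnstile> \<Gamma> \<Longrightarrow> n < length \<Gamma> \<Longrightarrow> \<Gamma> \<turnstile> Var n \<^bold>: wk (Suc n) (\<Gamma> ! n)"
| ty_conv: "\<Gamma> \<turnstile> a \<^bold>: A \<Longrightarrow> \<Gamma> \<turnstile> A \<approx> B \<^bold>: U i \<Longrightarrow> \<Gamma> \<turnstile> a \<^bold>: B"
| eq_refl: "\<Gamma> \<turnstile> a \<^bold>: A \<Longrightarrow> \<Gamma> \<turnstile> a \<approx> a \<^bold>: A"
| eq_sym: "\<Gamma> \<turnstile> a \<approx> b \<^bold>: A \<Longrightarrow> \<Gamma> \<turnstile> b \<approx> a \<^bold>: A"
| eq_trans: "\<Gamma> \<turnstile> a \<approx> b \<^bold>: A \<Longrightarrow> \<Gamma> \<turnstile> b \<approx> c \<^bold>: A \<Longrightarrow> \<Gamma> \<turnstile> a \<approx> c \<^bold>: A"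
| eq_conv: "\<Gamma> \<turnstile> a \<approx> b \<^bold>: A \<Longrightarrow> \<Gamma> \<turnstile> A \<approx> B \<^bold>: U i \<Longrightarrow> \<Gamma> \<turnstile> a \<approx> b \<^bold>: B"

\<comment> \<open>universes\<close>
| ty_univ: "\<turnstile> \<Gamma> \<Longrightarrow> \<Gamma> \<turnstile> U i \<^bold>: U (Suc i)"
| ty_cumul: "\<Gamma> \<turnstile> A \<^bold>: U i \<Longrightarrow> \<Gamma> \<turnstile> A \<^bold>: U (Suc i)"
| eq_cumul: "\<Gamma> \<turnstile> A \<approx> B \<^bold>: U i \<Longrightarrow> \<Gamma> \<turnstile> A \<approx> B \<^bold>: U (Suc i)"

\<comment> \<open>dependent products\<close>
| ty_Pi: "\<Gamma> \<turnstile> A \<^bold>: U i \<Longrightarrow> A # \<Gamma> \<turnstile> B \<^bold>: U i \<Longrightarrow> \<Gamma> \<turnstile> Pi A B \<^bold>: U i"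
| ty_Lam: "\<Gamma> \<turnstile> A \<^bold>: U i \<Longrightarrow> A # \<Gamma> \<turnstile> B \<^bold>: U i \<Longrightarrow> A # \<Gamma> \<turnstile> b \<^bold>: B \<Longrightarrow> \<Gamma> \<turnstile> Lam A b \<^bold>: Pi A B"
| ty_App: "\<Gamma> \<turnstile> A \<^bold>: U i \<Longrightarrow> A # \<Gamma> \<turnstile> B \<^bold>: U i \<Longrightarrow> \<Gamma> \<turnstile> f \<^bold>: Pi A B \<Longrightarrow> \<Gamma> \<turnstile> a \<^bold>: A \<Longrightarrow>
    \<Gamma> \<turnstile> App f a \<^bold>: inst B a"
| eq_Pi: "\<Gamma> \<turnstile> A \<^bold>: U i \<Longrightarrow> \<Gamma> \<turnstile> A \<approx> A' \<^bold>: U i \<Longrightarrow> A # \<Gamma> \<turnstile> B \<approx> B' \<^bold>: U i \<Longrightarrow>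
    \<Gamma> \<turnstile> Pi A B \<approx> Pi A' B' \<^bold>: U i"
| eq_Lam: "\<Gamma> \<turnstile> A \<^bold>: U i \<Longrightarrow> \<Gamma> \<turnstile> A \<approx> A' \<^bold>: U i \<Longrightarrow> A # \<Gamma> \<turnstile> B \<^bold>: U i \<Longrightarrow>
    A # \<Gamma> \<turnstile> b \<approx> b' \<^bold>: B \<Longrightarrow> \<Gamma> \<turnstile> Lam A b \<approx> Lam A' b' \<^bold>: Pi A B"
| eq_App: "\<Gamma> \<turnstile> A \<^bold>: U i \<Longrightarrow> A # \<Gamma> \<turnstile> B \<^bold>: U i \<Longrightarrow> \<Gamma> \<turnstile> f \<approx> f' \<^bold>: Pi A B \<Longrightarrow>
    \<Gamma> \<turnstile> a \<approx> a' \<^bold>: A \<Longrightarrow> \<Gamma> \<turnstile> App f a \<approx> App f' a' \<^bold>: inst B a"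
| beta_Pi: "\<Gamma> \<turnstile> A \<^bold>: U i \<Longrightarrow> A # \<Gamma> \<turnstile> B \<^bold>: U i \<Longrightarrow> A # \<Gamma> \<turnstile> b \<^bold>: B \<Longrightarrow> \<Gamma> \<turnstile> a \<^bold>: A \<Longrightarrow>
    \<Gamma> \<turnstile> App (Lam A b) a \<approx> inst b a \<^bold>: inst B a"
| eta_Pi: "\<Gamma> \<turnstile> A \<^bold>: U i \<Longrightarrow> A # \<Gamma> \<turnstile> B \<^bold>: U i \<Longrightarrow> \<Gamma> \<turnstile> f \<^bold>: Pi A B \<Longrightarrow>
    \<Gamma> \<turnstile> f \<approx> Lam A (App (wk 1 f) (Var 0)) \<^bold>: Pi A B"

\<comment> \<open>dependent sums\<close>
| ty_Sig: "\<Gamma> \<turnstile> A \<^bold>: U i \<Longrightarrow> A # \<Gamma> \<turnstile> B \<^bold>: U i \<Longrightarrow> \<Gamma> \<turnstile> Sig A B \<^bold>: U i"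
| ty_Pair: "\<Gamma> \<turnstile> A \<^bold>: U i \<Longrightarrow> A # \<Gamma> \<turnstile> B \<^bold>: U i \<Longrightarrow> \<Gamma> \<turnstile> a \<^bold>: A \<Longrightarrow> \<Gamma> \<turnstile> b \<^bold>: inst B a \<Longrightarrow>
    \<Gamma> \<turnstile> Pair a b \<^bold>: Sig A B"
| ty_Fst: "\<Gamma> \<turnstile> A \<^bold>: U i \<Longrightarrow> A # \<Gamma> \<turnstile> B \<^bold>: U i \<Longrightarrow> \<Gamma> \<turnstile> t \<^bold>: Sig A B \<Longrightarrow> \<Gamma> \<turnstile> Fst t \<^bold>: A"
| ty_Snd: "\<Gamma> \<turnstile> A \<^bold>: U i \<Longrightarrow> A # \<Gamma> \<turnstile> B \<^bold>: U i \<Longrightarrow> \<Gamma> \<turnstile> t \<^bold>: Sig A B \<Longrightarrow>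
    \<Gamma> \<turnstile> Snd t \<^bold>: inst B (Fst t)"
| eq_Sig: "\<Gamma> \<turnstile> A \<^bold>: U i \<Longrightarrow> \<Gamma> \<turnstile> A \<approx> A' \<^bold>: U i \<Longrightarrow> A # \<Gamma> \<turnstile> B \<approx> B' \<^bold>: U i \<Longrightarrow>
    \<Gamma> \<turnstile> Sig A B \<approx> Sig A' B' \<^bold>: U i"
| eq_Pair: "\<Gamma> \<turnstile> A \<^bold>: U i \<Longrightarrow> A # \<Gamma> \<turnstile> B \<^bold>: U i \<Longrightarrow> \<Gamma> \<turnstile> a \<approx> a' \<^bold>: A \<Longrightarrow>
    \<Gamma> \<turnstile> b \<approx> b' \<^bold>: inst B a \<Longrightarrow> \<Gamma> \<turnstile> Pair a b \<approx> Pair a' b' \<^bold>: Sig A B"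
| eq_Fst: "\<Gamma> \<turnstile> A \<^bold>: U i \<Longrightarrow> A # \<Gamma> \<turnstile> B \<^bold>: U i \<Longrightarrow> \<Gamma> \<turnstile> t \<approx> t' \<^bold>: Sig A B \<Longrightarrow>
    \<Gamma> \<turnstile> Fst t \<approx> Fst t' \<^bold>: A"
| eq_Snd: "\<Gamma> \<turnstile> A \<^bold>: U i \<Longrightarrow> A # \<Gamma> \<turnstile> B \<^bold>: U i \<Longrightarrow> \<Gamma> \<turnstile> t \<approx> t' \<^bold>: Sig A B \<Longrightarrow>
    \<Gamma> \<turnstile> Snd t \<approx> Snd t' \<^bold>: inst B (Fst t)"
| beta_Fst: "\<Gamma> \<turnstile> A \<^bold>: U i \<Longrightarrow> A # \<Gamma> \<turnstile> B \<^bold>: U i \<Longrightarrow> \<Gamma> \<turnstile> a \<^bold>: A \<Longrightarrow> \<Gamma> \<turnstile> b \<^bold>: inst B a \<Longrightarrow>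
    \<Gamma> \<turnstile> Fst (Pair a b) \<approx> a \<^bold>: A"
| beta_Snd: "\<Gamma> \<turnstile> A \<^bold>: U i \<Longrightarrow> A # \<Gamma> \<turnstile> B \<^bold>: U i \<Longrightarrow> \<Gamma> \<turnstile> a \<^bold>: A \<Longrightarrow> \<Gamma> \<turnstile> b \<^bold>: inst B a \<Longrightarrow>
    \<Gamma> \<turnstile> Snd (Pair a b) \<approx> b \<^bold>: inst B a"
| eta_Sig: "\<Gamma> \<turnstile> A \<^bold>: U i \<Longrightarrow> A # \<Gamma> \<turnstile> B \<^bold>: U i \<Longrightarrow> \<Gamma> \<turnstile> t \<^bold>: Sig A B \<Longrightarrow>
    \<Gamma> \<turnstile> t \<approx> Pair (Fst t) (Snd t) \<^bold>: Sig A B"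

\<comment> \<open>identity types\<close>
| ty_Eq: "\<Gamma> \<turnstile> A \<^bold>: U i \<Longrightarrow> \<Gamma> \<turnstile> a \<^bold>: A \<Longrightarrow> \<Gamma> \<turnstile> b \<^bold>: A \<Longrightarrow> \<Gamma> \<turnstile> Eq A a b \<^bold>: U i"
| ty_Refl: "\<Gamma> \<turnstile> A \<^bold>: U i \<Longrightarrow> \<Gamma> \<turnstile> a \<^bold>: A \<Longrightarrow> \<Gamma> \<turnstile> Refl a \<^bold>: Eq A a a"
| ty_J: "\<Gamma> \<turnstile> A \<^bold>: U i \<Longrightarrow>
    Eq (wk 2 A) (Var 1) (Var 0) # wk 1 A # A # \<Gamma> \<turnstile> C \<^bold>: U k \<Longrightarrow>
    A # \<Gamma> \<turnstile> d \<^bold>: sub (Refl (Var 0) ;; Var 0 ;; Var) C \<Longrightarrow>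
    \<Gamma> \<turnstile> a \<^bold>: A \<Longrightarrow> \<Gamma> \<turnstile> b \<^bold>: A \<Longrightarrow> \<Gamma> \<turnstile> p \<^bold>: Eq A a b \<Longrightarrow>
    \<Gamma> \<turnstile> J A C d a b p \<^bold>: sub (p ;; b ;; a ;; Var) C"
| eq_Eq: "\<Gamma> \<turnstile> A \<approx> A' \<^bold>: U i \<Longrightarrow> \<Gamma> \<turnstile> a \<approx> a' \<^bold>: A \<Longrightarrow> \<Gamma> \<turnstile> b \<approx> b' \<^bold>: A \<Longrightarrow>
    \<Gamma> \<turnstile> Eq A a b \<approx> Eq A' a' b' \<^bold>: U i"
| eq_Refl: "\<Gamma> \<turnstile> A \<^bold>: U i \<Longrightarrow> \<Gamma> \<turnstile> a \<approx> a' \<^bold>: A \<Longrightarrow> \<Gamma> \<turnstile> Refl a \<approx> Refl a' \<^bold>: Eq A a a"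
| eq_J: "\<Gamma> \<turnstile> A \<^bold>: U i \<Longrightarrow> \<Gamma> \<turnstile> A \<approx> A' \<^bold>: U i \<Longrightarrow>
    Eq (wk 2 A) (Var 1) (Var 0) # wk 1 A # A # \<Gamma> \<turnstile> C \<^bold>: U k \<Longrightarrow>
    Eq (wk 2 A) (Var 1) (Var 0) # wk 1 A # A # \<Gamma> \<turnstile> C \<approx> C' \<^bold>: U k \<Longrightarrow>
    A # \<Gamma> \<turnstile> d \<approx> d' \<^bold>: sub (Refl (Var 0) ;; Var 0 ;; Var) C \<Longrightarrow>
    \<Gamma> \<turnstile> a \<approx> a' \<^bold>: A \<Longrightarrow> \<Gamma> \<turnstile> b \<approx> b' \<^bold>: A \<Longrightarrow> \<Gamma> \<turnstile> p \<approx> p' \<^bold>: Eq A a b \<Longrightarrow>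
    \<Gamma> \<turnstile> J A C d a b p \<approx> J A' C' d' a' b' p' \<^bold>: sub (p ;; b ;; a ;; Var) C"
| beta_J: "\<Gamma> \<turnstile> A \<^bold>: U i \<Longrightarrow>
    Eq (wk 2 A) (Var 1) (Var 0) # wk 1 A # A # \<Gamma> \<turnstile> C \<^bold>: U k \<Longrightarrow>
    A # \<Gamma> \<turnstile> d \<^bold>: sub (Refl (Var 0) ;; Var 0 ;; Var) C \<Longrightarrow> \<Gamma> \<turnstile> a \<^bold>: A \<Longrightarrow>
    \<Gamma> \<turnstile> J A C d a a (Refl a) \<approx> inst d a \<^bold>: sub (Refl a ;; a ;; a ;; Var) C"

\<comment> \<open>empty type\<close>
| ty_EmptyT: "\<turnstile> \<Gamma> \<Longrightarrow> \<Gamma> \<turnstile> EmptyT \<^bold>: U i"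
| ty_EmptyRec: "EmptyT # \<Gamma> \<turnstile> C \<^bold>: U k \<Longrightarrow> \<Gamma> \<turnstile> t \<^bold>: EmptyT \<Longrightarrow> \<Gamma> \<turnstile> EmptyRec C t \<^bold>: inst C t"
| eq_EmptyRec: "EmptyT # \<Gamma> \<turnstile> C \<approx> C' \<^bold>: U k \<Longrightarrow> \<Gamma> \<turnstile> t \<approx> t' \<^bold>: EmptyT \<Longrightarrow>
    \<Gamma> \<turnstile> EmptyRec C t \<approx> EmptyRec C' t' \<^bold>: inst C t"

\<comment> \<open>unit type\<close>
| ty_UnitT: "\<turnstile> \<Gamma> \<Longrightarrow> \<Gamma> \<turnstile> UnitT \<^bold>: U i"
| ty_Star: "\<turnstile> \<Gamma> \<Longrightarrow> \<Gamma> \<turnstile> Star \<^bold>: UnitT"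
| ty_UnitRec: "UnitT # \<Gamma> \<turnstile> C \<^bold>: U k \<Longrightarrow> \<Gamma> \<turnstile> c \<^bold>: inst C Star \<Longrightarrow> \<Gamma> \<turnstile> t \<^bold>: UnitT \<Longrightarrow>
    \<Gamma> \<turnstile> UnitRec C c t \<^bold>: inst C t"
| eq_UnitRec: "UnitT # \<Gamma> \<turnstile> C \<approx> C' \<^bold>: U k \<Longrightarrow> \<Gamma> \<turnstile> c \<approx> c' \<^bold>: inst C Star \<Longrightarrow>
    \<Gamma> \<turnstile> t \<approx> t' \<^bold>: UnitT \<Longrightarrow> \<Gamma> \<turnstile> UnitRec C c t \<approx> UnitRec C' c' t' \<^bold>: inst C t"
| beta_UnitRec: "UnitT # \<Gamma> \<turnstile> C \<^bold>: U k \<Longrightarrow> \<Gamma> \<turnstile> c \<^bold>: inst C Star \<Longrightarrow>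
    \<Gamma> \<turnstile> UnitRec C c Star \<approx> c \<^bold>: inst C Star"

\<comment> \<open>coproducts\<close>
| ty_SumT: "\<Gamma> \<turnstile> A \<^bold>: U i \<Longrightarrow> \<Gamma> \<turnstile> B \<^bold>: U i \<Longrightarrow> \<Gamma> \<turnstile> SumT A B \<^bold>: U i"
| ty_InL: "\<Gamma> \<turnstile> A \<^bold>: U i \<Longrightarrow> \<Gamma> \<turnstile> B \<^bold>: U i \<Longrightarrow> \<Gamma> \<turnstile> a \<^bold>: A \<Longrightarrow> \<Gamma> \<turnstile> InL a \<^bold>: SumT A B"
| ty_InR: "\<Gamma> \<turnstile> A \<^bold>: U i \<Longrightarrow> \<Gamma> \<turnstile> B \<^bold>: U i \<Longrightarrow> \<Gamma> \<turnstile> b \<^bold>: B \<Longrightarrow> \<Gamma> \<turnstile> InR b \<^bold>: SumT A B"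
| ty_SumRec: "\<Gamma> \<turnstile> A \<^bold>: U i \<Longrightarrow> \<Gamma> \<turnstile> B \<^bold>: U i \<Longrightarrow> SumT A B # \<Gamma> \<turnstile> C \<^bold>: U k \<Longrightarrow>
    A # \<Gamma> \<turnstile> l \<^bold>: sub (InL (Var 0) ;; shift 1) C \<Longrightarrow>
    B # \<Gamma> \<turnstile> r \<^bold>: sub (InR (Var 0) ;; shift 1) C \<Longrightarrow>
    \<Gamma> \<turnstile> t \<^bold>: SumT A B \<Longrightarrow> \<Gamma> \<turnstile> SumRec C l r t \<^bold>: inst C t"
| eq_SumT: "\<Gamma> \<turnstile> A \<approx> A' \<^bold>: U i \<Longrightarrow> \<Gamma> \<turnstile> B \<approx> B' \<^bold>: U i \<Longrightarrow> \<Gamma> \<turnstile> SumT A B \<approx> SumT A' B' \<^bold>: U i"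
| eq_InL: "\<Gamma> \<turnstile> A \<^bold>: U i \<Longrightarrow> \<Gamma> \<turnstile> B \<^bold>: U i \<Longrightarrow> \<Gamma> \<turnstile> a \<approx> a' \<^bold>: A \<Longrightarrow>
    \<Gamma> \<turnstile> InL a \<approx> InL a' \<^bold>: SumT A B"
| eq_InR: "\<Gamma> \<turnstile> A \<^bold>: U i \<Longrightarrow> \<Gamma> \<turnstile> B \<^bold>: U i \<Longrightarrow> \<Gamma> \<turnstile> b \<approx> b' \<^bold>: B \<Longrightarrow>
    \<Gamma> \<turnstile> InR b \<approx> InR b' \<^bold>: SumT A B"
| eq_SumRec: "\<Gamma> \<turnstile> A \<^bold>: U i \<Longrightarrow> \<Gamma> \<turnstile> B \<^bold>: U i \<Longrightarrow>
    SumT A B # \<Gamma> \<turnstile> C \<^bold>: U k \<Longrightarrow> SumT A B # \<Gamma> \<turnstile> C \<approx> C' \<^bold>: U k \<Longrightarrow>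
    A # \<Gamma> \<turnstile> l \<approx> l' \<^bold>: sub (InL (Var 0) ;; shift 1) C \<Longrightarrow>
    B # \<Gamma> \<turnstile> r \<approx> r' \<^bold>: sub (InR (Var 0) ;; shift 1) C \<Longrightarrow>
    \<Gamma> \<turnstile> t \<approx> t' \<^bold>: SumT A B \<Longrightarrow> \<Gamma> \<turnstile> SumRec C l r t \<approx> SumRec C' l' r' t' \<^bold>: inst C t"
| beta_InL: "\<Gamma> \<turnstile> A \<^bold>: U i \<Longrightarrow> \<Gamma> \<turnstile> B \<^bold>: U i \<Longrightarrow> SumT A B # \<Gamma> \<turnstile> C \<^bold>: U k \<Longrightarrow>
    A # \<Gamma> \<turnstile> l \<^bold>: sub (InL (Var 0) ;; shift 1) C \<Longrightarrow>
    B # \<Gamma> \<turnstile> r \<^bold>: sub (InR (Var 0) ;; shift 1) C \<Longrightarrow>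
    \<Gamma> \<turnstile> a \<^bold>: A \<Longrightarrow> \<Gamma> \<turnstile> SumRec C l r (InL a) \<approx> inst l a \<^bold>: inst C (InL a)"
| beta_InR: "\<Gamma> \<turnstile> A \<^bold>: U i \<Longrightarrow> \<Gamma> \<turnstile> B \<^bold>: U i \<Longrightarrow> SumT A B # \<Gamma> \<turnstile> C \<^bold>: U k \<Longrightarrow>
    A # \<Gamma> \<turnstile> l \<^bold>: sub (InL (Var 0) ;; shift 1) C \<Longrightarrow>
    B # \<Gamma> \<turnstile> r \<^bold>: sub (InR (Var 0) ;; shift 1) C \<Longrightarrow>
    \<Gamma> \<turnstile> b \<^bold>: B \<Longrightarrow> \<Gamma> \<turnstile> SumRec C l r (InR b) \<approx> inst r b \<^bold>: inst C (InR b)"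

\<comment> \<open>natural numbers\<close>
| ty_NatT: "\<turnstile> \<Gamma> \<Longrightarrow> \<Gamma> \<turnstile> NatT \<^bold>: U i"
| ty_Zero: "\<turnstile> \<Gamma> \<Longrightarrow> \<Gamma> \<turnstile> Zero \<^bold>: NatT"
| ty_Succ: "\<Gamma> \<turnstile> t \<^bold>: NatT \<Longrightarrow> \<Gamma> \<turnstile> Succ t \<^bold>: NatT"
| ty_NatRec: "NatT # \<Gamma> \<turnstile> C \<^bold>: U k \<Longrightarrow> \<Gamma> \<turnstile> z \<^bold>: inst C Zero \<Longrightarrow>
    C # NatT # \<Gamma> \<turnstile> s \<^bold>: sub (Succ (Var 1) ;; shift 2) C \<Longrightarrow>
    \<Gamma> \<turnstile> t \<^bold>: NatT \<Longrightarrow> \<Gamma> \<turnstile> NatRec C z s t \<^bold>: inst C t"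
| eq_Succ: "\<Gamma> \<turnstile> t \<approx> t' \<^bold>: NatT \<Longrightarrow> \<Gamma> \<turnstile> Succ t \<approx> Succ t' \<^bold>: NatT"
| eq_NatRec: "NatT # \<Gamma> \<turnstile> C \<^bold>: U k \<Longrightarrow> NatT # \<Gamma> \<turnstile> C \<approx> C' \<^bold>: U k \<Longrightarrow>
    \<Gamma> \<turnstile> z \<approx> z' \<^bold>: inst C Zero \<Longrightarrow>
    C # NatT # \<Gamma> \<turnstile> s \<approx> s' \<^bold>: sub (Succ (Var 1) ;; shift 2) C \<Longrightarrow>
    \<Gamma> \<turnstile> t \<approx> t' \<^bold>: NatT \<Longrightarrow> \<Gamma> \<turnstile> NatRec C z s t \<approx> NatRec C' z' s' t' \<^bold>: inst C t"
| beta_Zero: "NatT # \<Gamma> \<turnstile> C \<^bold>: U k \<Longrightarrow> \<Gamma> \<turnstile> z \<^bold>: inst C Zero \<Longrightarrow>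
    C # NatT # \<Gamma> \<turnstile> s \<^bold>: sub (Succ (Var 1) ;; shift 2) C \<Longrightarrow>
    \<Gamma> \<turnstile> NatRec C z s Zero \<approx> z \<^bold>: inst C Zero"
| beta_Succ: "NatT # \<Gamma> \<turnstile> C \<^bold>: U k \<Longrightarrow> \<Gamma> \<turnstile> z \<^bold>: inst C Zero \<Longrightarrow>
    C # NatT # \<Gamma> \<turnstile> s \<^bold>: sub (Succ (Var 1) ;; shift 2) C \<Longrightarrow> \<Gamma> \<turnstile> t \<^bold>: NatT \<Longrightarrow>
    \<Gamma> \<turnstile> NatRec C z s (Succ t) \<approx> sub (NatRec C z s t ;; t ;; Var) s \<^bold>: inst C (Succ t)"

\<comment> \<open>homotopy pushouts\<close>
| ty_Po: "\<Gamma> \<turnstile> S \<^bold>: U i \<Longrightarrow> \<Gamma> \<turnstile> A \<^bold>: U i \<Longrightarrow> \<Gamma> \<turnstile> B \<^bold>: U i \<Longrightarrow>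
    \<Gamma> \<turnstile> u \<^bold>: arr S A \<Longrightarrow> \<Gamma> \<turnstile> v \<^bold>: arr S B \<Longrightarrow> \<Gamma> \<turnstile> Po S A B u v \<^bold>: U i"
| ty_PoL: "\<Gamma> \<turnstile> Po S A B u v \<^bold>: U i \<Longrightarrow> \<Gamma> \<turnstile> a \<^bold>: A \<Longrightarrow> \<Gamma> \<turnstile> PoL a \<^bold>: Po S A B u v"
| ty_PoR: "\<Gamma> \<turnstile> Po S A B u v \<^bold>: U i \<Longrightarrow> \<Gamma> \<turnstile> b \<^bold>: B \<Longrightarrow> \<Gamma> \<turnstile> PoR b \<^bold>: Po S A B u v"
| ty_Glue: "\<Gamma> \<turnstile> Po S A B u v \<^bold>: U i \<Longrightarrow> \<Gamma> \<turnstile> s \<^bold>: S \<Longrightarrow>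
    \<Gamma> \<turnstile> Glue s \<^bold>: Eq (Po S A B u v) (PoL (App u s)) (PoR (App v s))"
| ty_PoRec: "\<Gamma> \<turnstile> S \<^bold>: U i \<Longrightarrow> \<Gamma> \<turnstile> A \<^bold>: U i \<Longrightarrow> \<Gamma> \<turnstile> B \<^bold>: U i \<Longrightarrow>
    \<Gamma> \<turnstile> u \<^bold>: arr S A \<Longrightarrow> \<Gamma> \<turnstile> v \<^bold>: arr S B \<Longrightarrow>
    Po S A B u v # \<Gamma> \<turnstile> C \<^bold>: U k \<Longrightarrow>
    A # \<Gamma> \<turnstile> l \<^bold>: sub (PoL (Var 0) ;; shift 1) C \<Longrightarrow>
    B # \<Gamma> \<turnstile> r \<^bold>: sub (PoR (Var 0) ;; shift 1) C \<Longrightarrow>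
    S # \<Gamma> \<turnstile> g \<^bold>: glue_clause S A B u v C l r \<Longrightarrow>
    \<Gamma> \<turnstile> t \<^bold>: Po S A B u v \<Longrightarrow> \<Gamma> \<turnstile> PoRec S A B u v C l r g t \<^bold>: inst C t"
| eq_Po: "\<Gamma> \<turnstile> S \<approx> S' \<^bold>: U i \<Longrightarrow> \<Gamma> \<turnstile> A \<approx> A' \<^bold>: U i \<Longrightarrow> \<Gamma> \<turnstile> B \<approx> B' \<^bold>: U i \<Longrightarrow>
    \<Gamma> \<turnstile> u \<approx> u' \<^bold>: arr S A \<Longrightarrow> \<Gamma> \<turnstile> v \<approx> v' \<^bold>: arr S B \<Longrightarrow>
    \<Gamma> \<turnstile> Po S A B u v \<approx> Po S' A' B' u' v' \<^bold>: U i"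
| eq_PoL: "\<Gamma> \<turnstile> Po S A B u v \<^bold>: U i \<Longrightarrow> \<Gamma> \<turnstile> a \<approx> a' \<^bold>: A \<Longrightarrow> \<Gamma> \<turnstile> PoL a \<approx> PoL a' \<^bold>: Po S A B u v"
| eq_PoR: "\<Gamma> \<turnstile> Po S A B u v \<^bold>: U i \<Longrightarrow> \<Gamma> \<turnstile> b \<approx> b' \<^bold>: B \<Longrightarrow> \<Gamma> \<turnstile> PoR b \<approx> PoR b' \<^bold>: Po S A B u v"
| eq_Glue: "\<Gamma> \<turnstile> Po S A B u v \<^bold>: U i \<Longrightarrow> \<Gamma> \<turnstile> s \<approx> s' \<^bold>: S \<Longrightarrow>
    \<Gamma> \<turnstile> Glue s \<approx> Glue s' \<^bold>: Eq (Po S A B u v) (PoL (App u s)) (PoR (App v s))"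
| eq_PoRec: "\<Gamma> \<turnstile> S \<^bold>: U i \<Longrightarrow> \<Gamma> \<turnstile> A \<^bold>: U i \<Longrightarrow> \<Gamma> \<turnstile> B \<^bold>: U i \<Longrightarrow>
    \<Gamma> \<turnstile> u \<^bold>: arr S A \<Longrightarrow> \<Gamma> \<turnstile> v \<^bold>: arr S B \<Longrightarrow> Po S A B u v # \<Gamma> \<turnstile> C \<^bold>: U k \<Longrightarrow>
    \<Gamma> \<turnstile> S \<approx> S' \<^bold>: U i \<Longrightarrow> \<Gamma> \<turnstile> A \<approx> A' \<^bold>: U i \<Longrightarrow> \<Gamma> \<turnstile> B \<approx> B' \<^bold>: U i \<Longrightarrow>
    \<Gamma> \<turnstile> u \<approx> u' \<^bold>: arr S A \<Longrightarrow> \<Gamma> \<turnstile> v \<approx> v' \<^bold>: arr S B \<Longrightarrow>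
    Po S A B u v # \<Gamma> \<turnstile> C \<approx> C' \<^bold>: U k \<Longrightarrow>
    A # \<Gamma> \<turnstile> l \<approx> l' \<^bold>: sub (PoL (Var 0) ;; shift 1) C \<Longrightarrow>
    B # \<Gamma> \<turnstile> r \<approx> r' \<^bold>: sub (PoR (Var 0) ;; shift 1) C \<Longrightarrow>
    S # \<Gamma> \<turnstile> g \<approx> g' \<^bold>: glue_clause S A B u v C l r \<Longrightarrow>
    \<Gamma> \<turnstile> t \<approx> t' \<^bold>: Po S A B u v \<Longrightarrow>
    \<Gamma> \<turnstile> PoRec S A B u v C l r g t \<approx> PoRec S' A' B' u' v' C' l' r' g' t' \<^bold>: inst C t"
| beta_PoL: "\<Gamma> \<turnstile> S \<^bold>: U i \<Longrightarrow> \<Gamma> \<turnstile> A \<^bold>: U i \<Longrightarrow> \<Gamma> \<turnstile> B \<^bold>: U i \<Longrightarrow>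
    \<Gamma> \<turnstile> u \<^bold>: arr S A \<Longrightarrow> \<Gamma> \<turnstile> v \<^bold>: arr S B \<Longrightarrow>
    Po S A B u v # \<Gamma> \<turnstile> C \<^bold>: U k \<Longrightarrow>
    A # \<Gamma> \<turnstile> l \<^bold>: sub (PoL (Var 0) ;; shift 1) C \<Longrightarrow>
    B # \<Gamma> \<turnstile> r \<^bold>: sub (PoR (Var 0) ;; shift 1) C \<Longrightarrow>
    S # \<Gamma> \<turnstile> g \<^bold>: glue_clause S A B u v C l r \<Longrightarrow>
    \<Gamma> \<turnstile> a \<^bold>: A \<Longrightarrow> \<Gamma> \<turnstile> PoRec S A B u v C l r g (PoL a) \<approx> inst l a \<^bold>: inst C (PoL a)"
| beta_PoR: "\<Gamma> \<turnstile> S \<^bold>: U i \<Longrightarrow> \<Gamma> \<turnstile> A \<^bold>: U i \<Longrightarrow> \<Gamma> \<turnstile> B \<^bold>: U i \<Longrightarrow>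
    \<Gamma> \<turnstile> u \<^bold>: arr S A \<Longrightarrow> \<Gamma> \<turnstile> v \<^bold>: arr S B \<Longrightarrow>
    Po S A B u v # \<Gamma> \<turnstile> C \<^bold>: U k \<Longrightarrow>
    A # \<Gamma> \<turnstile> l \<^bold>: sub (PoL (Var 0) ;; shift 1) C \<Longrightarrow>
    B # \<Gamma> \<turnstile> r \<^bold>: sub (PoR (Var 0) ;; shift 1) C \<Longrightarrow>
    S # \<Gamma> \<turnstile> g \<^bold>: glue_clause S A B u v C l r \<Longrightarrow>
    \<Gamma> \<turnstile> b \<^bold>: B \<Longrightarrow> \<Gamma> \<turnstile> PoRec S A B u v C l r g (PoR b) \<approx> inst r b \<^bold>: inst C (PoR b)"
| ty_PoBeta: "\<Gamma> \<turnstile> S \<^bold>: U i \<Longrightarrow> \<Gamma> \<turnstile> A \<^bold>: U i \<Longrightarrow> \<Gamma> \<turnstile> B \<^bold>: U i \<Longrightarrow>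
    \<Gamma> \<turnstile> u \<^bold>: arr S A \<Longrightarrow> \<Gamma> \<turnstile> v \<^bold>: arr S B \<Longrightarrow>
    Po S A B u v # \<Gamma> \<turnstile> C \<^bold>: U k \<Longrightarrow>
    A # \<Gamma> \<turnstile> l \<^bold>: sub (PoL (Var 0) ;; shift 1) C \<Longrightarrow>
    B # \<Gamma> \<turnstile> r \<^bold>: sub (PoR (Var 0) ;; shift 1) C \<Longrightarrow>
    S # \<Gamma> \<turnstile> g \<^bold>: glue_clause S A B u v C l r \<Longrightarrow>
    \<Gamma> \<turnstile> s \<^bold>: S \<Longrightarrow>
    \<Gamma> \<turnstile> PoBeta S A B u v C l r g s \<^bold>:
      Eq (inst (glue_clause S A B u v C l r) s)
         (apd (Po S A B u v) C
            (PoRec (wk 1 S) (wk 1 A) (wk 1 B) (wk 1 u) (wk 1 v) (wk1 1 C) (wk1 1 l) (wk1 1 r)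
               (wk1 1 g) (Var 0))
            (PoL (App u s)) (PoR (App v s)) (Glue s))
         (inst g s)"
| eq_PoBeta: "\<Gamma> \<turnstile> S \<^bold>: U i \<Longrightarrow> \<Gamma> \<turnstile> A \<^bold>: U i \<Longrightarrow> \<Gamma> \<turnstile> B \<^bold>: U i \<Longrightarrow>
    \<Gamma> \<turnstile> u \<^bold>: arr S A \<Longrightarrow> \<Gamma> \<turnstile> v \<^bold>: arr S B \<Longrightarrow> Po S A B u v # \<Gamma> \<turnstile> C \<^bold>: U k \<Longrightarrow>
    \<Gamma> \<turnstile> S \<approx> S' \<^bold>: U i \<Longrightarrow> \<Gamma> \<turnstile> A \<approx> A' \<^bold>: U i \<Longrightarrow> \<Gamma> \<turnstile> B \<approx> B' \<^bold>: U i \<Longrightarrow>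
    \<Gamma> \<turnstile> u \<approx> u' \<^bold>: arr S A \<Longrightarrow> \<Gamma> \<turnstile> v \<approx> v' \<^bold>: arr S B \<Longrightarrow>
    Po S A B u v # \<Gamma> \<turnstile> C \<approx> C' \<^bold>: U k \<Longrightarrow>
    A # \<Gamma> \<turnstile> l \<approx> l' \<^bold>: sub (PoL (Var 0) ;; shift 1) C \<Longrightarrow>
    B # \<Gamma> \<turnstile> r \<approx> r' \<^bold>: sub (PoR (Var 0) ;; shift 1) C \<Longrightarrow>
    S # \<Gamma> \<turnstile> g \<approx> g' \<^bold>: glue_clause S A B u v C l r \<Longrightarrow>
    \<Gamma> \<turnstile> s \<approx> s' \<^bold>: S \<Longrightarrow>
    \<Gamma> \<turnstile> PoBeta S A B u v C l r g s \<approx> PoBeta S' A' B' u' v' C' l' r' g' s' \<^bold>: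
      Eq (inst (glue_clause S A B u v C l r) s)
         (apd (Po S A B u v) C
            (PoRec (wk 1 S) (wk 1 A) (wk 1 B) (wk 1 u) (wk 1 v) (wk1 1 C) (wk1 1 l) (wk1 1 r)
               (wk1 1 g) (Var 0))
            (PoL (App u s)) (PoR (App v s)) (Glue s))
         (inst g s)"

\<comment> \<open>function extensionality\<close>
| ty_FunExt: "\<Gamma> \<turnstile> A \<^bold>: U i \<Longrightarrow> A # \<Gamma> \<turnstile> B \<^bold>: U i \<Longrightarrow> \<Gamma> \<turnstile> f \<^bold>: Pi A B \<Longrightarrow> \<Gamma> \<turnstile> g \<^bold>: Pi A B \<Longrightarrow>
    \<Gamma> \<turnstile> FunExt A B f g \<^bold>: isequiv (Eq (Pi A B) f g) (htpy A B f g) (happly A B f g)"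
| eq_FunExt: "\<Gamma> \<turnstile> A \<^bold>: U i \<Longrightarrow> \<Gamma> \<turnstile> A \<approx> A' \<^bold>: U i \<Longrightarrow>
    A # \<Gamma> \<turnstile> B \<^bold>: U i \<Longrightarrow> A # \<Gamma> \<turnstile> B \<approx> B' \<^bold>: U i \<Longrightarrow>
    \<Gamma> \<turnstile> f \<approx> f' \<^bold>: Pi A B \<Longrightarrow> \<Gamma> \<turnstile> g \<approx> g' \<^bold>: Pi A B \<Longrightarrow>
    \<Gamma> \<turnstile> FunExt A B f g \<approx> FunExt A' B' f' g' \<^bold>:
      isequiv (Eq (Pi A B) f g) (htpy A B f g) (happly A B f g)"

\<comment> \<open>univalence\<close>
| ty_Univalence: "\<Gamma> \<turnstile> A \<^bold>: U i \<Longrightarrow> \<Gamma> \<turnstile> B \<^bold>: U i \<Longrightarrow>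
    \<Gamma> \<turnstile> Univalence i A B \<^bold>: isequiv (Eq (U i) A B) (equiv_type A B) (id_to_equiv i A B)"
| eq_Univalence: "\<Gamma> \<turnstile> A \<approx> A' \<^bold>: U i \<Longrightarrow> \<Gamma> \<turnstile> B \<approx> B' \<^bold>: U i \<Longrightarrow>
    \<Gamma> \<turnstile> Univalence i A B \<approx> Univalence i A' B' \<^bold>:
      isequiv (Eq (U i) A B) (equiv_type A B) (id_to_equiv i A B)"


section \<open>Reflexive graphs\<close>

text \<open>\<open>\<Sum>A\<^sub>0:U. \<Sum>A\<^sub>1:A\<^sub>0\<rightarrow>A\<^sub>0\<rightarrow>U. \<Prod>x:A\<^sub>0. A\<^sub>1 x x\<close>\<close>

definition RGraph :: "nat \<Rightarrow> tm" where
  "RGraph i =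
     Sig (U i) (Sig (arr (Var 0) (arr (Var 0) (U i))) (Pi (Var 1) (App2 (Var 1) (Var 0) (Var 0))))"

definition vert :: "tm \<Rightarrow> tm" where "vert A = Fst A"
definition edge :: "tm \<Rightarrow> tm \<Rightarrow> tm \<Rightarrow> tm" where "edge A x y = App2 (Fst (Snd A)) x y"
definition rfx :: "tm \<Rightarrow> tm \<Rightarrow> tm" where "rfx A x = App (Snd (Snd A)) x"

definition on_vert :: "tm \<Rightarrow> tm \<Rightarrow> tm" where "on_vert f x = App (Fst f) x"
definition on_edge :: "tm \<Rightarrow> tm \<Rightarrow> tm \<Rightarrow> tm \<Rightarrow> tm" where "on_edge f x y e = App3 (Fst (Snd f)) x y e"
definition on_rfx :: "tm \<Rightarrow> tm \<Rightarrow> tm" where "on_rfx f x = App (Snd (Snd f)) x"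

text \<open>
  \<open>\<Sum>f\<^sub>0:A\<^sub>0\<rightarrow>B\<^sub>0. \<Sum>f\<^sub>1:(\<Prod>x,y:A\<^sub>0. A\<^sub>1 x y \<rightarrow> B\<^sub>1 (f\<^sub>0 x) (f\<^sub>0 y)). \<Prod>x:A\<^sub>0. f\<^sub>1 x x (rfx\<^sub>A x) = rfx\<^sub>B (f\<^sub>0 x)\<close>
\<close>

definition Hom :: "tm \<Rightarrow> tm \<Rightarrow> tm" where
  "Hom A B =
     Sig (arr (vert A) (vert B))
       (Sig (Pi (vert (wk 1 A)) (Pi (vert (wk 2 A))
              (arr (edge (wk 3 A) (Var 1) (Var 0))
                   (edge (wk 3 B) (App (Var 2) (Var 1)) (App (Var 2) (Var 0))))))
          (Pi (vert (wk 2 A))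
             (Eq (edge (wk 3 B) (App (Var 2) (Var 0)) (App (Var 2) (Var 0)))
                 (App3 (Var 1) (Var 0) (Var 0) (rfx (wk 3 A) (Var 0)))
                 (rfx (wk 3 B) (App (Var 2) (Var 0))))))"

text \<open>
  The composite of \<open>f : Hom A B\<close> and \<open>g : Hom B C\<close>. Its reflexivity datum at \<open>x\<close> is
  \<open>ap\<^bsub>g\<^sub>1\<^esub> (rfx\<^sub>f x) \<cdot> rfx\<^sub>g (f\<^sub>0 x) : g\<^sub>1 (f\<^sub>1 (rfx\<^sub>A x)) = rfx\<^sub>C (g\<^sub>0 (f\<^sub>0 x))\<close>.
\<close>

definition hom_comp_rfx :: "tm \<Rightarrow> tm \<Rightarrow> tm \<Rightarrow> tm \<Rightarrow> tm \<Rightarrow> tm \<Rightarrow> tm" where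
  "hom_comp_rfx A B C g f x =
     (let fx = on_vert f x; gfx = on_vert g fx;
          f_rfx = on_edge f x x (rfx A x)
      in concat_path (edge C gfx gfx)
           (on_edge g fx fx f_rfx) (on_edge g fx fx (rfx B fx)) (rfx C gfx)
           (ap (edge B fx fx) (edge C gfx gfx) (App2 (Fst (Snd g)) fx fx)
              f_rfx (rfx B fx) (on_rfx f x))
           (on_rfx g fx))"

definition hom_comp :: "tm \<Rightarrow> tm \<Rightarrow> tm \<Rightarrow> tm \<Rightarrow> tm \<Rightarrow> tm" where
  "hom_comp A B C g f =
     Pair (Lam (vert A) (on_vert (wk 1 g) (on_vert (wk 1 f) (Var 0))))
       (Pair (Lam (vert A) (Lam (vert (wk 1 A)) (Lam (edge (wk 2 A) (Var 1) (Var 0))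
                (on_edge (wk 3 g) (on_vert (wk 3 f) (Var 2)) (on_vert (wk 3 f) (Var 1))
                   (on_edge (wk 3 f) (Var 2) (Var 1) (Var 0))))))
             (Lam (vert A) (hom_comp_rfx (wk 1 A) (wk 1 B) (wk 1 C) (wk 1 g) (wk 1 f) (Var 0))))"

text \<open>The discrete graph on a type, and its action on a function \<open>h : X \<rightarrow> Y\<close>\<close>

definition Disc :: "tm \<Rightarrow> tm" where
  "Disc X =
     Pair X (Pair (Lam X (Lam (wk 1 X) (Eq (wk 2 X) (Var 1) (Var 0)))) (Lam X (Refl (Var 0))))"

definition Disc_map :: "tm \<Rightarrow> tm \<Rightarrow> tm \<Rightarrow> tm" where
  "Disc_map X Y h =
     Pair h
       (Pair (Lam X (Lam (wk 1 X) (Lam (Eq (wk 2 X) (Var 1) (Var 0))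
                (ap (wk 3 X) (wk 3 Y) (wk 3 h) (Var 2) (Var 1) (Var 0)))))
             (Lam X (Refl (Refl (App (wk 1 h) (Var 0))))))"

text \<open>
  For all \<open>Y\<close> in the \<open>k\<close>-th universe, \<open>\<lambda>h:X\<rightarrow>Y. Disc_map h \<circ> f\<close> is an equivalence from \<open>X \<rightarrow> Y\<close>
  to \<open>Hom A (Disc Y)\<close>. Under the second binder \<open>Y\<close> is \<open>Var 1\<close> and \<open>h\<close> is \<open>Var 0\<close>.
\<close>

definition is_rcoeq :: "nat \<Rightarrow> tm \<Rightarrow> tm \<Rightarrow> tm \<Rightarrow> tm" where
  "is_rcoeq k A X f =
     Pi (U k)
       (isequiv (arr (wk 1 X) (Var 0)) (Hom (wk 1 A) (Disc (Var 0)))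
          (Lam (arr (wk 1 X) (Var 0))
             (hom_comp (wk 2 A) (Disc (wk 2 X)) (Disc (Var 1))
                (Disc_map (wk 2 X) (Var 1) (Var 0)) (wk 2 f))))"


section \<open>Pushout squares\<close>

text \<open>\<open>\<Sum>p:A\<rightarrow>Y. \<Sum>q:B\<rightarrow>Y. p \<circ> u \<sim> q \<circ> v\<close>\<close>

definition Cocone :: "tm \<Rightarrow> tm \<Rightarrow> tm \<Rightarrow> tm \<Rightarrow> tm \<Rightarrow> tm \<Rightarrow> tm" where
  "Cocone S A B u v Y =
     Sig (arr A Y) (Sig (arr (wk 1 B) (wk 1 Y))
       (htpy (wk 2 S) (wk 3 Y)
          (compose (wk 2 S) (Var 1) (wk 2 u)) (compose (wk 2 S) (Var 0) (wk 2 v))))"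

text \<open>
  The square with legs \<open>u : S \<rightarrow> A\<close>, \<open>v : S \<rightarrow> B\<close>, \<open>i : A \<rightarrow> X\<close>, \<open>j : B \<rightarrow> X\<close> and homotopy
  \<open>H : i \<circ> u \<sim> j \<circ> v\<close> is a pushout square with respect to the types in the \<open>k\<close>-th universe.
\<close>

definition is_pushout ::
  "nat \<Rightarrow> tm \<Rightarrow> tm \<Rightarrow> tm \<Rightarrow> tm \<Rightarrow> tm \<Rightarrow> tm \<Rightarrow> tm \<Rightarrow> tm \<Rightarrow> tm \<Rightarrow> tm" where
  "is_pushout k S A B X u v i j H =
     Pi (U k)
       (isequiv (arr (wk 1 X) (Var 0)) (Cocone (wk 1 S) (wk 1 A) (wk 1 B) (wk 1 u) (wk 1 v) (Var 0))
          (Lam (arr (wk 1 X) (Var 0))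
             (Pair (compose (wk 2 A) (Var 0) (wk 2 i))
                (Pair (compose (wk 2 B) (Var 0) (wk 2 j))
                   (Lam (wk 2 S)
                      (ap (wk 3 X) (Var 2) (Var 1)
                         (App (wk 3 i) (App (wk 3 u) (Var 0)))
                         (App (wk 3 j) (App (wk 3 v) (Var 0)))
                         (App (wk 3 H) (Var 0))))))))"

text \<open>The span \<open>A\<^sub>0 \<leftarrow> \<Sum>x,y:A\<^sub>0. A\<^sub>1 x y \<rightarrow> A\<^sub>0\<close> of a reflexive graph, and its square over \<open>f : Hom A (Disc X)\<close>\<close>

definition total_edges :: "tm \<Rightarrow> tm" where
  "total_edges A = Sig (vert A) (Sig (vert (wk 1 A)) (edge (wk 2 A) (Var 1) (Var 0)))"

definition edge_src :: "tm \<Rightarrow> tm"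
  where "edge_src A = Lam (total_edges A) (Fst (Var 0))"

definition edge_tgt :: "tm \<Rightarrow> tm"
  where "edge_tgt A = Lam (total_edges A) (Fst (Snd (Var 0)))"

definition edge_htpy :: "tm \<Rightarrow> tm \<Rightarrow> tm" where
  "edge_htpy A f =
     Lam (total_edges A)
       (on_edge (wk 1 f) (Fst (Var 0)) (Fst (Snd (Var 0))) (Snd (Snd (Var 0))))"

definition is_edge_pushout :: "nat \<Rightarrow> tm \<Rightarrow> tm \<Rightarrow> tm \<Rightarrow> tm" where
  "is_edge_pushout k A X f =
     is_pushout k (total_edges A) (vert A) (vert A) X
       (edge_src A) (edge_tgt A) (Fst f) (Fst f) (edge_htpy A f)"

end

theory Submission
  imports Defs
begin

text \<open>
  Fix a reflexive graph \<open>A\<close> and a type \<open>Y\<close>. A morphism \<open>m = (m\<^sub>0, m\<^sub>1, m\<^sub>2)\<close> from \<open>A\<close> to the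
  discrete graph on \<open>Y\<close> restricts to the cocone \<open>(m\<^sub>0, m\<^sub>0, m\<^sub>1)\<close> under the span
  \<open>A\<^sub>0 \<leftarrow> \<Sum>x,y. A\<^sub>1 x y \<rightarrow> A\<^sub>0\<close>. The whole theorem rests on the fact that this restriction is an
  equivalence (\<open>open_equiv_coc_of_hom\<close>). A cocone consists of two maps \<open>p, q : A\<^sub>0 \<rightarrow> Y\<close> and of paths
  \<open>H x y e : p x = q y\<close>; evaluating \<open>H\<close> at the reflexive edges gives a homotopy
  \<open>K x = H x x (rfx x) : p x = q x\<close>, and the pair \<open>(q, K)\<close> can be contracted to \<open>(p, refl)\<close>. What remains
  is \<open>p\<close>, together with an action on edges that sends reflexive edges to reflexivity. Explicitly, the
  inverse divides by \<open>K\<close>: it sends \<open>(p, q, H)\<close> to the morphism with edge component \<open>H x y e \<cdot> (K y)\<inverse>\<close>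
  (\<open>hom_of_coc\<close>), and the two round trips are \<open>coc_of_hom_of_coc\<close> and \<open>hom_of_coc_of_hom\<close>.

  For \<open>h : X \<rightarrow> Y\<close>, the restriction of the composite of \<open>f\<close> with the map induced by \<open>h\<close> is
  judgmentally the cocone \<open>(h \<circ> f\<^sub>0, h \<circ> f\<^sub>0, ap h \<circ> f\<^sub>1)\<close> that occurs in the pushout property of the
  square (\<open>coc_of_hom_comp\<close>). So the two maps out of \<open>X \<rightarrow> Y\<close> that have to be equivalences differ by an
  equivalence, and one of them is an equivalence if and only if the other is
  (\<open>rcoeq_iff_pushout_at\<close>).

  For the existence of reflexive coequalizers, let \<open>X\<close> be the pushout of the span. Its universal property
  is derived from the induction principle: existence by induction into a constant family
  (\<open>pushout_recursion\<close>), uniqueness by induction into a family of paths and function extensionality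
  (\<open>pushout_uniqueness\<close>), both combined in \<open>pushout_open_equiv\<close>. The inverse of the restriction map turns
  the universal cocone into a morphism \<open>f\<close> whose restriction is the universal cocone up to a path, and
  cancelling the same equivalence as before shows that \<open>f\<close> is a reflexive coequalizer
  (\<open>rcoeq_at_glued\<close>).

  The first half of the development makes the object theory usable. Weakening and substitution are
  not derivation rules, so they are proved admissible (\<open>substitution\<close>), and judgmental equality is shown
  to be a congruence under substitution (\<open>functional\<close>). The judgments are bundled with their
  presuppositions, which turns the derivation rules into syntax-directed proof rules; substitutions
  are normalised by rewriting. The statements to be proved only ask
  for the existence of terms, so most arguments are phrased with the inhabitation predicate \<open>inh\<close>.
\<close>

section \<open>Parallel substitutions\<close>

definition scomp :: "(nat \<Rightarrow> tm) \<Rightarrow> (nat \<Rightarrow> tm) \<Rightarrow> nat \<Rightarrow> tm"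
  where "scomp \<sigma> \<tau> n = sub \<sigma> (\<tau> n)"

lemma up_ren: "up (\<lambda>n. Var (\<rho> n)) = (\<lambda>n. Var (lift \<rho> n))"
  by (auto simp: up_def lift_def fun_eq_iff split: nat.splits)

text \<open>
  Renamings are substitutions, so one calculus of parallel substitutions covers weakening,
  instantiation and all substitutions that occur in the derivation rules.
\<close>

lemma ren_as_sub: "ren \<rho> t = sub (\<lambda>n. Var (\<rho> n)) t"
  by (induction t arbitrary: \<rho>) (simp_all add: up_ren)

lemma up_Var: "up Var = Var"
  by (auto simp: up_def fun_eq_iff split: nat.splits)

lemma sub_Var: "sub Var t = t"
  by (induction t) (simp_all add: up_Var)

lemma lift_comp: "lift (\<lambda>n. \<rho> (\<rho>' n)) = (\<lambda>n. lift \<rho> (lift \<rho>' n))"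
  by (auto simp: lift_def fun_eq_iff split: nat.splits)

lemma ren_ren: "ren \<rho> (ren \<rho>' t) = ren (\<lambda>n. \<rho> (\<rho>' n)) t"
  by (induction t arbitrary: \<rho> \<rho>') (simp_all add: lift_comp)

lemma up_lift: "up (\<lambda>n. \<sigma> (\<rho> n)) = (\<lambda>n. up \<sigma> (lift \<rho> n))"
  by (auto simp: up_def lift_def fun_eq_iff split: nat.splits)

lemma sub_ren: "sub \<sigma> (ren \<rho> t) = sub (\<lambda>n. \<sigma> (\<rho> n)) t"
  by (induction t arbitrary: \<sigma> \<rho>) (simp_all add: up_lift)

lemma lift_up: "up (\<lambda>n. ren \<rho> (\<sigma> n)) = (\<lambda>n. ren (lift \<rho>) (up \<sigma> n))"
  by (auto simp: up_def lift_def fun_eq_iff ren_ren split: nat.splits)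

lemma ren_sub: "ren \<rho> (sub \<sigma> t) = sub (\<lambda>n. ren \<rho> (\<sigma> n)) t"
  by (induction t arbitrary: \<sigma> \<rho>) (simp_all add: lift_up)

lemma up_scomp: "up (scomp \<sigma> \<tau>) = scomp (up \<sigma>) (up \<tau>)"
  by (auto simp: scomp_def up_def fun_eq_iff ren_sub sub_ren split: nat.splits)

lemma sub_sub: "sub \<sigma> (sub \<tau> t) = sub (scomp \<sigma> \<tau>) t"
  by (induction t arbitrary: \<sigma> \<tau>) (simp_all add: up_scomp, simp add: scomp_def)

lemma shift_0: "shift 0 = Var"
  by (simp add: shift_def fun_eq_iff)

lemma wk_sub: "wk k t = sub (shift k) t"
  by (simp add: wk_def ren_as_sub shift_def[abs_def])

lemma ren_Suc_sub: "ren Suc t = sub (shift (Suc 0)) t"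
  by (simp add: ren_as_sub shift_def[abs_def])

lemma wk1_sub: "wk1 k t = sub (Var 0 ;; shift (Suc k)) t"
proof -
  have "(\<lambda>n. Var (lift (\<lambda>n. n + k) n)) = (Var 0 ;; shift (Suc k))"
    by (auto simp: lift_def shift_def fun_eq_iff split: nat.splits)
  then show ?thesis by (simp add: wk1_def ren_as_sub)
qed

lemma up_cons: "up \<sigma> = (Var 0 ;; scomp (shift (Suc 0)) \<sigma>)"
  by (simp add: up_def scomp_def[abs_def] ren_Suc_sub)

lemma scomp_cons: "scomp \<sigma> (a ;; \<tau>) = (sub \<sigma> a ;; scomp \<sigma> \<tau>)"
  by (auto simp: scomp_def fun_eq_iff split: nat.splits)

lemma scomp_Var_right: "scomp \<sigma> Var = \<sigma>"
  by (simp add: scomp_def fun_eq_iff)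

lemma scomp_Var_left: "scomp Var \<sigma> = \<sigma>"
  by (simp add: scomp_def fun_eq_iff sub_Var)

lemma scomp_assoc: "scomp (scomp \<sigma> \<tau>) \<upsilon> = scomp \<sigma> (scomp \<tau> \<upsilon>)"
  by (simp add: scomp_def fun_eq_iff sub_sub)

lemma scomp_cons_shift: "scomp (a ;; \<sigma>) (shift (Suc k)) = scomp \<sigma> (shift k)"
  by (simp add: scomp_def fun_eq_iff shift_def)

lemma scomp_cons_shift': "scomp (a ;; \<sigma>) (scomp (shift (Suc k)) \<tau>) = scomp \<sigma> (scomp (shift k) \<tau>)"
  by (simp flip: scomp_assoc add: scomp_cons_shift)

lemma scomp_shift_shift: "scomp (shift k) (shift m) = shift (k + m)"
  by (simp add: scomp_def fun_eq_iff shift_def)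

lemma scomp_shift_shift': "scomp (shift k) (scomp (shift m) \<tau>) = scomp (shift (k + m)) \<tau>"
  by (simp flip: scomp_assoc add: scomp_shift_shift)

lemma shift_app: "shift k n = Var (n + k)"
  by (simp add: shift_def)

lemma cons_eta: "(Var k ;; shift (Suc k)) = shift k"
  by (auto simp: shift_def fun_eq_iff split: nat.splits)

lemma cons_eta': "(\<sigma> k ;; scomp \<sigma> (shift (Suc k))) = scomp \<sigma> (shift k)"
  by (auto simp: scomp_def shift_def fun_eq_iff split: nat.splits)

lemma cons_eta_Var: "(Var 0 ;; shift (Suc 0)) = Var"
  using cons_eta[of 0] by (simp add: shift_0)

text \<open>
  Weakening by one variable is the normal form of \<open>wk 1\<close>: the rewrite rules below turn every \<open>wk k\<close>
  into a substitution by \<open>shift k\<close>, with \<open>k\<close> in unary notation.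
\<close>

abbreviation weaken :: "tm \<Rightarrow> tm" ("\<up>") where "\<up> \<equiv> sub (shift (Suc 0))"

lemmas scons_app = nat.case
lemmas nums = One_nat_def numeral_2_eq_2 numeral_3_eq_3 numeral_eq_Suc pred_numeral_simps add_Suc add_Suc_right add_0 add_0_right BitM.simps

text \<open>
  The equations of the sigma calculus. They normalise a composite of substitutions to a finite list of
  terms followed by a shift, so that simplification proves the equations between substitution instances
  that arise from the typing rules.
\<close>

lemmas asimp = sub.simps sub_sub scomp_cons scomp_Var_right scomp_Var_left scomp_assoc
  scomp_cons_shift scomp_cons_shift' scomp_shift_shift scomp_shift_shift' shift_app shift_0 sub_Var
  scons_app up_cons cons_eta cons_eta' cons_eta_Var wk_sub wk1_sub ren_Suc_sub inst_def
  nums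

lemmas dsimp = asimp arr_def prodT_def iffT_def compose_def htpy_def transport_def apd_def ap_def
  concat_path_def isequiv_def equiv_type_def id_equiv_def id_to_equiv_def happly_def
  glue_clause_def Let_def

section \<open>Admissibility of substitution\<close>

lemma sub_derived:
  "sub \<sigma> (arr A B) = arr (sub \<sigma> A) (sub \<sigma> B)"
  "sub \<sigma> (isequiv A B f) = isequiv (sub \<sigma> A) (sub \<sigma> B) (sub \<sigma> f)"
  "sub \<sigma> (equiv_type A B) = equiv_type (sub \<sigma> A) (sub \<sigma> B)"
  "sub \<sigma> (happly A P f g) = happly (sub \<sigma> A) (sub (up \<sigma>) P) (sub \<sigma> f) (sub \<sigma> g)"
  "sub \<sigma> (htpy A P f g) = htpy (sub \<sigma> A) (sub (up \<sigma>) P) (sub \<sigma> f) (sub \<sigma> g)"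
  "sub \<sigma> (id_to_equiv i A B) = id_to_equiv i (sub \<sigma> A) (sub \<sigma> B)"
  "sub \<sigma> (apd A P e a b p) = apd (sub \<sigma> A) (sub (up \<sigma>) P) (sub (up \<sigma>) e) (sub \<sigma> a) (sub \<sigma> b) (sub \<sigma> p)"
  "sub \<sigma> (ap A B f a b p) = ap (sub \<sigma> A) (sub \<sigma> B) (sub \<sigma> f) (sub \<sigma> a) (sub \<sigma> b) (sub \<sigma> p)"
  "sub \<sigma> (transport A P a b p t) = transport (sub \<sigma> A) (sub (up \<sigma>) P) (sub \<sigma> a) (sub \<sigma> b) (sub \<sigma> p) (sub \<sigma> t)"
  "sub \<sigma> (concat_path A a b c p q) = concat_path (sub \<sigma> A) (sub \<sigma> a) (sub \<sigma> b) (sub \<sigma> c) (sub \<sigma> p) (sub \<sigma> q)"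
  by (simp_all only: dsimp)

lemma sub_up_glue_clause: "sub (up \<sigma>) (glue_clause S A B u v C l r) =
  glue_clause (sub \<sigma> S) (sub \<sigma> A) (sub \<sigma> B) (sub \<sigma> u) (sub \<sigma> v) (sub (up \<sigma>) C) (sub (up \<sigma>) l) (sub (up \<sigma>) r)"
  by (simp only: dsimp)

lemma sub_inst: "sub \<sigma> (inst b a) = inst (sub (up \<sigma>) b) (sub \<sigma> a)"
  by (simp only: dsimp)

lemma sub_cons_shift:
  "sub (up \<sigma>) (sub (PoL (Var 0) ;; shift 1) C) = sub (PoL (Var 0) ;; shift 1) (sub (up \<sigma>) C)"
  "sub (up \<sigma>) (sub (PoR (Var 0) ;; shift 1) C) = sub (PoR (Var 0) ;; shift 1) (sub (up \<sigma>) C)"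
  "sub (up \<sigma>) (sub (InL (Var 0) ;; shift 1) C) = sub (InL (Var 0) ;; shift 1) (sub (up \<sigma>) C)"
  "sub (up \<sigma>) (sub (InR (Var 0) ;; shift 1) C) = sub (InR (Var 0) ;; shift 1) (sub (up \<sigma>) C)"
  "sub (up (up \<sigma>)) (sub (Succ (Var 1) ;; shift 2) C) = sub (Succ (Var 1) ;; shift 2) (sub (up \<sigma>) C)"
  "sub (up \<sigma>) (sub (Refl (Var 0) ;; Var 0 ;; Var) C) = sub (Refl (Var 0) ;; Var 0 ;; Var) (sub (up (up (up \<sigma>))) C)"
  "sub \<sigma> (sub (p ;; b ;; a ;; Var) C) = sub (sub \<sigma> p ;; sub \<sigma> b ;; sub \<sigma> a ;; Var) (sub (up (up (up \<sigma>))) C)"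
  "sub \<sigma> (sub (p ;; b ;; Var) s) = sub (sub \<sigma> p ;; sub \<sigma> b ;; Var) (sub (up (up \<sigma>)) s)"
  by (simp_all only: dsimp)

lemma sub_wk:
  "sub (up \<sigma>) (wk 1 t) = wk 1 (sub \<sigma> t)"
  "sub (up (up \<sigma>)) (wk 2 t) = wk 2 (sub \<sigma> t)"
  "sub (up (up \<sigma>)) (wk1 1 t) = wk1 1 (sub (up \<sigma>) t)"
  by (simp_all only: dsimp)

lemma up_0: "up \<sigma> 0 = Var 0" by (simp add: up_def)

lemmas sub_commute = sub.simps sub_derived sub_up_glue_clause sub_inst sub_cons_shift sub_wk up_0

lemmas sub_commute_IH = sub.simps sub_derived sub_inst sub_wk up_0
lemmas sub_fold = sub_cons_shift(1-6)[symmetric] sub_up_glue_clause[symmetric]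
lemmas eq_rules = eq_Pi eq_Lam eq_App eq_Sig eq_Pair eq_Fst eq_Snd eq_Eq eq_Refl eq_EmptyRec eq_UnitRec
  eq_SumT eq_InL eq_InR eq_SumRec eq_Succ eq_NatRec eq_Po eq_PoL eq_PoR eq_Glue eq_PoRec eq_PoBeta
  eq_FunExt eq_Univalence
lemmas beta_rules = beta_Pi beta_Fst beta_Snd beta_UnitRec beta_InL beta_InR beta_Zero beta_Succ beta_PoL beta_PoR
lemmas ty_rules = ty_univ ty_Pi ty_Lam ty_App ty_Sig ty_Pair ty_Fst ty_Snd ty_Eq ty_Refl ty_EmptyT ty_EmptyRec
  ty_UnitT ty_Star ty_UnitRec ty_SumT ty_InL ty_InR ty_SumRec ty_NatT ty_Zero ty_Succ ty_NatRec
  ty_Po ty_PoL ty_PoR ty_Glue ty_PoRec ty_PoBeta ty_FunExt ty_Univalence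

text \<open>
  Admissibility of renaming and of substitution have the same inductive proof; the renaming case is
  needed first, because lifting a substitution under a binder weakens its terms. The proof is therefore
  done once, for any class \<open>P\<close> of well-typed substitutions that is closed under lifting and weakening.
\<close>

context
  fixes P :: "ctx \<Rightarrow> (nat \<Rightarrow> tm) \<Rightarrow> ctx \<Rightarrow> bool"
  assumes P_var: "\<And>\<Gamma> \<sigma> \<Delta> n. P \<Gamma> \<sigma> \<Delta> \<Longrightarrow> n < length \<Gamma> \<Longrightarrow> \<Delta> \<turnstile> \<sigma> n \<^bold>: sub \<sigma> (wk (Suc n) (\<Gamma> ! n))"
    and P_wf: "\<And>\<Gamma> \<sigma> \<Delta>. P \<Gamma> \<sigma> \<Delta> \<Longrightarrow> \<turnstile> \<Delta>"
    and P_up: "\<And>\<Gamma> \<sigma> \<Delta> A i. P \<Gamma> \<sigma> \<Delta> \<Longrightarrow> \<Delta> \<turnstile> sub \<sigma> A \<^bold>: U i \<Longrightarrow> P (A # \<Gamma>) (up \<sigma>) (sub \<sigma> A # \<Delta>)"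
    and P_wk: "\<And>\<Gamma> \<sigma> \<Delta> B i. P \<Gamma> \<sigma> \<Delta> \<Longrightarrow> \<Delta> \<turnstile> B \<^bold>: U i \<Longrightarrow> P \<Gamma> (scomp (shift 1) \<sigma>) (B # \<Delta>)"
begin

lemmas P_up_former =
  P_up[where A = EmptyT, unfolded sub.simps] P_up[where A = UnitT, unfolded sub.simps]
  P_up[where A = NatT, unfolded sub.simps] P_up[where A = "SumT A B" for A B, unfolded sub.simps]
  P_up[where A = "Po S A B u v" for S A B u v, unfolded sub.simps]

lemmas lifts = P_wf P_up P_up_former ty_EmptyT ty_UnitT ty_NatT ty_SumT ty_Po

text \<open>
  The motive of \<open>J\<close> lives under three binders whose types are not premises of the rule, so the
  induction hypotheses do not lift the substitution.
\<close>

lemma P_up_J: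
  assumes A: "\<And>\<sigma> \<Delta>. P \<Gamma> \<sigma> \<Delta> \<Longrightarrow> \<Delta> \<turnstile> sub \<sigma> A \<^bold>: U i" and P: "P \<Gamma> \<sigma> \<Delta>"
  shows "P (Eq (wk 2 A) (Var 1) (Var 0) # wk 1 A # A # \<Gamma>) (up (up (up \<sigma>)))
    (Eq (wk 2 (sub \<sigma> A)) (Var 1) (Var 0) # wk 1 (sub \<sigma> A) # sub \<sigma> A # \<Delta>)"
proof -
  let ?A = "sub \<sigma> A"
  have 1: "P (A # \<Gamma>) (up \<sigma>) (?A # \<Delta>)" using P A P_up by blast
  have w: "P \<Gamma> (scomp (shift 1) \<sigma>) (?A # \<Delta>)" using P A P_wk by blast
  have wA: "?A # \<Delta> \<turnstile> wk 1 ?A \<^bold>: U i" using A[OF w] by (simp only: dsimp)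
  have 2: "P (wk 1 A # A # \<Gamma>) (up (up \<sigma>)) (wk 1 ?A # ?A # \<Delta>)"
    using P_up[OF 1, of "wk 1 A" i] wA unfolding sub_wk by blast
  have w2: "P \<Gamma> (scomp (shift 1) (scomp (shift 1) \<sigma>)) (wk 1 ?A # ?A # \<Delta>)" using w wA P_wk by blast
  have w2A: "wk 1 ?A # ?A # \<Delta> \<turnstile> wk 2 ?A \<^bold>: U i" using A[OF w2] by (simp only: dsimp)
  have "wk 1 ?A # ?A # \<Delta> \<turnstile> Eq (wk 2 ?A) (Var 1) (Var 0) \<^bold>: U i"
    using ty_var[OF P_wf[OF 2], of 0] ty_var[OF P_wf[OF 2], of 1]
    by (intro ty_Eq w2A) (simp_all only: dsimp length_Cons nth_Cons_0 nth_Cons_Suc zero_less_Suc Suc_less_eq simp_thms)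
  then show ?thesis
    using P_up[OF 2, of "Eq (wk 2 A) (Var 1) (Var 0)" i] unfolding sub.simps sub_wk by (simp add: up_def)
qed

text \<open>
  Each case applies the derivation rule itself to the substituted premises. Apart from the structural
  rules, the cases that are treated by name are those in which a substitution that is part of the rule
  has to be commuted with \<open>\<sigma>\<close>.
\<close>

lemma substitution_generic:
  "\<turnstile> \<Gamma> \<Longrightarrow> True"
  "\<Gamma> \<turnstile> t \<^bold>: T \<Longrightarrow> (\<And>\<sigma> \<Delta>. P \<Gamma> \<sigma> \<Delta> \<Longrightarrow> \<Delta> \<turnstile> sub \<sigma> t \<^bold>: sub \<sigma> T)"
  "\<Gamma> \<turnstile> t \<approx> t' \<^bold>: T \<Longrightarrow> (\<And>\<sigma> \<Delta>. P \<Gamma> \<sigma> \<Delta> \<Longrightarrow> \<Delta> \<turnstile> sub \<sigma> t \<approx> sub \<sigma> t' \<^bold>: sub \<sigma> T)"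
proof (induction rule: wf_ctx_has_type_equal_at.inducts)
  case (ty_var \<Gamma> n)
  then show ?case by (simp add: P_var)
next
  case (ty_J \<Gamma> A i C k d a b p)
  show ?case unfolding sub_commute
    by (rule wf_ctx_has_type_equal_at.ty_J; (simp only: sub_fold)?, blast intro: ty_J.IH[unfolded sub_commute_IH] P_up P_up_J[OF ty_J.IH(1)[unfolded sub_commute_IH] ty_J.prems] ty_J.prems)
next
  case (eq_J \<Gamma> A i A' C k C' d d' a a' b b' p p')
  show ?case unfolding sub_commute
    by (rule wf_ctx_has_type_equal_at.eq_J; (simp only: sub_fold)?, blast intro: eq_J.IH[unfolded sub_commute_IH] P_up P_up_J[OF eq_J.IH(1)[unfolded sub_commute_IH] eq_J.prems] eq_J.prems)
next
  case (beta_J \<Gamma> A i C k d a)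
  show ?case unfolding sub_commute
    by (rule wf_ctx_has_type_equal_at.beta_J; (simp only: sub_fold)?, blast intro: beta_J.IH[unfolded sub_commute_IH] P_up P_up_J[OF beta_J.IH(1)[unfolded sub_commute_IH] beta_J.prems] beta_J.prems)
next
  case eq_trans then show ?case by (blast intro: wf_ctx_has_type_equal_at.eq_trans)
next
  case (eq_sym \<Gamma> a b A) then show ?case by (blast intro: wf_ctx_has_type_equal_at.eq_sym)
next
  case (eta_Pi \<Gamma> A i B f)
  show ?case unfolding sub_commute
    by (rule wf_ctx_has_type_equal_at.eta_Pi; (simp only: sub_fold)?, blast intro: eta_Pi.IH[unfolded sub_commute_IH] P_up eta_Pi.prems)
next
  case (eta_Sig \<Gamma> A i B f)
  show ?case unfolding sub_commute
    by (rule wf_ctx_has_type_equal_at.eta_Sig; (simp only: sub_fold)?, blast intro: eta_Sig.IH[unfolded sub_commute_IH] P_up eta_Sig.prems)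
next
  case (ty_conv \<Gamma> a A B i)
  then show ?case unfolding sub_commute by (blast intro: wf_ctx_has_type_equal_at.ty_conv)
next
  case (eq_conv \<Gamma> a A B i)
  then show ?case unfolding sub_commute by (blast intro: wf_ctx_has_type_equal_at.eq_conv)
next
  case (eq_refl \<Gamma> a A)
  then show ?case by (blast intro: wf_ctx_has_type_equal_at.eq_refl)
next
  case (ty_cumul \<Gamma> a A)
  then show ?case unfolding sub_commute by (blast intro: wf_ctx_has_type_equal_at.ty_cumul)
next
  case (eq_cumul \<Gamma> a A)
  then show ?case unfolding sub_commute by (blast intro: wf_ctx_has_type_equal_at.eq_cumul)
next
  case beta_Succ show ?case unfolding sub_commute by (rule wf_ctx_has_type_equal_at.beta_Succ; (simp (no_asm) only: sub_fold)?,
    blast intro: beta_Succ.IH[unfolded sub_commute_IH] beta_Succ.prems lifts)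
next
  case ty_PoRec show ?case unfolding sub_commute by (rule wf_ctx_has_type_equal_at.ty_PoRec; (simp (no_asm) only: sub_fold)?,
    blast intro: ty_PoRec.IH[unfolded sub_commute_IH] ty_PoRec.prems lifts)
next
  case eq_PoRec show ?case unfolding sub_commute by (rule wf_ctx_has_type_equal_at.eq_PoRec; (simp (no_asm) only: sub_fold)?,
    blast intro: eq_PoRec.IH[unfolded sub_commute_IH] eq_PoRec.prems lifts)
next
  case beta_PoL show ?case unfolding sub_commute by (rule wf_ctx_has_type_equal_at.beta_PoL; (simp (no_asm) only: sub_fold)?,
    blast intro: beta_PoL.IH[unfolded sub_commute_IH] beta_PoL.prems lifts)
next
  case beta_PoR show ?case unfolding sub_commute by (rule wf_ctx_has_type_equal_at.beta_PoR; (simp (no_asm) only: sub_fold)?,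
    blast intro: beta_PoR.IH[unfolded sub_commute_IH] beta_PoR.prems lifts)
next
  case ty_PoBeta show ?case unfolding sub_commute by (rule wf_ctx_has_type_equal_at.ty_PoBeta; (simp (no_asm) only: sub_fold)?,
    blast intro: ty_PoBeta.IH[unfolded sub_commute_IH] ty_PoBeta.prems lifts)
next
  case eq_PoBeta show ?case unfolding sub_commute by (rule wf_ctx_has_type_equal_at.eq_PoBeta; (simp (no_asm) only: sub_fold)?,
    blast intro: eq_PoBeta.IH[unfolded sub_commute_IH] eq_PoBeta.prems lifts)
qed ((rule TrueI)+, unfold sub_commute_IH,
  ((rule ty_rules eq_rules beta_rules; (simp (no_asm) only: sub_fold)?, (blast intro: lifts))[1])+)

end

lemma ctx_of_judgment:
  "\<turnstile> \<Gamma> \<Longrightarrow> True"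
  "\<Gamma> \<turnstile> t \<^bold>: T \<Longrightarrow> \<turnstile> \<Gamma>"
  "\<Gamma> \<turnstile> t \<approx> t' \<^bold>: T \<Longrightarrow> \<turnstile> \<Gamma>"
  by (induction rule: wf_ctx_has_type_equal_at.inducts) simp_all

definition is_renaming :: "ctx \<Rightarrow> (nat \<Rightarrow> tm) \<Rightarrow> ctx \<Rightarrow> bool" where
  "is_renaming \<Gamma> \<sigma> \<Delta> \<longleftrightarrow> \<turnstile> \<Delta> \<and> (\<forall>n < length \<Gamma>. \<exists>m < length \<Delta>.
     \<sigma> n = Var m \<and> wk (Suc m) (\<Delta> ! m) = sub \<sigma> (wk (Suc n) (\<Gamma> ! n)))"

lemma sub_up_wk_Suc: "sub (up \<sigma>) (wk (Suc n) t) = wk 1 (sub \<sigma> (wk n t))"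
  by (simp only: dsimp)

lemma is_renaming_up:
  assumes "is_renaming \<Gamma> \<sigma> \<Delta>" "\<Delta> \<turnstile> sub \<sigma> A \<^bold>: U i"
  shows "is_renaming (A # \<Gamma>) (up \<sigma>) (sub \<sigma> A # \<Delta>)"
  unfolding is_renaming_def
proof (intro conjI allI impI)
  show "\<turnstile> sub \<sigma> A # \<Delta>" using assms ctx_extend is_renaming_def by blast
  fix n assume n: "n < length (A # \<Gamma>)"
  show "\<exists>m<length (sub \<sigma> A # \<Delta>). up \<sigma> n = Var m \<and> wk (Suc m) ((sub \<sigma> A # \<Delta>) ! m) = sub (up \<sigma>) (wk (Suc n) ((A # \<Gamma>) ! n))"
  proof (cases n)
    case 0 then show ?thesis by (intro exI[of _ 0]) (simp add: up_0 sub_wk(1)[unfolded One_nat_def])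
  next
    case (Suc k)
    then obtain m where m: "m < length \<Delta>" "\<sigma> k = Var m" "wk (Suc m) (\<Delta> ! m) = sub \<sigma> (wk (Suc k) (\<Gamma> ! k))"
      using assms(1) n unfolding is_renaming_def by auto
    have "wk (Suc (Suc m)) (\<Delta> ! m) = wk 1 (wk (Suc m) (\<Delta> ! m))" by (simp only: dsimp)
    then show ?thesis using m Suc by (intro exI[of _ "Suc m"]) (simp add: sub_up_wk_Suc, simp add: up_def)
  qed
qed

lemma is_renaming_wk:
  assumes "is_renaming \<Gamma> \<sigma> \<Delta>" "\<Delta> \<turnstile> B \<^bold>: U i"
  shows "is_renaming \<Gamma> (scomp (shift 1) \<sigma>) (B # \<Delta>)"
  unfolding is_renaming_def
proof (intro conjI allI impI)
  show "\<turnstile> B # \<Delta>" using assms ctx_extend is_renaming_def by blast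
  fix n assume n: "n < length \<Gamma>"
  then obtain m where m: "m < length \<Delta>" "\<sigma> n = Var m" "wk (Suc m) (\<Delta> ! m) = sub \<sigma> (wk (Suc n) (\<Gamma> ! n))"
    using assms(1) n unfolding is_renaming_def by auto
  have "wk (Suc (Suc m)) (\<Delta> ! m) = wk 1 (wk (Suc m) (\<Delta> ! m))" by (simp only: dsimp)
  also have "\<dots> = sub (scomp (shift 1) \<sigma>) (wk (Suc n) (\<Gamma> ! n))" unfolding m(3) by (simp only: dsimp)
  finally show "\<exists>m<length (B # \<Delta>). scomp (shift 1) \<sigma> n = Var m \<and> wk (Suc m) ((B # \<Delta>) ! m) = sub (scomp (shift 1) \<sigma>) (wk (Suc n) (\<Gamma> ! n))"
    using m(1,2) by (intro exI[of _ "Suc m"]) (simp add: scomp_def shift_def)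
qed

lemma renaming:
  assumes "is_renaming \<Gamma> \<sigma> \<Delta>"
  shows "\<Gamma> \<turnstile> t \<^bold>: T \<Longrightarrow> \<Delta> \<turnstile> sub \<sigma> t \<^bold>: sub \<sigma> T"
proof -
  have var: "\<Delta> \<turnstile> \<sigma> n \<^bold>: sub \<sigma> (wk (Suc n) (\<Gamma> ! n))"
    if "is_renaming \<Gamma> \<sigma> \<Delta>" "n < length \<Gamma>" for \<Gamma> \<sigma> \<Delta> n
    using that ty_var unfolding is_renaming_def by metis
  show "\<Gamma> \<turnstile> t \<^bold>: T \<Longrightarrow> \<Delta> \<turnstile> sub \<sigma> t \<^bold>: sub \<sigma> T"
    by (rule substitution_generic(2)[where P = is_renaming])
      (use assms var is_renaming_up is_renaming_wk in \<open>auto simp: is_renaming_def\<close>)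
qed

lemma is_renaming_shift: "\<turnstile> B # \<Gamma> \<Longrightarrow> is_renaming \<Gamma> (shift 1) (B # \<Gamma>)"
  unfolding is_renaming_def
  by (auto intro!: exI[of _ "Suc n" for n] simp: shift_def wk_sub sub_sub scomp_shift_shift)

lemma weakening: "\<Gamma> \<turnstile> t \<^bold>: T \<Longrightarrow> \<turnstile> B # \<Gamma> \<Longrightarrow> B # \<Gamma> \<turnstile> sub (shift 1) t \<^bold>: sub (shift 1) T"
  using renaming is_renaming_shift by blast

definition is_subst :: "ctx \<Rightarrow> (nat \<Rightarrow> tm) \<Rightarrow> ctx \<Rightarrow> bool" where
  "is_subst \<Gamma> \<sigma> \<Delta> \<longleftrightarrow> \<turnstile> \<Delta> \<and> (\<forall>n < length \<Gamma>. \<Delta> \<turnstile> \<sigma> n \<^bold>: sub \<sigma> (wk (Suc n) (\<Gamma> ! n)))"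

lemma is_subst_wk:
  assumes "is_subst \<Gamma> \<sigma> \<Delta>" "\<turnstile> B # \<Delta>"
  shows "is_subst \<Gamma> (scomp (shift 1) \<sigma>) (B # \<Delta>)"
  using assms weakening[of \<Delta> "\<sigma> n" "sub \<sigma> (wk (Suc n) (\<Gamma> ! n))" B for n]
  unfolding is_subst_def by (auto simp: sub_sub scomp_assoc) (simp add: scomp_def)

lemma is_subst_up:
  assumes "is_subst \<Gamma> \<sigma> \<Delta>" "\<Delta> \<turnstile> sub \<sigma> A \<^bold>: U i"
  shows "is_subst (A # \<Gamma>) (up \<sigma>) (sub \<sigma> A # \<Delta>)"
proof -
  have wf: "\<turnstile> sub \<sigma> A # \<Delta>" using assms ctx_extend is_subst_def by blast
  show ?thesis unfolding is_subst_def
  proof (intro conjI allI impI wf)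
    fix n assume n: "n < length (A # \<Gamma>)"
    show "sub \<sigma> A # \<Delta> \<turnstile> up \<sigma> n \<^bold>: sub (up \<sigma>) (wk (Suc n) ((A # \<Gamma>) ! n))"
    proof (cases n)
      case 0 then show ?thesis using ty_var[OF wf, of 0] by (simp add: up_0 sub_wk(1)[unfolded One_nat_def])
    next
      case (Suc k)
      then have "sub \<sigma> A # \<Delta> \<turnstile> wk 1 (\<sigma> k) \<^bold>: wk 1 (sub \<sigma> (wk (Suc k) (\<Gamma> ! k)))"
        using weakening[OF _ wf] assms(1) n unfolding is_subst_def wk_sub by auto
      then show ?thesis using Suc by (simp add: sub_up_wk_Suc) (simp add: up_def wk_def)
    qed
  qed
qed

lemma substitution:
  assumes "is_subst \<Gamma> \<sigma> \<Delta>"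
  shows "\<Gamma> \<turnstile> t \<^bold>: T \<Longrightarrow> \<Delta> \<turnstile> sub \<sigma> t \<^bold>: sub \<sigma> T"
    and "\<Gamma> \<turnstile> t \<approx> t' \<^bold>: T \<Longrightarrow> \<Delta> \<turnstile> sub \<sigma> t \<approx> sub \<sigma> t' \<^bold>: sub \<sigma> T"
proof -
  note inst = substitution_generic[where P = is_subst, OF _ _ is_subst_up is_subst_wk]
  show "\<Gamma> \<turnstile> t \<^bold>: T \<Longrightarrow> \<Delta> \<turnstile> sub \<sigma> t \<^bold>: sub \<sigma> T"
    by (rule inst(2)) (use assms ctx_extend in \<open>auto simp: is_subst_def\<close>)
  show "\<Gamma> \<turnstile> t \<approx> t' \<^bold>: T \<Longrightarrow> \<Delta> \<turnstile> sub \<sigma> t \<approx> sub \<sigma> t' \<^bold>: sub \<sigma> T"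
    by (rule inst(3)) (use assms ctx_extend in \<open>auto simp: is_subst_def\<close>)
qed

section \<open>Judgments with presuppositions\<close>

text \<open>
  The cumulativity and conversion rules do not change the term, so a plain induction suffices, without
  any uniqueness of types.
\<close>

lemma type_inversion:
  "\<turnstile> \<Gamma> \<Longrightarrow> True"
  "\<Gamma> \<turnstile> t \<^bold>: T \<Longrightarrow>
     (\<forall>A B. t = Pi A B \<or> t = Sig A B \<longrightarrow> (\<exists>i. \<Gamma> \<turnstile> A \<^bold>: U i \<and> A # \<Gamma> \<turnstile> B \<^bold>: U i)) \<and>
     (\<forall>A a b. t = Eq A a b \<longrightarrow> (\<exists>i. \<Gamma> \<turnstile> A \<^bold>: U i) \<and> \<Gamma> \<turnstile> a \<^bold>: A \<and> \<Gamma> \<turnstile> b \<^bold>: A)"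
  "\<Gamma> \<turnstile> t \<approx> t' \<^bold>: T \<Longrightarrow> True"
proof (induction rule: wf_ctx_has_type_equal_at.inducts)
  case (ty_conv \<Gamma> a A B i) show ?case by (rule ty_conv.IH(1))
next
  case (ty_cumul \<Gamma> A i) show ?case by (rule ty_cumul.IH)
next
  case (ty_Pi \<Gamma> A i B) then show ?case by (simp (no_asm)) blast
next
  case (ty_Sig \<Gamma> A i B) then show ?case by (simp (no_asm)) blast
next
  case (ty_Eq \<Gamma> A i a b) then show ?case by (simp (no_asm)) blast
qed (simp_all (no_asm))

lemma cumul: "\<Gamma> \<turnstile> A \<^bold>: U i \<Longrightarrow> i \<le> j \<Longrightarrow> \<Gamma> \<turnstile> A \<^bold>: U j"
proof -
  assume A: "\<Gamma> \<turnstile> A \<^bold>: U i"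
  have "\<Gamma> \<turnstile> A \<^bold>: U (i + d)" for d by (induction d) (simp_all add: A ty_cumul)
  then show "i \<le> j \<Longrightarrow> \<Gamma> \<turnstile> A \<^bold>: U j" by (auto simp: le_iff_add)
qed

lemma eq_cumul_le: "\<Gamma> \<turnstile> A \<approx> B \<^bold>: U i \<Longrightarrow> i \<le> j \<Longrightarrow> \<Gamma> \<turnstile> A \<approx> B \<^bold>: U j"
proof -
  assume A: "\<Gamma> \<turnstile> A \<approx> B \<^bold>: U i"
  have "\<Gamma> \<turnstile> A \<approx> B \<^bold>: U (i + d)" for d by (induction d) (simp_all add: A eq_cumul)
  then show "i \<le> j \<Longrightarrow> \<Gamma> \<turnstile> A \<approx> B \<^bold>: U j" by (auto simp: le_iff_add)
qed

text \<open>
  Judgments with their presuppositions: \<open>has\<close> and \<open>teq\<close> also assert that the type is a type, and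
  \<open>teq\<close> that both sides are typed. In \<open>chk\<close> the type is an input and is assumed to be well formed.
  This bidirectional reading (\<open>has\<close> infers, \<open>chk\<close> checks) is what makes the rules below syntax directed.
\<close>

definition wty :: "ctx \<Rightarrow> tm \<Rightarrow> bool" where "wty \<Gamma> A \<longleftrightarrow> (\<exists>i. \<Gamma> \<turnstile> A \<^bold>: U i)"
definition has :: "ctx \<Rightarrow> tm \<Rightarrow> tm \<Rightarrow> bool" where "has \<Gamma> t T \<longleftrightarrow> \<Gamma> \<turnstile> t \<^bold>: T \<and> wty \<Gamma> T"
definition chk :: "ctx \<Rightarrow> tm \<Rightarrow> tm \<Rightarrow> bool" where "chk \<Gamma> t T \<longleftrightarrow> (wty \<Gamma> T \<longrightarrow> \<Gamma> \<turnstile> t \<^bold>: T)"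
definition teq :: "ctx \<Rightarrow> tm \<Rightarrow> tm \<Rightarrow> tm \<Rightarrow> bool"
  where "teq \<Gamma> a b T \<longleftrightarrow> \<Gamma> \<turnstile> a \<approx> b \<^bold>: T \<and> has \<Gamma> a T \<and> has \<Gamma> b T"
definition tyeq :: "ctx \<Rightarrow> tm \<Rightarrow> tm \<Rightarrow> bool"
  where "tyeq \<Gamma> A B \<longleftrightarrow> (\<exists>i. teq \<Gamma> A B (U i))"
definition inh :: "ctx \<Rightarrow> tm \<Rightarrow> bool" where "inh \<Gamma> T \<longleftrightarrow> (\<exists>t. has \<Gamma> t T)"

lemma wty_ctx': "wty \<Gamma> A \<Longrightarrow> \<turnstile> \<Gamma>"
  unfolding wty_def by (elim exE) (rule ctx_of_judgment(2))

lemma wty_ctx: "wty \<Gamma> A \<Longrightarrow> \<turnstile> A # \<Gamma>"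
  unfolding wty_def using ctx_extend ctx_of_judgment(2)[of \<Gamma> A] by auto

lemma ctx_wty: "\<turnstile> A # \<Gamma> \<Longrightarrow> wty \<Gamma> A"
  unfolding wty_def by (erule wf_ctx.cases) auto

lemma has_ctx: "has \<Gamma> t A \<Longrightarrow> \<turnstile> \<Gamma>"
  unfolding has_def by (elim conjE) (rule ctx_of_judgment(2))

lemma wty_binderD:
  assumes "wty \<Gamma> (Pi A B) \<or> wty \<Gamma> (Sig A B)" shows "wty \<Gamma> A" "wty (A # \<Gamma>) B"
proof -
  obtain i t where t: "\<Gamma> \<turnstile> t \<^bold>: U i" "t = Pi A B \<or> t = Sig A B" using assms wty_def by auto
  then obtain j where "\<Gamma> \<turnstile> A \<^bold>: U j" "A # \<Gamma> \<turnstile> B \<^bold>: U j"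
    using conjunct1[OF type_inversion(2)[OF t(1)], THEN spec, THEN spec, THEN mp, OF t(2)] by (elim exE conjE)
  then show "wty \<Gamma> A" "wty (A # \<Gamma>) B" by (auto simp: wty_def)
qed

lemmas wty_PiD = wty_binderD[OF disjI1] and wty_SigD = wty_binderD[OF disjI2]

lemma
  assumes "wty \<Gamma> (Eq A a b)" shows wty_EqD: "wty \<Gamma> A" "has \<Gamma> a A" "has \<Gamma> b A"
proof -
  obtain i where i: "\<Gamma> \<turnstile> Eq A a b \<^bold>: U i" using assms unfolding wty_def by (elim exE)
  have "(\<exists>i. \<Gamma> \<turnstile> A \<^bold>: U i) \<and> \<Gamma> \<turnstile> a \<^bold>: A \<and> \<Gamma> \<turnstile> b \<^bold>: A"
    using conjunct2[OF type_inversion(2)[OF i], THEN spec, THEN spec, THEN spec, THEN mp, OF refl] .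
  then show "wty \<Gamma> A" "has \<Gamma> a A" "has \<Gamma> b A" unfolding wty_def has_def by simp_all
qed

lemma wtyI: "\<Gamma> \<turnstile> A \<^bold>: U i \<Longrightarrow> wty \<Gamma> A"
  unfolding wty_def by (rule exI)

text \<open>
  The rules for type formers want their arguments in one universe; cumulativity provides it.
\<close>

lemma common_level:
  assumes "wty \<Gamma> A" "wty \<Delta> B" shows "\<exists>i. \<Gamma> \<turnstile> A \<^bold>: U i \<and> \<Delta> \<turnstile> B \<^bold>: U i"
proof -
  obtain i j where "\<Gamma> \<turnstile> A \<^bold>: U i" "\<Delta> \<turnstile> B \<^bold>: U j" using assms unfolding wty_def by (elim exE)
  then have "\<Gamma> \<turnstile> A \<^bold>: U (max i j) \<and> \<Delta> \<turnstile> B \<^bold>: U (max i j)"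
    by (intro conjI cumul[OF _ max.cobounded1] cumul[OF _ max.cobounded2])
  then show ?thesis by (rule exI)
qed

lemma wty_U: "\<turnstile> \<Gamma> \<Longrightarrow> wty \<Gamma> (U i)" by (rule wtyI, rule ty_univ)

lemma wty_Pi: "wty \<Gamma> A \<Longrightarrow> (\<turnstile> A # \<Gamma> \<Longrightarrow> wty (A # \<Gamma>) B) \<Longrightarrow> wty \<Gamma> (Pi A B)"
  using common_level[of \<Gamma> A "A # \<Gamma>" B] wty_ctx[of \<Gamma> A] by (auto intro: wtyI ty_Pi)

lemma wty_Sig: "wty \<Gamma> A \<Longrightarrow> (\<turnstile> A # \<Gamma> \<Longrightarrow> wty (A # \<Gamma>) B) \<Longrightarrow> wty \<Gamma> (Sig A B)"
  using common_level[of \<Gamma> A "A # \<Gamma>" B] wty_ctx[of \<Gamma> A] by (auto intro: wtyI ty_Sig)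

lemma wty_Eq: "wty \<Gamma> A \<Longrightarrow> chk \<Gamma> a A \<Longrightarrow> chk \<Gamma> b A \<Longrightarrow> wty \<Gamma> (Eq A a b)"
  unfolding chk_def by (simp, unfold wty_def) (elim exE, rule exI, rule ty_Eq)

lemma wty_el: "has \<Gamma> A T \<Longrightarrow> T = U i \<Longrightarrow> wty \<Gamma> A" unfolding has_def by (elim conjE) (simp, rule wtyI)

lemma wty_sub: "wty \<Gamma> A \<Longrightarrow> is_subst \<Gamma> \<sigma> \<Delta> \<Longrightarrow> wty \<Delta> (sub \<sigma> A)"
  using substitution(1)[of \<Gamma> \<sigma> \<Delta> A "U i" for i] unfolding wty_def by auto

lemma has_sub: "has \<Gamma> t T \<Longrightarrow> is_subst \<Gamma> \<sigma> \<Delta> \<Longrightarrow> sub \<sigma> T = T' \<Longrightarrow> has \<Delta> (sub \<sigma> t) T'"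
  using substitution(1)[of \<Gamma> \<sigma> \<Delta> t T] wty_sub[of \<Gamma> T \<sigma> \<Delta>] unfolding has_def by simp

lemma chkD: "chk \<Gamma> t T \<Longrightarrow> wty \<Gamma> T \<Longrightarrow> has \<Gamma> t T" by (simp add: chk_def has_def)
lemma chk_has: "has \<Gamma> t T' \<Longrightarrow> T' = T \<Longrightarrow> chk \<Gamma> t T" by (simp add: chk_def has_def)

lemma is_subst_Var: "\<turnstile> \<Gamma> \<Longrightarrow> is_subst \<Gamma> Var \<Gamma>"
  by (auto simp: is_subst_def ty_var sub_Var)
lemma is_subst_cons:
  "is_subst \<Gamma> \<sigma> \<Delta> \<Longrightarrow> \<turnstile> A # \<Gamma> \<Longrightarrow> sub \<sigma> A = A' \<Longrightarrow> chk \<Delta> a A' \<Longrightarrow> is_subst (A # \<Gamma>) (a ;; \<sigma>) \<Delta>"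
proof -
  assume *: "is_subst \<Gamma> \<sigma> \<Delta>" "\<turnstile> A # \<Gamma>" "sub \<sigma> A = A'" "chk \<Delta> a A'"
  then have "\<Delta> \<turnstile> a \<^bold>: sub \<sigma> A" using wty_sub ctx_wty chkD has_def by blast
  then show ?thesis using * unfolding is_subst_def
    by (auto simp: wk_sub sub_sub scomp_cons_shift shift_0 scomp_Var_right nth_Cons split: nat.splits)
qed
lemma is_subst_shift: "\<turnstile> A # \<Delta> \<Longrightarrow> is_subst \<Gamma> (shift k) \<Delta> \<Longrightarrow> is_subst \<Gamma> (shift (Suc k)) (A # \<Delta>)"
  using is_subst_wk[of \<Gamma> "shift k" \<Delta> A] by (simp add: scomp_shift_shift)
lemma ctx_tail: "\<turnstile> A # \<Gamma> \<Longrightarrow> \<turnstile> \<Gamma>" using ctx_wty wty_ctx' by blast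

text \<open>
  The rules for shifts and variables are unfolded up to a depth that covers the telescopes below, so that
  they apply by matching.
\<close>

lemma is_subst_shift_1: "\<turnstile> A # \<Gamma> \<Longrightarrow> is_subst \<Gamma> (shift (Suc 0)) (A # \<Gamma>)"
  by (rule is_subst_shift, assumption, drule ctx_tail, simp add: shift_0 is_subst_Var)
lemma is_subst_shift_2: "\<turnstile> A # B # \<Gamma> \<Longrightarrow> is_subst \<Gamma> (shift (Suc (Suc 0))) (A # B # \<Gamma>)"
  by (rule is_subst_shift, assumption, drule ctx_tail, rule is_subst_shift_1)
lemma is_subst_shift_3: "\<turnstile> A # B # C # \<Gamma> \<Longrightarrow> is_subst \<Gamma> (shift (Suc (Suc (Suc 0)))) (A # B # C # \<Gamma>)"
  by (rule is_subst_shift, assumption, drule ctx_tail, rule is_subst_shift_2)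
lemma is_subst_shift_4: "\<turnstile> A # B # C # D # \<Gamma> \<Longrightarrow> is_subst \<Gamma> (shift (Suc (Suc (Suc (Suc 0))))) (A # B # C # D # \<Gamma>)"
  by (rule is_subst_shift, assumption, drule ctx_tail, rule is_subst_shift_3)
lemma is_subst_shift_5: "\<turnstile> A # B # C # D # E # \<Gamma> \<Longrightarrow> is_subst \<Gamma> (shift (Suc (Suc (Suc (Suc (Suc 0)))))) (A # B # C # D # E # \<Gamma>)"
  by (rule is_subst_shift, assumption, drule ctx_tail, rule is_subst_shift_4)
lemma is_subst_shift_6: "\<turnstile> A # B # C # D # E # F # \<Gamma> \<Longrightarrow> is_subst \<Gamma> (shift (Suc (Suc (Suc (Suc (Suc (Suc 0))))))) (A # B # C # D # E # F # \<Gamma>)"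
  by (rule is_subst_shift, assumption, drule ctx_tail, rule is_subst_shift_5)
lemma is_subst_shift_7: "\<turnstile> B0 # B1 # B2 # B3 # B4 # B5 # B6 # \<Gamma> \<Longrightarrow> is_subst \<Gamma> (shift (Suc (Suc (Suc (Suc (Suc (Suc (Suc 0)))))))) (B0 # B1 # B2 # B3 # B4 # B5 # B6 # \<Gamma>)"
  by (rule is_subst_shift, assumption, drule ctx_tail, rule is_subst_shift_6)
lemma is_subst_shift_8: "\<turnstile> B0 # B1 # B2 # B3 # B4 # B5 # B6 # B7 # \<Gamma> \<Longrightarrow> is_subst \<Gamma> (shift (Suc (Suc (Suc (Suc (Suc (Suc (Suc (Suc 0))))))))) (B0 # B1 # B2 # B3 # B4 # B5 # B6 # B7 # \<Gamma>)"
  by (rule is_subst_shift, assumption, drule ctx_tail, rule is_subst_shift_7)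
lemma is_subst_shift_9: "\<turnstile> B0 # B1 # B2 # B3 # B4 # B5 # B6 # B7 # B8 # \<Gamma> \<Longrightarrow> is_subst \<Gamma> (shift (Suc (Suc (Suc (Suc (Suc (Suc (Suc (Suc (Suc 0)))))))))) (B0 # B1 # B2 # B3 # B4 # B5 # B6 # B7 # B8 # \<Gamma>)"
  by (rule is_subst_shift, assumption, drule ctx_tail, rule is_subst_shift_8)

lemmas subst_shifts = is_subst_shift_1 is_subst_shift_2 is_subst_shift_3 is_subst_shift_4 is_subst_shift_5 is_subst_shift_6
  is_subst_shift_7 is_subst_shift_8 is_subst_shift_9

lemma has_VarI: "is_subst (A # \<Gamma>) (shift k) \<Delta> \<Longrightarrow> sub (shift (Suc k)) A = T \<Longrightarrow> \<turnstile> A # \<Gamma> \<Longrightarrow> has \<Delta> (Var k) T"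
proof -
  assume *: "is_subst (A # \<Gamma>) (shift k) \<Delta>" "sub (shift (Suc k)) A = T" "\<turnstile> A # \<Gamma>"
  have "has (A # \<Gamma>) (Var 0) (sub (shift 1) A)"
    using ty_var[OF *(3), of 0] wty_sub[OF ctx_wty[OF *(3)] subst_shifts(1)[OF *(3)]]
    by (simp add: has_def wk_sub)
  then show ?thesis using *(1,2) has_sub[of "A # \<Gamma>" "Var 0" "sub (shift 1) A" "shift k" \<Delta> T]
    by (simp add: sub_sub scomp_shift_shift shift_app)
qed

lemma has_Var_0: "\<turnstile> A # \<Gamma> \<Longrightarrow> sub (shift 1) A = T \<Longrightarrow> has (A # \<Gamma>) (Var 0) T"
  by (rule has_VarI) (simp_all add: shift_0 is_subst_Var)
lemma has_Var_1: "\<turnstile> B # A # \<Gamma> \<Longrightarrow> sub (shift 2) A = T \<Longrightarrow> has (B # A # \<Gamma>) (Var (Suc 0)) T"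
  by (rule has_VarI, rule is_subst_shift_1, assumption, simp only: nums, (erule ctx_tail | drule ctx_tail)+)
lemma has_Var_2: "\<turnstile> C # B # A # \<Gamma> \<Longrightarrow> sub (shift 3) A = T \<Longrightarrow> has (C # B # A # \<Gamma>) (Var (Suc (Suc 0))) T"
  by (rule has_VarI, rule is_subst_shift_2, assumption, simp only: nums, (erule ctx_tail | drule ctx_tail)+)
lemma has_Var_3: "\<turnstile> D # C # B # A # \<Gamma> \<Longrightarrow> sub (shift 4) A = T \<Longrightarrow> has (D # C # B # A # \<Gamma>) (Var (Suc (Suc (Suc 0)))) T"
  by (rule has_VarI, rule is_subst_shift_3, assumption, simp only: nums, (erule ctx_tail | drule ctx_tail)+)
lemma has_Var_4: "\<turnstile> E # D # C # B # A # \<Gamma> \<Longrightarrow> sub (shift 5) A = T \<Longrightarrow> has (E # D # C # B # A # \<Gamma>) (Var (Suc (Suc (Suc (Suc 0))))) T"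
  by (rule has_VarI, rule is_subst_shift_4, assumption, simp only: nums, (erule ctx_tail | drule ctx_tail)+)
lemma has_Var_5: "\<turnstile> F # E # D # C # B # A # \<Gamma> \<Longrightarrow> sub (shift 6) A = T \<Longrightarrow> has (F # E # D # C # B # A # \<Gamma>) (Var (Suc (Suc (Suc (Suc (Suc 0)))))) T"
  by (rule has_VarI, rule is_subst_shift_5, assumption, simp only: nums, (erule ctx_tail | drule ctx_tail)+)
lemma has_Var_6: "\<turnstile> B6 # B5 # B4 # B3 # B2 # B1 # B0 # \<Gamma> \<Longrightarrow> sub (shift 7) B0 = T \<Longrightarrow> has (B6 # B5 # B4 # B3 # B2 # B1 # B0 # \<Gamma>) (Var (Suc (Suc (Suc (Suc (Suc (Suc 0))))))) T"
  by (rule has_VarI, rule is_subst_shift_6, assumption, simp only: nums, (erule ctx_tail | drule ctx_tail)+)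
lemma has_Var_7: "\<turnstile> B7 # B6 # B5 # B4 # B3 # B2 # B1 # B0 # \<Gamma> \<Longrightarrow> sub (shift 8) B0 = T \<Longrightarrow> has (B7 # B6 # B5 # B4 # B3 # B2 # B1 # B0 # \<Gamma>) (Var (Suc (Suc (Suc (Suc (Suc (Suc (Suc 0)))))))) T"
  by (rule has_VarI, rule is_subst_shift_7, assumption, simp only: nums, (erule ctx_tail | drule ctx_tail)+)
lemma has_Var_8: "\<turnstile> B8 # B7 # B6 # B5 # B4 # B3 # B2 # B1 # B0 # \<Gamma> \<Longrightarrow> sub (shift 9) B0 = T \<Longrightarrow> has (B8 # B7 # B6 # B5 # B4 # B3 # B2 # B1 # B0 # \<Gamma>) (Var (Suc (Suc (Suc (Suc (Suc (Suc (Suc (Suc 0))))))))) T"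
  by (rule has_VarI, rule is_subst_shift_8, assumption, simp only: nums, (erule ctx_tail | drule ctx_tail)+)
lemmas has_Var = has_Var_0 has_Var_1 has_Var_2 has_Var_3 has_Var_4 has_Var_5 has_Var_6 has_Var_7 has_Var_8

lemma is_subst_inst: "\<turnstile> A # \<Gamma> \<Longrightarrow> \<Gamma> \<turnstile> a \<^bold>: A \<Longrightarrow> is_subst (A # \<Gamma>) (a ;; Var) \<Gamma>"
  using is_subst_cons[OF is_subst_Var] ctx_tail by (simp add: sub_Var chk_def)

lemma wty_inst: "wty (A # \<Gamma>) B \<Longrightarrow> \<Gamma> \<turnstile> a \<^bold>: A \<Longrightarrow> wty \<Gamma> (inst B a)"
  unfolding inst_def using wty_sub is_subst_inst wty_ctx' by blast

lemma has_App:
  "has \<Gamma> f F \<Longrightarrow> F = Pi A B \<Longrightarrow> chk \<Gamma> a A \<Longrightarrow> inst B a = T \<Longrightarrow> has \<Gamma> (App f a) T"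
proof -
  assume *: "has \<Gamma> f F" "F = Pi A B" "chk \<Gamma> a A" "inst B a = T"
  then have t: "wty \<Gamma> (Pi A B)" using has_def by simp
  then have a: "\<Gamma> \<turnstile> a \<^bold>: A" using * wty_PiD chk_def by blast
  obtain i where "\<Gamma> \<turnstile> A \<^bold>: U i" "A # \<Gamma> \<turnstile> B \<^bold>: U i" using common_level[OF wty_PiD[OF t]] by blast
  then show ?thesis using ty_App a * wty_inst wty_PiD(2)[OF t] unfolding has_def by blast
qed
lemma has_Fst: "has \<Gamma> t F \<Longrightarrow> F = Sig A B \<Longrightarrow> has \<Gamma> (Fst t) A"
proof -
  assume *: "has \<Gamma> t F" "F = Sig A B"
  then have t: "wty \<Gamma> (Sig A B)" using has_def by simp
  then show ?thesis using * common_level[OF wty_SigD[OF t]] wty_SigD[OF t] ty_Fst unfolding has_def by blast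
qed
lemma has_Snd: "has \<Gamma> t F \<Longrightarrow> F = Sig A B \<Longrightarrow> inst B (Fst t) = T \<Longrightarrow> has \<Gamma> (Snd t) T"
proof -
  assume *: "has \<Gamma> t F" "F = Sig A B" "inst B (Fst t) = T"
  then have t: "wty \<Gamma> (Sig A B)" using has_def by simp
  have f: "\<Gamma> \<turnstile> Fst t \<^bold>: A" using has_Fst * has_def by blast
  then have "wty \<Gamma> T" using wty_inst wty_SigD[OF t] * by blast
  then show ?thesis using * common_level[OF wty_SigD[OF t]] ty_Snd unfolding has_def by blast
qed
lemma has_Lam: "wty \<Gamma> A \<Longrightarrow> (\<turnstile> A # \<Gamma> \<Longrightarrow> has (A # \<Gamma>) b B) \<Longrightarrow> has \<Gamma> (Lam A b) (Pi A B)"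
proof -
  assume A: "wty \<Gamma> A" and "\<turnstile> A # \<Gamma> \<Longrightarrow> has (A # \<Gamma>) b B"
  then have b: "A # \<Gamma> \<turnstile> b \<^bold>: B" "wty (A # \<Gamma>) B" using wty_ctx has_def by blast+
  then show ?thesis using common_level[OF A b(2)] ty_Lam wty_Pi[OF A] unfolding has_def by blast
qed
lemma has_Refl: "has \<Gamma> a A \<Longrightarrow> has \<Gamma> (Refl a) (Eq A a a)"
proof -
  assume a: "has \<Gamma> a A"
  then have "chk \<Gamma> a A" "wty \<Gamma> A" by (auto simp: chk_def has_def)
  then show ?thesis using wty_Eq[of \<Gamma> A a a] ty_Refl a unfolding has_def wty_def by blast
qed
lemma has_U: "\<turnstile> \<Gamma> \<Longrightarrow> has \<Gamma> (U i) (U (Suc i))" unfolding has_def using ty_univ wty_U by blast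
lemma chk_Lam: "A = A' \<Longrightarrow> (\<turnstile> A # \<Gamma> \<Longrightarrow> chk (A # \<Gamma>) b B) \<Longrightarrow> chk \<Gamma> (Lam A b) (Pi A' B)"
proof -
  assume *: "A = A'" "\<turnstile> A # \<Gamma> \<Longrightarrow> chk (A # \<Gamma>) b B"
  show ?thesis unfolding chk_def
  proof
    assume "wty \<Gamma> (Pi A' B)"
    note t = wty_PiD[OF this]
    have "A # \<Gamma> \<turnstile> b \<^bold>: B" using * t wty_ctx chk_def by blast
    then show "\<Gamma> \<turnstile> Lam A b \<^bold>: Pi A' B" using common_level[OF t] ty_Lam * by blast
  qed
qed
lemma chk_Pair: "chk \<Gamma> a A \<Longrightarrow> inst B a = B' \<Longrightarrow> chk \<Gamma> b B' \<Longrightarrow> chk \<Gamma> (Pair a b) (Sig A B)"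
proof -
  assume *: "chk \<Gamma> a A" "inst B a = B'" "chk \<Gamma> b B'"
  show ?thesis unfolding chk_def
  proof
    assume "wty \<Gamma> (Sig A B)"
    note t = wty_SigD[OF this]
    have a: "\<Gamma> \<turnstile> a \<^bold>: A" using * t chk_def by blast
    have "\<Gamma> \<turnstile> b \<^bold>: inst B a" using * wty_inst[OF t(2) a] chk_def by blast
    then show "\<Gamma> \<turnstile> Pair a b \<^bold>: Sig A B" using a common_level[OF t] ty_Pair by blast
  qed
qed

lemma path_ctx: "wty \<Gamma> A \<Longrightarrow> \<turnstile> Eq (wk 2 A) (Var 1) (Var 0) # wk 1 A # A # \<Gamma>"
proof -
  assume A: "wty \<Gamma> A"
  have 1: "\<turnstile> A # \<Gamma>" using A wty_ctx by blast
  then have 2: "\<turnstile> wk 1 A # A # \<Gamma>"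
    using wty_ctx wty_sub[OF A subst_shifts(1)] by (simp add: wk_sub)
  note 3 = 2[unfolded wk_sub One_nat_def]
  have v: "has (wk 1 A # A # \<Gamma>) (Var 0) (wk 2 A)" "has (wk 1 A # A # \<Gamma>) (Var (Suc 0)) (wk 2 A)"
    unfolding wk_sub One_nat_def
     by (rule has_Var(1)[OF 3], simp only: asimp) (rule has_Var(2)[OF 3], simp only: asimp)
  have "wty (wk 1 A # A # \<Gamma>) (Eq (wk 2 A) (Var 1) (Var 0))"
    using wty_Eq[OF _ chk_has[OF v(2) refl] chk_has[OF v(1) refl]] v(1) unfolding has_def One_nat_def by blast
  then show ?thesis using wty_ctx by blast
qed

lemma is_subst_J:
  assumes "wty \<Gamma> A" "has \<Gamma> a A" "has \<Gamma> b A" "has \<Gamma> p (Eq A a b)"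
  shows "is_subst (Eq (wk 2 A) (Var 1) (Var 0) # wk 1 A # A # \<Gamma>) (p ;; b ;; a ;; Var) \<Gamma>"
proof -
  note c = path_ctx[OF assms(1)]
  show ?thesis
    apply (rule is_subst_cons[OF _ c])
      apply (rule is_subst_cons[OF _ ctx_tail[OF c]])
        apply (rule is_subst_cons[OF is_subst_Var wty_ctx[OF assms(1)]])
         apply (rule has_ctx[OF assms(2)])
        apply (rule sub_Var)
       apply (rule chk_has[OF assms(2) refl])
      apply (simp only: asimp)
     apply (rule chk_has[OF assms(3) refl])
    apply (simp only: asimp)
    apply (rule chk_has[OF assms(4) refl])
    done
qed

lemma is_subst_refl_J:
  assumes A: "wty \<Gamma> A"
  shows "is_subst (Eq (wk 2 A) (Var 1) (Var 0) # wk 1 A # A # \<Gamma>) (Refl (Var 0) ;; Var 0 ;; Var) (A # \<Gamma>)"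
proof -
  have A1: "\<turnstile> A # \<Gamma>" using A wty_ctx by blast
  show ?thesis
    apply (rule is_subst_cons[OF _ path_ctx[OF A]])
      apply (rule is_subst_cons[OF is_subst_Var[OF A1] ctx_tail[OF path_ctx[OF A]]])
       apply (rule sub_Var)
      apply (rule chk_has[OF has_Var(1)[OF A1 refl]], simp only: asimp)
     apply (simp only: asimp)
    apply (rule chk_has[OF has_Refl[OF has_Var(1)[OF A1 refl]]], simp only: asimp)
    done
qed

lemma has_J:
  "wty \<Gamma> A \<Longrightarrow>
    (\<turnstile> Eq (wk 2 A) (Var 1) (Var 0) # wk 1 A # A # \<Gamma> \<Longrightarrow> wty (Eq (wk 2 A) (Var 1) (Var 0) # wk 1 A # A # \<Gamma>) C) \<Longrightarrow>
    sub (Refl (Var 0) ;; Var 0 ;; Var) C = D \<Longrightarrow> (\<turnstile> A # \<Gamma> \<Longrightarrow> chk (A # \<Gamma>) d D) \<Longrightarrow>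
    chk \<Gamma> a A \<Longrightarrow> chk \<Gamma> b A \<Longrightarrow> chk \<Gamma> p (Eq A a b) \<Longrightarrow> sub (p ;; b ;; a ;; Var) C = T \<Longrightarrow>
    has \<Gamma> (J A C d a b p) T"
proof -
  assume *: "wty \<Gamma> A"
    "\<turnstile> Eq (wk 2 A) (Var 1) (Var 0) # wk 1 A # A # \<Gamma> \<Longrightarrow> wty (Eq (wk 2 A) (Var 1) (Var 0) # wk 1 A # A # \<Gamma>) C"
    "sub (Refl (Var 0) ;; Var 0 ;; Var) C = D" "\<turnstile> A # \<Gamma> \<Longrightarrow> chk (A # \<Gamma>) d D"
    "chk \<Gamma> a A" "chk \<Gamma> b A" "chk \<Gamma> p (Eq A a b)" "sub (p ;; b ;; a ;; Var) C = T"
  have C: "wty (Eq (wk 2 A) (Var 1) (Var 0) # wk 1 A # A # \<Gamma>) C" using * path_ctx by blast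
  have a: "has \<Gamma> a A" "has \<Gamma> b A" using * chkD by blast+
  have p: "has \<Gamma> p (Eq A a b)" using * chkD wty_Eq by blast
  have A1: "\<turnstile> A # \<Gamma>" using * wty_ctx by blast
  note is_subst_refl_J[OF *(1)]
  then have "A # \<Gamma> \<turnstile> d \<^bold>: D" using *(3,4) A1 wty_sub[OF C] chk_def by blast
  moreover have "wty \<Gamma> T" using wty_sub[OF C is_subst_J[OF *(1) a p]] * by simp
  moreover obtain i k where "\<Gamma> \<turnstile> A \<^bold>: U i" "Eq (wk 2 A) (Var 1) (Var 0) # wk 1 A # A # \<Gamma> \<turnstile> C \<^bold>: U k"
    using *(1) C wty_def by blast
  ultimately show ?thesis using ty_J a p unfolding has_def *(3)[symmetric] *(8)[symmetric] by blast
qed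

section \<open>Judgmental equality\<close>

lemma teqD: "teq \<Gamma> a b T \<Longrightarrow> has \<Gamma> a T" "teq \<Gamma> a b T \<Longrightarrow> has \<Gamma> b T"
  and hasD: "has \<Gamma> a T \<Longrightarrow> wty \<Gamma> T"
  unfolding teq_def has_def by simp_all

lemma tyeqE: assumes "tyeq \<Gamma> A B" obtains i where "\<Gamma> \<turnstile> A \<approx> B \<^bold>: U i" "\<Gamma> \<turnstile> A \<^bold>: U i" "\<Gamma> \<turnstile> B \<^bold>: U i"
  using assms unfolding tyeq_def teq_def has_def by (elim exE conjE)
lemma tyeqI: "\<Gamma> \<turnstile> A \<approx> B \<^bold>: U i \<Longrightarrow> \<Gamma> \<turnstile> A \<^bold>: U i \<Longrightarrow> \<Gamma> \<turnstile> B \<^bold>: U i \<Longrightarrow> tyeq \<Gamma> A B"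
  unfolding tyeq_def teq_def has_def
  by (intro exI[of _ i] conjI; (rule wty_U, rule ctx_of_judgment(2))?)
lemma tyeq_wty: assumes "tyeq \<Gamma> A B" shows "wty \<Gamma> A" "wty \<Gamma> B"
  using assms by (auto elim!: tyeqE intro: wtyI)
lemma tyeq_level: assumes "tyeq \<Gamma> A B" "tyeq \<Delta> A' B'" obtains i where
  "\<Gamma> \<turnstile> A \<approx> B \<^bold>: U i" "\<Gamma> \<turnstile> A \<^bold>: U i" "\<Gamma> \<turnstile> B \<^bold>: U i" "\<Delta> \<turnstile> A' \<approx> B' \<^bold>: U i" "\<Delta> \<turnstile> A' \<^bold>: U i" "\<Delta> \<turnstile> B' \<^bold>: U i"
proof -
  obtain i where i: "\<Gamma> \<turnstile> A \<approx> B \<^bold>: U i" "\<Gamma> \<turnstile> A \<^bold>: U i" "\<Gamma> \<turnstile> B \<^bold>: U i" by (rule tyeqE[OF assms(1)])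
  obtain j where j: "\<Delta> \<turnstile> A' \<approx> B' \<^bold>: U j" "\<Delta> \<turnstile> A' \<^bold>: U j" "\<Delta> \<turnstile> B' \<^bold>: U j" by (rule tyeqE[OF assms(2)])
  have "i \<le> max i j" "j \<le> max i j" by simp_all
  then show ?thesis using i j cumul eq_cumul_le that[of "max i j"] by blast
qed

lemma teq_refl: "has \<Gamma> a T \<Longrightarrow> teq \<Gamma> a a T"
  unfolding teq_def has_def by (simp add: eq_refl)
lemma teq_sym: "teq \<Gamma> a b T \<Longrightarrow> teq \<Gamma> b a T"
  unfolding teq_def by (simp add: eq_sym)
lemma teq_trans: "teq \<Gamma> a b T \<Longrightarrow> teq \<Gamma> b c T \<Longrightarrow> teq \<Gamma> a c T"
  unfolding teq_def by (auto elim: eq_trans)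
lemma tyeq_refl: "wty \<Gamma> A \<Longrightarrow> tyeq \<Gamma> A A"
  unfolding wty_def by (elim exE) (rule tyeqI, rule eq_refl)
lemma tyeq_sym: "tyeq \<Gamma> A B \<Longrightarrow> tyeq \<Gamma> B A"
  unfolding tyeq_def by (elim exE) (rule exI, rule teq_sym)
lemma tyeq_trans: assumes "tyeq \<Gamma> A B" "tyeq \<Gamma> B C" shows "tyeq \<Gamma> A C"
  by (rule tyeq_level[OF assms], rule tyeqI, rule eq_trans)
lemma teq_tyeq: "teq \<Gamma> A B T \<Longrightarrow> T = U i \<Longrightarrow> tyeq \<Gamma> A B" unfolding tyeq_def by auto
lemma has_conv: assumes "has \<Gamma> a A" "tyeq \<Gamma> A B" shows "has \<Gamma> a B"
  using assms(1) tyeq_wty(2)[OF assms(2)] unfolding has_def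
  by (auto intro: tyeqE[OF assms(2)] ty_conv)
lemma teq_conv: assumes "teq \<Gamma> a b A" "tyeq \<Gamma> A B" shows "teq \<Gamma> a b B"
  using assms(1) has_conv[OF _ assms(2)] unfolding teq_def
  by (auto intro: tyeqE[OF assms(2)] eq_conv)

text \<open>
  Judgmental equality is stable under substitution of equal terms because \<open>B[a]\<close> is a \<open>\<beta>\<close>-redex:
  \<open>(\<lambda>x. B) a\<close> and \<open>(\<lambda>x. B) a'\<close> are equal by congruence of application.
\<close>

lemma functional_type:
  assumes B: "wty (A # \<Gamma>) B" and a: "teq \<Gamma> a a' A" shows "tyeq \<Gamma> (inst B a) (inst B a')"
proof -
  have A: "wty \<Gamma> A" using a teqD hasD by blast
  obtain i where i: "\<Gamma> \<turnstile> A \<^bold>: U i" "A # \<Gamma> \<turnstile> B \<^bold>: U i" using common_level[OF A B] by blast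
  have ty: "\<Gamma> \<turnstile> a \<^bold>: A" "\<Gamma> \<turnstile> a' \<^bold>: A" "\<Gamma> \<turnstile> a \<approx> a' \<^bold>: A" using a unfolding teq_def has_def by simp_all
  have g: "\<turnstile> A # \<Gamma>" using wty_ctx[OF A] .
  have iS: "\<Gamma> \<turnstile> A \<^bold>: U (Suc i)" "A # \<Gamma> \<turnstile> U i \<^bold>: U (Suc i)" using i g by (auto intro: ty_cumul ty_univ)
  have L: "\<Gamma> \<turnstile> Lam A B \<^bold>: Pi A (U i)" using ty_Lam iS i(2) by blast
  have beta: "\<Gamma> \<turnstile> App (Lam A B) c \<approx> inst B c \<^bold>: U i" "\<Gamma> \<turnstile> inst B c \<^bold>: U i" if "\<Gamma> \<turnstile> c \<^bold>: A" for c
    using beta_Pi[OF iS i(2) that] substitution(1)[OF is_subst_inst[OF g that] i(2)] by (simp_all add: inst_def)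
  have "\<Gamma> \<turnstile> App (Lam A B) a \<approx> App (Lam A B) a' \<^bold>: U i"
    using eq_App[OF iS eq_refl[OF L] ty(3)] by (simp add: inst_def)
  then have "\<Gamma> \<turnstile> inst B a \<approx> inst B a' \<^bold>: U i"
    using beta ty by (meson eq_sym eq_trans)
  then show ?thesis using tyeqI beta ty by blast
qed

lemma teq_App:
  assumes f: "teq \<Gamma> f f' F" and F: "F = Pi A B" and a: "teq \<Gamma> a a' A" and T: "inst B a = T"
  shows "teq \<Gamma> (App f a) (App f' a') T"
proof -
  note w = wty_PiD[OF hasD[OF teqD(1)[OF f[unfolded F]]]]
  obtain i where i: "\<Gamma> \<turnstile> A \<^bold>: U i" "A # \<Gamma> \<turnstile> B \<^bold>: U i" using common_level[OF w] by blast
  have h: "has \<Gamma> (App f a) (inst B a)" "has \<Gamma> (App f' a') (inst B a')"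
    using has_App[OF _ refl _ refl] chk_has[OF _ refl] teqD[OF f[unfolded F]] teqD[OF a] by blast+
  have "\<Gamma> \<turnstile> App f a \<approx> App f' a' \<^bold>: inst B a"
    by (rule eq_App[OF i]) (use f[unfolded F] a in \<open>simp_all add: teq_def\<close>)
  then show ?thesis
    using h has_conv[OF h(2) tyeq_sym[OF functional_type[OF w(2) a]]] T unfolding teq_def by simp
qed

lemma teq_beta:
  assumes b: "has (A # \<Gamma>) b B" and a: "has \<Gamma> a A"
  shows "teq \<Gamma> (App (Lam A b) a) (inst b a) (inst B a)"
proof -
  have w: "wty \<Gamma> A" "wty (A # \<Gamma>) B" using a b hasD by blast+
  obtain i where i: "\<Gamma> \<turnstile> A \<^bold>: U i" "A # \<Gamma> \<turnstile> B \<^bold>: U i" using common_level[OF w] by blast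
  have "has \<Gamma> (App (Lam A b) a) (inst B a)"
    using has_App[OF has_Lam[OF w(1) b] refl chk_has[OF a refl] refl] .
  moreover have "has \<Gamma> (inst b a) (inst B a)" unfolding inst_def
    by (rule has_sub[OF b is_subst_inst refl]) (use a wty_ctx[OF w(1)] in \<open>simp_all add: has_def\<close>)
  moreover have "\<Gamma> \<turnstile> App (Lam A b) a \<approx> inst b a \<^bold>: inst B a"
    by (rule beta_Pi[OF i]) (use a b in \<open>simp_all add: has_def\<close>)
  ultimately show ?thesis unfolding teq_def by simp
qed

text \<open>
  Judgmentally equal substitutions, generated from a common tail by adding equal terms. Where they
  are used below, only finitely many innermost variables are replaced by different terms.
\<close>

inductive substeq :: "ctx \<Rightarrow> (nat \<Rightarrow> tm) \<Rightarrow> (nat \<Rightarrow> tm) \<Rightarrow> ctx \<Rightarrow> bool" where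
  substeq_refl: "is_subst \<Gamma> \<sigma> \<Delta> \<Longrightarrow> substeq \<Gamma> \<sigma> \<sigma> \<Delta>"
| substeq_cons: "substeq \<Gamma> \<sigma> \<tau> \<Delta> \<Longrightarrow> wty \<Gamma> A \<Longrightarrow> sub \<sigma> A = A' \<Longrightarrow> teq \<Delta> a a' A' \<Longrightarrow> substeq (A # \<Gamma>) (a ;; \<sigma>) (a' ;; \<tau>) \<Delta>"

lemma wty_has: assumes "wty \<Gamma> A" obtains i where "has \<Gamma> A (U i)"
  using assms wty_U[OF wty_ctx'[OF assms]] unfolding wty_def has_def by blast

text \<open>
  The same \<open>\<beta>\<close>-expansion as for a single variable, iterated over the changed components: abstract the
  last variable, apply the induction hypothesis to the abstraction, and reduce on both sides.
\<close>

lemma substeq_functional: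
  assumes "substeq \<Gamma> \<sigma> \<tau> \<Delta>"
  shows "is_subst \<Gamma> \<sigma> \<Delta> \<and> is_subst \<Gamma> \<tau> \<Delta> \<and> (\<forall>t T. has \<Gamma> t T \<longrightarrow> teq \<Delta> (sub \<sigma> t) (sub \<tau> t) (sub \<sigma> T))"
  using assms
proof induction
  case (substeq_refl \<Gamma> \<sigma> \<Delta>)
  then show ?case using teq_refl has_sub by blast
next
  case (substeq_cons \<Gamma> \<sigma> \<tau> \<Delta> A A' a a')
  note IH = substeq_cons.IH[THEN conjunct2, THEN conjunct2, rule_format]
  have subs: "is_subst \<Gamma> \<sigma> \<Delta>" "is_subst \<Gamma> \<tau> \<Delta>" using substeq_cons.IH by simp_all
  have a: "teq \<Delta> a a' (sub \<sigma> A)" using substeq_cons.hyps by simp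
  have eqA: "tyeq \<Delta> (sub \<sigma> A) (sub \<tau> A)"
    by (rule wty_has[OF \<open>wty \<Gamma> A\<close>]) (drule IH, erule teq_tyeq, simp)
  note a' = has_conv[OF teqD(2)[OF a] eqA]
  note g = wty_ctx[OF \<open>wty \<Gamma> A\<close>]
  have new: "is_subst (A # \<Gamma>) (a ;; \<sigma>) \<Delta>" "is_subst (A # \<Gamma>) (a' ;; \<tau>) \<Delta>"
    using is_subst_cons[OF subs(1) g refl chk_has[OF teqD(1)[OF a] refl]]
      is_subst_cons[OF subs(2) g refl chk_has[OF a' refl]] by this+
  have up: "is_subst (A # \<Gamma>) (up \<sigma>) (sub \<sigma> A # \<Delta>)" "is_subst (A # \<Gamma>) (up \<tau>) (sub \<tau> A # \<Delta>)"
    using is_subst_up subs tyeq_wty[OF eqA] unfolding wty_def by blast+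
  have inst_up: "inst (sub (up \<rho>) t) c = sub (c ;; \<rho>) t" for \<rho> t c by (simp only: asimp)
  have raw: "teq \<Delta> (App (Lam (sub \<sigma> A) (sub (up \<sigma>) t)) a) (App (Lam (sub \<tau> A) (sub (up \<tau>) t)) a') (sub (a ;; \<sigma>) T)
     \<and> teq \<Delta> (App (Lam (sub \<sigma> A) (sub (up \<sigma>) t)) a) (sub (a ;; \<sigma>) t) (sub (a ;; \<sigma>) T)
     \<and> teq \<Delta> (App (Lam (sub \<tau> A) (sub (up \<tau>) t)) a') (sub (a' ;; \<tau>) t) (sub (a' ;; \<tau>) T)"
    if t: "has (A # \<Gamma>) t T" for t T
  proof (intro conjI)
    note L = IH[OF has_Lam[OF \<open>wty \<Gamma> A\<close> t], unfolded sub.simps]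
    show "teq \<Delta> (App (Lam (sub \<sigma> A) (sub (up \<sigma>) t)) a) (App (Lam (sub \<tau> A) (sub (up \<tau>) t)) a') (sub (a ;; \<sigma>) T)"
      by (rule teq_App[OF L refl a inst_up])
    show "teq \<Delta> (App (Lam (sub \<sigma> A) (sub (up \<sigma>) t)) a) (sub (a ;; \<sigma>) t) (sub (a ;; \<sigma>) T)"
      using teq_beta[OF has_sub[OF t up(1) refl] teqD(1)[OF a]] unfolding inst_up .
    show "teq \<Delta> (App (Lam (sub \<tau> A) (sub (up \<tau>) t)) a') (sub (a' ;; \<tau>) t) (sub (a' ;; \<tau>) T)"
      using teq_beta[OF has_sub[OF t up(2) refl] a'] unfolding inst_up .
  qed
  have "teq \<Delta> (sub (a ;; \<sigma>) t) (sub (a' ;; \<tau>) t) (sub (a ;; \<sigma>) T)" if t: "has (A # \<Gamma>) t T" for t T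
  proof -
    obtain i where T: "has (A # \<Gamma>) T (U i)" by (rule wty_has[OF hasD[OF t]])
    have "teq \<Delta> (sub (a ;; \<sigma>) T) (sub (a' ;; \<tau>) T) (U i)"
      using raw[OF T] unfolding sub.simps by (meson teq_sym teq_trans)
    then have "tyeq \<Delta> (sub (a' ;; \<tau>) T) (sub (a ;; \<sigma>) T)" using teq_tyeq tyeq_sym by blast
    then show ?thesis using raw[OF t] by (meson teq_conv teq_sym teq_trans)
  qed
  then show ?case using new by blast
qed

lemma functional: "substeq \<Gamma> \<sigma> \<tau> \<Delta> \<Longrightarrow> has \<Gamma> t T \<Longrightarrow> sub \<sigma> T = T' \<Longrightarrow> teq \<Delta> (sub \<sigma> t) (sub \<tau> t) T'"
  using substeq_functional by blast

lemma functional_wty: "substeq \<Gamma> \<sigma> \<tau> \<Delta> \<Longrightarrow> wty \<Gamma> A \<Longrightarrow> tyeq \<Delta> (sub \<sigma> A) (sub \<tau> A)"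
  by (erule wty_has, rule teq_tyeq, erule (1) functional, rule sub.simps, rule refl)

lemma functional1: "teq \<Gamma> a a' A \<Longrightarrow> has (A # \<Gamma>) t T \<Longrightarrow> sub (a ;; Var) T = T' \<Longrightarrow> teq \<Gamma> (sub (a ;; Var) t) (sub (a' ;; Var) t) T'"
  by (rule functional[OF substeq_cons[OF substeq_refl[OF is_subst_Var]]])
    (auto simp: sub_Var dest: teqD hasD intro: wty_ctx')

lemma teq_sub: "teq \<Gamma> a b T \<Longrightarrow> is_subst \<Gamma> \<sigma> \<Delta> \<Longrightarrow> sub \<sigma> T = T' \<Longrightarrow> teq \<Delta> (sub \<sigma> a) (sub \<sigma> b) T'"
  using substitution(2)[of \<Gamma> \<sigma> \<Delta> a b T] has_sub[of \<Gamma> _ T \<sigma> \<Delta>] unfolding teq_def by simp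
lemma tyeq_sub: "tyeq \<Gamma> A B \<Longrightarrow> is_subst \<Gamma> \<sigma> \<Delta> \<Longrightarrow> tyeq \<Delta> (sub \<sigma> A) (sub \<sigma> B)"
  unfolding tyeq_def by (elim exE) (rule exI, erule (1) teq_sub, rule sub.simps)

lemma is_subst_ctx_conv: assumes "tyeq \<Gamma> A A'" shows "is_subst (A # \<Gamma>) Var (A' # \<Gamma>)"
proof -
  have g: "\<turnstile> A # \<Gamma>" "\<turnstile> A' # \<Gamma>" using tyeq_wty[OF assms] wty_ctx by blast+
  have s: "is_subst \<Gamma> (shift (Suc 0)) (A' # \<Gamma>)" using g subst_shifts(1) by blast
  have "tyeq (A' # \<Gamma>) (\<up> A') (\<up> A)"
    by (rule tyeq_sub[OF tyeq_sym[OF assms] s])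
  then have "has (A' # \<Gamma>) (Var 0) (\<up> A)"
    using has_conv has_Var(1)[OF g(2) refl] by simp
  then have "is_subst (A # \<Gamma>) (Var 0 ;; shift (Suc 0)) (A' # \<Gamma>)"
    using is_subst_cons[OF s g(1) refl] chk_has by blast
  then show ?thesis by (simp only: cons_eta shift_0)
qed

lemma has_ctx_conv: "has (A # \<Gamma>) t T \<Longrightarrow> tyeq \<Gamma> A A' \<Longrightarrow> has (A' # \<Gamma>) t T"
  using has_sub[OF _ is_subst_ctx_conv refl] by (simp add: sub_Var)
lemma tyeq_Pi: assumes "tyeq \<Gamma> A A'" "\<turnstile> A # \<Gamma> \<Longrightarrow> tyeq (A # \<Gamma>) B B'" shows "tyeq \<Gamma> (Pi A B) (Pi A' B')"
proof -
  have B: "tyeq (A # \<Gamma>) B B'" using assms wty_ctx tyeq_wty by blast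
  obtain i where i: "\<Gamma> \<turnstile> A \<approx> A' \<^bold>: U i" "\<Gamma> \<turnstile> A \<^bold>: U i" "\<Gamma> \<turnstile> A' \<^bold>: U i"
    "A # \<Gamma> \<turnstile> B \<approx> B' \<^bold>: U i" "A # \<Gamma> \<turnstile> B \<^bold>: U i" "A # \<Gamma> \<turnstile> B' \<^bold>: U i" by (rule tyeq_level[OF assms(1) B])
  have "A' # \<Gamma> \<turnstile> B' \<^bold>: U i" using substitution(1)[OF is_subst_ctx_conv[OF assms(1)] i(6)] by (simp add: sub_Var)
  then show ?thesis using i by (intro tyeqI[of _ _ _ i]) (rule eq_Pi ty_Pi; assumption)+
qed
lemma tyeq_Sig: assumes "tyeq \<Gamma> A A'" "\<turnstile> A # \<Gamma> \<Longrightarrow> tyeq (A # \<Gamma>) B B'" shows "tyeq \<Gamma> (Sig A B) (Sig A' B')"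
proof -
  have B: "tyeq (A # \<Gamma>) B B'" using assms wty_ctx tyeq_wty by blast
  obtain i where i: "\<Gamma> \<turnstile> A \<approx> A' \<^bold>: U i" "\<Gamma> \<turnstile> A \<^bold>: U i" "\<Gamma> \<turnstile> A' \<^bold>: U i"
    "A # \<Gamma> \<turnstile> B \<approx> B' \<^bold>: U i" "A # \<Gamma> \<turnstile> B \<^bold>: U i" "A # \<Gamma> \<turnstile> B' \<^bold>: U i" by (rule tyeq_level[OF assms(1) B])
  have "A' # \<Gamma> \<turnstile> B' \<^bold>: U i" using substitution(1)[OF is_subst_ctx_conv[OF assms(1)] i(6)] by (simp add: sub_Var)
  then show ?thesis using i by (intro tyeqI[of _ _ _ i]) (rule eq_Sig ty_Sig; assumption)+
qed
lemma tyeq_Eq: assumes "tyeq \<Gamma> A A'" "teq \<Gamma> a a' A" "teq \<Gamma> b b' A" shows "tyeq \<Gamma> (Eq A a b) (Eq A' a' b')"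
proof -
  obtain i where i: "\<Gamma> \<turnstile> A \<approx> A' \<^bold>: U i" "\<Gamma> \<turnstile> A \<^bold>: U i" "\<Gamma> \<turnstile> A' \<^bold>: U i" by (rule tyeqE[OF assms(1)])
  have "has \<Gamma> a' A'" "has \<Gamma> b' A'" using has_conv[OF _ assms(1)] teqD assms by blast+
  then show ?thesis using i assms(2,3) unfolding teq_def has_def
    by (intro tyeqI[of _ _ _ i]) (rule eq_Eq ty_Eq; simp)+
qed
lemma teq_Lam: assumes "wty \<Gamma> A" "\<turnstile> A # \<Gamma> \<Longrightarrow> teq (A # \<Gamma>) b b' B" shows "teq \<Gamma> (Lam A b) (Lam A b') (Pi A B)"
proof -
  have b: "teq (A # \<Gamma>) b b' B" using assms wty_ctx by blast
  obtain i where i: "\<Gamma> \<turnstile> A \<^bold>: U i" "A # \<Gamma> \<turnstile> B \<^bold>: U i" using common_level[OF assms(1) hasD[OF teqD(1)[OF b]]] by blast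
  have "\<Gamma> \<turnstile> Lam A b \<approx> Lam A b' \<^bold>: Pi A B"
    by (rule eq_Lam[OF i(1) eq_refl[OF i(1)] i(2)]) (use b in \<open>simp add: teq_def\<close>)
  then show ?thesis using has_Lam[OF assms(1) teqD(1)[OF b]] has_Lam[OF assms(1) teqD(2)[OF b]] by (simp add: teq_def)
qed
lemma teq_Pair: assumes S: "wty \<Gamma> (Sig A B)" and a: "teq \<Gamma> a a' A" and B': "inst B a = B'" and b: "teq \<Gamma> b b' B'"
  shows "teq \<Gamma> (Pair a b) (Pair a' b') (Sig A B)"
proof -
  note w = wty_SigD[OF S]
  obtain i where i: "\<Gamma> \<turnstile> A \<^bold>: U i" "A # \<Gamma> \<turnstile> B \<^bold>: U i" using common_level[OF w] by blast
  have "has \<Gamma> b' (inst B a')" using has_conv[OF teqD(2)[OF b[folded B']] functional_type[OF w(2) a]] .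
  then have "has \<Gamma> (Pair a b) (Sig A B)" "has \<Gamma> (Pair a' b') (Sig A B)"
    using chkD[OF chk_Pair[OF _ refl] S] chk_has[OF _ refl] teqD[OF a] teqD[OF b[folded B']] by blast+
  moreover have "\<Gamma> \<turnstile> Pair a b \<approx> Pair a' b' \<^bold>: Sig A B"
    by (rule eq_Pair[OF i]) (use a b B' in \<open>simp_all add: teq_def\<close>)
  ultimately show ?thesis by (simp add: teq_def)
qed
lemma teq_Fst: assumes t: "teq \<Gamma> t t' F" and F: "F = Sig A B" shows "teq \<Gamma> (Fst t) (Fst t') A"
proof -
  note w = wty_SigD[OF hasD[OF teqD(1)[OF t[unfolded F]]]]
  obtain i where i: "\<Gamma> \<turnstile> A \<^bold>: U i" "A # \<Gamma> \<turnstile> B \<^bold>: U i" using common_level[OF w] by blast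
  have "\<Gamma> \<turnstile> Fst t \<approx> Fst t' \<^bold>: A" by (rule eq_Fst[OF i]) (use t F in \<open>simp add: teq_def\<close>)
  then show ?thesis using has_Fst[OF teqD(1)[OF t] F] has_Fst[OF teqD(2)[OF t] F] by (simp add: teq_def)
qed
lemma teq_Snd: assumes t: "teq \<Gamma> t t' F" and F: "F = Sig A B" and T: "inst B (Fst t) = T" shows "teq \<Gamma> (Snd t) (Snd t') T"
proof -
  note w = wty_SigD[OF hasD[OF teqD(1)[OF t[unfolded F]]]]
  obtain i where i: "\<Gamma> \<turnstile> A \<^bold>: U i" "A # \<Gamma> \<turnstile> B \<^bold>: U i" using common_level[OF w] by blast
  have "\<Gamma> \<turnstile> Snd t \<approx> Snd t' \<^bold>: T" unfolding T[symmetric] by (rule eq_Snd[OF i]) (use t F in \<open>simp add: teq_def\<close>)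
  moreover have "has \<Gamma> (Snd t') T"
    using has_conv[OF has_Snd[OF teqD(2)[OF t] F refl] tyeq_sym[OF functional_type[OF w(2) teq_Fst[OF t F]]]] T by simp
  ultimately show ?thesis using has_Snd[OF teqD(1)[OF t] F T] by (simp add: teq_def)
qed
lemma teq_Refl: assumes "teq \<Gamma> a a' A" shows "teq \<Gamma> (Refl a) (Refl a') (Eq A a a)"
proof -
  have A: "wty \<Gamma> A" using assms teqD hasD by blast
  then obtain i where i: "\<Gamma> \<turnstile> A \<^bold>: U i" unfolding wty_def by blast
  have "\<Gamma> \<turnstile> Refl a \<approx> Refl a' \<^bold>: Eq A a a" by (rule eq_Refl[OF i]) (use assms in \<open>simp add: teq_def\<close>)
  moreover have "has \<Gamma> (Refl a') (Eq A a a)"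
    using has_conv[OF has_Refl[OF teqD(2)[OF assms]] tyeq_sym[OF tyeq_Eq[OF tyeq_refl[OF A] assms assms]]] .
  ultimately show ?thesis using has_Refl[OF teqD(1)[OF assms]] by (simp add: teq_def)
qed
lemma teq_beta_pair: assumes S: "wty \<Gamma> (Sig A B)" and a: "chk \<Gamma> a A" and B': "inst B a = B'" and b: "chk \<Gamma> b B'"
  shows "teq \<Gamma> (Fst (Pair a b)) a A" "teq \<Gamma> (Snd (Pair a b)) b B'"
proof -
  note w = wty_SigD[OF S]
  obtain i where i: "\<Gamma> \<turnstile> A \<^bold>: U i" "A # \<Gamma> \<turnstile> B \<^bold>: U i" using common_level[OF w] by blast
  note p = chkD[OF chk_Pair[OF a B' b] S]
  have ha: "has \<Gamma> a A" using a w chkD by blast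
  then have hb: "has \<Gamma> b B'" using b wty_inst[OF w(2)] B' unfolding has_def chk_def by blast
  show f: "teq \<Gamma> (Fst (Pair a b)) a A"
    using has_Fst[OF p refl] beta_Fst[OF i] ha hb B' unfolding teq_def has_def by blast
  have "tyeq \<Gamma> (inst B (Fst (Pair a b))) B'" using functional_type[OF w(2) f] B' by simp
  then have "has \<Gamma> (Snd (Pair a b)) B'" using has_conv[OF has_Snd[OF p refl refl]] by blast
  then show "teq \<Gamma> (Snd (Pair a b)) b B'"
    using beta_Snd[OF i] ha hb B' unfolding teq_def has_def by blast
qed
lemma teq_eta_Sig: assumes t: "has \<Gamma> t (Sig A B)" shows "teq \<Gamma> (Pair (Fst t) (Snd t)) t (Sig A B)"
proof -
  note w = wty_SigD[OF hasD[OF t]]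
  obtain i where i: "\<Gamma> \<turnstile> A \<^bold>: U i" "A # \<Gamma> \<turnstile> B \<^bold>: U i" using common_level[OF w] by blast
  have "has \<Gamma> (Pair (Fst t) (Snd t)) (Sig A B)"
    using chkD[OF chk_Pair[OF chk_has refl chk_has] hasD[OF t], OF has_Fst[OF t refl] refl has_Snd[OF t refl refl] refl] .
  then show ?thesis using eq_sym[OF eta_Sig[OF i]] t unfolding teq_def has_def by simp
qed
lemma teq_eta_Pi: assumes t: "has \<Gamma> t (Pi A B)" shows "teq \<Gamma> (Lam A (App (\<up> t) (Var 0))) t (Pi A B)"
proof -
  note w = wty_PiD[OF hasD[OF t]] note g = wty_ctx[OF w(1)]
  obtain i where i: "\<Gamma> \<turnstile> A \<^bold>: U i" "A # \<Gamma> \<turnstile> B \<^bold>: U i" using common_level[OF w] by blast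
  have "has (A # \<Gamma>) (App (\<up> t) (Var 0)) B"
    by (rule has_App[OF has_sub[OF t subst_shifts(1)[OF g] sub.simps(3)] refl chk_has[OF has_Var(1)[OF g refl]]])
      (simp_all only: asimp)
  then have "has \<Gamma> (Lam A (App (\<up> t) (Var 0))) (Pi A B)" using has_Lam[OF w(1)] by blast
  then show ?thesis using eq_sym[OF eta_Pi[OF i]] t unfolding teq_def has_def by (simp add: wk_sub)
qed
lemma teq_beta_J:
  assumes A: "wty \<Gamma> A" and C: "\<turnstile> Eq (wk 2 A) (Var 1) (Var 0) # wk 1 A # A # \<Gamma> \<Longrightarrow> wty (Eq (wk 2 A) (Var 1) (Var 0) # wk 1 A # A # \<Gamma>) C"
    and D: "sub (Refl (Var 0) ;; Var 0 ;; Var) C = D" and d: "\<turnstile> A # \<Gamma> \<Longrightarrow> chk (A # \<Gamma>) d D" and a: "chk \<Gamma> a A"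
    and T: "sub (Refl a ;; a ;; a ;; Var) C = T"
  shows "teq \<Gamma> (J A C d a a (Refl a)) (sub (a ;; Var) d) T"
proof -
  have ha: "has \<Gamma> a A" using chkD[OF a A] .
  have p: "chk \<Gamma> (Refl a) (Eq A a a)" using chk_has[OF has_Refl[OF ha] refl] .
  have J: "has \<Gamma> (J A C d a a (Refl a)) T" by (rule has_J[OF A C D d a a p T])
  have g: "\<turnstile> A # \<Gamma>" using wty_ctx[OF A] .
  have w: "wty (A # \<Gamma>) D"
  proof -
    have "is_subst (Eq (wk 2 A) (Var 1) (Var 0) # wk 1 A # A # \<Gamma>) (Refl (Var 0) ;; Var 0 ;; Var) (A # \<Gamma>)"
      by (rule is_subst_refl_J[OF A])
    then show ?thesis using wty_sub[OF C[OF path_ctx[OF A]]] D by blast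
  qed
  have d': "has (A # \<Gamma>) d D" using chkD[OF d[OF g] w] .
  have "has \<Gamma> (sub (a ;; Var) d) T"
    by (rule has_sub[OF d' is_subst_inst[OF g]]) (use ha has_def in blast, simp only: D[symmetric] T[symmetric] asimp)
  moreover obtain i k where "\<Gamma> \<turnstile> A \<^bold>: U i" "Eq (wk 2 A) (Var 1) (Var 0) # wk 1 A # A # \<Gamma> \<turnstile> C \<^bold>: U k"
    using A C[OF path_ctx[OF A]] unfolding wty_def by blast
  then have "\<Gamma> \<turnstile> J A C d a a (Refl a) \<approx> sub (a ;; Var) d \<^bold>: T"
    using beta_J d' ha unfolding has_def D[symmetric] T[symmetric] inst_def by blast
  ultimately show ?thesis using J by (simp add: teq_def)
qed

section \<open>Paths and inhabitation\<close>

lemmas wty_neutral = wty_el[where A = "App f a" for f a] wty_el[where A = "Fst t" for t]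
  wty_el[where A = "Snd t" for t] wty_el[where A = "Var n" for n]

lemma teq_rhs: "teq \<Gamma> a b T \<Longrightarrow> b = b' \<Longrightarrow> T = T' \<Longrightarrow> teq \<Gamma> a b' T'" by simp

lemma chk_Refl: assumes "chk \<Gamma> a A" "a = b" "a = c" shows "chk \<Gamma> (Refl a) (Eq A b c)"
  unfolding chk_def
proof
  assume "wty \<Gamma> (Eq A b c)"
  then have "has \<Gamma> (Refl a) (Eq A b c)" using has_Refl[of \<Gamma> a A] wty_EqD(2)[of \<Gamma> A b c] assms by simp
  then show "\<Gamma> \<turnstile> Refl a \<^bold>: Eq A b c" by (simp add: has_def)
qed

text \<open>
  The two collections drive nearly all typing proofs: \<open>tc\<close> contains one rule for each term former, to be
  applied by matching, and \<open>nf\<close> normalises substitutions and pushes them through derived operations.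
  The usual proof alternates assumptions, rules, normalisation and reflexivity until nothing is left.
\<close>

lemmas tc = wty_U wty_Pi wty_Sig wty_Eq wty_neutral wty_sub
  has_Var has_App has_Fst has_Snd has_Lam has_Refl has_U has_J[unfolded wk_sub nums] has_sub
  chk_Lam chk_Pair chk_Refl chk_has subst_shifts is_subst_Var is_subst_cons wty_ctx

lemmas nf = asimp arr_def prodT_def compose_def htpy_def sub_derived(4,7-)

lemma has_transport:
  assumes "wty \<Gamma> A" "\<turnstile> A # \<Gamma> \<Longrightarrow> wty (A # \<Gamma>) P" and a: "chk \<Gamma> a A" and b: "chk \<Gamma> b A" and p: "chk \<Gamma> p (Eq A a b)"
    and Pa: "sub (a ;; Var) P = Pa" and t: "chk \<Gamma> t Pa" and T: "sub (b ;; Var) P = T"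
  shows "has \<Gamma> (transport A P a b p t) T"
proof -
  have P: "wty (A # \<Gamma>) P" using assms wty_ctx by blast
  have t': "chk \<Gamma> t (sub (a ;; Var) P)" using t Pa by simp
  show ?thesis unfolding transport_def T[symmetric] arr_def wk_sub nums
    by (assumption | rule assms(1) a b p P t' tc | simp only: nf | rule refl)+
qed

lemma teq_transport_refl:
  assumes P: "wty (A # \<Gamma>) P" and a: "has \<Gamma> a A" and t: "has \<Gamma> t T" "sub (a ;; Var) P = T"
  shows "teq \<Gamma> (transport A P a a (Refl a) t) t T"
proof -
  have A: "wty \<Gamma> A" using a hasD by blast
  have t': "has \<Gamma> t (sub (a ;; Var) P)" using t by simp
  note g = has_ctx[OF a]
  have J: "teq \<Gamma> (J A (arr (sub (Var 2 ;; shift 3) P) (sub (Var 1 ;; shift 3) P)) (Lam P (Var 0)) a a (Refl a))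
    (Lam (sub (a ;; Var) P) (Var 0)) (Pi (sub (a ;; Var) P) (sub (\<up> a ;; shift (Suc 0)) P))"
    apply (rule teq_beta_J[unfolded wk_sub nums, THEN teq_rhs])
    by (assumption | rule A P a t' g tc | simp only: nf | rule refl)+
  have "teq \<Gamma> (App (Lam (sub (a ;; Var) P) (Var 0)) t) t T"
    apply (rule teq_beta[THEN teq_rhs])
    by (assumption | rule A P a t' g tc | simp only: nf t(2) | rule refl)+
  from this show ?thesis unfolding transport_def
    by - (rule teq_trans[OF teq_App[OF J refl teq_refl[OF t']]], simp only: nf t(2))
qed

lemma has_concat_path:
  assumes A: "wty \<Gamma> A" and a: "chk \<Gamma> a A" and b: "chk \<Gamma> b A" and c: "chk \<Gamma> c A"
    and p: "chk \<Gamma> p (Eq A a b)" and q: "chk \<Gamma> q (Eq A b c)" and T: "Eq A a c = T"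
  shows "has \<Gamma> (concat_path A a b c p q) T"
proof -
  note a' = chkD[OF a A]
  show ?thesis unfolding concat_path_def T[symmetric]
    by (assumption | rule A a' b c p q tc has_transport | simp only: nf | rule refl)+
qed

lemma has_ap:
  assumes A: "wty \<Gamma> A" and B: "wty \<Gamma> B" and f: "chk \<Gamma> f (Pi A (\<up> B))" and a: "chk \<Gamma> a A" and b: "chk \<Gamma> b A"
    and p: "chk \<Gamma> p (Eq A a b)" and T: "Eq B (App f a) (App f b) = T"
  shows "has \<Gamma> (ap A B f a b p) T"
proof -
  have g: "\<turnstile> A # \<Gamma>" using A wty_ctx by blast
  have "wty \<Gamma> (Pi A (\<up> B))"
    by (assumption | rule A B tc | simp only: nf | rule refl)+
  note f' = chkD[OF f this]
  show ?thesis unfolding ap_def T[symmetric]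
    by (assumption | rule A B f' a b p tc | simp only: nf | rule refl)+
qed

lemma has_apd:
  assumes A: "wty \<Gamma> A" and e: "\<turnstile> A # \<Gamma> \<Longrightarrow> has (A # \<Gamma>) e P" and a: "chk \<Gamma> a A" and b: "chk \<Gamma> b A"
    and p: "chk \<Gamma> p (Eq A a b)" and T: "Eq (sub (b ;; Var) P) (transport A P a b p (sub (a ;; Var) e)) (sub (b ;; Var) e) = T"
  shows "has \<Gamma> (apd A P e a b p) T"
proof -
  have g: "\<turnstile> A # \<Gamma>" using A wty_ctx by blast
  note e' = e[OF g] and P = hasD[OF e[OF g]]
  have tr: "teq (A # \<Gamma>) (transport (\<up> A) (sub (Var 0 ;; shift (Suc (Suc 0))) P) (Var 0) (Var 0) (Refl (Var 0)) e) e P"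
    by (rule teq_transport_refl) (assumption | rule A P e' g tc | simp only: nf | rule refl)+
  note r = has_conv[OF has_Refl[OF e'] tyeq_Eq[OF tyeq_refl[OF P] teq_sym[OF tr] teq_refl[OF e']]]
  show ?thesis unfolding apd_def T[symmetric]
    by (assumption | rule A P e' a b p r tc has_transport | simp only: nf | rule refl)+
qed

lemma inhI: "has \<Gamma> t T \<Longrightarrow> inh \<Gamma> T" unfolding inh_def by (rule exI)
lemma inh_wty: "inh \<Gamma> T \<Longrightarrow> wty \<Gamma> T" unfolding inh_def by (elim exE) (rule hasD)
lemma inh_conv: "inh \<Gamma> A \<Longrightarrow> tyeq \<Gamma> A B \<Longrightarrow> inh \<Gamma> B" unfolding inh_def by (elim exE) (rule exI, rule has_conv)
lemma inh_Pi: "wty \<Gamma> A \<Longrightarrow> (\<turnstile> A # \<Gamma> \<Longrightarrow> inh (A # \<Gamma>) B) \<Longrightarrow> inh \<Gamma> (Pi A B)"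
  using wty_ctx[of \<Gamma> A] has_Lam[of \<Gamma> A _ B] unfolding inh_def by auto
lemma inh_App: "inh \<Gamma> (Pi A B) \<Longrightarrow> chk \<Gamma> a A \<Longrightarrow> sub (a ;; Var) B = T \<Longrightarrow> inh \<Gamma> T"
  unfolding inh_def by (elim exE) (rule exI, erule has_App, rule refl, assumption, simp add: inst_def)
lemma inh_sub: "inh \<Gamma> A \<Longrightarrow> is_subst \<Gamma> \<sigma> \<Delta> \<Longrightarrow> sub \<sigma> A = B \<Longrightarrow> inh \<Delta> B"
  unfolding inh_def by (elim exE) (rule exI, rule has_sub)
lemma inh_Eq_refl: "teq \<Gamma> a b A \<Longrightarrow> inh \<Gamma> (Eq A a b)"
  by (rule inh_conv[OF inhI[OF has_Refl[OF teqD(1)]] tyeq_Eq[OF tyeq_refl[OF hasD[OF teqD(1)]]]]) (auto intro: teq_refl teqD)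

text \<open>
  Transport without its terms; it is the rewriting step behind all equational reasoning with \<open>inh\<close>.
\<close>

lemma inh_transport:
  assumes p: "inh \<Gamma> (Eq A a b)" and P: "wty (A # \<Gamma>) P" and t: "inh \<Gamma> T" "sub (a ;; Var) P = T" and "sub (b ;; Var) P = T'"
  shows "inh \<Gamma> T'"
proof -
  note w = wty_EqD[OF inh_wty[OF p]]
  obtain q s where "has \<Gamma> q (Eq A a b)" "has \<Gamma> s T" using p t unfolding inh_def by blast
  then show ?thesis using has_transport[OF w(1) P chk_has[OF w(2) refl] chk_has[OF w(3) refl] _ t(2) _ assms(5)] chk_has[OF _ refl] inhI by blast
qed

lemma inh_sym: assumes "inh \<Gamma> (Eq A a b)" shows "inh \<Gamma> (Eq A b a)"
proof -
  note w = wty_EqD[OF inh_wty[OF assms]]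
  have "wty (A # \<Gamma>) (Eq (\<up> A) (Var 0) (\<up> a))"
    by (assumption | rule w tc | simp only: nf | rule refl)+
  from inh_transport[OF assms this inhI[OF has_Refl[OF w(2)]]] show ?thesis by (simp only: nf)
qed

lemma inh_trans: assumes "inh \<Gamma> (Eq A a b)" "inh \<Gamma> (Eq A b c)" shows "inh \<Gamma> (Eq A a c)"
proof -
  note w = wty_EqD[OF inh_wty[OF assms(1)]]
  have "wty (A # \<Gamma>) (Eq (\<up> A) (\<up> a) (Var 0))"
    by (assumption | rule w tc | simp only: nf | rule refl)+
  from inh_transport[OF assms(2) this assms(1)] show ?thesis by (simp only: nf)
qed

lemma inh_ap: assumes "inh \<Gamma> (Eq A a b)" "has (A # \<Gamma>) t (\<up> B)" and B: "wty \<Gamma> B"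
  shows "inh \<Gamma> (Eq B (sub (a ;; Var) t) (sub (b ;; Var) t))"
proof -
  note w = wty_EqD[OF inh_wty[OF assms(1)]]
  have ta: "has \<Gamma> (sub (a ;; Var) t) B"
    by (assumption | rule w assms(2) tc has_ctx[OF w(2)] | simp only: nf | rule refl)+
  have "wty (A # \<Gamma>) (Eq (\<up> B) (\<up> (sub (a ;; Var) t)) t)"
    by (assumption | rule w B assms(2) ta tc | simp only: nf | rule refl)+
  from inh_transport[OF assms(1) this inhI[OF has_Refl[OF ta]]] show ?thesis by (simp only: nf)
qed

text \<open>
  Path induction with a fixed endpoint. It follows from the two-sided eliminator by contracting the
  singleton \<open>\<Sum>x. a = x\<close>: a path from \<open>(a, refl)\<close> to \<open>(b, p)\<close> is obtained by \<open>J\<close>, and \<open>C\<close> is transported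
  along it.
\<close>

lemma path_induction:
  assumes p: "has \<Gamma> p (Eq A a b)"
    and C: "wty (Eq (\<up> A) (\<up> a) (Var 0) # A # \<Gamma>) C"
    and base: "inh \<Gamma> (sub (Refl a ;; a ;; Var) C)"
    and T: "sub (p ;; b ;; Var) C = T"
  shows "inh \<Gamma> T"
proof -
  note w = wty_EqD[OF hasD[OF p]]
  have g: "\<turnstile> \<Gamma>" using has_ctx[OF p] .
  let ?S = "Sig A (Eq (\<up> A) (\<up> a) (Var 0))"
  let ?M = "Eq (Sig (sub (shift 3) A) (Eq (sub (shift 4) A) (Var 3) (Var 0))) (Pair (Var 2) (Refl (Var 2))) (Pair (Var 1) (Var 0))"
  have S: "wty \<Gamma> ?S" by (assumption | rule w g tc | simp only: nf | rule refl)+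
  have "has \<Gamma> (J A ?M (Refl (Pair (Var 0) (Refl (Var 0)))) a b p) (Eq ?S (Pair a (Refl a)) (Pair b p))"
    apply (simp only: nf)
    apply (assumption | rule w p g tc | simp only: nf | rule refl)+
    done
  note sing = inhI[OF this]
  have C': "wty (?S # \<Gamma>) (sub (Snd (Var 0) ;; Fst (Var 0) ;; shift (Suc 0)) C)"
    apply (assumption | rule w S g C tc | simp only: nf | rule refl)+
    done
  obtain s where s: "has \<Gamma> s (sub (Refl a ;; a ;; Var) C)" using base unfolding inh_def by blast
  have eq: "tyeq \<Gamma> (sub (Snd (Pair c q) ;; Fst (Pair c q) ;; Var) C) (sub (q ;; c ;; Var) C)"
    if c: "has \<Gamma> c A" and q: "has \<Gamma> q (Eq A a c)" for c q
  proof -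
    have q': "chk \<Gamma> q (Eq A a c)" using chk_has[OF q refl] .
    note beta = teq_beta_pair[OF S chk_has[OF c refl] _ q', unfolded inst_def]
    show ?thesis
      by (rule tyeq_sym, rule functional_wty[OF substeq_cons[OF substeq_cons[OF substeq_refl[OF is_subst_Var[OF g]]]] C];
        (assumption | rule beta[THEN teq_sym] w tc | simp only: nf | rule refl)+)
  qed
  have "inh \<Gamma> (sub (Snd (Pair b p) ;; Fst (Pair b p) ;; Var) C)"
    by (rule inh_transport[OF sing C' inh_conv[OF base tyeq_sym[OF eq[OF w(2) has_Refl[OF w(2)]]]]]) (simp_all only: nf)
  from inh_conv[OF this eq[OF w(3) p]] show ?thesis using T by simp
qed

section \<open>Conversion and function extensionality\<close>

text \<open>
  The checking version of judgmental equality; the collection \<open>ec\<close> below extends \<open>tc\<close> to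
  equations.
\<close>

definition teqc :: "ctx \<Rightarrow> tm \<Rightarrow> tm \<Rightarrow> tm \<Rightarrow> bool" where "teqc \<Gamma> a b T \<longleftrightarrow> (wty \<Gamma> T \<longrightarrow> teq \<Gamma> a b T)"

lemma teqcD: "teqc \<Gamma> a b T \<Longrightarrow> wty \<Gamma> T \<Longrightarrow> teq \<Gamma> a b T" by (simp add: teqc_def)
lemma teqc_refl: "chk \<Gamma> a T \<Longrightarrow> teqc \<Gamma> a a T" unfolding teqc_def using chkD teq_refl by blast
lemma teqcI: "teq \<Gamma> a b T' \<Longrightarrow> T' = T \<Longrightarrow> teqc \<Gamma> a b T" by (simp add: teqc_def)
lemma teqc_Lam: "A = A' \<Longrightarrow> (\<turnstile> A # \<Gamma> \<Longrightarrow> teqc (A # \<Gamma>) b b' B) \<Longrightarrow> teqc \<Gamma> (Lam A b) (Lam A b') (Pi A' B)"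
  unfolding teqc_def using teq_Lam wty_PiD wty_ctx by blast
lemma teqc_Pair: assumes "teqc \<Gamma> a a' A" "inst B a = B'" "teqc \<Gamma> b b' B'" shows "teqc \<Gamma> (Pair a b) (Pair a' b') (Sig A B)"
  unfolding teqc_def
proof
  assume S: "wty \<Gamma> (Sig A B)"
  have a: "teq \<Gamma> a a' A" using teqcD[OF assms(1) wty_SigD(1)[OF S]] .
  have "wty \<Gamma> B'" using wty_inst[OF wty_SigD(2)[OF S]] teqD(1)[OF a] assms(2) by (auto simp: has_def)
  then show "teq \<Gamma> (Pair a b) (Pair a' b') (Sig A B)" using teq_Pair[OF S a assms(2)] teqcD[OF assms(3)] by blast
qed
lemma teqc_App: "teq \<Gamma> f f' F \<Longrightarrow> F = Pi A B \<Longrightarrow> teqc \<Gamma> a a' A \<Longrightarrow> inst B a = T \<Longrightarrow> teq \<Gamma> (App f a) (App f' a') T"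
  using teq_App[of \<Gamma> f f' F A B a a' T] teqcD[of \<Gamma> a a' A] teqD(1)[of \<Gamma> f f' F] hasD[of \<Gamma> f F] wty_PiD(1)[of \<Gamma> A B] by simp
lemma teqc_Eq: assumes "tyeq \<Gamma> A A'" "teqc \<Gamma> a a' A" "teqc \<Gamma> b b' A" shows "tyeq \<Gamma> (Eq A a b) (Eq A' a' b')"
  using tyeq_Eq[OF assms(1)] assms(2,3) tyeq_wty(1)[OF assms(1)] teqcD by blast
lemma teq_beta_step:
  assumes b: "\<turnstile> A # \<Gamma> \<Longrightarrow> has (A # \<Gamma>) b B" and A: "wty \<Gamma> A" and a: "chk \<Gamma> a A" and "sub (a ;; Var) b = c" "teq \<Gamma> c d T'" "sub (a ;; Var) B = T" "T' = T"
  shows "teq \<Gamma> (App (Lam A b) a) d T"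
  using teq_trans[OF teq_beta[OF b[OF wty_ctx[OF A]] chkD[OF a A], unfolded inst_def]] assms by simp
lemma substeqc_cons: "substeq \<Gamma> \<sigma> \<tau> \<Delta> \<Longrightarrow> \<turnstile> A # \<Gamma> \<Longrightarrow> sub \<sigma> A = A' \<Longrightarrow> teqc \<Delta> a a' A' \<Longrightarrow> substeq (A # \<Gamma>) (a ;; \<sigma>) (a' ;; \<tau>) \<Delta>"
  using substeq_cons[of \<Gamma> \<sigma> \<tau> \<Delta> A A' a a'] ctx_wty[of A \<Gamma>] substeq_functional[of \<Gamma> \<sigma> \<tau> \<Delta>] wty_sub[of \<Gamma> A \<sigma> \<Delta>] teqcD[of \<Delta> a a' A'] by blast

lemmas ec = teq_refl tyeq_refl substeq_refl teqc_refl teqc_Lam teqc_Pair teqc_App teq_Fst teq_Snd teq_Refl teq_beta_step tyeq_Pi tyeq_Sig teqc_Eq teqcI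
  substeqc_cons

lemma teq_ap_refl:
  assumes "wty \<Gamma> B" "has \<Gamma> f (Pi A (\<up> B))" "has \<Gamma> a A"
  shows "teq \<Gamma> (ap A B f a a (Refl a)) (Refl (App f a)) (Eq B (App f a) (App f a))"
proof -
  have A: "wty \<Gamma> A" using assms hasD by blast
  show ?thesis unfolding ap_def
    apply (rule teq_beta_J[unfolded wk_sub nums, THEN teq_rhs])
    by (assumption | rule A assms has_ctx[OF assms(3)] tc | simp only: nf | rule refl)+
qed

lemma teq_apd_refl:
  assumes e: "has (A # \<Gamma>) e P" and a: "has \<Gamma> a A"
  shows "teq \<Gamma> (apd A P e a a (Refl a)) (Refl (sub (a ;; Var) e)) (Eq (sub (a ;; Var) P) (transport A P a a (Refl a) (sub (a ;; Var) e)) (sub (a ;; Var) e))"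
proof -
  have A: "wty \<Gamma> A" using a hasD by blast
  have g: "\<turnstile> A # \<Gamma>" using A wty_ctx by blast
  note P = hasD[OF e]
  have tr: "teq (A # \<Gamma>) (transport (\<up> A) (sub (Var 0 ;; shift (Suc (Suc 0))) P) (Var 0) (Var 0) (Refl (Var 0)) e) e P"
    by (rule teq_transport_refl) (assumption | rule A P e g tc | simp only: nf | rule refl)+
  note r = has_conv[OF has_Refl[OF e] tyeq_Eq[OF tyeq_refl[OF P] teq_sym[OF tr] teq_refl[OF e]]]
  show ?thesis unfolding apd_def
    apply (rule teq_beta_J[unfolded wk_sub nums, THEN teq_rhs])
    by (assumption | rule A e r a P g has_ctx[OF a] tc has_transport | simp only: nf | rule refl)+
qed

lemma has_happly:
  assumes f: "has \<Gamma> f (Pi A B)" and g: "has \<Gamma> g (Pi A B)"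
    and T: "Pi (Eq (Pi A B) f g) (sub (shift 1) (htpy A B f g)) = T"
  shows "has \<Gamma> (happly A B f g) T"
proof -
  note w = wty_PiD[OF hasD[OF f]]
  show ?thesis unfolding happly_def T[symmetric] htpy_def
    apply (simp only: nf)
    by (assumption | rule w f g has_ctx[OF f] tc | simp only: nf | rule refl)+
qed

lemma teq_happly_refl:
  assumes f: "has \<Gamma> f (Pi A B)"
  shows "teq \<Gamma> (App (happly A B f f) (Refl f)) (Lam A (Refl (App (\<up> f) (Var 0)))) (htpy A B f f)"
proof -
  note w = wty_PiD[OF hasD[OF f]]
  show ?thesis unfolding happly_def htpy_def
    apply (simp only: nf)
    apply (rule teq_beta_step)
          apply (assumption | rule w f has_ctx[OF f] tc | simp only: nf | rule refl)+
     apply (rule teq_beta_J[unfolded wk_sub nums, THEN teq_rhs])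
    by (assumption | rule w f has_ctx[OF f] tc | simp only: nf | rule refl)+
qed

lemma has_FunExt:
  assumes f: "has \<Gamma> f (Pi A B)" and g: "has \<Gamma> g (Pi A B)"
  shows "has \<Gamma> (FunExt A B f g) (isequiv (Eq (Pi A B) f g) (htpy A B f g) (happly A B f g))"
proof -
  note w = wty_PiD[OF hasD[OF f]]
  obtain i where i: "\<Gamma> \<turnstile> A \<^bold>: U i" "A # \<Gamma> \<turnstile> B \<^bold>: U i" using common_level[OF w] by blast
  have "wty \<Gamma> (isequiv (Eq (Pi A B) f g) (htpy A B f g) (happly A B f g))"
    unfolding isequiv_def htpy_def apply (simp only: nf)
    by (assumption | rule w f g has_ctx[OF f] has_happly tc | simp only: nf | rule refl)+
  then show ?thesis using ty_FunExt[OF i] f g unfolding has_def by blast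
qed

text \<open>
  Function extensionality in the form in which it is used: to prove a statement about a function
  homotopic to \<open>f\<close>, it suffices to prove it for \<open>f\<close> itself and the constant homotopy. The homotopy \<open>K\<close> is
  equal to the homotopy of a path, and for that path induction applies.
\<close>

lemma homotopy_induction:
  assumes f: "has \<Gamma> f (Pi A B)" and g: "has \<Gamma> g (Pi A B)"
    and K: "has \<Gamma> K (Pi A (Eq B (App (\<up> f) (Var 0)) (App (\<up> g) (Var 0))))"
    and C: "wty (Pi (\<up> A) (Eq (sub (Var 0 ;; shift (Suc (Suc 0))) B) (App (sub (shift (Suc (Suc 0))) f) (Var 0)) (App (Var (Suc 0)) (Var 0)))
       # Pi A B # \<Gamma>) C"
    and base: "inh \<Gamma> T0" "sub (Lam A (Refl (App (\<up> f) (Var 0))) ;; f ;; Var) C = T0"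
    and T: "sub (K ;; g ;; Var) C = T"
  shows "inh \<Gamma> T"
proof -
  note w = wty_PiD[OF hasD[OF f]]
  note ctx = has_ctx[OF f]
  note E = has_FunExt[OF f g, unfolded isequiv_def htpy_def]
  define H where "H = Pi A (Eq B (App (\<up> f) (Var 0)) (App (\<up> g) (Var 0)))"
  define fe where "fe = App (Fst (Fst (FunExt A B f g))) K"
  define \<kappa> where "\<kappa> = App (Snd (Fst (FunExt A B f g))) K"
  have fe: "has \<Gamma> fe (Eq (Pi A B) f g)" unfolding fe_def
    by (assumption | rule E K tc | simp only: nf | rule refl)+
  have \<kappa>: "has \<Gamma> \<kappa> (Eq H (App (happly A B f g) fe) K)" unfolding \<kappa>_def fe_def H_def
    by (assumption | rule E K tc | simp only: nf | rule refl)+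
  let ?C1 = "sub (App (happly (sub (shift 2) A) (sub (Var 0 ;; shift 3) B) (sub (shift 2) f) (Var 1)) (Var 0) ;; Var 1 ;; shift 2) C"
  have C1: "wty (Eq (\<up> (Pi A B)) (\<up> f) (Var 0) # Pi A B # \<Gamma>) ?C1"
    apply (simp only: nf)
    apply (assumption | rule w f ctx C tc has_happly[unfolded htpy_def] | simp only: nf | rule refl)+
    done
  have "tyeq \<Gamma> (sub (Lam A (Refl (App (\<up> f) (Var 0))) ;; f ;; Var) C) (sub (App (happly A B f f) (Refl f) ;; f ;; Var) C)"
    apply (rule functional_wty[OF _ C])
    apply (assumption | rule teq_happly_refl[OF f, unfolded htpy_def, THEN teq_sym] w f ctx ec tc | simp only: nf | rule refl)+
    done
  then have b: "inh \<Gamma> (sub (App (happly A B f f) (Refl f) ;; f ;; Var) C)" using inh_conv base by blast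
  have s1: "inh \<Gamma> (sub (App (happly A B f g) fe ;; g ;; Var) C)"
    by (rule path_induction[OF fe C1]) (insert b, simp_all only: nf)
  have C2: "wty (H # \<Gamma>) (sub (Var 0 ;; \<up> g ;; shift (Suc 0)) C)" unfolding H_def
    by (assumption | rule w f g ctx C tc | simp only: nf | rule refl)+
  show ?thesis
    by (rule inh_transport[OF inhI[OF \<kappa>] C2 s1]) (simp_all only: nf T)
qed

section \<open>Equivalences\<close>

lemma inh_Sig: "wty (A # \<Gamma>) B \<Longrightarrow> has \<Gamma> a A \<Longrightarrow> inh \<Gamma> T \<Longrightarrow> sub (a ;; Var) B = T \<Longrightarrow> inh \<Gamma> (Sig A B)"
  unfolding inh_def
  by (elim exE) (rule exI, rule chkD[OF chk_Pair[OF chk_has[OF _ refl] _ chk_has[OF _ refl]]], assumption,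
    simp add: inst_def, assumption, rule wty_Sig, rule hasD)

lemma inh_funext:
  assumes f: "has \<Gamma> f (Pi A B)" and g: "has \<Gamma> g (Pi A B)"
    and K: "inh (A # \<Gamma>) (Eq B (App (\<up> f) (Var 0)) (App (\<up> g) (Var 0)))"
  shows "inh \<Gamma> (Eq (Pi A B) f g)"
proof -
  note w = wty_PiD[OF hasD[OF f]]
  obtain k where k: "has (A # \<Gamma>) k (Eq B (App (\<up> f) (Var 0)) (App (\<up> g) (Var 0)))"
    using K unfolding inh_def by blast
  have C: "wty (Pi (\<up> A) (Eq (sub (Var 0 ;; shift (Suc (Suc 0))) B) (App (sub (shift (Suc (Suc 0))) f) (Var 0)) (App (Var (Suc 0)) (Var 0)))
       # Pi A B # \<Gamma>) (Eq (sub (shift 2) (Pi A B)) (sub (shift 2) f) (Var 1))"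
    by (assumption | rule w f g has_ctx[OF f] tc | simp only: nf | rule refl)+
  show ?thesis
    by (rule homotopy_induction[OF f g has_Lam[OF w(1) k] C inhI[OF has_Refl[OF f]]]) (simp_all only: nf)
qed

lemma inh_funext_Lam:
  assumes A: "wty \<Gamma> A" and b: "has (A # \<Gamma>) b B" and c: "has (A # \<Gamma>) c B" and K: "inh (A # \<Gamma>) (Eq B b c)"
  shows "inh \<Gamma> (Eq (Pi A B) (Lam A b) (Lam A c))"
proof -
  have g: "\<turnstile> A # \<Gamma>" using wty_ctx[OF A] .
  have beta: "teq (A # \<Gamma>) (App (\<up> (Lam A d)) (Var 0)) d B" if d: "has (A # \<Gamma>) d B" for d
    apply (simp only: nf)
    by (assumption | rule A d g wty_ctx'[OF A] ec tc | simp only: nf | rule refl)+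
  show ?thesis
    by (rule inh_funext[OF has_Lam[OF A b] has_Lam[OF A c]
      inh_conv[OF K tyeq_Eq[OF tyeq_refl[OF hasD[OF b]] beta[OF b, THEN teq_sym] beta[OF c, THEN teq_sym]]]])
qed

text \<open>
  The substitution allows the function \<open>t\<close> to be stated once in the base context and used in extensions
  of it.
\<close>

lemma inh_ap_open:
  assumes p: "inh \<Delta> (Eq B' a b)" and t: "has (B # \<Gamma>) t (\<up> C)" and C: "wty \<Gamma> C" and s: "is_subst \<Gamma> \<sigma> \<Delta>"
    and B': "B' = sub \<sigma> B" and T: "Eq (sub \<sigma> C) (sub (a ;; \<sigma>) t) (sub (b ;; \<sigma>) t) = T"
  shows "inh \<Delta> T"
proof -
  note w = wty_EqD[OF inh_wty[OF p]]
  have g: "\<turnstile> B # \<Gamma>" using has_ctx[OF t] .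
  note g' = wty_ctx[OF w(1)]
  have s': "is_subst \<Gamma> (scomp (shift (Suc 0)) \<sigma>) (B' # \<Delta>)" using is_subst_wk[OF s g'] by (simp only: nums)
  have "has (B' # \<Delta>) (sub (Var 0 ;; scomp (shift (Suc 0)) \<sigma>) t) (\<up> (sub \<sigma> C))"
    by (rule has_sub[OF t is_subst_cons[OF s' g refl chk_has[OF has_Var(1)[OF g' refl]]]]) (simp_all only: nf B')
  from inh_ap[OF p this wty_sub[OF C s]] show ?thesis unfolding T[symmetric] by (simp only: nf)
qed

text \<open>
  An equivalence whose underlying map is presented by an open term: \<open>F\<close> in context \<open>A # \<Gamma>\<close>. Composition
  is then substitution, and composites are free of redexes. The right and the
  left inverse are independent, as in the definition of equivalences.
\<close>

definition open_equiv :: "ctx \<Rightarrow> tm \<Rightarrow> tm \<Rightarrow> tm \<Rightarrow> bool" where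
  "open_equiv \<Gamma> A B F \<longleftrightarrow> wty \<Gamma> A \<and> wty \<Gamma> B \<and> has (A # \<Gamma>) F (\<up> B) \<and>
    (\<exists>G. has (B # \<Gamma>) G (\<up> A) \<and> inh (B # \<Gamma>) (Eq (\<up> B) (sub (G ;; shift (Suc 0)) F) (Var 0))) \<and>
    (\<exists>H. has (B # \<Gamma>) H (\<up> A) \<and> inh (A # \<Gamma>) (Eq (\<up> A) (sub (F ;; shift (Suc 0)) H) (Var 0)))"

lemma teq_wk_beta:
  assumes A: "wty \<Gamma> A" and b: "has (A # \<Gamma>) b B"
  shows "teq (A # \<Gamma>) (App (\<up> (Lam A b)) (Var 0)) b B"
  apply (simp only: nf)
  by (assumption | rule A b wty_ctx[OF A] wty_ctx'[OF A] ec tc | simp only: nf | rule refl)+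

lemma isequiv_wty:
  assumes A: "wty \<Gamma> A" and B: "wty \<Gamma> B" and f: "has \<Gamma> f (Pi A (\<up> B))"
  shows "wty \<Gamma> (isequiv A B f)"
  unfolding isequiv_def apply (simp only: nf)
  by (assumption | rule A B f has_ctx[OF f] tc | simp only: nf | rule refl)+

lemma isequivI:
  assumes F: "open_equiv \<Gamma> A B F" and f: "has \<Gamma> f (Pi A (\<up> B))"
    and bF: "teq (A # \<Gamma>) (App (\<up> f) (Var 0)) F (\<up> B)"
  shows "inh \<Gamma> (isequiv A B f)"
proof -
  obtain G H where A: "wty \<Gamma> A" and B: "wty \<Gamma> B" and F: "has (A # \<Gamma>) F (\<up> B)"
    and G: "has (B # \<Gamma>) G (\<up> A)" "inh (B # \<Gamma>) (Eq (\<up> B) (sub (G ;; shift (Suc 0)) F) (Var 0))"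
    and H: "has (B # \<Gamma>) H (\<up> A)" "inh (A # \<Gamma>) (Eq (\<up> A) (sub (F ;; shift (Suc 0)) H) (Var 0))"
    using assms unfolding open_equiv_def by blast
  note g = wty_ctx'[OF A] wty_ctx[OF A] wty_ctx[OF B]
  note loop = A B F f g
  let ?R = "Sig (Pi B (\<up> A)) (Pi (\<up> B) (Eq (sub (shift (Suc (Suc 0))) B) (App (sub (shift (Suc (Suc 0))) f) (App (Var (Suc 0)) (Var 0))) (Var 0)))"
  let ?L = "Sig (Pi B (\<up> A)) (Pi (\<up> A) (Eq (sub (shift (Suc (Suc 0))) A) (App (Var (Suc 0)) (App (sub (shift (Suc (Suc 0))) f) (Var 0))) (Var 0)))"
  have R: "wty \<Gamma> ?R" by (assumption | rule A B f g tc | simp only: nf | rule refl)+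
  have L: "wty \<Gamma> ?L" by (assumption | rule A B f g tc | simp only: nf | rule refl)+
  have "teq (B # \<Gamma>) (App (\<up> f) (App (\<up> (Lam B G)) (Var 0))) (sub (G ;; shift (Suc 0)) F) (\<up> B)"
  proof (rule teq_trans)
    show "teq (B # \<Gamma>) (App (\<up> f) (App (\<up> (Lam B G)) (Var 0))) (App (\<up> f) G) (\<up> B)"
      by (rule teqc_App[OF teq_refl]) (assumption | rule A B f g teq_wk_beta[OF B G(1)] teqcI tc | simp only: nf | rule refl)+
    have "teq (B # \<Gamma>) (sub (G ;; shift (Suc 0)) (App (\<up> f) (Var 0))) (sub (G ;; shift (Suc 0)) F) (\<up> B)"
      by (rule teq_sub[OF bF]) (assumption | rule A B f g G(1) tc | simp only: nf | rule refl)+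
    then show "teq (B # \<Gamma>) (App (\<up> f) G) (sub (G ;; shift (Suc 0)) F) (\<up> B)"
      by (simp only: nf)
  qed
  from tyeq_Eq[OF tyeq_refl[OF hasD[OF teqD(1)[OF this]]] teq_sym[OF this] teq_refl[OF has_Var(1)[OF g(3) refl, unfolded nums]]]
  have "inh \<Gamma> (Pi B (Eq (\<up> B) (App (\<up> f) (App (\<up> (Lam B G)) (Var 0))) (Var 0)))"
    by (intro inh_Pi[OF B] inh_conv[OF G(2)])
  then have iR: "inh \<Gamma> ?R"
    by (rule inh_Sig[OF wty_SigD(2)[OF R] has_Lam[OF B G(1)]]) (simp only: nf)
  have "teq (A # \<Gamma>) (App (\<up> (Lam B H)) (App (\<up> f) (Var 0))) (sub (F ;; shift (Suc 0)) H) (\<up> A)"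
  proof (rule teq_trans)
    show "teq (A # \<Gamma>) (App (\<up> (Lam B H)) (App (\<up> f) (Var 0))) (App (\<up> (Lam B H)) F) (\<up> A)"
      by (rule teqc_App[OF teq_refl]) (assumption | rule has_sub[OF has_Lam[OF B H(1)]] A B f g bF teqcI tc | simp only: sub.simps | simp only: nf | rule refl)+
    have "teq (A # \<Gamma>) (sub (F ;; shift (Suc 0)) (App (\<up> (Lam B H)) (Var 0))) (sub (F ;; shift (Suc 0)) H) (\<up> A)"
      by (rule teq_sub[OF teq_wk_beta[OF B H(1)]]) (assumption | rule A B f g F tc | simp only: nf | rule refl)+
    then show "teq (A # \<Gamma>) (App (\<up> (Lam B H)) F) (sub (F ;; shift (Suc 0)) H) (\<up> A)"
      by (simp only: nf)
  qed
  from tyeq_Eq[OF tyeq_refl[OF hasD[OF teqD(1)[OF this]]] teq_sym[OF this] teq_refl[OF has_Var(1)[OF g(2) refl, unfolded nums]]]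
  have "inh \<Gamma> (Pi A (Eq (\<up> A) (App (\<up> (Lam B H)) (App (\<up> f) (Var 0))) (Var 0)))"
    by (intro inh_Pi[OF A] inh_conv[OF H(2)])
  then have iL: "inh \<Gamma> ?L"
    by (rule inh_Sig[OF wty_SigD(2)[OF L] has_Lam[OF B H(1)]]) (simp only: nf)
  obtain r where r: "has \<Gamma> r ?R" using iR unfolding inh_def by blast
  have "inh \<Gamma> (Sig ?R (\<up> ?L))"
    by (rule inh_Sig[OF _ r iL]) (assumption | rule wty_sub[OF L] wty_ctx[OF R] tc | simp only: nf)+
  then show ?thesis unfolding isequiv_def by (simp only: nf)
qed

lemma isequivE:
  assumes E: "inh \<Gamma> (isequiv A B f)" and A: "wty \<Gamma> A" and B: "wty \<Gamma> B" and f: "has \<Gamma> f (Pi A (\<up> B))"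
    and bF: "teq (A # \<Gamma>) (App (\<up> f) (Var 0)) F (\<up> B)"
  shows "open_equiv \<Gamma> A B F"
proof -
  note g = wty_ctx'[OF A] wty_ctx[OF A] wty_ctx[OF B]
  let ?R = "Sig (Pi B (\<up> A)) (Pi (\<up> B) (Eq (sub (shift (Suc (Suc 0))) B) (App (sub (shift (Suc (Suc 0))) f) (App (Var (Suc 0)) (Var 0))) (Var 0)))"
  let ?L = "Sig (Pi B (\<up> A)) (Pi (\<up> A) (Eq (sub (shift (Suc (Suc 0))) A) (App (Var (Suc 0)) (App (sub (shift (Suc (Suc 0))) f) (Var 0))) (Var 0)))"
  obtain t where "has \<Gamma> t (isequiv A B f)" using E unfolding inh_def by blast
  then have t: "has \<Gamma> t (Sig ?R (\<up> ?L))" unfolding isequiv_def by (simp only: nf)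
  define G where "G = App (\<up> (Fst (Fst t))) (Var 0)"
  define H where "H = App (\<up> (Fst (Snd t))) (Var 0)"
  have t1: "has \<Gamma> (Fst (Fst t)) (Pi B (\<up> A))" "has \<Gamma> (Fst (Snd t)) (Pi B (\<up> A))"
    by (assumption | rule t tc | simp only: nf | rule refl)+
  have G: "has (B # \<Gamma>) G (\<up> A)" unfolding G_def
    by (assumption | rule has_sub[OF t1(1)] A B g tc | simp only: nf | rule refl)+
  have H: "has (B # \<Gamma>) H (\<up> A)" unfolding H_def
    by (assumption | rule has_sub[OF t1(2)] A B g tc | simp only: nf | rule refl)+
  have "has (B # \<Gamma>) (App (\<up> (Snd (Fst t))) (Var 0)) (Eq (\<up> B) (App (\<up> f) G) (Var 0))"
    unfolding G_def
    apply (simp only: nf)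
    by (assumption | rule t A B g tc | simp only: nf | rule refl)+
  note eG = inhI[OF this]
  have "has (A # \<Gamma>) (App (\<up> (Snd (Snd t))) (Var 0)) (Eq (\<up> A) (sub (App (\<up> f) (Var 0) ;; shift (Suc 0)) H) (Var 0))"
    unfolding H_def
    apply (simp only: nf)
    by (assumption | rule t A B g tc | simp only: nf | rule refl)+
  note eH = inhI[OF this]
  have "teq (B # \<Gamma>) (sub (G ;; shift (Suc 0)) (App (\<up> f) (Var 0))) (sub (G ;; shift (Suc 0)) F) (\<up> B)"
    by (rule teq_sub[OF bF]) (assumption | rule A B f g G(1) tc | simp only: nf | rule refl)+
  then have G2: "teq (B # \<Gamma>) (App (\<up> f) G) (sub (G ;; shift (Suc 0)) F) (\<up> B)"
    by (simp only: nf)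
  have H2: "teq (A # \<Gamma>) (sub (App (\<up> f) (Var 0) ;; shift (Suc 0)) H) (sub (F ;; shift (Suc 0)) H) (\<up> A)"
    by (rule functional[OF _ H]) (assumption | rule substeqc_cons[OF substeq_refl] teqcI[OF bF] A B f g tc | simp only: nf | rule refl)+
  have "inh (B # \<Gamma>) (Eq (\<up> B) (sub (G ;; shift (Suc 0)) F) (Var 0))"
    by (rule inh_conv[OF eG tyeq_Eq[OF tyeq_refl[OF hasD[OF teqD(1)[OF G2]]] G2 teq_refl[OF has_Var(1)[OF g(3) refl, unfolded nums]]]])
  moreover have "inh (A # \<Gamma>) (Eq (\<up> A) (sub (F ;; shift (Suc 0)) H) (Var 0))"
    by (rule inh_conv[OF eH tyeq_Eq[OF tyeq_refl[OF hasD[OF teqD(1)[OF H2]]] H2 teq_refl[OF has_Var(1)[OF g(2) refl, unfolded nums]]]])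
  ultimately show ?thesis unfolding open_equiv_def using A B G H teqD(2)[OF bF] by blast
qed

context
  fixes \<Gamma> A B C F1 F2 F
  assumes F1: "has (A # \<Gamma>) F1 (\<up> B)" and F: "has (A # \<Gamma>) F (\<up> C)"
    and hom: "inh (A # \<Gamma>) (Eq (\<up> C) (sub (F1 ;; shift (Suc 0)) F2) F)"
    and eq2: "open_equiv \<Gamma> B C F2" and A: "wty \<Gamma> A"
begin

text \<open>
  Two out of three, for a triangle that commutes up to homotopy.
\<close>

lemma open_equiv_comp:
  assumes eq1: "open_equiv \<Gamma> A B F1" shows "open_equiv \<Gamma> A C F"
proof -
  obtain G2 H2 where B: "wty \<Gamma> B" and C: "wty \<Gamma> C" and F2: "has (B # \<Gamma>) F2 (\<up> C)"
    and G2: "has (C # \<Gamma>) G2 (\<up> B)" "inh (C # \<Gamma>) (Eq (\<up> C) (sub (G2 ;; shift (Suc 0)) F2) (Var 0))"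
    and H2: "has (C # \<Gamma>) H2 (\<up> B)" "inh (B # \<Gamma>) (Eq (\<up> B) (sub (F2 ;; shift (Suc 0)) H2) (Var 0))"
    using eq2 unfolding open_equiv_def by blast
  obtain G1 H1 where
        G1: "has (B # \<Gamma>) G1 (\<up> A)" "inh (B # \<Gamma>) (Eq (\<up> B) (sub (G1 ;; shift (Suc 0)) F1) (Var 0))"
    and H1: "has (B # \<Gamma>) H1 (\<up> A)" "inh (A # \<Gamma>) (Eq (\<up> A) (sub (F1 ;; shift (Suc 0)) H1) (Var 0))"
    using eq1 unfolding open_equiv_def by blast
  note g = wty_ctx'[OF A] wty_ctx[OF A] wty_ctx[OF B] wty_ctx[OF C]
  note typing = A B C F1 F2 F G1(1) H1(1) G2(1) H2(1) g
  define G where "G = sub (G2 ;; shift (Suc 0)) G1"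
  define H where "H = sub (H2 ;; shift (Suc 0)) H1"
  have G: "has (C # \<Gamma>) G (\<up> A)" unfolding G_def
    by (assumption | rule typing tc | simp only: nf | rule refl)+
  have H: "has (C # \<Gamma>) H (\<up> A)" unfolding H_def
    by (assumption | rule typing tc | simp only: nf | rule refl)+
  have sG: "is_subst (A # \<Gamma>) (G ;; shift (Suc 0)) (C # \<Gamma>)"
    by (assumption | rule typing G tc | simp only: nf | rule refl)+
  have sG2: "is_subst (B # \<Gamma>) (G2 ;; shift (Suc 0)) (C # \<Gamma>)"
    by (assumption | rule typing G tc | simp only: nf | rule refl)+
  have sF1: "is_subst (B # \<Gamma>) (F1 ;; shift (Suc 0)) (A # \<Gamma>)"
    by (assumption | rule typing G tc | simp only: nf | rule refl)+
  have e1: "inh (C # \<Gamma>) (Eq (\<up> C) (sub (G ;; shift (Suc 0)) F) (sub (sub (G ;; shift (Suc 0)) F1 ;; shift (Suc 0)) F2))"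
    by (rule inh_sym, rule inh_sub[OF hom sG]) (simp only: nf)
  have e2: "inh (C # \<Gamma>) (Eq (\<up> B) (sub (G ;; shift (Suc 0)) F1) G2)"
    by (rule inh_sub[OF G1(2) sG2]) (simp only: nf G_def)
  have e3: "inh (C # \<Gamma>) (Eq (\<up> C) (sub (sub (G ;; shift (Suc 0)) F1 ;; shift (Suc 0)) F2) (sub (G2 ;; shift (Suc 0)) F2))"
    by (rule inh_ap_open[OF e2 F2 C is_subst_shift_1[OF g(4)]]) (simp_all only: nf)
  have ret: "inh (C # \<Gamma>) (Eq (\<up> C) (sub (G ;; shift (Suc 0)) F) (Var 0))"
    by (rule inh_trans[OF e1 inh_trans[OF e3 G2(2)]])
  have h1: "inh (A # \<Gamma>) (Eq (\<up> A) (sub (F ;; shift (Suc 0)) H) (sub (sub (F1 ;; shift (Suc 0)) F2 ;; shift (Suc 0)) H))"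
    by (rule inh_ap_open[OF inh_sym[OF hom] H A is_subst_shift_1[OF g(2)]]) (simp_all only: nf)
  have h2: "inh (A # \<Gamma>) (Eq (\<up> B) (sub (sub (F1 ;; shift (Suc 0)) F2 ;; shift (Suc 0)) H2) F1)"
    by (rule inh_sub[OF H2(2) sF1]) (simp only: nf)
  have h3: "inh (A # \<Gamma>) (Eq (\<up> A) (sub (sub (F1 ;; shift (Suc 0)) F2 ;; shift (Suc 0)) H) (sub (F1 ;; shift (Suc 0)) H1))"
    by (rule inh_ap_open[OF h2 H1(1) A is_subst_shift_1[OF g(2)]]) (simp_all only: nf H_def)
  have "inh (A # \<Gamma>) (Eq (\<up> A) (sub (F ;; shift (Suc 0)) H) (Var 0))"
    by (rule inh_trans[OF h1 inh_trans[OF h3 H1(2)]])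
  then show ?thesis unfolding open_equiv_def using A C F G H ret by blast
qed

lemma open_equiv_cancel:
  assumes eq: "open_equiv \<Gamma> A C F" shows "open_equiv \<Gamma> A B F1"
proof -
  obtain G2 H2 where B: "wty \<Gamma> B" and C: "wty \<Gamma> C" and F2: "has (B # \<Gamma>) F2 (\<up> C)"
    and H2: "has (C # \<Gamma>) H2 (\<up> B)" "inh (B # \<Gamma>) (Eq (\<up> B) (sub (F2 ;; shift (Suc 0)) H2) (Var 0))"
    using eq2 unfolding open_equiv_def by blast
  obtain G H where
        G: "has (C # \<Gamma>) G (\<up> A)" "inh (C # \<Gamma>) (Eq (\<up> C) (sub (G ;; shift (Suc 0)) F) (Var 0))"
    and H: "has (C # \<Gamma>) H (\<up> A)" "inh (A # \<Gamma>) (Eq (\<up> A) (sub (F ;; shift (Suc 0)) H) (Var 0))"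
    using eq unfolding open_equiv_def by blast
  note g = wty_ctx'[OF A] wty_ctx[OF A] wty_ctx[OF B] wty_ctx[OF C]
  note typing = A B C F1 F2 F G(1) H(1) H2(1) g
  define G1 where "G1 = sub (F2 ;; shift (Suc 0)) G"
  define H1 where "H1 = sub (F2 ;; shift (Suc 0)) H"
  have G1: "has (B # \<Gamma>) G1 (\<up> A)" unfolding G1_def
    by (assumption | rule typing tc | simp only: nf | rule refl)+
  have H1: "has (B # \<Gamma>) H1 (\<up> A)" unfolding H1_def
    by (assumption | rule typing tc | simp only: nf | rule refl)+
  have sG1: "is_subst (A # \<Gamma>) (G1 ;; shift (Suc 0)) (B # \<Gamma>)"
    by (assumption | rule typing G1 tc | simp only: nf | rule refl)+
  have sF2: "is_subst (C # \<Gamma>) (F2 ;; shift (Suc 0)) (B # \<Gamma>)"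
    by (assumption | rule typing tc | simp only: nf | rule refl)+
  let ?x = "sub (G1 ;; shift (Suc 0)) F1"
  have "has (B # \<Gamma>) ?x (\<up> B)"
    by (rule has_sub[OF F1 sG1]) (simp only: nf)
  then have sx: "is_subst (B # \<Gamma>) (?x ;; shift (Suc 0)) (B # \<Gamma>)"
    by (rule is_subst_cons[OF is_subst_shift_1[OF g(3)] g(3) refl chk_has[OF _ refl]])
  have e1: "inh (B # \<Gamma>) (Eq (\<up> B) ?x (sub (sub (?x ;; shift (Suc 0)) F2 ;; shift (Suc 0)) H2))"
    by (rule inh_sym, rule inh_sub[OF H2(2) sx]) (simp only: nf)
  have e2: "inh (B # \<Gamma>) (Eq (\<up> C) (sub (?x ;; shift (Suc 0)) F2) (sub (G1 ;; shift (Suc 0)) F))"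
    by (rule inh_sub[OF hom sG1]) (simp only: nf)
  have e3: "inh (B # \<Gamma>) (Eq (\<up> C) (sub (G1 ;; shift (Suc 0)) F) F2)"
    by (rule inh_sub[OF G(2) sF2]) (simp only: nf G1_def)
  have e4: "inh (B # \<Gamma>) (Eq (\<up> B) (sub (sub (?x ;; shift (Suc 0)) F2 ;; shift (Suc 0)) H2) (sub (F2 ;; shift (Suc 0)) H2))"
    by (rule inh_ap_open[OF inh_trans[OF e2 e3] H2(1) B is_subst_shift_1[OF g(3)]]) (simp_all only: nf)
  have ret: "inh (B # \<Gamma>) (Eq (\<up> B) ?x (Var 0))"
    by (rule inh_trans[OF e1 inh_trans[OF e4 H2(2)]])
  have h1: "inh (A # \<Gamma>) (Eq (\<up> A) (sub (F1 ;; shift (Suc 0)) H1) (sub (F ;; shift (Suc 0)) H))"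
    by (rule inh_ap_open[OF hom H(1) A is_subst_shift_1[OF g(2)]]) (simp_all only: nf H1_def)
  have "inh (A # \<Gamma>) (Eq (\<up> A) (sub (F1 ;; shift (Suc 0)) H1) (Var 0))"
    by (rule inh_trans[OF h1 H(2)])
  then show ?thesis unfolding open_equiv_def using A B F1 G1 H1 ret by blast
qed

end

lemma open_equiv_conv:
  assumes e: "open_equiv \<Gamma> A B F" and B: "tyeq \<Gamma> B B'" and F: "teq (A # \<Gamma>) F F' (\<up> B)"
  shows "open_equiv \<Gamma> A B' F'"
proof -
  obtain G H where A: "wty \<Gamma> A" 
    and G: "has (B # \<Gamma>) G (\<up> A)" "inh (B # \<Gamma>) (Eq (\<up> B) (sub (G ;; shift (Suc 0)) F) (Var 0))"
    and H: "has (B # \<Gamma>) H (\<up> A)" "inh (A # \<Gamma>) (Eq (\<up> A) (sub (F ;; shift (Suc 0)) H) (Var 0))"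
    using e unfolding open_equiv_def by blast
  note wB = tyeq_wty[OF B]
  note g = wty_ctx'[OF A] wty_ctx[OF A] wty_ctx[OF wB(1)] wty_ctx[OF wB(2)]
  have BB: "tyeq (B # \<Gamma>) (\<up> B) (\<up> B')" "tyeq (A # \<Gamma>) (\<up> B) (\<up> B')"
    using tyeq_sub[OF B] is_subst_shift_1 g by blast+
  have "teq (B # \<Gamma>) (sub (G ;; shift (Suc 0)) F) (sub (G ;; shift (Suc 0)) F') (\<up> B)"
    by (rule teq_sub[OF F]) (assumption | rule A wB g G(1) tc | simp only: nf | rule refl)+
  from inh_conv[OF G(2) tyeq_Eq[OF BB(1) this teq_refl[OF has_Var(1)[OF g(3) refl, unfolded nums]]]]
  have "inh (B' # \<Gamma>) (Eq (\<up> B') (sub (G ;; shift (Suc 0)) F') (Var 0))"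
    by (rule inh_sub[OF _ is_subst_ctx_conv[OF B] sub_Var])
  moreover have "teq (A # \<Gamma>) (sub (F ;; shift (Suc 0)) H) (sub (F' ;; shift (Suc 0)) H) (\<up> A)"
    by (rule functional[OF _ H(1)]) (assumption | rule substeqc_cons[OF substeq_refl] teqcI[OF F] A wB g tc | simp only: nf | rule refl)+
  from inh_conv[OF H(2) tyeq_Eq[OF tyeq_refl[OF hasD[OF teqD(1)[OF this]]] this teq_refl[OF has_Var(1)[OF g(2) refl, unfolded nums]]]]
  have "inh (A # \<Gamma>) (Eq (\<up> A) (sub (F' ;; shift (Suc 0)) H) (Var 0))" .
  ultimately show ?thesis unfolding open_equiv_def
    using A wB has_ctx_conv[OF G(1) B] has_ctx_conv[OF H(1) B] has_conv[OF teqD(2)[OF F] BB(2)] by blast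
qed

section \<open>Division of paths\<close>

text \<open>
  The path \<open>a \<cdot> b\<inverse> : u = w\<close> for \<open>a : u = v\<close> and \<open>b : w = v\<close>. It is defined by induction on \<open>b\<close>, so that
  division by reflexivity is judgmentally the identity.
\<close>

definition path_div :: "tm \<Rightarrow> tm \<Rightarrow> tm \<Rightarrow> tm \<Rightarrow> tm \<Rightarrow> tm \<Rightarrow> tm" where
  "path_div Y u w v b a =
     App (J Y (arr (Eq (wk 3 Y) (wk 3 u) (Var 1)) (Eq (wk 3 Y) (wk 3 u) (Var 2)))
            (Lam (Eq (wk 1 Y) (wk 1 u) (Var 0)) (Var 0)) w v b) a"

lemma sub_path_div: "sub \<sigma> (path_div Y u w v b a) = path_div (sub \<sigma> Y) (sub \<sigma> u) (sub \<sigma> w) (sub \<sigma> v) (sub \<sigma> b) (sub \<sigma> a)"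
  unfolding path_div_def by (simp only: nf)

lemma has_path_div:
  assumes Y: "wty \<Gamma> Y" and u: "chk \<Gamma> u Y" and w: "chk \<Gamma> w Y" and v: "chk \<Gamma> v Y" and b: "chk \<Gamma> b (Eq Y w v)" and a: "chk \<Gamma> a (Eq Y u v)"
    and T: "Eq Y u w = T"
  shows "has \<Gamma> (path_div Y u w v b a) T"
proof -
  note u' = chkD[OF u Y]
  show ?thesis unfolding path_div_def T[symmetric] apply (simp only: nf)
    by (assumption | rule Y u' w v b a has_ctx[OF u'] tc | simp only: nf | rule refl)+
qed

lemma teq_path_div_refl:
  assumes a: "has \<Gamma> a (Eq Y u v)"
  shows "teq \<Gamma> (path_div Y u v v (Refl v) a) a (Eq Y u v)"
proof -
  note w = wty_EqD[OF hasD[OF a]]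
  have J: "teq \<Gamma> (J Y (arr (Eq (wk 3 Y) (wk 3 u) (Var 1)) (Eq (wk 3 Y) (wk 3 u) (Var 2)))
            (Lam (Eq (wk 1 Y) (wk 1 u) (Var 0)) (Var 0)) v v (Refl v)) (Lam (Eq Y u v) (Var 0)) (Pi (Eq Y u v) (Eq (\<up> Y) (\<up> u) (\<up> v)))"
    apply (simp only: nf)
    apply (rule teq_beta_J[unfolded wk_sub nums, THEN teq_rhs])
    by (assumption | rule w a has_ctx[OF a] tc | simp only: nf | rule refl)+
  have "teq \<Gamma> (App (Lam (Eq Y u v) (Var 0)) a) a (Eq Y u v)"
    by (assumption | rule w a has_ctx[OF a] ec tc | simp only: nf | rule refl)+
  then show ?thesis unfolding path_div_def
    by - (rule teq_trans[OF teqc_App[OF J refl teqc_refl[OF chk_has[OF a refl]]]], simp only: nf)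
qed

lemma teq_path_div:
  assumes b: "teq \<Gamma> b b' (Eq Y w v)" and a: "teq \<Gamma> a a' (Eq Y u v)"
  shows "teq \<Gamma> (path_div Y u w v b a) (path_div Y u w v b' a') (Eq Y u w)"
proof -
  note w = wty_EqD[OF hasD[OF teqD(1)[OF b]]] wty_EqD[OF hasD[OF teqD(1)[OF a]]] has_ctx[OF teqD(1)[OF b]]
  have "has (\<up> (Eq Y u v) # Eq Y w v # \<Gamma>) (path_div (sub (shift 2) Y) (sub (shift 2) u) (sub (shift 2) w) (sub (shift 2) v) (Var 1) (Var 0)) (Eq (sub (shift 2) Y) (sub (shift 2) u) (sub (shift 2) w))"
    by (assumption | rule w tc has_path_div | simp only: nf sub_path_div | rule refl)+
  note t = this
  have "substeq (\<up> (Eq Y u v) # Eq Y w v # \<Gamma>) (a ;; b ;; Var) (a' ;; b' ;; Var) \<Gamma>"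
    by (assumption | rule substeqc_cons substeq_refl a[THEN teqcI] b[THEN teqcI] w tc | simp only: nf | rule refl)+
  from functional[OF this t refl] show ?thesis by (simp only: nf sub_path_div)
qed
text \<open>
  From \<open>s : a = b\<close> a path \<open>a \<cdot> b\<inverse> = refl\<close>. For \<open>b\<close> a reflexivity its result is judgmentally \<open>s\<close> itself; the
  round trip through cocones needs this to return the given reflexivity datum unchanged.
\<close>

definition div_unit :: "tm \<Rightarrow> tm \<Rightarrow> tm \<Rightarrow> tm \<Rightarrow> tm \<Rightarrow> tm \<Rightarrow> tm" where
  "div_unit Y u v b a s =
     App2 (J Y (Pi (Eq (wk 3 Y) (Var 2) (Var 1)) (Pi (Eq (Eq (wk 4 Y) (Var 3) (Var 2)) (Var 0) (Var 1))
                (Eq (Eq (wk 5 Y) (Var 4) (Var 4)) (path_div (wk 5 Y) (Var 4) (Var 4) (Var 3) (Var 2) (Var 1)) (Refl (Var 4)))))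
            (Lam (Eq (wk 1 Y) (Var 0) (Var 0)) (Lam (Eq (Eq (wk 2 Y) (Var 1) (Var 1)) (Var 0) (Refl (Var 1))) (Var 0))) u v b) a s"

lemma sub_div_unit: "sub \<sigma> (div_unit Y u v b a s) = div_unit (sub \<sigma> Y) (sub \<sigma> u) (sub \<sigma> v) (sub \<sigma> b) (sub \<sigma> a) (sub \<sigma> s)"
  unfolding div_unit_def by (simp only: nf sub_path_div)

lemmas nfd = nf sub_path_div sub_div_unit

lemma div_unit_conv:
  assumes a: "has \<Gamma> a (Eq Y u u)"
  shows "tyeq \<Gamma> (Eq (Eq Y u u) (path_div Y u u u (Refl u) a) (Refl u)) (Eq (Eq Y u u) a (Refl u))"
  using wty_EqD[OF hasD[OF a]]
  by (intro tyeq_Eq tyeq_refl teq_path_div_refl[OF a] teq_refl has_Refl hasD[OF a])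

lemma div_unit_base:
  assumes Y: "wty \<Gamma> Y"
  shows "has (Eq (Eq (sub (shift (Suc (Suc 0))) Y) (Var (Suc 0)) (Var (Suc 0))) (Var 0) (Refl (Var (Suc 0))) # Eq (\<up> Y) (Var 0) (Var 0) # Y # \<Gamma>)
    (Var 0) (Eq (Eq (sub (shift (Suc (Suc (Suc 0)))) Y) (Var (Suc (Suc 0))) (Var (Suc (Suc 0))))
       (path_div (sub (shift (Suc (Suc (Suc 0)))) Y) (Var (Suc (Suc 0))) (Var (Suc (Suc 0))) (Var (Suc (Suc 0))) (Refl (Var (Suc (Suc 0)))) (Var (Suc 0))) (Refl (Var (Suc (Suc 0)))))"
  by (rule has_conv[OF _ tyeq_sym[OF div_unit_conv]])
    (assumption | rule Y wty_ctx[OF Y] wty_ctx'[OF Y] tc | simp only: nf | rule refl)+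

lemma has_div_unit:
  assumes Y: "wty \<Gamma> Y" and u: "chk \<Gamma> u Y" and v: "chk \<Gamma> v Y" and b: "chk \<Gamma> b (Eq Y u v)" and a: "chk \<Gamma> a (Eq Y u v)"
    and s: "chk \<Gamma> s (Eq (Eq Y u v) a b)" and T: "Eq (Eq Y u u) (path_div Y u u v b a) (Refl u) = T"
  shows "has \<Gamma> (div_unit Y u v b a s) T"
  unfolding div_unit_def T[symmetric] apply (simp only: nfd)
  by (assumption | rule Y u v b a s div_unit_base[OF Y] wty_ctx'[OF Y] tc has_path_div | simp only: nfd | rule refl)+

lemma teq_div_unit_refl:
  assumes a: "has \<Gamma> a (Eq Y u u)" and s: "has \<Gamma> s (Eq (Eq Y u u) a (Refl u))"
  shows "teq \<Gamma> (div_unit Y u u (Refl u) a s) s (Eq (Eq Y u u) a (Refl u))"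
proof -
  note w = wty_EqD[OF hasD[OF a]] has_ctx[OF a]
  let ?Y = "\<lambda>k. sub (shift k) Y" and ?u = "\<lambda>k. sub (shift k) u"
  let ?Z = "Eq (Eq (?Y (Suc 0)) (?u (Suc 0)) (?u (Suc 0))) (Var 0) (Refl (?u (Suc 0)))"
  let ?T = "Eq (Eq (?Y 2) (?u 2) (?u 2)) (path_div (?Y 2) (?u 2) (?u 2) (?u 2) (Refl (?u 2)) (Var 1)) (Refl (?u 2))"
  let ?Ta = "Eq (Eq (?Y 1) (?u 1) (?u 1)) (path_div (?Y 1) (?u 1) (?u 1) (?u 1) (Refl (?u 1)) (sub (shift 1) a)) (Refl (?u 1))"
  let ?J = "J Y (Pi (Eq (wk 3 Y) (Var 2) (Var 1)) (Pi (Eq (Eq (wk 4 Y) (Var 3) (Var 2)) (Var 0) (Var 1))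
                (Eq (Eq (wk 5 Y) (Var 4) (Var 4)) (path_div (wk 5 Y) (Var 4) (Var 4) (Var 3) (Var 2) (Var 1)) (Refl (Var 4)))))
            (Lam (Eq (wk 1 Y) (Var 0) (Var 0)) (Lam (Eq (Eq (wk 2 Y) (Var 1) (Var 1)) (Var 0) (Refl (Var 1))) (Var 0))) u u (Refl u)"
  have J: "teq \<Gamma> ?J (Lam (Eq Y u u) (Lam ?Z (Var 0))) (Pi (Eq Y u u) (Pi ?Z ?T))"
    apply (simp only: nfd)
    apply (rule teq_beta_J[unfolded wk_sub nums, THEN teq_rhs])
    by (assumption | rule w a div_unit_base has_ctx[OF a] tc has_path_div | simp only: nfd | rule refl)+
  have b1: "has (?Z # Eq Y u u # \<Gamma>) (Var 0) ?T"
    apply (rule has_conv[OF _ tyeq_sym[OF div_unit_conv]]; (simp only: nfd)?)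
    by (assumption | rule w a has_ctx[OF a] tc | simp only: nf | rule refl)+
  have b2: "has (Eq (Eq Y u u) a (Refl u) # \<Gamma>) (Var 0) ?Ta"
    apply (rule has_conv[OF _ tyeq_sym[OF div_unit_conv]]; (simp only: nfd)?)
    by (assumption | rule w a has_ctx[OF a] tc | simp only: nf | rule refl)+
  have B1: "teq \<Gamma> (App (Lam (Eq Y u u) (Lam ?Z (Var 0))) a) (Lam (Eq (Eq Y u u) a (Refl u)) (Var 0)) (Pi (Eq (Eq Y u u) a (Refl u)) ?Ta)"
    by (rule teq_beta_step[OF has_Lam[OF _ b1] _ _ _ teq_refl[OF has_Lam[OF _ b2]]])
      (assumption | rule w a has_ctx[OF a] tc | simp only: nfd | rule refl)+
  have B2: "teq \<Gamma> (App (Lam (Eq (Eq Y u u) a (Refl u)) (Var 0)) s) s (Eq (Eq Y u u) (path_div Y u u u (Refl u) a) (Refl u))"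
    by (rule teq_beta_step[OF b2 _ _ _ teq_refl[OF has_conv[OF s tyeq_sym[OF div_unit_conv[OF a]]]]])
      (assumption | rule w a s has_ctx[OF a] tc | simp only: nfd | rule refl)+
  have C1: "teq \<Gamma> (App2 ?J a s) (App2 (Lam (Eq Y u u) (Lam ?Z (Var 0))) a s) (Eq (Eq Y u u) (path_div Y u u u (Refl u) a) (Refl u))"
    by (rule teqc_App[OF teqc_App[OF J refl]])
      (assumption | rule teqc_refl w a s has_ctx[OF a] tc | simp only: nfd | rule refl)+
  have C2: "teq \<Gamma> (App2 (Lam (Eq Y u u) (Lam ?Z (Var 0))) a s) (App (Lam (Eq (Eq Y u u) a (Refl u)) (Var 0)) s) (Eq (Eq Y u u) (path_div Y u u u (Refl u) a) (Refl u))"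
    by (rule teqc_App[OF B1])
      (assumption | rule teqc_refl w a s has_ctx[OF a] tc | simp only: nfd | rule refl)+
  show ?thesis unfolding div_unit_def
    by (rule teq_conv[OF teq_trans[OF C1 teq_trans[OF C2 B2]] div_unit_conv[OF a]])
qed

lemma teq_div_unit:
  assumes b: "teq \<Gamma> b b' (Eq Y u v)" and a: "teq \<Gamma> a a' (Eq Y u v)" and s: "teq \<Gamma> s s' (Eq (Eq Y u v) a b)"
  shows "teq \<Gamma> (div_unit Y u v b a s) (div_unit Y u v b' a' s') (Eq (Eq Y u u) (path_div Y u u v b a) (Refl u))"
proof -
  note w = wty_EqD[OF hasD[OF teqD(1)[OF b]]] has_ctx[OF teqD(1)[OF b]]
  let ?\<Delta> = "Eq (Eq (sub (shift 2) Y) (sub (shift 2) u) (sub (shift 2) v)) (Var 0) (Var 1) # Eq (\<up> Y) (\<up> u) (\<up> v) # Eq Y u v # \<Gamma>"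
  have t: "has ?\<Delta> (div_unit (sub (shift 3) Y) (sub (shift 3) u) (sub (shift 3) v) (Var 2) (Var 1) (Var 0))
    (Eq (Eq (sub (shift 3) Y) (sub (shift 3) u) (sub (shift 3) u)) (path_div (sub (shift 3) Y) (sub (shift 3) u) (sub (shift 3) u) (sub (shift 3) v) (Var 2) (Var 1)) (Refl (sub (shift 3) u)))"
    apply (simp only: nfd)
    by (assumption | rule w tc has_div_unit | simp only: nfd | rule refl)+
  have "substeq ?\<Delta> (s ;; a ;; b ;; Var) (s' ;; a' ;; b' ;; Var) \<Gamma>"
    apply (simp only: nfd)
    by (assumption | rule substeqc_cons substeq_refl s[THEN teqcI] a[THEN teqcI] b[THEN teqcI] w tc | simp only: nfd | rule refl)+
  from functional[OF this t refl] show ?thesis by (simp only: nfd)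
qed

section \<open>Morphisms into discrete graphs versus cocones\<close>

text \<open>
  A reflexive graph given by its three components in an arbitrary context. The components are variables
  in the lemmas below, which keeps the types free of projections.
\<close>

definition graph :: "nat \<Rightarrow> ctx \<Rightarrow> tm \<Rightarrow> tm \<Rightarrow> tm \<Rightarrow> bool" where
  "graph i \<Gamma> A E r \<longleftrightarrow> has \<Gamma> A (U i) \<and> has \<Gamma> E (arr A (arr A (U i))) \<and> has \<Gamma> r (Pi A (App2 (wk 1 E) (Var 0) (Var 0)))"

text \<open>
  The types of edges, of the components of a morphism into the discrete graph on \<open>Y\<close>, and of cocones
  under the span of sources and targets, with the discrete graph and the legs of the span already
  unfolded. They agree with the given types up to conversion.
\<close>

definition edgesT :: "tm \<Rightarrow> tm \<Rightarrow> tm" where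
  "edgesT A E = Sig A (Sig (wk 1 A) (App2 (wk 2 E) (Var 1) (Var 0)))"
definition hom1T :: "tm \<Rightarrow> tm \<Rightarrow> tm \<Rightarrow> tm \<Rightarrow> tm" where
  "hom1T A E Y f0 = Pi A (Pi (wk 1 A) (Pi (App2 (wk 2 E) (Var 1) (Var 0)) (Eq (wk 3 Y) (App (wk 3 f0) (Var 2)) (App (wk 3 f0) (Var 1)))))"
definition hom2T :: "tm \<Rightarrow> tm \<Rightarrow> tm \<Rightarrow> tm \<Rightarrow> tm \<Rightarrow> tm" where
  "hom2T A r Y f0 f1 = Pi A (Eq (Eq (wk 1 Y) (App (wk 1 f0) (Var 0)) (App (wk 1 f0) (Var 0)))
     (App3 (wk 1 f1) (Var 0) (Var 0) (App (wk 1 r) (Var 0))) (Refl (App (wk 1 f0) (Var 0))))"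
definition HomT :: "tm \<Rightarrow> tm \<Rightarrow> tm \<Rightarrow> tm \<Rightarrow> tm" where
  "HomT A E r Y = Sig (arr A Y) (Sig (hom1T (wk 1 A) (wk 1 E) (wk 1 Y) (Var 0)) (hom2T (wk 2 A) (wk 2 r) (wk 2 Y) (Var 1) (Var 0)))"
definition coc2T :: "tm \<Rightarrow> tm \<Rightarrow> tm \<Rightarrow> tm \<Rightarrow> tm \<Rightarrow> tm" where
  "coc2T A E Y p q = Pi (edgesT A E) (Eq (wk 1 Y) (App (wk 1 p) (Fst (Var 0))) (App (wk 1 q) (Fst (Snd (Var 0)))))"
definition CocT :: "tm \<Rightarrow> tm \<Rightarrow> tm \<Rightarrow> tm" where
  "CocT A E Y = Sig (arr A Y) (Sig (wk 1 (arr A Y)) (coc2T (wk 2 A) (wk 2 E) (wk 2 Y) (Var 1) (Var 0)))"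

lemmas gd = edgesT_def hom1T_def hom2T_def HomT_def coc2T_def CocT_def
lemmas tcd = tc has_path_div has_div_unit

lemma graphD:
  assumes "graph i \<Gamma> A E r"
  shows "wty \<Gamma> A" "has \<Gamma> E (Pi A (Pi (\<up> A) (U i)))"
    "has \<Gamma> r (Pi A (App2 (\<up> E) (Var 0) (Var 0)))" "\<turnstile> \<Gamma>" "\<turnstile> A # \<Gamma>"
proof -
  note * = assms[unfolded graph_def, simplified nf]
  show "wty \<Gamma> A" "has \<Gamma> E (Pi A (Pi (\<up> A) (U i)))"
    "has \<Gamma> r (Pi A (App2 (\<up> E) (Var 0) (Var 0)))" "\<turnstile> \<Gamma>" "\<turnstile> A # \<Gamma>"
    using * wty_el[of \<Gamma> A "U i" i] wty_ctx[of \<Gamma> A] has_ctx[of \<Gamma> A "U i"] by simp_all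
qed

lemma graph_sub: assumes "graph i \<Gamma> A E r" "is_subst \<Gamma> \<sigma> \<Delta>" shows "graph i \<Delta> (sub \<sigma> A) (sub \<sigma> E) (sub \<sigma> r)"
proof -
  have *: "has \<Gamma> A (U i)" using assms by (simp add: graph_def)
  show ?thesis unfolding graph_def
    by (simp only: nf, intro conjI; rule has_sub[OF * assms(2)] has_sub[OF graphD(2)[OF assms(1)] assms(2)] has_sub[OF graphD(3)[OF assms(1)] assms(2)]; simp only: nf)
qed

lemma teq_beta3:
  assumes b: "has (C # B # A # \<Gamma>) b T" and x: "has \<Gamma> x A" and y: "has \<Gamma> y (sub (x ;; Var) B)" and e: "has \<Gamma> e (sub (y ;; x ;; Var) C)"
    and c: "sub (e ;; y ;; x ;; Var) b = c" and T: "sub (e ;; y ;; x ;; Var) T = T'"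
  shows "teq \<Gamma> (App3 (Lam A (Lam B (Lam C b))) x y e) c T'"
proof -
  note g3 = has_ctx[OF b] note g2 = ctx_tail[OF g3] note g1 = ctx_tail[OF g2] note g0 = ctx_tail[OF g1]
  note w = ctx_wty[OF g1] ctx_wty[OF g2] ctx_wty[OF g3] hasD[OF b] b x y e g0 g1 g2 g3
  have 1: "teq \<Gamma> (App (Lam A (Lam B (Lam C b))) x) (sub (x ;; Var) (Lam B (Lam C b))) (Pi (sub (x ;; Var) B) (sub (Var 0 ;; \<up> x ;; shift (Suc 0)) (Pi C T)))"
    apply (rule teq_beta[unfolded inst_def, THEN teq_rhs])
    by (assumption | rule w tc | simp only: nf | rule refl)+
  have 2: "teq \<Gamma> (App (sub (x ;; Var) (Lam B (Lam C b))) y) (sub (y ;; x ;; Var) (Lam C b)) (sub (y ;; x ;; Var) (Pi C T))"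
    apply (simp only: nf)
    apply (rule teq_beta[unfolded inst_def, THEN teq_rhs])
    by (assumption | rule w tc | simp only: nf | rule refl)+
  have 3: "teq \<Gamma> (App (sub (y ;; x ;; Var) (Lam C b)) e) c T'"
    apply (simp only: nf)
    apply (rule teq_beta[unfolded inst_def, THEN teq_rhs])
    by (assumption | rule w tc | simp only: nf c[symmetric] T[symmetric] | rule refl)+
  note a1 = teqc_App[OF 1 refl teqc_refl[OF chk_has[OF y refl]] refl]
  have a1: "teq \<Gamma> (App2 (Lam A (Lam B (Lam C b))) x y) (App (sub (x ;; Var) (Lam B (Lam C b))) y) (sub (y ;; x ;; Var) (Pi C T))"
    by (rule teqc_App[OF 1 refl teqc_refl[OF chk_has[OF y refl]]]) (simp only: nf)
  have a2: "teq \<Gamma> (App3 (Lam A (Lam B (Lam C b))) x y e) (App (sub (y ;; x ;; Var) (Lam C b)) e) T'"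
    by (rule teqc_App[OF teq_trans[OF a1 2]  sub.simps(3) teqc_refl[OF chk_has[OF e refl]]]) (simp only: nf T[symmetric])
  show ?thesis by (rule teq_trans[OF a2 3])
qed

lemma Lam_path_div_refl:
  assumes H: "has \<Gamma> H (Pi S (Eq (\<up> Y) u v))" and k: "teq (S # \<Gamma>) k (Refl v) (Eq (\<up> Y) v v)"
  shows "teq \<Gamma> (Lam S (path_div (\<up> Y) u v v k (App (\<up> H) (Var 0)))) H (Pi S (Eq (\<up> Y) u v))"
proof -
  note w = wty_PiD[OF hasD[OF H]]
  note g = wty_ctx[OF w(1)]
  have a: "has (S # \<Gamma>) (App (\<up> H) (Var 0)) (Eq (\<up> Y) u v)"
    by (assumption | rule H w g tc | simp only: nf | rule refl)+
  show ?thesis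
    by (rule teq_trans[OF teq_Lam[OF w(1) teq_trans[OF teq_path_div[OF k teq_refl[OF a]] teq_path_div_refl[OF a]]] teq_eta_Pi[OF H]])
qed

text \<open>
  The contraction of \<open>(q, K)\<close>: by homotopy induction \<open>K\<close> is constant, and then the two cocones are
  judgmentally equal.
\<close>

lemma coc_div_eq:
  assumes G: "graph i \<Gamma> A E r" and Y: "wty \<Gamma> Y"
    and p: "has \<Gamma> p (Pi A (\<up> Y))" and q: "has \<Gamma> q (Pi A (\<up> Y))"
    and K: "has \<Gamma> K (Pi A (Eq (\<up> Y) (App (\<up> p) (Var 0)) (App (\<up> q) (Var 0))))"
    and H: "has \<Gamma> H (coc2T A E Y p q)"
  shows "inh \<Gamma> (Eq (CocT A E Y)
    (Pair p (Pair p (Lam (edgesT A E) (path_div (wk 1 Y) (App (wk 1 p) (Fst (Var 0))) (App (wk 1 p) (Fst (Snd (Var 0)))) (App (wk 1 q) (Fst (Snd (Var 0))))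
       (App (wk 1 K) (Fst (Snd (Var 0)))) (App (wk 1 H) (Var 0))))))
    (Pair p (Pair q H)))"
proof -
  note w = graphD[OF G] Y p
  let ?C = "Pi (coc2T (wk 2 A) (wk 2 E) (wk 2 Y) (wk 2 p) (Var 1)) (Eq (wk 3 (CocT A E Y))
     (Pair (wk 3 p) (Pair (wk 3 p) (Lam (wk 3 (edgesT A E)) (path_div (wk 4 Y) (App (wk 4 p) (Fst (Var 0))) (App (wk 4 p) (Fst (Snd (Var 0)))) (App (Var 3) (Fst (Snd (Var 0))))
       (App (Var 2) (Fst (Snd (Var 0)))) (App (Var 1) (Var 0))))))
     (Pair (wk 3 p) (Pair (Var 2) (Var 0))))"
  have C: "wty (Pi (\<up> A) (Eq (sub (Var 0 ;; shift (Suc (Suc 0))) (\<up> Y)) (App (sub (shift (Suc (Suc 0))) p) (Var 0)) (App (Var (Suc 0)) (Var 0)))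
       # Pi A (\<up> Y) # \<Gamma>) ?C"
    apply (simp only: nfd gd)
    by (assumption | rule w tcd | simp only: nfd | rule refl)+
  let ?HT = "coc2T A E Y p p"
  have HT: "wty \<Gamma> ?HT" apply (simp only: nfd gd)
    by (assumption | rule w tcd | simp only: nfd | rule refl)+
  note g = wty_ctx[OF HT]
  have beta: "teq (edgesT (wk 1 A) (wk 1 E) # ?HT # \<Gamma>) (App (Lam (sub (shift (Suc (Suc 0))) A) (Refl (App (sub (shift (Suc (Suc (Suc 0)))) p) (Var 0)))) (Fst (Snd (Var 0))))
     (Refl (App (sub (shift (Suc (Suc 0))) p) (Fst (Snd (Var 0)))))
     (Eq (sub (shift (Suc (Suc 0))) Y) (App (sub (shift (Suc (Suc 0))) p) (Fst (Snd (Var 0)))) (App (sub (shift (Suc (Suc 0))) p) (Fst (Snd (Var 0)))))"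
    apply (insert g, simp only: nfd gd)
    by (assumption | rule w ec tcd | simp only: nfd | rule refl)+
  have hv: "has (?HT # \<Gamma>) (Var 0) (Pi (edgesT (wk 1 A) (wk 1 E)) (Eq (\<up> (wk 1 Y)) (App (wk 2 p) (Fst (Var 0))) (App (wk 2 p) (Fst (Snd (Var 0))))))"
    apply (insert g, simp only: nfd gd)
    by (assumption | rule w ec tcd | simp only: nfd | rule refl)+
  have "teq (?HT # \<Gamma>) (Lam (edgesT (wk 1 A) (wk 1 E)) (path_div (wk 2 Y) (App (wk 2 p) (Fst (Var 0))) (App (wk 2 p) (Fst (Snd (Var 0)))) (App (wk 2 p) (Fst (Snd (Var 0))))
       (App (Lam (sub (shift (Suc (Suc 0))) A) (Refl (App (sub (shift (Suc (Suc (Suc 0)))) p) (Var 0)))) (Fst (Snd (Var 0)))) (App (Var 1) (Var 0)))) (Var 0)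
       (Pi (edgesT (wk 1 A) (wk 1 E)) (Eq (\<up> (wk 1 Y)) (App (wk 2 p) (Fst (Var 0))) (App (wk 2 p) (Fst (Snd (Var 0))))))"
    using Lam_path_div_refl[OF hv] beta by (simp only: nfd gd)
  note red = this[simplified nfd gd]
  have cw: "wty (?HT # \<Gamma>) (wk 1 (CocT A E Y))" apply (insert g, simp only: nfd gd)
    by (assumption | rule w tcd | simp only: nfd | rule refl)+
  have "teq (?HT # \<Gamma>) (Pair (wk 1 p) (Pair (wk 1 p) (Lam (edgesT (wk 1 A) (wk 1 E)) (path_div (wk 2 Y) (App (wk 2 p) (Fst (Var 0))) (App (wk 2 p) (Fst (Snd (Var 0)))) (App (wk 2 p) (Fst (Snd (Var 0))))
       (App (Lam (sub (shift (Suc (Suc 0))) A) (Refl (App (sub (shift (Suc (Suc (Suc 0)))) p) (Var 0)))) (Fst (Snd (Var 0)))) (App (Var 1) (Var 0))))))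
       (Pair (wk 1 p) (Pair (wk 1 p) (Var 0))) (wk 1 (CocT A E Y))"
    apply (rule teqcD[OF _ cw])
    apply (insert g, simp only: nfd gd)
    apply (rule teqc_Pair teqc_refl)+
    by (assumption | rule red[THEN teqcI] teqc_Pair teqc_refl w tcd | simp only: nfd | rule refl)+
  note base = inh_Pi[OF HT inh_Eq_refl[OF this]]
  have "inh \<Gamma> (Pi (coc2T A E Y p q) (Eq (wk 1 (CocT A E Y))
    (Pair (wk 1 p) (Pair (wk 1 p) (Lam (wk 1 (edgesT A E)) (path_div (wk 2 Y) (App (wk 2 p) (Fst (Var 0))) (App (wk 2 p) (Fst (Snd (Var 0)))) (App (wk 2 q) (Fst (Snd (Var 0))))
       (App (wk 2 K) (Fst (Snd (Var 0)))) (App (Var 1) (Var 0))))))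
    (Pair (wk 1 p) (Pair (wk 1 q) (Var 0)))))"
    by (rule homotopy_induction[OF p q K C base]) (simp_all only: nfd gd)
  from inh_App[OF this chk_has[OF H refl]] show ?thesis by (simp only: nfd gd)
qed

text \<open>
  \<open>diag\<close> is the homotopy \<open>K x = H x x (rfx x)\<close>. The morphism obtained by dividing is defined for a general
  homotopy \<open>K\<close> and a general homotopy \<open>s\<close> from \<open>diag\<close> to \<open>K\<close>, since the pair \<open>(K, s)\<close> has to vary in the
  proof that the inverse is a retraction.
\<close>

definition diag :: "tm \<Rightarrow> tm \<Rightarrow> tm \<Rightarrow> tm" where
  "diag A r H = Lam A (App (wk 1 H) (Pair (Var 0) (Pair (Var 0) (App (wk 1 r) (Var 0)))))"
definition div_hom1 :: "tm \<Rightarrow> tm \<Rightarrow> tm \<Rightarrow> tm \<Rightarrow> tm \<Rightarrow> tm \<Rightarrow> tm \<Rightarrow> tm" where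
  "div_hom1 A E Y p q K H = Lam A (Lam (wk 1 A) (Lam (App2 (wk 2 E) (Var 1) (Var 0))
     (path_div (wk 3 Y) (App (wk 3 p) (Var 2)) (App (wk 3 p) (Var 1)) (App (wk 3 q) (Var 1)) (App (wk 3 K) (Var 1))
        (App (wk 3 H) (Pair (Var 2) (Pair (Var 1) (Var 0)))))))"
definition div_hom2 :: "tm \<Rightarrow> tm \<Rightarrow> tm \<Rightarrow> tm \<Rightarrow> tm \<Rightarrow> tm \<Rightarrow> tm \<Rightarrow> tm \<Rightarrow> tm" where
  "div_hom2 A r Y p q K H s = Lam A (div_unit (wk 1 Y) (App (wk 1 p) (Var 0)) (App (wk 1 q) (Var 0)) (App (wk 1 K) (Var 0))
     (App (wk 1 (diag A r H)) (Var 0)) (App (wk 1 s) (Var 0)))"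
definition div_hom :: "tm \<Rightarrow> tm \<Rightarrow> tm \<Rightarrow> tm \<Rightarrow> tm \<Rightarrow> tm \<Rightarrow> tm \<Rightarrow> tm \<Rightarrow> tm \<Rightarrow> tm" where
  "div_hom A E r Y p q K H s = Pair p (Pair (div_hom1 A E Y p q K H) (div_hom2 A r Y p q K H s))"

lemmas rd = diag_def div_hom1_def div_hom2_def div_hom_def

lemma edge_pair:
  assumes G: "graph i \<Gamma> A E r" and x: "has \<Gamma> x A" and y: "has \<Gamma> y A" and e: "has \<Gamma> e (App2 E x y)"
  shows "has \<Gamma> (Pair x (Pair y e)) (edgesT A E)" "teq \<Gamma> (Fst (Pair x (Pair y e))) x A"
    "teq \<Gamma> (Fst (Snd (Pair x (Pair y e)))) y A" "teq \<Gamma> (Snd (Snd (Pair x (Pair y e)))) e (App2 E x y)"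
proof -
  note w = graphD[OF G] x y e
  have S: "wty \<Gamma> (edgesT A E)" unfolding edgesT_def
    apply (simp only: nf)
    by (assumption | rule w tc | simp only: nf | rule refl)+
  have S2: "wty \<Gamma> (Sig A (App2 (sub (shift 1) E) (sub (shift 1) x) (Var 0)))"
    apply (simp only: nf)
    by (assumption | rule w tc | simp only: nf | rule refl)+
  have e': "chk \<Gamma> e (App2 E x y)" using chk_has[OF e refl] .
  have inner: "has \<Gamma> (Pair y e) (Sig A (App2 (sub (shift 1) E) (sub (shift 1) x) (Var 0)))"
    by (rule chkD[OF chk_Pair[OF chk_has[OF y refl] _ e'] S2]) (simp only: nf)
  have outer: "inst (Sig (wk 1 A) (App2 (wk 2 E) (Var 1) (Var 0))) x = Sig A (App2 (sub (shift 1) E) (sub (shift 1) x) (Var 0))"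
    by (simp only: nf)
  show "has \<Gamma> (Pair x (Pair y e)) (edgesT A E)" unfolding edgesT_def
    by (rule chkD[OF chk_Pair[OF chk_has[OF x refl] outer chk_has[OF inner refl]] S[unfolded edgesT_def]])
  note b = teq_beta_pair[OF S[unfolded edgesT_def] chk_has[OF x refl] outer chk_has[OF inner refl]]
  show "teq \<Gamma> (Fst (Pair x (Pair y e))) x A" by (rule b(1))
  have c: "teq \<Gamma> (Fst (Pair y e)) y A" "teq \<Gamma> (Snd (Pair y e)) e (App2 E x y)"
    by (rule teq_beta_pair[OF S2 chk_has[OF y refl] _ e'], simp only: nf)+
  show "teq \<Gamma> (Fst (Snd (Pair x (Pair y e)))) y A" by (rule teq_trans[OF teq_Fst[OF b(2) refl] c(1)])
  have 1: "teq \<Gamma> (Snd (Pair y e)) (Snd (Snd (Pair x (Pair y e)))) (App2 E x (Fst (Pair y e)))"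
    by (rule teq_Snd[OF teq_sym[OF b(2)] refl]) (simp only: nf)
  have "tyeq \<Gamma> (App2 E x (Fst (Pair y e))) (App2 E x y)"
    by (assumption | rule teq_tyeq[OF teqc_App[OF teq_refl]] c[THEN teqcI] w tc | simp only: nf | rule refl)+
  from teq_conv[OF 1 this] show "teq \<Gamma> (Snd (Snd (Pair x (Pair y e)))) e (App2 E x y)"
    by (rule teq_trans[OF teq_sym c(2)])
qed

lemma coc_app:
  assumes G: "graph i \<Gamma> A E r" and Y: "wty \<Gamma> Y"
    and p: "has \<Gamma> p (Pi A (\<up> Y))" and q: "has \<Gamma> q (Pi A (\<up> Y))"
    and H: "has \<Gamma> H (Pi (edgesT A E) (Eq (wk 1 Y) (App (wk 1 p) (Fst (Var 0))) (App (wk 1 q) (Fst (Snd (Var 0))))))"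
    and x: "has \<Gamma> x A" and y: "has \<Gamma> y A" and e: "has \<Gamma> e (App2 E x y)"
  shows "has \<Gamma> (App H (Pair x (Pair y e))) (Eq Y (App p x) (App q y))"
proof -
  note pr = edge_pair[OF G x y e]
  have h: "has \<Gamma> (App H (Pair x (Pair y e))) (Eq Y (App p (Fst (Pair x (Pair y e)))) (App q (Fst (Snd (Pair x (Pair y e))))))"
    by (rule has_App[OF H refl chk_has[OF pr(1) refl]]) (simp only: nf)
  have "tyeq \<Gamma> (Eq Y (App p (Fst (Pair x (Pair y e)))) (App q (Fst (Snd (Pair x (Pair y e)))))) (Eq Y (App p x) (App q y))"
    by (rule tyeq_Eq[OF tyeq_refl[OF Y] teq_App[OF teq_refl[OF p] refl pr(2)] teq_App[OF teq_refl[OF q] refl pr(3)]]) (simp_all only: nf)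
  from has_conv[OF h this] show ?thesis .
qed

context
  fixes i \<Gamma> A E r Y p q H
  assumes G: "graph i \<Gamma> A E r" and Y: "wty \<Gamma> Y"
    and p: "has \<Gamma> p (Pi A (\<up> Y))" and q: "has \<Gamma> q (Pi A (\<up> Y))"
    and H: "has \<Gamma> H (coc2T A E Y p q)"
begin

lemma H': "has \<Gamma> H (Pi (edgesT A E) (Eq (wk 1 Y) (App (wk 1 p) (Fst (Var 0))) (App (wk 1 q) (Fst (Snd (Var 0))))))"
  using H unfolding coc2T_def .

lemma coc_app_sub:
  assumes s: "is_subst \<Gamma> \<sigma> \<Delta>" and x: "chk \<Delta> x (sub \<sigma> A)" and y: "chk \<Delta> y (sub \<sigma> A)" and e: "chk \<Delta> e (App2 (sub \<sigma> E) x y)"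
    and T: "Eq (sub \<sigma> Y) (App (sub \<sigma> p) x) (App (sub \<sigma> q) y) = T"
  shows "has \<Delta> (App (sub \<sigma> H) (Pair x (Pair y e))) T"
proof -
  note Gs = graph_sub[OF G s]
  note xy = chkD[OF x graphD(1)[OF Gs]] chkD[OF y graphD(1)[OF Gs]]
  have "wty \<Delta> (App2 (sub \<sigma> E) x y)"
    by (assumption | rule graphD[OF Gs] xy tc | simp only: nf | rule refl)+
  note e' = chkD[OF e this]
  show ?thesis unfolding T[symmetric]
    by (rule coc_app[OF Gs wty_sub[OF Y s] has_sub[OF p s] has_sub[OF q s] has_sub[OF H' s] xy e']) (simp_all only: nf gd)
qed

lemmas typing = coc_app_sub graphD[OF G] Y p q H'[simplified nfd gd]

lemma has_diag: "has \<Gamma> (diag A r H) (Pi A (Eq (wk 1 Y) (App (wk 1 p) (Var 0)) (App (wk 1 q) (Var 0))))"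
  apply (simp only: nfd gd rd)
  by (assumption | rule typing tcd | simp only: nfd | rule refl)+

lemma diag_beta: "teq (A # \<Gamma>) (App (wk 1 (diag A r H)) (Var 0)) (App (wk 1 H) (Pair (Var 0) (Pair (Var 0) (App (wk 1 r) (Var 0)))))
    (Eq (wk 1 Y) (App (wk 1 p) (Var 0)) (App (wk 1 q) (Var 0)))"
  apply (simp only: nfd gd rd)
  by (assumption | rule typing ec tcd | simp only: nfd | rule refl)+

context
  fixes K
  assumes K: "has \<Gamma> K (Pi A (Eq (wk 1 Y) (App (wk 1 p) (Var 0)) (App (wk 1 q) (Var 0))))"
begin

lemma has_div_hom1: "has \<Gamma> (div_hom1 A E Y p q K H) (hom1T A E Y p)"
  apply (insert K, simp only: nfd gd rd)
  by (assumption | rule typing tcd | simp only: nfd | rule refl)+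

lemma div_hom1_beta:
  assumes "is_subst \<Gamma> \<sigma> \<Delta>" "has \<Delta> x (sub \<sigma> A)" "has \<Delta> y (sub \<sigma> A)" "has \<Delta> e (App2 (sub \<sigma> E) x y)"
  shows "teq \<Delta> (App3 (sub \<sigma> (div_hom1 A E Y p q K H)) x y e)
    (path_div (sub \<sigma> Y) (App (sub \<sigma> p) x) (App (sub \<sigma> p) y) (App (sub \<sigma> q) y) (App (sub \<sigma> K) y) (App (sub \<sigma> H) (Pair x (Pair y e))))
    (Eq (sub \<sigma> Y) (App (sub \<sigma> p) x) (App (sub \<sigma> p) y))"
proof -
  let ?b = "path_div (wk 3 Y) (App (wk 3 p) (Var 2)) (App (wk 3 p) (Var 1)) (App (wk 3 q) (Var 1)) (App (wk 3 K) (Var 1))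
        (App (wk 3 H) (Pair (Var 2) (Pair (Var 1) (Var 0))))"
  let ?\<Delta> = "App2 (wk 2 E) (Var 1) (Var 0) # wk 1 A # A # \<Gamma>"
  have g: "\<turnstile> ?\<Delta>"
    apply (simp only: nf)
    by (assumption | rule typing tcd | simp only: nfd | rule refl)+
  have b: "has ?\<Delta> ?b (Eq (wk 3 Y) (App (wk 3 p) (Var 2)) (App (wk 3 p) (Var 1)))"
    apply (insert K g, simp only: nfd)
    by (assumption | rule typing tcd | simp only: nfd | rule refl)+
  have \<Delta>: "\<turnstile> \<Delta>" using has_ctx assms by blast
  have g1: "\<turnstile> sub \<sigma> A # \<Delta>" using wty_ctx[OF wty_sub[OF graphD(1)[OF G] assms(1)]] .
  have s1: "is_subst (A # \<Gamma>) (up \<sigma>) (sub \<sigma> A # \<Delta>)"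
    using wty_sub[OF graphD(1)[OF G] assms(1)] is_subst_up assms(1) unfolding wty_def by blast
  have g2: "\<turnstile> sub (up \<sigma>) (wk 1 A) # sub \<sigma> A # \<Delta>" using wty_ctx[OF wty_sub[OF ctx_wty[OF ctx_tail[OF g]] s1]] .
  have s2: "is_subst (wk 1 A # A # \<Gamma>) (up (up \<sigma>)) (sub (up \<sigma>) (wk 1 A) # sub \<sigma> A # \<Delta>)"
    using ctx_wty[OF g2] is_subst_up s1 unfolding wty_def by blast
  have g3: "\<turnstile> sub (up (up \<sigma>)) (App2 (wk 2 E) (Var 1) (Var 0)) # sub (up \<sigma>) (wk 1 A) # sub \<sigma> A # \<Delta>"
    using wty_ctx[OF wty_sub[OF ctx_wty[OF g] s2]] .
  have s3: "is_subst ?\<Delta> (up (up (up \<sigma>))) (sub (up (up \<sigma>)) (App2 (wk 2 E) (Var 1) (Var 0)) # sub (up \<sigma>) (wk 1 A) # sub \<sigma> A # \<Delta>)"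
    using ctx_wty[OF g3] is_subst_up s2 unfolding wty_def by blast
  note hb = has_sub[OF b s3 refl, simplified nfd]
  show ?thesis unfolding div_hom1_def
    by (simp only: nfd, rule teq_beta3[OF hb]) (use assms(2-) in \<open>simp_all only: nfd\<close>)
qed

context
  fixes s
  assumes s: "has \<Gamma> s (Pi A (Eq (Eq (wk 1 Y) (App (wk 1 p) (Var 0)) (App (wk 1 q) (Var 0))) (App (wk 1 (diag A r H)) (Var 0)) (App (wk 1 K) (Var 0))))"
begin

lemma has_div_hom2_raw:
  "has \<Gamma> (div_hom2 A r Y p q K H s) (Pi A (Eq (Eq (wk 1 Y) (App (wk 1 p) (Var 0)) (App (wk 1 p) (Var 0)))
      (path_div (wk 1 Y) (App (wk 1 p) (Var 0)) (App (wk 1 p) (Var 0)) (App (wk 1 q) (Var 0)) (App (wk 1 K) (Var 0)) (App (wk 1 (diag A r H)) (Var 0)))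
      (Refl (App (wk 1 p) (Var 0)))))"
proof -
  have d: "has (A # \<Gamma>) (App (wk 1 (diag A r H)) (Var 0)) (Eq (wk 1 Y) (App (wk 1 p) (Var 0)) (App (wk 1 q) (Var 0)))"
    by (rule teqD[OF diag_beta])
  show ?thesis unfolding div_hom2_def
    apply (insert K s d, simp only: wk_sub nums)
    by (assumption | rule typing tcd | simp only: nfd | rule refl)+
qed

lemma div_hom2_conv:
  "tyeq \<Gamma> (Pi A (Eq (Eq (wk 1 Y) (App (wk 1 p) (Var 0)) (App (wk 1 p) (Var 0)))
      (path_div (wk 1 Y) (App (wk 1 p) (Var 0)) (App (wk 1 p) (Var 0)) (App (wk 1 q) (Var 0)) (App (wk 1 K) (Var 0)) (App (wk 1 (diag A r H)) (Var 0)))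
      (Refl (App (wk 1 p) (Var 0))))) (hom2T A r Y p (div_hom1 A E Y p q K H))"
proof -
  have k: "has (A # \<Gamma>) (App (wk 1 K) (Var 0)) (Eq (wk 1 Y) (App (wk 1 p) (Var 0)) (App (wk 1 q) (Var 0)))"
    apply (insert K, simp only: nfd)
    by (assumption | rule typing tcd | simp only: nfd | rule refl)+
  have "teq (A # \<Gamma>) (App3 (sub (shift 1) (div_hom1 A E Y p q K H)) (Var 0) (Var 0) (App (sub (shift 1) r) (Var 0)))
    (path_div (sub (shift 1) Y) (App (sub (shift 1) p) (Var 0)) (App (sub (shift 1) p) (Var 0)) (App (sub (shift 1) q) (Var 0)) (App (sub (shift 1) K) (Var 0))
      (App (sub (shift 1) H) (Pair (Var 0) (Pair (Var 0) (App (sub (shift 1) r) (Var 0))))))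
    (Eq (sub (shift 1) Y) (App (sub (shift 1) p) (Var 0)) (App (sub (shift 1) p) (Var 0)))"
    apply (rule div_hom1_beta; simp only: nfd)
    by (assumption | rule typing tcd | simp only: nfd | rule refl)+
  from teq_trans[OF this[folded wk_sub] teq_path_div[OF teq_refl[OF k] teq_sym[OF diag_beta]]]
  have eq: "teq (A # \<Gamma>) (App3 (wk 1 (div_hom1 A E Y p q K H)) (Var 0) (Var 0) (App (wk 1 r) (Var 0)))
    (path_div (wk 1 Y) (App (wk 1 p) (Var 0)) (App (wk 1 p) (Var 0)) (App (wk 1 q) (Var 0)) (App (wk 1 K) (Var 0)) (App (wk 1 (diag A r H)) (Var 0)))
    (Eq (wk 1 Y) (App (wk 1 p) (Var 0)) (App (wk 1 p) (Var 0)))" .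
  have px: "has (A # \<Gamma>) (App (wk 1 p) (Var 0)) (wk 1 Y)"
    apply (simp only: nfd)
    by (assumption | rule typing tcd | simp only: nfd | rule refl)+
  show ?thesis unfolding hom2T_def
    by (rule tyeq_Pi[OF tyeq_refl[OF graphD(1)[OF G]] tyeq_Eq[OF tyeq_refl[OF hasD[OF teqD(1)[OF eq]]] teq_sym[OF eq] teq_refl[OF has_Refl[OF px]]]])
qed

lemma has_div_hom2: "has \<Gamma> (div_hom2 A r Y p q K H s) (hom2T A r Y p (div_hom1 A E Y p q K H))"
  by (rule has_conv[OF has_div_hom2_raw div_hom2_conv])

lemma HomT_wty: "wty \<Gamma> (HomT A E r Y)"
  apply (simp only: nfd gd)
  by (assumption | rule typing tcd | simp only: nfd | rule refl)+

lemma has_div_hom: "has \<Gamma> (div_hom A E r Y p q K H s) (HomT A E r Y)"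
  unfolding div_hom_def
  apply (rule chkD[OF _ HomT_wty])
  unfolding HomT_def
  apply (rule chk_Pair[OF chk_has[OF p]], simp only: nfd, simp only: sub.simps inst_def)
  apply (rule chk_Pair[OF chk_has[OF has_div_hom1]], simp only: nfd gd, rule refl)
  apply (rule chk_has[OF has_div_hom2], simp only: nfd gd)
  done

end
end
end

lemma triple:
  assumes S: "wty \<Gamma> (Sig A (Sig B C))" and a: "has \<Gamma> a A" and b: "has \<Gamma> b (sub (a ;; Var) B)" and c: "has \<Gamma> c (sub (b ;; a ;; Var) C)"
  shows has_triple: "has \<Gamma> (Pair a (Pair b c)) (Sig A (Sig B C))"
    and triple_fst: "teq \<Gamma> (Fst (Pair a (Pair b c))) a A"
    and triple_snd: "teq \<Gamma> (Fst (Snd (Pair a (Pair b c)))) b (sub (a ;; Var) B)"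
    and triple_trd: "teq \<Gamma> (Snd (Snd (Pair a (Pair b c)))) c (sub (b ;; a ;; Var) C)"
proof -
  have S2: "wty \<Gamma> (Sig (sub (a ;; Var) B) (sub (up (a ;; Var)) C))"
    using wty_inst[OF wty_SigD(2)[OF S], of a] a by (simp add: has_def inst_def)
  have c': "chk \<Gamma> c (sub (b ;; a ;; Var) C)" using chk_has[OF c refl] .
  have inner: "has \<Gamma> (Pair b c) (Sig (sub (a ;; Var) B) (sub (up (a ;; Var)) C))"
    by (rule chkD[OF chk_Pair[OF chk_has[OF b refl] _ c'] S2]) (simp only: nf)
  have outer: "inst (Sig B C) a = Sig (sub (a ;; Var) B) (sub (up (a ;; Var)) C)" by (simp only: sub.simps inst_def)
  show "has \<Gamma> (Pair a (Pair b c)) (Sig A (Sig B C))"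
    by (rule chkD[OF chk_Pair[OF chk_has[OF a refl] outer chk_has[OF inner refl]] S])
  note be = teq_beta_pair[OF S chk_has[OF a refl] outer chk_has[OF inner refl]]
  show "teq \<Gamma> (Fst (Pair a (Pair b c))) a A" by (rule be(1))
  have e: "teq \<Gamma> (Fst (Pair b c)) b (sub (a ;; Var) B)" "teq \<Gamma> (Snd (Pair b c)) c (sub (b ;; a ;; Var) C)"
    by (rule teq_beta_pair[OF S2 chk_has[OF b refl] _ c'], simp only: nf)+
  show "teq \<Gamma> (Fst (Snd (Pair a (Pair b c)))) b (sub (a ;; Var) B)" by (rule teq_trans[OF teq_Fst[OF be(2) refl] e(1)])
  have 1: "teq \<Gamma> (Snd (Pair b c)) (Snd (Snd (Pair a (Pair b c)))) (inst (sub (up (a ;; Var)) C) (Fst (Pair b c)))"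
    by (rule teq_Snd[OF teq_sym[OF be(2)] refl refl])
  have "tyeq \<Gamma> (inst (sub (up (a ;; Var)) C) (Fst (Pair b c))) (sub (b ;; a ;; Var) C)"
    using functional_type[OF wty_SigD(2)[OF S2] e(1)] by (simp only: nf)
  from teq_conv[OF 1 this] show "teq \<Gamma> (Snd (Snd (Pair a (Pair b c)))) c (sub (b ;; a ;; Var) C)"
    by (rule teq_trans[OF teq_sym e(2)])
qed

lemma triple_eta:
  assumes t: "has \<Gamma> t (Sig A (Sig B C))"
  shows "teq \<Gamma> (Pair (Fst t) (Pair (Fst (Snd t)) (Snd (Snd t)))) t (Sig A (Sig B C))"
proof -
  have "has \<Gamma> (Snd t) (Sig (sub (Fst t ;; Var) B) (sub (up (Fst t ;; Var)) C))"
    by (rule has_Snd[OF t refl]) (simp only: sub.simps inst_def)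
  note s = teq_eta_Sig[OF this]
  have "teq \<Gamma> (Pair (Fst t) (Pair (Fst (Snd t)) (Snd (Snd t)))) (Pair (Fst t) (Snd t)) (Sig A (Sig B C))"
    by (rule teq_Pair[OF hasD[OF t] teq_refl[OF has_Fst[OF t refl]] _ s]) (simp only: sub.simps inst_def)
  then show ?thesis by (rule teq_trans[OF _ teq_eta_Sig[OF t]])
qed

text \<open>
  The inverse of the restriction: divide by the diagonal itself.
\<close>

definition hom_of_coc :: "tm \<Rightarrow> tm \<Rightarrow> tm \<Rightarrow> tm \<Rightarrow> tm \<Rightarrow> tm \<Rightarrow> tm \<Rightarrow> tm" where
  "hom_of_coc A E r Y p q H = div_hom A E r Y p q (diag A r H) H (Lam A (Refl (App (wk 1 (diag A r H)) (Var 0))))"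

lemma has_hom_of_coc:
  assumes G: "graph i \<Gamma> A E r" and Y: "wty \<Gamma> Y"
    and p: "has \<Gamma> p (Pi A (\<up> Y))" and q: "has \<Gamma> q (Pi A (\<up> Y))"
    and H: "has \<Gamma> H (coc2T A E Y p q)"
  shows "has \<Gamma> (hom_of_coc A E r Y p q H) (HomT A E r Y)"
    and "has \<Gamma> (Lam A (Refl (App (wk 1 (diag A r H)) (Var 0)))) (Pi A (Eq (Eq (wk 1 Y) (App (wk 1 p) (Var 0)) (App (wk 1 q) (Var 0))) (App (wk 1 (diag A r H)) (Var 0)) (App (wk 1 (diag A r H)) (Var 0))))"
proof -
  show *: "has \<Gamma> (Lam A (Refl (App (wk 1 (diag A r H)) (Var 0)))) (Pi A (Eq (Eq (wk 1 Y) (App (wk 1 p) (Var 0)) (App (wk 1 q) (Var 0))) (App (wk 1 (diag A r H)) (Var 0)) (App (wk 1 (diag A r H)) (Var 0))))"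
    by (rule has_Lam[OF graphD(1)[OF G] has_Refl[OF teqD(1)[OF diag_beta[OF assms]]]])
  show "has \<Gamma> (hom_of_coc A E r Y p q H) (HomT A E r Y)" unfolding hom_of_coc_def
    by (rule has_div_hom[OF assms has_diag[OF assms] *])
qed

lemma arr_wty: "wty \<Gamma> A \<Longrightarrow> wty \<Gamma> Y \<Longrightarrow> wty \<Gamma> (Pi A (\<up> Y))"
  by (rule wty_Pi, assumption, rule wty_sub, assumption, rule is_subst_shift_1)

lemma coc2T_wty:
  assumes G: "graph i \<Gamma> A E r" and Y: "wty \<Gamma> Y"
    and p: "has \<Gamma> p (Pi A (\<up> Y))" and q: "has \<Gamma> q (Pi A (\<up> Y))"
  shows "wty \<Gamma> (coc2T A E Y p q)"
  apply (simp only: nfd gd)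
  by (assumption | rule graphD[OF G] Y p q tcd | simp only: nfd | rule refl)+

lemma CocT_wty:
  assumes G: "graph i \<Gamma> A E r" and Y: "wty \<Gamma> Y"
  shows "wty \<Gamma> (CocT A E Y)"
  apply (simp only: nfd gd)
  by (assumption | rule graphD[OF G] Y tcd | simp only: nfd | rule refl)+

lemma teq_hom_of_coc:
  assumes G: "graph i \<Gamma> A E r" and Y: "wty \<Gamma> Y"
    and p: "teq \<Gamma> p p' (Pi A (\<up> Y))" and q: "teq \<Gamma> q q' (Pi A (\<up> Y))"
    and H: "teq \<Gamma> H H' (coc2T A E Y p q)"
  shows "teq \<Gamma> (hom_of_coc A E r Y p q H) (hom_of_coc A E r Y p' q' H') (HomT A E r Y)"
proof -
  let ?ar = "Pi A (\<up> Y)"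
  have g2: "\<turnstile> \<up> ?ar # ?ar # \<Gamma>"
    apply (simp only: nf)
    by (assumption | rule graphD[OF G] Y tcd | simp only: nfd | rule refl)+
  have s2: "is_subst \<Gamma> (shift (Suc (Suc 0))) (\<up> ?ar # ?ar # \<Gamma>)" by (rule is_subst_shift_2[OF g2])
  let ?C = "coc2T (sub (shift (Suc (Suc 0))) A) (sub (shift (Suc (Suc 0))) E) (sub (shift (Suc (Suc 0))) Y) (Var (Suc 0)) (Var 0)"
  have C: "wty (\<up> ?ar # ?ar # \<Gamma>) ?C"
    apply (rule coc2T_wty[OF graph_sub[OF G s2] wty_sub[OF Y s2]]; insert g2; simp only: nf)
    by (assumption | rule graphD[OF G] Y tcd | simp only: nfd | rule refl)+
  note g3 = wty_ctx[OF C]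
  have s3: "is_subst \<Gamma> (shift (Suc (Suc (Suc 0)))) (?C # \<up> ?ar # ?ar # \<Gamma>)" by (rule is_subst_shift_3[OF g3])
  have t: "has (?C # \<up> ?ar # ?ar # \<Gamma>) (hom_of_coc (sub (shift 3) A) (sub (shift 3) E) (sub (shift 3) r) (sub (shift 3) Y) (Var 2) (Var 1) (Var 0)) (HomT (sub (shift 3) A) (sub (shift 3) E) (sub (shift 3) r) (sub (shift 3) Y))"
    apply (insert g3, simp only: nums)
    apply (rule has_hom_of_coc(1)[OF graph_sub[OF G s3] wty_sub[OF Y s3]]; (simp only: nf gd)?)
    by (assumption | rule graphD[OF G] Y tcd | simp only: nfd | rule refl)+
  have "substeq (?C # \<up> ?ar # ?ar # \<Gamma>) (H ;; q ;; p ;; Var) (H' ;; q' ;; p' ;; Var) \<Gamma>"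
    apply (rule substeqc_cons[OF substeqc_cons[OF substeqc_cons[OF substeq_refl[OF is_subst_Var[OF graphD(4)[OF G]]] _ _ teqcI[OF p]] g2 _ teqcI[OF q]] g3 _ teqcI[OF H]])
    by (insert g2, simp_all only: nf gd) (drule ctx_tail, assumption)
  from functional[OF this t refl] show ?thesis by (simp only: nfd rd gd hom_of_coc_def)
qed

text \<open>
  The restriction of a morphism to a cocone; it forgets the reflexivity datum and uses the vertex map on
  both sides.
\<close>

definition coc_path :: "tm \<Rightarrow> tm \<Rightarrow> tm \<Rightarrow> tm" where
  "coc_path A E f1 = Lam (edgesT A E) (App3 (wk 1 f1) (Fst (Var 0)) (Fst (Snd (Var 0))) (Snd (Snd (Var 0))))"
definition coc_of_hom :: "tm \<Rightarrow> tm \<Rightarrow> tm \<Rightarrow> tm" where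
  "coc_of_hom A E m = Pair (Fst m) (Pair (Fst m) (coc_path A E (Fst (Snd m))))"

lemma has_coc_path:
  assumes G: "graph i \<Gamma> A E r" and Y: "wty \<Gamma> Y"
    and f0: "has \<Gamma> f0 (Pi A (\<up> Y))" and f1: "has \<Gamma> f1 (hom1T A E Y f0)"
  shows "has \<Gamma> (coc_path A E f1) (coc2T A E Y f0 f0)"
  unfolding coc_path_def
  apply (simp only: nfd gd)
  by (assumption | rule graphD[OF G] Y f0 f1[simplified nfd gd] tcd | simp only: nfd | rule refl)+

lemma coc_path_beta:
  assumes G: "graph i \<Gamma> A E r" and Y: "wty \<Gamma> Y"
    and f0: "has \<Gamma> f0 (Pi A (\<up> Y))" and f1: "has \<Gamma> f1 (hom1T A E Y f0)"
    and x: "has \<Gamma> x A" and y: "has \<Gamma> y A" and e: "has \<Gamma> e (App2 E x y)"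
  shows "teq \<Gamma> (App (coc_path A E f1) (Pair x (Pair y e))) (App3 f1 x y e) (Eq Y (App f0 x) (App f0 y))"
proof -
  note f1' = f1[simplified nfd gd]
  note w = graphD[OF G] Y f0 f1' x y e
  note pr = edge_pair[OF G x y e]
  let ?t = "Pair x (Pair y e)"
  have S: "wty \<Gamma> (edgesT A E)" using hasD[OF pr(1)] .
  note g = wty_ctx[OF S]
  have b: "has (edgesT A E # \<Gamma>) (App3 (wk 1 f1) (Fst (Var 0)) (Fst (Snd (Var 0))) (Snd (Snd (Var 0)))) (Eq (wk 1 Y) (App (wk 1 f0) (Fst (Var 0))) (App (wk 1 f0) (Fst (Snd (Var 0)))))"
    apply (insert g, simp only: nfd gd)
    by (assumption | rule w tcd | simp only: nfd | rule refl)+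
  have B: "teq \<Gamma> (App (coc_path A E f1) ?t) (App3 f1 (Fst ?t) (Fst (Snd ?t)) (Snd (Snd ?t))) (Eq Y (App f0 (Fst ?t)) (App f0 (Fst (Snd ?t))))"
    unfolding coc_path_def by (rule teq_beta[OF b pr(1), THEN teq_rhs]) (simp_all only: nf)
  have cv: "tyeq \<Gamma> (Eq Y (App f0 (Fst ?t)) (App f0 (Fst (Snd ?t)))) (Eq Y (App f0 x) (App f0 y))"
    by (rule tyeq_Eq[OF tyeq_refl[OF Y] teq_App[OF teq_refl[OF f0] refl pr(2)] teq_App[OF teq_refl[OF f0] refl pr(3)]]) (simp_all only: nf)
  let ?\<Delta> = "App2 (sub (shift 2) E) (Var 1) (Var 0) # \<up> A # A # \<Gamma>"
  have g3: "\<turnstile> ?\<Delta>" apply (simp only: nfd)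
    by (assumption | rule w tcd | simp only: nfd | rule refl)+
  have t: "has ?\<Delta> (App3 (sub (shift 3) f1) (Var 2) (Var 1) (Var 0)) (Eq (sub (shift 3) Y) (App (sub (shift 3) f0) (Var 2)) (App (sub (shift 3) f0) (Var 1)))"
    apply (insert g3, simp only: nfd)
    by (assumption | rule w tcd | simp only: nfd | rule refl)+
  have "substeq ?\<Delta> (e ;; y ;; x ;; Var) (Snd (Snd ?t) ;; Fst (Snd ?t) ;; Fst ?t ;; Var) \<Gamma>"
    apply (insert g3, simp only: nfd)
    by (assumption | rule substeqc_cons substeq_refl pr(2-4)[THEN teq_sym, THEN teqcI] w tc | simp only: nfd | rule refl)+
  from functional[OF this t refl] have "teq \<Gamma> (App3 f1 x y e) (App3 f1 (Fst ?t) (Fst (Snd ?t)) (Snd (Snd ?t))) (Eq Y (App f0 x) (App f0 y))"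
    by (simp only: nfd)
  from teq_trans[OF teq_conv[OF B cv] teq_sym[OF this]] show ?thesis .
qed

lemma teq_eta3:
  assumes f: "has \<Gamma> f (Pi A (Pi B (Pi C D)))"
  shows "teq \<Gamma> (Lam A (Lam B (Lam C (App3 (sub (shift 3) f) (Var 2) (Var 1) (Var 0))))) f (Pi A (Pi B (Pi C D)))"
proof -
  note wA = wty_PiD[OF hasD[OF f]] note wB = wty_PiD[OF wA(2)] note wC = wty_PiD[OF wB(2)]
  note g1 = wty_ctx[OF wA(1)] note g2 = wty_ctx[OF wB(1)]
  have f1: "has (A # \<Gamma>) (App (\<up> f) (Var 0)) (Pi B (Pi C D))"
    by (rule has_App[OF has_sub[OF f is_subst_shift_1[OF g1] sub.simps(3)] refl chk_has[OF has_Var(1)[OF g1 refl]]]) (simp_all only: nf)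
  have f2: "has (B # A # \<Gamma>) (App (\<up> (App (\<up> f) (Var 0))) (Var 0)) (Pi C D)"
    by (rule has_App[OF has_sub[OF f1 is_subst_shift_1[OF g2] sub.simps(3)] refl chk_has[OF has_Var(1)[OF g2 refl]]]) (simp_all only: nf)
  have "teq \<Gamma> (Lam A (Lam B (Lam C (App (\<up> (App (\<up> (App (\<up> f) (Var 0))) (Var 0))) (Var 0)))))
     f (Pi A (Pi B (Pi C D)))"
    by (rule teq_trans[OF teq_Lam[OF wA(1) teq_trans[OF teq_Lam[OF wB(1) teq_eta_Pi[OF f2]] teq_eta_Pi[OF f1]]] teq_eta_Pi[OF f]])
  then show ?thesis by (simp only: nf)
qed

context
  fixes i \<Gamma> A E r Y f0 f1 f2
  assumes G: "graph i \<Gamma> A E r" and Y: "wty \<Gamma> Y"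
    and f0: "has \<Gamma> f0 (Pi A (\<up> Y))" and f1: "has \<Gamma> f1 (hom1T A E Y f0)" and f2: "has \<Gamma> f2 (hom2T A r Y f0 f1)"
begin

lemma f1': "has \<Gamma> f1 (Pi A (Pi (\<up> A) (Pi (App2 (sub (shift 2) E) (Var 1) (Var 0)) (Eq (sub (shift 3) Y) (App (sub (shift 3) f0) (Var 2)) (App (sub (shift 3) f0) (Var 1))))))"
  using f1 by (simp only: nf gd)

lemmas ht = graphD[OF G] Y f0 f1[simplified nfd gd]

abbreviation (input) "H0 \<equiv> coc_path A E f1"
abbreviation (input) "Rf \<equiv> Lam A (Refl (App (wk 1 f0) (Var 0)))"

lemma H0: "has \<Gamma> H0 (coc2T A E Y f0 f0)" by (rule has_coc_path[OF G Y f0 f1])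

lemma f0x: "has (A # \<Gamma>) (App (wk 1 f0) (Var 0)) (wk 1 Y)"
  apply (simp only: nf)
  by (assumption | rule ht tcd | simp only: nfd | rule refl)+

lemma Rf: "has \<Gamma> Rf (Pi A (Eq (wk 1 Y) (App (wk 1 f0) (Var 0)) (App (wk 1 f0) (Var 0))))"
  by (rule has_Lam[OF graphD(1)[OF G] has_Refl[OF f0x]])

lemma Rf_beta: "teq (A # \<Gamma>) (App (wk 1 Rf) (Var 0)) (Refl (App (wk 1 f0) (Var 0))) (Eq (wk 1 Y) (App (wk 1 f0) (Var 0)) (App (wk 1 f0) (Var 0)))"
  using teq_wk_beta[OF graphD(1)[OF G] has_Refl[OF f0x]] by (simp only: wk_sub nums)

lemma diag0: "teq (A # \<Gamma>) (App (wk 1 (diag A r H0)) (Var 0)) (App3 (wk 1 f1) (Var 0) (Var 0) (App (wk 1 r) (Var 0))) (Eq (wk 1 Y) (App (wk 1 f0) (Var 0)) (App (wk 1 f0) (Var 0)))"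
proof -
  have s: "is_subst \<Gamma> (shift (Suc 0)) (A # \<Gamma>)" by (rule is_subst_shift_1[OF graphD(5)[OF G]])
  have "teq (A # \<Gamma>) (App (coc_path (wk 1 A) (wk 1 E) (wk 1 f1)) (Pair (Var 0) (Pair (Var 0) (App (wk 1 r) (Var 0)))))
     (App3 (wk 1 f1) (Var 0) (Var 0) (App (wk 1 r) (Var 0))) (Eq (wk 1 Y) (App (wk 1 f0) (Var 0)) (App (wk 1 f0) (Var 0)))"
    unfolding wk_sub One_nat_def
    apply (rule coc_path_beta[OF graph_sub[OF G s] wty_sub[OF Y s]]; (simp only: nfd gd)?)
    by (assumption | rule ht tcd | simp only: nfd | rule refl)+
  moreover have "wk 1 H0 = coc_path (wk 1 A) (wk 1 E) (wk 1 f1)" by (simp only: nfd gd coc_path_def)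
  ultimately show ?thesis using teq_trans[OF diag_beta[OF G Y f0 f0 H0]] by simp
qed

lemma f2': "has \<Gamma> f2 (Pi A (Eq (Eq (wk 1 Y) (App (wk 1 f0) (Var 0)) (App (wk 1 f0) (Var 0))) (App (wk 1 (diag A r H0)) (Var 0)) (Refl (App (wk 1 f0) (Var 0)))))"
  by (rule has_conv[OF f2[unfolded hom2T_def] tyeq_Pi[OF tyeq_refl[OF graphD(1)[OF G]]
     tyeq_Eq[OF tyeq_refl[OF hasD[OF teqD(1)[OF diag0]]] teq_sym[OF diag0] teq_refl[OF has_Refl[OF f0x]]]]])

lemma f2'': "has \<Gamma> f2 (Pi A (Eq (Eq (wk 1 Y) (App (wk 1 f0) (Var 0)) (App (wk 1 f0) (Var 0))) (App (wk 1 (diag A r H0)) (Var 0)) (App (wk 1 Rf) (Var 0))))"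
  by (rule has_conv[OF f2' tyeq_Pi[OF tyeq_refl[OF graphD(1)[OF G]]
     tyeq_Eq[OF tyeq_refl[OF hasD[OF teqD(1)[OF diag0]]] teq_refl[OF teqD(1)[OF diag0]] teq_sym[OF Rf_beta]]]])

lemma div_hom1_refl: "teq \<Gamma> (div_hom1 A E Y f0 f0 Rf H0) f1 (hom1T A E Y f0)"
proof -
  let ?\<Delta> = "App2 (sub (shift (Suc (Suc 0))) E) (Var (Suc 0)) (Var 0) # \<up> A # A # \<Gamma>"
  have g3: "\<turnstile> ?\<Delta>" by (assumption | rule ht tcd | simp only: nfd | rule refl)+
  note g2 = ctx_tail[OF g3]
  have s3: "is_subst \<Gamma> (shift (Suc (Suc (Suc 0)))) ?\<Delta>" by (rule is_subst_shift_3[OF g3])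
  have "teq ?\<Delta> (App (coc_path (sub (shift (Suc (Suc (Suc 0)))) A) (sub (shift (Suc (Suc (Suc 0)))) E) (sub (shift (Suc (Suc (Suc 0)))) f1)) (Pair (Var 2) (Pair (Var 1) (Var 0))))
    (App3 (sub (shift (Suc (Suc (Suc 0)))) f1) (Var 2) (Var 1) (Var 0)) (Eq (sub (shift (Suc (Suc (Suc 0)))) Y) (App (sub (shift (Suc (Suc (Suc 0)))) f0) (Var 2)) (App (sub (shift (Suc (Suc (Suc 0)))) f0) (Var 1)))"
    apply (insert g3)
    apply (rule coc_path_beta[OF graph_sub[OF G s3] wty_sub[OF Y s3]]; (simp only: nfd gd)?)
    by (assumption | rule ht tcd | simp only: nfd | rule refl)+
  then have a: "teq ?\<Delta> (App (sub (shift (Suc (Suc (Suc 0)))) H0) (Pair (Var 2) (Pair (Var 1) (Var 0))))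
    (App3 (sub (shift (Suc (Suc (Suc 0)))) f1) (Var 2) (Var 1) (Var 0)) (Eq (sub (shift (Suc (Suc (Suc 0)))) Y) (App (sub (shift (Suc (Suc (Suc 0)))) f0) (Var 2)) (App (sub (shift (Suc (Suc (Suc 0)))) f0) (Var 1)))"
    by (simp only: nfd gd coc_path_def)
  have "teq ?\<Delta> (sub (Var (Suc 0) ;; shift (Suc (Suc (Suc 0)))) (App (wk 1 Rf) (Var 0))) (sub (Var (Suc 0) ;; shift (Suc (Suc (Suc 0)))) (Refl (App (wk 1 f0) (Var 0))))
     (sub (Var (Suc 0) ;; shift (Suc (Suc (Suc 0)))) (Eq (wk 1 Y) (App (wk 1 f0) (Var 0)) (App (wk 1 f0) (Var 0))))"
    apply (insert g3, rule teq_sub[OF Rf_beta _ refl])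
    by (assumption | rule ht tcd | simp only: nfd | rule refl)+
  then have k: "teq ?\<Delta> (App (sub (shift (Suc (Suc (Suc 0)))) Rf) (Var (Suc 0))) (Refl (App (sub (shift (Suc (Suc (Suc 0)))) f0) (Var (Suc 0))))
     (Eq (sub (shift (Suc (Suc (Suc 0)))) Y) (App (sub (shift (Suc (Suc (Suc 0)))) f0) (Var (Suc 0))) (App (sub (shift (Suc (Suc (Suc 0)))) f0) (Var (Suc 0))))"
    by (simp only: nfd)
  note body = teq_trans[OF teq_path_div[OF k a[unfolded nums]] teq_path_div_refl[OF teqD(2)[OF a[unfolded nums]]]]
  from teq_trans[OF teq_Lam[OF ctx_wty[OF graphD(5)[OF G]] teq_Lam[OF ctx_wty[OF g2] teq_Lam[OF ctx_wty[OF g3] body]]] teq_eta3[OF f1', unfolded nums]]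
  show ?thesis by (simp only: nfd gd div_hom1_def)
qed

lemma div_hom2_refl: "teq \<Gamma> (div_hom2 A r Y f0 f0 Rf H0 f2) f2 (hom2T A r Y f0 (div_hom1 A E Y f0 f0 Rf H0))"
proof -
  note d = teqD(1)[OF diag0]
  have s: "has (A # \<Gamma>) (App (wk 1 f2) (Var 0)) (Eq (Eq (wk 1 Y) (App (wk 1 f0) (Var 0)) (App (wk 1 f0) (Var 0))) (App (wk 1 (diag A r H0)) (Var 0)) (Refl (App (wk 1 f0) (Var 0))))"
    unfolding wk_sub One_nat_def
    by (rule has_App[OF has_sub[OF f2'[unfolded wk_sub One_nat_def] is_subst_shift_1[OF graphD(5)[OF G]] sub.simps(3)] refl chk_has[OF has_Var(1)[OF graphD(5)[OF G] refl]]])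
      (simp_all only: nf)
  have s': "has (A # \<Gamma>) (App (wk 1 f2) (Var 0)) (Eq (Eq (wk 1 Y) (App (wk 1 f0) (Var 0)) (App (wk 1 f0) (Var 0))) (App (wk 1 (diag A r H0)) (Var 0)) (App (wk 1 Rf) (Var 0)))"
    by (rule has_conv[OF s tyeq_Eq[OF tyeq_refl[OF hasD[OF d]] teq_refl[OF d] teq_sym[OF Rf_beta]]])
  let ?T = "\<lambda>k. Eq (Eq (wk 1 Y) (App (wk 1 f0) (Var 0)) (App (wk 1 f0) (Var 0)))
      (path_div (wk 1 Y) (App (wk 1 f0) (Var 0)) (App (wk 1 f0) (Var 0)) (App (wk 1 f0) (Var 0)) k (App (wk 1 (diag A r H0)) (Var 0)))
      (Refl (App (wk 1 f0) (Var 0)))"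
  have T: "tyeq (A # \<Gamma>) (?T (App (wk 1 Rf) (Var 0))) (Eq (Eq (wk 1 Y) (App (wk 1 f0) (Var 0)) (App (wk 1 f0) (Var 0))) (App (wk 1 (diag A r H0)) (Var 0)) (Refl (App (wk 1 f0) (Var 0))))"
    by (rule tyeq_trans[OF tyeq_Eq[OF tyeq_refl[OF hasD[OF d]] teq_path_div[OF Rf_beta teq_refl[OF d]] teq_refl[OF has_Refl[OF f0x]]] div_unit_conv[OF d]])
  have "teq (A # \<Gamma>) (div_unit (wk 1 Y) (App (wk 1 f0) (Var 0)) (App (wk 1 f0) (Var 0)) (App (wk 1 Rf) (Var 0)) (App (wk 1 (diag A r H0)) (Var 0)) (App (wk 1 f2) (Var 0)))
     (App (wk 1 f2) (Var 0)) (Eq (Eq (wk 1 Y) (App (wk 1 f0) (Var 0)) (App (wk 1 f0) (Var 0))) (App (wk 1 (diag A r H0)) (Var 0)) (Refl (App (wk 1 f0) (Var 0))))"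
    by (rule teq_trans[OF teq_conv[OF teq_div_unit[OF Rf_beta teq_refl[OF d] teq_refl[OF s']] T] teq_div_unit_refl[OF d s]])
  moreover have "teq \<Gamma> (Lam A (App (wk 1 f2) (Var 0))) f2 (Pi A (Eq (Eq (wk 1 Y) (App (wk 1 f0) (Var 0)) (App (wk 1 f0) (Var 0))) (App (wk 1 (diag A r H0)) (Var 0)) (Refl (App (wk 1 f0) (Var 0)))))"
    using teq_eta_Pi[OF f2'] by (simp only: wk_sub One_nat_def)
  ultimately
  have "teq \<Gamma> (div_hom2 A r Y f0 f0 Rf H0 f2) f2 (Pi A (Eq (Eq (wk 1 Y) (App (wk 1 f0) (Var 0)) (App (wk 1 f0) (Var 0))) (App (wk 1 (diag A r H0)) (Var 0)) (Refl (App (wk 1 f0) (Var 0)))))"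
    unfolding div_hom2_def by (blast intro: teq_trans teq_Lam graphD(1)[OF G])
  from teq_conv[OF teq_conv[OF this tyeq_Pi[OF tyeq_refl[OF graphD(1)[OF G]] tyeq_sym[OF T]]] div_hom2_conv[OF G Y f0 f0 H0 Rf f2'']]
  show ?thesis .
qed

text \<open>
  For the cocone of a morphism \<open>(f\<^sub>0, f\<^sub>1, f\<^sub>2)\<close> the diagonal is \<open>f\<^sub>1 x x (rfx x)\<close>, and \<open>f\<^sub>2\<close> is a homotopy from it to
  the constant one. Homotopy induction along \<open>f\<^sub>2\<close> moves the pair \<open>(K, s)\<close> from \<open>(diag, refl)\<close> to \<open>(refl, f\<^sub>2)\<close>,
  where the divided morphism is judgmentally \<open>(f\<^sub>0, f\<^sub>1, f\<^sub>2)\<close>.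
\<close>

lemma hom_of_coc_of_hom: "inh \<Gamma> (Eq (HomT A E r Y) (hom_of_coc A E r Y f0 f0 H0) (Pair f0 (Pair f1 f2)))"
proof -
  let ?B = "Eq (\<up> Y) (App (\<up> f0) (Var 0)) (App (\<up> f0) (Var 0))"
  let ?K = "diag A r H0"
  let ?h = "Pi (\<up> A) (Eq (sub (Var 0 ;; shift (Suc (Suc 0))) ?B) (App (sub (shift (Suc (Suc 0))) ?K) (Var 0)) (App (Var (Suc 0)) (Var 0)))"
  note K = has_diag[OF G Y f0 f0 H0, unfolded wk_sub One_nat_def]
  have g1: "\<turnstile> Pi A ?B # \<Gamma>" by (rule wty_ctx[OF hasD[OF K]])
  have g: "\<turnstile> ?h # Pi A ?B # \<Gamma>"
    apply (insert g1, rule wty_ctx, simp only: nfd)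
    by (assumption | rule K ht tcd | simp only: nfd | rule refl)+
  have s: "is_subst \<Gamma> (shift (Suc (Suc 0))) (?h # Pi A ?B # \<Gamma>)" by (rule is_subst_shift_2[OF g])
  let ?A = "sub (shift (Suc (Suc 0))) A" and ?E = "sub (shift (Suc (Suc 0))) E" and ?r = "sub (shift (Suc (Suc 0))) r" and ?Y = "sub (shift (Suc (Suc 0))) Y"
    and ?f = "sub (shift (Suc (Suc 0))) f0" and ?H = "sub (shift (Suc (Suc 0))) H0"
  note G2 = graph_sub[OF G s] and Y2 = wty_sub[OF Y s]
  have fs: "has (?h # Pi A ?B # \<Gamma>) ?f (Pi ?A (\<up> ?Y))" by (rule has_sub[OF f0 s]) (simp only: nf)
  have Hs: "has (?h # Pi A ?B # \<Gamma>) ?H (coc2T ?A ?E ?Y ?f ?f)" by (rule has_sub[OF H0 s]) (simp only: nf gd)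
  have Ks: "has (?h # Pi A ?B # \<Gamma>) (Var (Suc 0)) (Pi ?A (Eq (wk 1 ?Y) (App (wk 1 ?f) (Var 0)) (App (wk 1 ?f) (Var 0))))"
    by (rule has_Var_1[OF g]) (simp only: nf)
  have dg: "sub (shift (Suc (Suc 0))) (diag A r H0) = diag ?A ?r ?H" by (simp only: nf rd)
  have ss: "has (?h # Pi A ?B # \<Gamma>) (Var 0) (Pi ?A (Eq (Eq (wk 1 ?Y) (App (wk 1 ?f) (Var 0)) (App (wk 1 ?f) (Var 0))) (App (wk 1 (diag ?A ?r ?H)) (Var 0)) (App (wk 1 (Var (Suc 0))) (Var 0))))"
    unfolding dg[symmetric]
    by (rule has_Var_0[OF g]) (simp only: nf)
  have h1: "has (?h # Pi A ?B # \<Gamma>) (hom_of_coc ?A ?E ?r ?Y ?f ?f ?H) (HomT ?A ?E ?r ?Y)" by (rule has_hom_of_coc(1)[OF G2 Y2 fs fs Hs])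
  have h2: "has (?h # Pi A ?B # \<Gamma>) (div_hom ?A ?E ?r ?Y ?f ?f (Var (Suc 0)) ?H (Var 0)) (HomT ?A ?E ?r ?Y)"
    by (rule has_div_hom[OF G2 Y2 fs fs Hs Ks ss])
  have C: "wty (?h # Pi A ?B # \<Gamma>) (Eq (HomT ?A ?E ?r ?Y) (hom_of_coc ?A ?E ?r ?Y ?f ?f ?H) (div_hom ?A ?E ?r ?Y ?f ?f (Var (Suc 0)) ?H (Var 0)))"
    by (rule wty_Eq[OF hasD[OF h1] chk_has[OF h1 refl] chk_has[OF h2 refl]])
  have base: "inh \<Gamma> (Eq (HomT A E r Y) (hom_of_coc A E r Y f0 f0 H0) (hom_of_coc A E r Y f0 f0 H0))"
    by (rule inhI[OF has_Refl[OF has_hom_of_coc(1)[OF G Y f0 f0 H0]]])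
  have "inh \<Gamma> (Eq (HomT A E r Y) (hom_of_coc A E r Y f0 f0 H0) (div_hom A E r Y f0 f0 Rf H0 f2))"
    apply (rule homotopy_induction[OF K Rf[unfolded wk_sub One_nat_def] f2''[unfolded wk_sub One_nat_def] C base])
    by (simp_all only: nfd rd gd hom_of_coc_def coc_path_def)
  moreover have "teq \<Gamma> (div_hom A E r Y f0 f0 Rf H0 f2) (Pair f0 (Pair f1 f2)) (HomT A E r Y)"
  proof -
    note w = hasD[OF has_hom_of_coc(1)[OF G Y f0 f0 H0]]
    have "wty \<Gamma> (inst (Sig (hom1T (wk 1 A) (wk 1 E) (wk 1 Y) (Var 0)) (hom2T (wk 2 A) (wk 2 r) (wk 2 Y) (Var 1) (Var 0))) f0)"
      using wty_inst[OF wty_SigD(2)[OF w[unfolded HomT_def]]] f0 unfolding has_def by (simp add: has_def arr_def wk_sub)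
    then have w2: "wty \<Gamma> (Sig (hom1T A E Y f0) (hom2T (wk 1 A) (wk 1 r) (wk 1 Y) (wk 1 f0) (Var 0)))"
      by (simp only: nf gd)
    have "teq \<Gamma> (Pair (div_hom1 A E Y f0 f0 Rf H0) (div_hom2 A r Y f0 f0 Rf H0 f2)) (Pair f1 f2) (Sig (hom1T A E Y f0) (hom2T (wk 1 A) (wk 1 r) (wk 1 Y) (wk 1 f0) (Var 0)))"
      by (rule teq_Pair[OF w2 div_hom1_refl _ div_hom2_refl]) (simp only: nf gd)
    from teq_Pair[OF w[unfolded HomT_def] teq_refl[OF f0[folded arr_def[unfolded wk_sub One_nat_def]]] _ this]
    show ?thesis unfolding div_hom_def HomT_def by (simp only: nf gd)
  qed
  ultimately show ?thesis
    using inh_trans inh_Eq_refl by blast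
qed

end

text \<open>
  Up to \<open>\<beta>\<close> and \<open>\<eta>\<close> the cocone of the divided morphism is the divided cocone, which \<open>coc_div_eq\<close>
  identifies with the given one.
\<close>

lemma coc_of_hom_of_coc:
  assumes G: "graph i \<Gamma> A E r" and Y: "wty \<Gamma> Y"
    and p: "has \<Gamma> p (Pi A (\<up> Y))" and q: "has \<Gamma> q (Pi A (\<up> Y))"
    and H: "has \<Gamma> H (coc2T A E Y p q)"
  shows "inh \<Gamma> (Eq (CocT A E Y) (coc_of_hom A E (hom_of_coc A E r Y p q H)) (Pair p (Pair q H)))"
proof -
  let ?K = "diag A r H" and ?m = "hom_of_coc A E r Y p q H"
  let ?R1 = "div_hom1 A E Y p q ?K H"
  let ?R2 = "div_hom2 A r Y p q ?K H (Lam A (Refl (App (wk 1 (diag A r H)) (Var 0))))"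
  let ?S = "edgesT A E"
  note K = has_diag[OF assms]
  note m = has_hom_of_coc(1)[OF assms]
  have p': "has \<Gamma> p (arr A Y)" using p by (simp only: arr_def wk_sub One_nat_def)
  have R1: "has \<Gamma> ?R1 (sub (p ;; Var) (hom1T (wk 1 A) (wk 1 E) (wk 1 Y) (Var 0)))"
    using has_div_hom1[OF assms K] by (simp only: nf gd)
  have R2: "has \<Gamma> ?R2 (sub (?R1 ;; p ;; Var) (hom2T (wk 2 A) (wk 2 r) (wk 2 Y) (Var 1) (Var 0)))"
    using has_div_hom2[OF assms K has_hom_of_coc(2)[OF assms]] by (simp only: nf gd)
  note T = triple[OF hasD[OF m, unfolded HomT_def] p' R1 R2]
  have m1: "teq \<Gamma> (Fst ?m) p (Pi A (\<up> Y))"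
    using T(2) unfolding hom_of_coc_def div_hom_def by (simp only: arr_def wk_sub One_nat_def)
  have m2: "teq \<Gamma> (Fst (Snd ?m)) ?R1 (hom1T A E Y p)"
    using T(3) unfolding hom_of_coc_def div_hom_def by (simp only: nf gd)
  note m2' = m2[unfolded hom1T_def wk_sub]
  have S: "wty \<Gamma> ?S" by (rule wty_PiD[OF coc2T_wty[OF G Y p q, unfolded coc2T_def]])
  note g = wty_ctx[OF S]
  have s: "is_subst \<Gamma> (shift (Suc 0)) (?S # \<Gamma>)" by (rule is_subst_shift_1[OF g])
  note ht = graphD[OF G] Y p q
  have v: "has (?S # \<Gamma>) (Var 0) (Sig (\<up> A) (Sig (sub (shift (Suc (Suc 0))) A) (App2 (sub (shift (Suc (Suc (Suc 0)))) E) (Var (Suc 0)) (Var 0))))"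
    by (rule has_Var_0[OF g]) (simp only: nf gd)
  have pr: "has (?S # \<Gamma>) (Fst (Var 0)) (\<up> A)" "has (?S # \<Gamma>) (Fst (Snd (Var 0))) (\<up> A)"
    "has (?S # \<Gamma>) (Snd (Snd (Var 0))) (App2 (\<up> E) (Fst (Var 0)) (Fst (Snd (Var 0))))"
    by (assumption | rule v tc | simp only: nf | rule refl)+
  let ?w = "\<up>"
  have "teq (?S # \<Gamma>) (?w (Fst (Snd ?m))) (?w ?R1) (?w (hom1T A E Y p))" by (rule teq_sub[OF m2 s refl])
  then have e1: "teq (?S # \<Gamma>) (App3 (?w (Fst (Snd ?m))) (Fst (Var 0)) (Fst (Snd (Var 0))) (Snd (Snd (Var 0))))
     (App3 (?w ?R1) (Fst (Var 0)) (Fst (Snd (Var 0))) (Snd (Snd (Var 0)))) (Eq (?w Y) (App (?w p) (Fst (Var 0))) (App (?w p) (Fst (Snd (Var 0)))))"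
    apply (simp only: hom1T_def nf)
    apply (rule teqc_App, rule teqc_App, rule teqc_App, assumption)
    by (assumption | rule teqc_refl ht pr tc | simp only: nf | rule refl)+
  note e2 = div_hom1_beta[OF assms K s pr]
  have k: "has (?S # \<Gamma>) (App (?w ?K) (Fst (Snd (Var 0)))) (Eq (?w Y) (App (?w p) (Fst (Snd (Var 0)))) (App (?w q) (Fst (Snd (Var 0)))))"
    by (rule has_App[OF has_sub[OF K s sub.simps(3)] refl chk_has[OF pr(2) refl]]) (simp only: nf)
  have "teq (?S # \<Gamma>) (App (?w H) (Pair (Fst (Var 0)) (Pair (Fst (Snd (Var 0))) (Snd (Snd (Var 0)))))) (App (?w H) (Var 0))
     (Eq (?w Y) (App (?w p) (Fst (Var 0))) (App (?w q) (Fst (Snd (Var 0)))))"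
  proof -
    have vv: "teq (?S # \<Gamma>) (Var 0) (Pair (Fst (Var 0)) (Pair (Fst (Snd (Var 0))) (Snd (Snd (Var 0))))) (?w ?S)"
      using teq_sym[OF triple_eta[OF v]] by (simp only: nf gd)
    have h: "has (?S # \<Gamma>) (?w H) (Pi (?w ?S) (sub (up (shift (Suc 0))) (Eq (wk 1 Y) (App (wk 1 p) (Fst (Var 0))) (App (wk 1 q) (Fst (Snd (Var 0)))))))"
      by (rule has_sub[OF H[unfolded coc2T_def] s]) (simp only: sub.simps)
    show ?thesis by (rule teq_sym, rule teq_App[OF teq_refl[OF h] refl vv]) (simp only: nf)
  qed
  note e3 = teq_path_div[OF teq_refl[OF k] this]
  note body = teq_trans[OF e1 teq_trans[OF e2 e3]]
  let ?C = "Lam ?S (path_div (wk 1 Y) (App (wk 1 p) (Fst (Var 0))) (App (wk 1 p) (Fst (Snd (Var 0)))) (App (wk 1 q) (Fst (Snd (Var 0))))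
       (App (wk 1 ?K) (Fst (Snd (Var 0)))) (App (wk 1 H) (Var 0)))"
  have "teq \<Gamma> (coc_path A E (Fst (Snd ?m))) ?C (coc2T A E Y p p)"
    unfolding coc_path_def coc2T_def wk_sub One_nat_def by (rule teq_Lam[OF S body])
  then have c3: "teq \<Gamma> ?C (coc_path A E (Fst (Snd ?m))) (coc2T A E Y p p)" by (rule teq_sym)
  have cw: "wty \<Gamma> (CocT A E Y)" by (rule CocT_wty[OF G Y])
  have "teqc \<Gamma> (Pair p (Pair p ?C)) (coc_of_hom A E ?m) (CocT A E Y)"
    unfolding coc_of_hom_def CocT_def
    apply (rule teqc_Pair[OF teqcI[OF teq_sym[OF m1]]], simp only: nf, simp only: sub.simps inst_def)
    apply (rule teqc_Pair[OF teqcI[OF teq_sym[OF m1]]], simp only: nf, rule refl)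
    apply (rule teqcI[OF c3], simp only: nf gd)
    done
  from inh_Eq_refl[OF teq_sym[OF teqcD[OF this cw]]] coc_div_eq[OF G Y p q K[unfolded wk_sub One_nat_def] H]
  show ?thesis by (rule inh_trans)
qed

text \<open>
  The two round trips, applied to the components of a variable; by \<open>\<eta>\<close> it is the triple of these.
\<close>

lemma open_equiv_coc_of_hom:
  assumes G: "graph i \<Gamma> A E r" and Y: "wty \<Gamma> Y"
  shows "open_equiv \<Gamma> (HomT A E r Y) (CocT A E Y) (coc_of_hom (wk 1 A) (wk 1 E) (Var 0))"
proof -
  let ?w = "\<up>"
  have wC: "wty \<Gamma> (CocT A E Y)" by (rule CocT_wty[OF G Y])
  have wH: "wty \<Gamma> (HomT A E r Y)"
    apply (simp only: nfd gd)
    by (assumption | rule graphD[OF G] Y tcd | simp only: nfd | rule refl)+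
  note gC = wty_ctx[OF wC] and gH = wty_ctx[OF wH]
  have sC: "is_subst \<Gamma> (shift (Suc 0)) (CocT A E Y # \<Gamma>)" by (rule is_subst_shift_1[OF gC])
  have sH: "is_subst \<Gamma> (shift (Suc 0)) (HomT A E r Y # \<Gamma>)" by (rule is_subst_shift_1[OF gH])
  let ?p = "Fst (Var 0)" and ?q = "Fst (Snd (Var 0))" and ?h = "Snd (Snd (Var 0))"
  let ?G = "hom_of_coc (?w A) (?w E) (?w r) (?w Y) ?p ?q ?h"
  let ?F = "coc_of_hom (?w A) (?w E) (Var 0)"
  note GC = graph_sub[OF G sC] and YC = wty_sub[OF Y sC] and GH = graph_sub[OF G sH] and YH = wty_sub[OF Y sH]
  have vC: "has (CocT A E Y # \<Gamma>) (Var 0) (CocT (?w A) (?w E) (?w Y))" by (rule has_Var_0[OF gC]) (simp only: nf gd)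
  have vH: "has (HomT A E r Y # \<Gamma>) (Var 0) (HomT (?w A) (?w E) (?w r) (?w Y))" by (rule has_Var_0[OF gH]) (simp only: nf gd)
  have p: "has (CocT A E Y # \<Gamma>) ?p (Pi (?w A) (?w (?w Y)))" "has (CocT A E Y # \<Gamma>) ?q (Pi (?w A) (?w (?w Y)))"
    by (insert vC, simp only: CocT_def nf, (assumption | rule tc | simp only: nf)+)+
  have h: "has (CocT A E Y # \<Gamma>) ?h (coc2T (?w A) (?w E) (?w Y) ?p ?q)"
    apply (insert vC, simp only: gd nf)
    by (assumption | rule tc | simp only: nf)+
  have g: "has (CocT A E Y # \<Gamma>) ?G (HomT (?w A) (?w E) (?w r) (?w Y))" by (rule has_hom_of_coc(1)[OF GC YC p h])
  have f0: "has (HomT A E r Y # \<Gamma>) ?p (Pi (?w A) (?w (?w Y)))"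
    by (insert vH, simp only: HomT_def nf, (assumption | rule tc | simp only: nf)+)
  have f1: "has (HomT A E r Y # \<Gamma>) ?q (hom1T (?w A) (?w E) (?w Y) ?p)"
    apply (insert vH, simp only: gd nf)
    by (assumption | rule tc | simp only: nf)+
  have f2: "has (HomT A E r Y # \<Gamma>) ?h (hom2T (?w A) (?w r) (?w Y) ?p ?q)"
    apply (insert vH, simp only: gd nf)
    by (assumption | rule tc | simp only: nf)+
  note h3 = has_coc_path[OF GH YH f0 f1]
  have wC': "wty (HomT A E r Y # \<Gamma>) (CocT (?w A) (?w E) (?w Y))" by (rule CocT_wty[OF GH YH])
  have f0': "has (HomT A E r Y # \<Gamma>) ?p (arr (?w A) (?w Y))" using f0 by (simp only: nf)
  have f0'': "has (HomT A E r Y # \<Gamma>) ?p (sub (?p ;; Var) (wk 1 (arr (?w A) (?w Y))))" using f0 by (simp only: nf)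
  have h3': "has (HomT A E r Y # \<Gamma>) (coc_path (?w A) (?w E) ?q) (sub (?p ;; ?p ;; Var) (coc2T (wk 2 (?w A)) (wk 2 (?w E)) (wk 2 (?w Y)) (Var 1) (Var 0)))"
    using h3 by (simp only: nf gd)
  note T = triple[OF wC'[unfolded CocT_def] f0' f0'' h3', folded CocT_def coc_of_hom_def]
  have f: "has (HomT A E r Y # \<Gamma>) ?F (?w (CocT A E Y))" using T(1) by (simp only: nf gd)
  have "teq (HomT A E r Y # \<Gamma>) (Fst ?F) ?p (Pi (?w A) (?w (?w Y)))" using T(2) by (simp only: nf)
  moreover have "teq (HomT A E r Y # \<Gamma>) (Fst (Snd ?F)) ?p (Pi (?w A) (?w (?w Y)))" using T(3) by (simp only: nf)
  moreover have "teq (HomT A E r Y # \<Gamma>) (Snd (Snd ?F)) (coc_path (?w A) (?w E) ?q) (coc2T (?w A) (?w E) (?w Y) ?p ?p)" using T(4) by (simp only: nf gd)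
  ultimately have "teq (HomT A E r Y # \<Gamma>) (hom_of_coc (?w A) (?w E) (?w r) (?w Y) ?p ?p (coc_path (?w A) (?w E) ?q)) (hom_of_coc (?w A) (?w E) (?w r) (?w Y) (Fst ?F) (Fst (Snd ?F)) (Snd (Snd ?F))) (HomT (?w A) (?w E) (?w r) (?w Y))"
    by - (rule teq_hom_of_coc[OF GH YH]; rule teq_sym, assumption)
  then have s1: "inh (HomT A E r Y # \<Gamma>) (Eq (HomT (?w A) (?w E) (?w r) (?w Y)) (hom_of_coc (?w A) (?w E) (?w r) (?w Y) (Fst ?F) (Fst (Snd ?F)) (Snd (Snd ?F))) (hom_of_coc (?w A) (?w E) (?w r) (?w Y) ?p ?p (coc_path (?w A) (?w E) ?q)))"
    by (rule inh_Eq_refl[OF teq_sym])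
  have s3: "inh (HomT A E r Y # \<Gamma>) (Eq (HomT (?w A) (?w E) (?w r) (?w Y)) (Pair ?p (Pair ?q ?h)) (Var 0))"
    using inh_Eq_refl[OF triple_eta[OF vH[unfolded HomT_def]]] unfolding HomT_def .
  have eta: "inh (HomT A E r Y # \<Gamma>) (Eq (?w (HomT A E r Y)) (sub (?F ;; shift (Suc 0)) ?G) (Var 0))"
    using inh_trans[OF s1 inh_trans[OF hom_of_coc_of_hom[OF GH YH f0 f1 f2] s3]] by (simp only: nfd gd rd hom_of_coc_def)
  have e3: "inh (CocT A E Y # \<Gamma>) (Eq (CocT (?w A) (?w E) (?w Y)) (Pair ?p (Pair ?q ?h)) (Var 0))"
    using inh_Eq_refl[OF triple_eta[OF vC[unfolded CocT_def]]] unfolding CocT_def .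
  have eps: "inh (CocT A E Y # \<Gamma>) (Eq (?w (CocT A E Y)) (sub (?G ;; shift (Suc 0)) ?F) (Var 0))"
    using inh_trans[OF coc_of_hom_of_coc[OF GC YC p h] e3] by (simp only: nfd gd coc_of_hom_def coc_path_def)
  have g': "has (CocT A E Y # \<Gamma>) ?G (?w (HomT A E r Y))" using g by (simp only: nfd gd)
  show ?thesis unfolding open_equiv_def wk_sub One_nat_def using wC wH f g' eta eps by blast
qed

section \<open>Discrete graphs\<close>

lemma has_Eq_U: "has \<Gamma> A T \<Longrightarrow> T = U i \<Longrightarrow> chk \<Gamma> a A \<Longrightarrow> chk \<Gamma> b A \<Longrightarrow> has \<Gamma> (Eq A a b) (U i)"
proof -
  assume *: "has \<Gamma> A T" "T = U i" "chk \<Gamma> a A" "chk \<Gamma> b A"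
  then have "\<Gamma> \<turnstile> A \<^bold>: U i" "wty \<Gamma> A" by (auto simp: has_def intro: wtyI)
  then show ?thesis using ty_Eq * chkD hasD unfolding has_def chk_def by blast
qed

lemma sub_Disc: "sub \<sigma> (Disc Y) = Disc (sub \<sigma> Y)"
  unfolding Disc_def by (simp only: nf)

lemma disc_edges_beta:
  assumes Yl: "has \<Gamma> Y (U l)" and a: "has \<Gamma> a Y" and b: "has \<Gamma> b Y"
  shows "teq \<Gamma> (App2 (Lam Y (Lam (wk 1 Y) (Eq (wk 2 Y) (Var 1) (Var 0)))) a b) (Eq Y a b) (U l)"
proof -
  have Y: "wty \<Gamma> Y" by (rule wty_el[OF Yl refl])
  note g = has_ctx[OF a] wty_ctx[OF Y]
  have 1: "teq \<Gamma> (App (Lam Y (Lam (wk 1 Y) (Eq (wk 2 Y) (Var 1) (Var 0)))) a) (Lam Y (Eq (sub (shift 1) Y) (sub (shift 1) a) (Var 0))) (Pi Y (U l))"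
    apply (simp only: nf)
    apply (rule teq_beta_step)
    by (assumption | rule Y Yl a b g ec has_Eq_U tc | simp only: nf | rule refl)+
  have 2: "teq \<Gamma> (App (Lam Y (Eq (sub (shift 1) Y) (sub (shift 1) a) (Var 0))) b) (Eq Y a b) (U l)"
    apply (simp only: nf)
    apply (rule teq_beta_step)
    by (assumption | rule Y Yl a b g ec has_Eq_U tc | simp only: nf | rule refl)+
  have "teq \<Gamma> (App2 (Lam Y (Lam (wk 1 Y) (Eq (wk 2 Y) (Var 1) (Var 0)))) a b) (App (Lam Y (Eq (sub (shift 1) Y) (sub (shift 1) a) (Var 0))) b) (U l)"
    by (rule teqc_App[OF 1 refl teqc_refl[OF chk_has[OF b refl]]]) (simp only: nf)
  then show ?thesis using 2 by (rule teq_trans)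
qed

context
  fixes \<Gamma> Y
  assumes Y: "wty \<Gamma> Y"
begin

abbreviation (input) "D1 \<equiv> Lam Y (Lam (wk 1 Y) (Eq (wk 2 Y) (Var 1) (Var 0)))"

lemma disc_parts:
  shows disc_vert: "tyeq \<Gamma> Y (vert (Disc Y))"
    and disc_edge: "\<And>a b. has \<Gamma> a Y \<Longrightarrow> has \<Gamma> b Y \<Longrightarrow> tyeq \<Gamma> (Eq Y a b) (edge (Disc Y) a b)"
    and disc_rfx: "\<And>a. has \<Gamma> a Y \<Longrightarrow> teq \<Gamma> (Refl a) (rfx (Disc Y) a) (Eq Y a a)"
proof -
  obtain l where Yl: "has \<Gamma> Y (U l)" by (rule wty_has[OF Y])
  note g = wty_ctx'[OF Y] wty_ctx[OF Y]
  have S: "wty \<Gamma> (Sig (U l) (Sig (Pi (Var 0) (Pi (Var 1) (U l))) (Pi (Var 1) (App2 (Var 1) (Var 0) (Var 0)))))"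
    apply (simp only: nf)
    by (assumption | rule g tc | simp only: nf | rule refl)+
  have D1: "has \<Gamma> D1 (Pi Y (Pi (wk 1 Y) (U l)))"
    apply (simp only: nf)
    by (assumption | rule Y Yl g has_Eq_U tc | simp only: nf | rule refl)+
  then have D1': "has \<Gamma> D1 (sub (Y ;; Var) (Pi (Var 0) (Pi (Var 1) (U l))))" by (simp only: nf)
  have R: "has \<Gamma> (Lam Y (Refl (Var 0))) (Pi Y (Eq (wk 1 Y) (Var 0) (Var 0)))"
    apply (simp only: nf)
    by (assumption | rule Y Yl g has_Eq_U tc | simp only: nf | rule refl)+
  have v: "has (Y # \<Gamma>) (Var 0) (\<up> Y)" by (rule has_Var_0[OF g(2)]) (simp only: nf)
  have "tyeq (Y # \<Gamma>) (App2 (\<up> D1) (Var 0) (Var 0)) (Eq (\<up> Y) (Var 0) (Var 0))"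
    using teq_tyeq[OF disc_edges_beta[OF has_sub[OF Yl is_subst_shift_1[OF g(2)] sub.simps(2)] v v] refl] by (simp only: nf)
  then have cv: "tyeq \<Gamma> (Pi Y (App2 (wk 1 D1) (Var 0) (Var 0))) (Pi Y (Eq (wk 1 Y) (Var 0) (Var 0)))"
    by (intro tyeq_Pi tyeq_refl Y) (simp only: wk_sub nums)
  have R': "has \<Gamma> (Lam Y (Refl (Var 0))) (sub (D1 ;; Y ;; Var) (Pi (Var 1) (App2 (Var 1) (Var 0) (Var 0))))"
    using has_conv[OF R tyeq_sym[OF cv]] by (simp only: nf)
  note T = triple[OF S Yl D1' R', folded Disc_def]
  show "tyeq \<Gamma> Y (vert (Disc Y))" unfolding vert_def by (rule teq_tyeq[OF teq_sym[OF T(2)] refl])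
  show "tyeq \<Gamma> (Eq Y a b) (edge (Disc Y) a b)" if a: "has \<Gamma> a Y" and b: "has \<Gamma> b Y" for a b
  proof -
    have d: "teq \<Gamma> (Fst (Snd (Disc Y))) D1 (Pi Y (Pi (\<up> Y) (U l)))" using T(3) by (simp only: nf sub_Disc)
    have "teq \<Gamma> (edge (Disc Y) a b) (App2 D1 a b) (U l)" unfolding edge_def
      by (rule teqc_App[OF teqc_App[OF d refl]]) (assumption | rule teqc_refl a b tc | simp only: nf | rule refl)+
    from teq_trans[OF this disc_edges_beta[OF Yl a b]]
    show ?thesis by (rule tyeq_sym[OF teq_tyeq[OF _ refl]])
  qed
  show "teq \<Gamma> (Refl a) (rfx (Disc Y) a) (Eq Y a a)" if a: "has \<Gamma> a Y" for a
  proof -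
    have d: "teq \<Gamma> (Snd (Snd (Disc Y))) (Lam Y (Refl (Var 0))) (Pi Y (Eq (wk 1 Y) (Var 0) (Var 0)))"
      by (rule teq_conv[OF _ cv]) (use T(4) in \<open>simp only: nf sub_Disc\<close>)
    have "teq \<Gamma> (rfx (Disc Y) a) (App (Lam Y (Refl (Var 0))) a) (Eq Y a a)" unfolding rfx_def
      by (rule teqc_App[OF d refl teqc_refl[OF chk_has[OF a refl]]]) (simp only: nf)
    moreover have "teq \<Gamma> (App (Lam Y (Refl (Var 0))) a) (Refl a) (Eq Y a a)"
      by (rule teq_beta[OF has_Refl[OF v] a, THEN teq_rhs]) (simp_all only: nf)
    ultimately show ?thesis by (rule teq_sym[OF teq_trans])
  qed
qed

end

lemma graphI:
  assumes A: "has \<Gamma> A (RGraph i)"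
  shows "graph i \<Gamma> (vert A) (Fst (Snd A)) (Snd (Snd A))"
proof -
  note A' = A[unfolded RGraph_def, simplified nf]
  show ?thesis unfolding graph_def vert_def
    by (simp only: nf, intro conjI) (assumption | rule A' tc | simp only: nf | rule refl)+
qed

lemma Hom_Disc:
  assumes A: "has \<Gamma> A (RGraph i)" and Y: "wty \<Gamma> Y"
  shows "tyeq \<Gamma> (HomT (vert A) (Fst (Snd A)) (Snd (Snd A)) Y) (Hom A (Disc Y))"
proof -
  note G = graphI[OF A]
  note w = graphD[OF G, unfolded vert_def] Y A[unfolded RGraph_def, simplified nf]
  let ?E = "Fst (Snd A)"
  have s: "wty \<Gamma> (Pi (Fst A) (\<up> Y))" by (rule arr_wty[OF w(1) Y])
  show ?thesis
    unfolding Hom_def HomT_def hom1T_def hom2T_def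
    apply (simp only: nf sub_Disc vert_def edge_def rfx_def)
    apply (rule tyeq_Sig[OF tyeq_Pi[OF tyeq_refl[OF w(1)]]])
     apply (rule disc_vert[unfolded vert_def])
     apply (assumption | rule w tc | simp only: nf | rule refl)+
    apply (rule tyeq_Sig)
     apply (rule tyeq_Pi[OF tyeq_refl tyeq_Pi[OF tyeq_refl tyeq_Pi[OF tyeq_refl disc_edge[unfolded edge_def]]]])
           apply (assumption | rule w tc | simp only: nf | rule refl)+
    apply (rule tyeq_Pi[OF tyeq_refl teqc_Eq[OF disc_edge[unfolded edge_def] teqc_refl teqcI[OF disc_rfx[unfolded rfx_def]]]])
           apply (assumption | rule w tc | simp only: nf | rule refl)+
    done
qed

section \<open>Composition of morphisms into discrete graphs\<close>

text \<open>
  The type of morphisms between two discrete graphs, again with the discrete graphs unfolded.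
\<close>

definition dm1T :: "tm \<Rightarrow> tm \<Rightarrow> tm \<Rightarrow> tm" where
  "dm1T X Y g0 = Pi X (Pi (wk 1 X) (Pi (Eq (wk 2 X) (Var 1) (Var 0)) (Eq (wk 3 Y) (App (wk 3 g0) (Var 2)) (App (wk 3 g0) (Var 1)))))"
definition dm2T :: "tm \<Rightarrow> tm \<Rightarrow> tm \<Rightarrow> tm \<Rightarrow> tm" where
  "dm2T X Y g0 g1 = Pi X (Eq (Eq (wk 1 Y) (App (wk 1 g0) (Var 0)) (App (wk 1 g0) (Var 0))) (App3 (wk 1 g1) (Var 0) (Var 0) (Refl (Var 0))) (Refl (App (wk 1 g0) (Var 0))))"
definition DMT :: "tm \<Rightarrow> tm \<Rightarrow> tm" where
  "DMT X Y = Sig (arr X Y) (Sig (dm1T (wk 1 X) (wk 1 Y) (Var 0)) (dm2T (wk 2 X) (wk 2 Y) (Var 1) (Var 0)))"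

lemmas dmd = dm1T_def dm2T_def DMT_def

definition dm1 :: "tm \<Rightarrow> tm \<Rightarrow> tm \<Rightarrow> tm" where
  "dm1 X Y h = Lam X (Lam (wk 1 X) (Lam (Eq (wk 2 X) (Var 1) (Var 0)) (ap (wk 3 X) (wk 3 Y) (wk 3 h) (Var 2) (Var 1) (Var 0))))"

context
  fixes \<Gamma> X Y h
  assumes X: "wty \<Gamma> X" and Y: "wty \<Gamma> Y" and h: "has \<Gamma> h (Pi X (\<up> Y))"
begin

lemmas XYh = wty_ctx'[OF X] wty_ctx[OF X] X Y h

lemma has_dm1: "has \<Gamma> (dm1 X Y h) (dm1T X Y h)"
  unfolding dm1_def dm1T_def apply (simp only: nf)
  by (assumption | rule XYh tc has_ap | simp only: nf | rule refl)+

lemma dm1_beta: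
  assumes x: "has \<Gamma> x X" and y: "has \<Gamma> y X" and e: "has \<Gamma> e (Eq X x y)"
  shows "teq \<Gamma> (App3 (dm1 X Y h) x y e) (ap X Y h x y e) (Eq Y (App h x) (App h y))"
proof -
  let ?\<Delta> = "Eq (wk 2 X) (Var 1) (Var 0) # wk 1 X # X # \<Gamma>"
  have g: "\<turnstile> ?\<Delta>" by (rule path_ctx[OF X])
  have b: "has ?\<Delta> (ap (wk 3 X) (wk 3 Y) (wk 3 h) (Var 2) (Var 1) (Var 0)) (Eq (wk 3 Y) (App (wk 3 h) (Var 2)) (App (wk 3 h) (Var 1)))"
    apply (insert g, simp only: nf)
    by (assumption | rule XYh tc has_ap | simp only: nf | rule refl)+
  show ?thesis unfolding dm1_def
    by (rule teq_beta3[OF b x]) (use y e in \<open>simp_all only: nf\<close>)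
qed

end

context
  fixes \<Gamma> X Y h
  assumes X: "wty \<Gamma> X" and Y: "wty \<Gamma> Y" and h: "has \<Gamma> h (Pi X (\<up> Y))"
begin

lemma disc_map:
  shows has_Disc_map: "has \<Gamma> (Disc_map X Y h) (DMT X Y)"
    and Disc_map_fst: "teq \<Gamma> (Fst (Disc_map X Y h)) h (Pi X (\<up> Y))"
    and Disc_map_snd: "teq \<Gamma> (Fst (Snd (Disc_map X Y h))) (dm1 X Y h) (dm1T X Y h)"
proof -
  have S: "wty \<Gamma> (DMT X Y)"
    apply (simp only: dmd nf)
    by (assumption | rule wty_ctx'[OF X] wty_ctx[OF X] X Y h tc has_ap | simp only: nf | rule refl)+
  have h': "has \<Gamma> h (arr X Y)" using h by (simp only: nf)
  have g1: "has \<Gamma> (dm1 X Y h) (sub (h ;; Var) (dm1T (wk 1 X) (wk 1 Y) (Var 0)))" using has_dm1[OF X Y h] by (simp only: nf dmd)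
  let ?w = "\<up>"
  have s: "is_subst \<Gamma> (shift (Suc 0)) (X # \<Gamma>)" by (rule is_subst_shift_1[OF wty_ctx[OF X]])
  have hx: "has (X # \<Gamma>) (App (?w h) (Var 0)) (?w Y)"
    by (assumption | rule wty_ctx'[OF X] wty_ctx[OF X] X Y h tc has_ap | simp only: nf | rule refl)+
  have v: "has (X # \<Gamma>) (Var 0) (?w X)" by (rule has_Var_0[OF wty_ctx[OF X]]) (simp only: nf)
  have hw: "has (X # \<Gamma>) (?w h) (Pi (?w X) (?w (?w Y)))" by (rule has_sub[OF h s]) (simp only: nf)
  have "teq (X # \<Gamma>) (App3 (dm1 (?w X) (?w Y) (?w h)) (Var 0) (Var 0) (Refl (Var 0))) (Refl (App (?w h) (Var 0))) (Eq (?w Y) (App (?w h) (Var 0)) (App (?w h) (Var 0)))"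
  proof (rule teq_trans)
    show "teq (X # \<Gamma>) (ap (?w X) (?w Y) (?w h) (Var 0) (Var 0) (Refl (Var 0))) (Refl (App (?w h) (Var 0))) (Eq (?w Y) (App (?w h) (Var 0)) (App (?w h) (Var 0)))"
      by (rule teq_ap_refl[OF wty_sub[OF Y s] hw v])
    show "teq (X # \<Gamma>) (App3 (dm1 (?w X) (?w Y) (?w h)) (Var 0) (Var 0) (Refl (Var 0))) (ap (?w X) (?w Y) (?w h) (Var 0) (Var 0) (Refl (Var 0))) (Eq (?w Y) (App (?w h) (Var 0)) (App (?w h) (Var 0)))"
      by (rule dm1_beta[OF wty_sub[OF X s] wty_sub[OF Y s] hw v v has_Refl[OF v]])
  qed
  then have e: "teq (X # \<Gamma>) (App3 (wk 1 (dm1 X Y h)) (Var 0) (Var 0) (Refl (Var 0))) (Refl (App (wk 1 h) (Var 0))) (Eq (wk 1 Y) (App (wk 1 h) (Var 0)) (App (wk 1 h) (Var 0)))"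
    by (simp only: nf dm1_def)
  have cv: "tyeq \<Gamma> (Pi X (Eq (Eq (wk 1 Y) (App (wk 1 h) (Var 0)) (App (wk 1 h) (Var 0))) (Refl (App (wk 1 h) (Var 0))) (Refl (App (wk 1 h) (Var 0))))) (dm2T X Y h (dm1 X Y h))"
    unfolding dm2T_def
    by (rule tyeq_Pi[OF tyeq_refl[OF X] tyeq_Eq[OF tyeq_refl[OF hasD[OF teqD(1)[OF e]]] teq_sym[OF e] teq_refl[OF teqD(2)[OF e]]]])
  have "has \<Gamma> (Lam X (Refl (Refl (App (wk 1 h) (Var 0))))) (Pi X (Eq (Eq (wk 1 Y) (App (wk 1 h) (Var 0)) (App (wk 1 h) (Var 0))) (Refl (App (wk 1 h) (Var 0))) (Refl (App (wk 1 h) (Var 0)))))"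
    by (rule has_Lam[OF X has_Refl[OF teqD(2)[OF e]]])
  from has_conv[OF this cv] have g2: "has \<Gamma> (Lam X (Refl (Refl (App (wk 1 h) (Var 0))))) (sub (dm1 X Y h ;; h ;; Var) (dm2T (wk 2 X) (wk 2 Y) (Var 1) (Var 0)))"
    by (simp only: nf dmd)
  have eq: "Disc_map X Y h = Pair h (Pair (dm1 X Y h) (Lam X (Refl (Refl (App (wk 1 h) (Var 0))))))"
    unfolding Disc_map_def dm1_def ..
  note T = triple[OF S[unfolded DMT_def] h' g1 g2, folded eq DMT_def]
  show "has \<Gamma> (Disc_map X Y h) (DMT X Y)" by (rule T(1))
  show "teq \<Gamma> (Fst (Disc_map X Y h)) h (Pi X (\<up> Y))" using T(2) by (simp only: nf)
  show "teq \<Gamma> (Fst (Snd (Disc_map X Y h))) (dm1 X Y h) (dm1T X Y h)" using T(3) by (simp only: nf dmd)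
qed

end

text \<open>
  The reflexivity datum of a composite mentions edges of discrete graphs, whose types are identity types
  only up to conversion.
\<close>

lemma comp_rfx:
  assumes X: "wty \<Gamma> X" and Y: "wty \<Gamma> Y" and g0: "has \<Gamma> g0 (Pi X (\<up> Y))" and g1: "has \<Gamma> g1 (dm1T X Y g0)" and g2: "has \<Gamma> g2 (dm2T X Y g0 g1)"
    and x: "has \<Gamma> x X" and a: "has \<Gamma> a (Eq X x x)" and s: "has \<Gamma> s (Eq (Eq X x x) a (Refl x))"
  shows "has \<Gamma> (concat_path (edge (Disc Y) (App g0 x) (App g0 x)) (App3 g1 x x a) (App3 g1 x x (rfx (Disc X) x)) (rfx (Disc Y) (App g0 x))
     (ap (edge (Disc X) x x) (edge (Disc Y) (App g0 x) (App g0 x)) (App2 g1 x x) a (rfx (Disc X) x) s) (App g2 x))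
     (Eq (Eq Y (App g0 x) (App g0 x)) (App3 g1 x x a) (Refl (App g0 x)))"
proof -
  note g1' = g1[simplified dmd nf] and g2' = g2[simplified dmd nf]
  note w = X Y g0 g1' g2' x a s has_ctx[OF x] wty_ctx[OF X]
  let ?y = "App g0 x"
  let ?E = "edge (Disc X) x x" and ?T = "edge (Disc Y) ?y ?y" and ?rX = "rfx (Disc X) x" and ?rY = "rfx (Disc Y) ?y"
  have y: "has \<Gamma> ?y Y" by (assumption | rule w tc | simp only: nf | rule refl)+
  note E = disc_edge[OF X x x] and T = disc_edge[OF Y y y] and rX = disc_rfx[OF X x] and rY = disc_rfx[OF Y y]
  note wE = tyeq_wty(2)[OF E] and wT = tyeq_wty(2)[OF T]
  have g1x: "has \<Gamma> (App2 g1 x x) (Pi (Eq X x x) (\<up> (Eq Y ?y ?y)))"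
    apply (simp only: nf)
    by (assumption | rule w tc | simp only: nf | rule refl)+
  have gE: "\<turnstile> Eq X x x # \<Gamma>" by (rule wty_ctx[OF hasD[OF a]])
  have g1c: "has \<Gamma> (App2 g1 x x) (Pi ?E (\<up> ?T))"
    by (rule has_conv[OF g1x tyeq_Pi[OF E tyeq_sub[OF T is_subst_shift_1[OF gE]]]])
  have aE: "has \<Gamma> a ?E" by (rule has_conv[OF a E])
  have rE: "has \<Gamma> ?rX ?E" by (rule has_conv[OF teqD(2)[OF rX] E])
  have sE: "has \<Gamma> s (Eq ?E a ?rX)" by (rule has_conv[OF s tyeq_Eq[OF E teq_refl[OF a] rX]])
  have A: "has \<Gamma> (ap ?E ?T (App2 g1 x x) a ?rX s) (Eq ?T (App3 g1 x x a) (App3 g1 x x ?rX))"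
    by (rule has_ap[OF wE wT chk_has[OF g1c refl] chk_has[OF aE refl] chk_has[OF rE refl] chk_has[OF sE refl] refl])
  have app: "has \<Gamma> (App3 g1 x x c) (Eq Y ?y ?y)" if "has \<Gamma> c (Eq X x x)" for c
    by (rule has_App[OF g1x refl chk_has[OF that refl]]) (simp only: nf)
  have appT: "has \<Gamma> (App3 g1 x x c) ?T" if "has \<Gamma> c (Eq X x x)" for c
    by (rule has_conv[OF app[OF that] T])
  have "teq \<Gamma> (App3 g1 x x (Refl x)) (App3 g1 x x ?rX) (Eq Y ?y ?y)"
    by (rule teq_App[OF teq_refl[OF g1x] refl rX]) (simp only: nf)
  note e2 = tyeq_Eq[OF T this rY]
  have "has \<Gamma> (App g2 x) (Eq (Eq Y ?y ?y) (App3 g1 x x (Refl x)) (Refl ?y))"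
    by (assumption | rule w tc | simp only: nf | rule refl)+
  note B = has_conv[OF this e2]
  have rT: "has \<Gamma> ?rY ?T" by (rule has_conv[OF teqD(2)[OF rY] T])
  have "has \<Gamma> (concat_path ?T (App3 g1 x x a) (App3 g1 x x ?rX) ?rY (ap ?E ?T (App2 g1 x x) a ?rX s) (App g2 x)) (Eq ?T (App3 g1 x x a) ?rY)"
    by (rule has_concat_path[OF wT chk_has[OF appT[OF a] refl] chk_has[OF appT[OF teqD(2)[OF rX]] refl] chk_has[OF rT refl] chk_has[OF A refl] chk_has[OF B refl] refl])
  from has_conv[OF this tyeq_sym[OF tyeq_Eq[OF T teq_refl[OF app[OF a]] rY]]] show ?thesis .
qed

text \<open>
  The three components of the composite with a map of discrete graphs, in terms of the components of its
  two factors.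
\<close>

definition comp0 :: "tm \<Rightarrow> tm \<Rightarrow> tm \<Rightarrow> tm" where
  "comp0 A f0 g0 = Lam A (App (wk 1 g0) (App (wk 1 f0) (Var 0)))"
definition comp1 :: "tm \<Rightarrow> tm \<Rightarrow> tm \<Rightarrow> tm \<Rightarrow> tm \<Rightarrow> tm" where
  "comp1 A E f0 f1 g1 = Lam A (Lam (wk 1 A) (Lam (App2 (wk 2 E) (Var 1) (Var 0))
     (App3 (wk 3 g1) (App (wk 3 f0) (Var 2)) (App (wk 3 f0) (Var 1)) (App3 (wk 3 f1) (Var 2) (Var 1) (Var 0)))))"
definition comp2 :: "tm \<Rightarrow> tm \<Rightarrow> tm \<Rightarrow> tm \<Rightarrow> tm \<Rightarrow> tm \<Rightarrow> tm \<Rightarrow> tm \<Rightarrow> tm \<Rightarrow> tm \<Rightarrow> tm" where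
  "comp2 A r X Y f0 f1 f2 g0 g1 g2 =
    (let x = App (wk 1 f0) (Var 0); y = App (wk 1 g0) x; a = App3 (wk 1 f1) (Var 0) (Var 0) (App (wk 1 r) (Var 0)); g1x = App2 (wk 1 g1) x x;
         E = edge (Disc (wk 1 X)) x x; T = edge (Disc (wk 1 Y)) y y; rX = rfx (Disc (wk 1 X)) x; rY = rfx (Disc (wk 1 Y)) y
     in Lam A (concat_path T (App g1x a) (App g1x rX) rY (ap E T g1x a rX (App (wk 1 f2) (Var 0))) (App (wk 1 g2) x)))"
lemmas compd = comp0_def comp1_def

context
  fixes i \<Gamma> A E r X Y f0 f1 g0 g1
  assumes G: "graph i \<Gamma> A E r" and X: "wty \<Gamma> X" and Y: "wty \<Gamma> Y"
    and f0: "has \<Gamma> f0 (Pi A (\<up> X))" and f1: "has \<Gamma> f1 (hom1T A E X f0)"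
    and g0: "has \<Gamma> g0 (Pi X (\<up> Y))" and g1: "has \<Gamma> g1 (dm1T X Y g0)"
begin

lemma comp1_spec:
  shows "has \<Gamma> (comp1 A E f0 f1 g1) (Pi A (Pi (wk 1 A) (Pi (App2 (wk 2 E) (Var 1) (Var 0))
     (Eq (wk 3 Y) (App (wk 3 g0) (App (wk 3 f0) (Var 2))) (App (wk 3 g0) (App (wk 3 f0) (Var 1)))))))"
    and "\<And>x y e. has \<Gamma> x A \<Longrightarrow> has \<Gamma> y A \<Longrightarrow> has \<Gamma> e (App2 E x y) \<Longrightarrow>
      teq \<Gamma> (App3 (comp1 A E f0 f1 g1) x y e) (App3 g1 (App f0 x) (App f0 y) (App3 f1 x y e)) (Eq Y (App g0 (App f0 x)) (App g0 (App f0 y)))"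
proof -
  note w = graphD[OF G] X Y f0 f1[simplified nfd gd] g0 g1[simplified dmd nf]
  let ?\<Delta> = "App2 (wk 2 E) (Var 1) (Var 0) # wk 1 A # A # \<Gamma>"
  have g: "\<turnstile> ?\<Delta>" apply (simp only: nf)
    by (assumption | rule w tc | simp only: nf | rule refl)+
  have b: "has ?\<Delta> (App3 (wk 3 g1) (App (wk 3 f0) (Var 2)) (App (wk 3 f0) (Var 1)) (App3 (wk 3 f1) (Var 2) (Var 1) (Var 0)))
     (Eq (wk 3 Y) (App (wk 3 g0) (App (wk 3 f0) (Var 2))) (App (wk 3 g0) (App (wk 3 f0) (Var 1))))"
    apply (insert g, simp only: nf)
    by (assumption | rule w tc | simp only: nf | rule refl)+
  note c = ctx_wty[OF g] ctx_wty[OF ctx_tail[OF g]] graphD(1)[OF G]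
  show "has \<Gamma> (comp1 A E f0 f1 g1) (Pi A (Pi (wk 1 A) (Pi (App2 (wk 2 E) (Var 1) (Var 0))
     (Eq (wk 3 Y) (App (wk 3 g0) (App (wk 3 f0) (Var 2))) (App (wk 3 g0) (App (wk 3 f0) (Var 1)))))))"
    unfolding comp1_def by (rule has_Lam[OF c(3) has_Lam[OF c(2) has_Lam[OF c(1) b]]])
  show "teq \<Gamma> (App3 (comp1 A E f0 f1 g1) x y e) (App3 g1 (App f0 x) (App f0 y) (App3 f1 x y e)) (Eq Y (App g0 (App f0 x)) (App g0 (App f0 y)))"
    if x: "has \<Gamma> x A" and y: "has \<Gamma> y A" and e: "has \<Gamma> e (App2 E x y)" for x y e
    unfolding comp1_def
    by (rule teq_beta3[OF b x]) (use y e in \<open>simp_all only: nf\<close>)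
qed

lemma comp0_body: "has (A # \<Gamma>) (App (wk 1 g0) (App (wk 1 f0) (Var 0))) (wk 1 Y)"
  apply (simp only: nf)
  by (assumption | rule graphD[OF G] X Y f0 g0 tc | simp only: nf | rule refl)+

lemma has_comp0: "has \<Gamma> (comp0 A f0 g0) (Pi A (wk 1 Y))"
  unfolding comp0_def by (rule has_Lam[OF graphD(1)[OF G] comp0_body])

lemma comp0_beta:
  assumes s: "is_subst \<Gamma> \<sigma> \<Delta>" and x: "has \<Delta> x (sub \<sigma> A)"
  shows "teq \<Delta> (App (sub \<sigma> (comp0 A f0 g0)) x) (App (sub \<sigma> g0) (App (sub \<sigma> f0) x)) (sub \<sigma> Y)"
proof -
  have "is_subst (A # \<Gamma>) (x ;; \<sigma>) \<Delta>" by (rule is_subst_cons[OF s graphD(5)[OF G] refl chk_has[OF x refl]])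
  from teq_sub[OF teq_wk_beta[OF graphD(1)[OF G] comp0_body] this refl] show ?thesis
    by (simp only: nf comp0_def)
qed

lemma has_comp1: "has \<Gamma> (comp1 A E f0 f1 g1) (hom1T A E Y (comp0 A f0 g0))"
proof -
  let ?\<Delta> = "App2 (wk 2 E) (Var 1) (Var 0) # wk 1 A # A # \<Gamma>"
  note w = graphD[OF G] X Y f0 f1[simplified nfd gd] g0 g1[simplified dmd nf]
  have g: "\<turnstile> ?\<Delta>" apply (simp only: nf)
    by (assumption | rule w tc | simp only: nf | rule refl)+
  note c = ctx_wty[OF g] ctx_wty[OF ctx_tail[OF g]] graphD(1)[OF G]
  have s: "is_subst \<Gamma> (shift 3) ?\<Delta>" using is_subst_shift_3[OF g] by (simp only: nums)
  have v: "has ?\<Delta> (Var 2) (sub (shift 3) A)" "has ?\<Delta> (Var 1) (sub (shift 3) A)"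
    by (insert g, simp_all only: nf) (assumption | rule w tc | simp only: nf | rule refl)+
  have "tyeq ?\<Delta> (Eq (wk 3 Y) (App (wk 3 g0) (App (wk 3 f0) (Var 2))) (App (wk 3 g0) (App (wk 3 f0) (Var 1)))) (Eq (wk 3 Y) (App (wk 3 (comp0 A f0 g0)) (Var 2)) (App (wk 3 (comp0 A f0 g0)) (Var 1)))"
    unfolding wk_sub[of 3]
    by (rule tyeq_Eq[OF tyeq_refl[OF wty_sub[OF Y s]] teq_sym[OF comp0_beta[OF s v(1)]] teq_sym[OF comp0_beta[OF s v(2)]]])
  from has_conv[OF comp1_spec(1) tyeq_Pi[OF tyeq_refl[OF c(3)] tyeq_Pi[OF tyeq_refl[OF c(2)] tyeq_Pi[OF tyeq_refl[OF c(1)] this]]]]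
  show ?thesis unfolding hom1T_def .
qed

end

lemma has_comp2:
  assumes G: "graph i \<Gamma> A E r" and X: "wty \<Gamma> X" and Y: "wty \<Gamma> Y"
    and f0: "has \<Gamma> f0 (Pi A (\<up> X))" and f1: "has \<Gamma> f1 (hom1T A E X f0)" and f2: "has \<Gamma> f2 (hom2T A r X f0 f1)"
    and g0: "has \<Gamma> g0 (Pi X (\<up> Y))" and g1: "has \<Gamma> g1 (dm1T X Y g0)" and g2: "has \<Gamma> g2 (dm2T X Y g0 g1)"
  shows "has \<Gamma> (comp2 A r X Y f0 f1 f2 g0 g1 g2) (hom2T A r Y (comp0 A f0 g0) (comp1 A E f0 f1 g1))"
proof -
  let ?w = "\<up>"
  have s: "is_subst \<Gamma> (shift (Suc 0)) (A # \<Gamma>)" by (rule is_subst_shift_1[OF graphD(5)[OF G]])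
  note GA = graph_sub[OF G s] and XA = wty_sub[OF X s] and YA = wty_sub[OF Y s]
  note w = graphD[OF G] X Y f0 f1[simplified nfd gd] f2[simplified nfd gd]
  have f0A: "has (A # \<Gamma>) (?w f0) (Pi (?w A) (?w (?w X)))" by (rule has_sub[OF f0 s]) (simp only: nf)
  have f1A: "has (A # \<Gamma>) (?w f1) (hom1T (?w A) (?w E) (?w X) (?w f0))" by (rule has_sub[OF f1 s]) (simp only: nf gd)
  have g0A: "has (A # \<Gamma>) (?w g0) (Pi (?w X) (?w (?w Y)))" by (rule has_sub[OF g0 s]) (simp only: nf)
  have g1A: "has (A # \<Gamma>) (?w g1) (dm1T (?w X) (?w Y) (?w g0))" by (rule has_sub[OF g1 s]) (simp only: nf dmd)
  have g2A: "has (A # \<Gamma>) (?w g2) (dm2T (?w X) (?w Y) (?w g0) (?w g1))" by (rule has_sub[OF g2 s]) (simp only: nf dmd)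
  let ?x = "App (?w f0) (Var 0)" and ?rv = "App (?w r) (Var 0)"
  let ?a = "App3 (?w f1) (Var 0) (Var 0) ?rv"
  have x: "has (A # \<Gamma>) ?x (?w X)" and a: "has (A # \<Gamma>) ?a (Eq (?w X) ?x ?x)"
    and sx: "has (A # \<Gamma>) (App (?w f2) (Var 0)) (Eq (Eq (?w X) ?x ?x) ?a (Refl ?x))"
    and v: "has (A # \<Gamma>) (Var 0) (?w A)" and rv: "has (A # \<Gamma>) ?rv (App2 (?w E) (Var 0) (Var 0))"
    by (assumption | rule w tc | simp only: nf | rule refl)+
  let ?y = "App (?w g0) ?x"
  have y: "has (A # \<Gamma>) ?y (?w Y)" using comp0_body[OF G X Y f0 f1 g0 g1] by (simp only: nf)
  note body = comp_rfx[OF XA YA g0A g1A g2A x a sx]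
  have 1: "teq (A # \<Gamma>) (App (?w (comp0 A f0 g0)) (Var 0)) ?y (?w Y)" by (rule comp0_beta[OF G X Y f0 f1 g0 g1 s v])
  have "teq (A # \<Gamma>) (App3 (comp1 (?w A) (?w E) (?w f0) (?w f1) (?w g1)) (Var 0) (Var 0) ?rv) (App3 (?w g1) ?x ?x ?a) (Eq (?w Y) ?y ?y)"
    by (rule comp1_spec(2)[OF GA XA YA f0A f1A g0A g1A v v rv])
  then have 2: "teq (A # \<Gamma>) (App3 (?w (comp1 A E f0 f1 g1)) (Var 0) (Var 0) ?rv) (App3 (?w g1) ?x ?x ?a) (Eq (?w Y) ?y ?y)"
    by (simp only: nf compd)
  have "tyeq (A # \<Gamma>) (Eq (Eq (?w Y) ?y ?y) (App3 (?w g1) ?x ?x ?a) (Refl ?y))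
     (Eq (Eq (?w Y) (App (?w (comp0 A f0 g0)) (Var 0)) (App (?w (comp0 A f0 g0)) (Var 0))) (App3 (?w (comp1 A E f0 f1 g1)) (Var 0) (Var 0) ?rv) (Refl (App (?w (comp0 A f0 g0)) (Var 0))))"
    by (rule tyeq_Eq[OF tyeq_Eq[OF tyeq_refl[OF YA] teq_sym[OF 1] teq_sym[OF 1]] teq_sym[OF 2] teq_Refl[OF teq_sym[OF 1]]])
  from has_Lam[OF graphD(1)[OF G] has_conv[OF body this]]
  show ?thesis unfolding comp2_def hom2T_def Let_def wk_sub One_nat_def .
qed

lemma teq_ap:
  assumes X: "wty \<Gamma> X" and Y: "wty \<Gamma> Y" and h: "has \<Gamma> h (Pi X (\<up> Y))"
    and a: "teq \<Gamma> a a' X" and b: "teq \<Gamma> b b' X" and p: "teq \<Gamma> p p' (Eq X a b)"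
  shows "teq \<Gamma> (ap X Y h a b p) (ap X Y h a' b' p') (Eq Y (App h a) (App h b))"
proof -
  have g: "\<turnstile> Eq (wk 2 X) (Var 1) (Var 0) # wk 1 X # X # \<Gamma>" by (rule path_ctx[OF X])
  have t: "has (Eq (wk 2 X) (Var 1) (Var 0) # wk 1 X # X # \<Gamma>) (ap (wk 3 X) (wk 3 Y) (wk 3 h) (Var 2) (Var 1) (Var 0)) (Eq (wk 3 Y) (App (wk 3 h) (Var 2)) (App (wk 3 h) (Var 1)))"
    apply (insert g, simp only: nf)
    by (assumption | rule X Y h tc has_ap | simp only: nf | rule refl)+
  have "substeq (Eq (wk 2 X) (Var 1) (Var 0) # wk 1 X # X # \<Gamma>) (p ;; b ;; a ;; Var) (p' ;; b' ;; a' ;; Var) \<Gamma>"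
    apply (insert g, simp only: nf)
    by (assumption | rule substeqc_cons substeq_refl a[THEN teqcI] b[THEN teqcI] p[THEN teqcI] X Y wty_ctx'[OF X] tc | simp only: nf | rule refl)+
  from functional[OF this t refl] show ?thesis by (simp only: nf)
qed

lemma hom_proj:
  assumes f: "has \<Gamma> f (HomT A E r Y)"
  shows "has \<Gamma> (Fst f) (Pi A (\<up> Y))" "has \<Gamma> (Fst (Snd f)) (hom1T A E Y (Fst f))" "has \<Gamma> (Snd (Snd f)) (hom2T A r Y (Fst f) (Fst (Snd f)))"
  by (insert f[simplified gd nf], simp_all only: gd nf) (assumption | rule tc | simp only: nf)+

lemma dm_proj:
  assumes f: "has \<Gamma> g (DMT X Y)"
  shows "has \<Gamma> (Fst g) (Pi X (\<up> Y))" "has \<Gamma> (Fst (Snd g)) (dm1T X Y (Fst g))" "has \<Gamma> (Snd (Snd g)) (dm2T X Y (Fst g) (Fst (Snd g)))"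
  by (insert f[simplified dmd nf], simp_all only: dmd nf) (assumption | rule tc | simp only: nf)+

lemma hom_comp:
  assumes A: "has \<Gamma> A (RGraph i)" and X: "wty \<Gamma> X" and Y: "wty \<Gamma> Y"
    and f: "has \<Gamma> f (HomT (vert A) (Fst (Snd A)) (Snd (Snd A)) X)" and g: "has \<Gamma> g (DMT X Y)"
  shows has_hom_comp: "has \<Gamma> (hom_comp A (Disc X) (Disc Y) g f) (HomT (vert A) (Fst (Snd A)) (Snd (Snd A)) Y)"
    and hom_comp_fst: "teq \<Gamma> (Fst (hom_comp A (Disc X) (Disc Y) g f)) (comp0 (vert A) (Fst f) (Fst g)) (Pi (vert A) (\<up> Y))"
    and hom_comp_snd: "teq \<Gamma> (Fst (Snd (hom_comp A (Disc X) (Disc Y) g f))) (comp1 (vert A) (Fst (Snd A)) (Fst f) (Fst (Snd f)) (Fst (Snd g)))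
       (hom1T (vert A) (Fst (Snd A)) Y (comp0 (vert A) (Fst f) (Fst g)))"
proof -
  let ?A = "vert A" and ?E = "Fst (Snd A)" and ?r = "Snd (Snd A)"
  note G = graphI[OF A]
  note fp = hom_proj[OF f] and gp = dm_proj[OF g]
  have S: "wty \<Gamma> (HomT ?A ?E ?r Y)"
    by (rule tyeq_wty(1)[OF Hom_Disc[OF A Y]])
  have 0: "has \<Gamma> (comp0 ?A (Fst f) (Fst g)) (arr ?A Y)"
    using has_comp0[OF G X Y fp(1,2) gp(1,2)] by (simp only: nf)
  have 1: "has \<Gamma> (comp1 ?A ?E (Fst f) (Fst (Snd f)) (Fst (Snd g))) (sub (comp0 ?A (Fst f) (Fst g) ;; Var) (hom1T (wk 1 ?A) (wk 1 ?E) (wk 1 Y) (Var 0)))"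
    using has_comp1[OF G X Y fp(1,2) gp(1,2)] by (simp only: nf gd)
  have 2: "has \<Gamma> (comp2 ?A ?r X Y (Fst f) (Fst (Snd f)) (Snd (Snd f)) (Fst g) (Fst (Snd g)) (Snd (Snd g)))
     (sub (comp1 ?A ?E (Fst f) (Fst (Snd f)) (Fst (Snd g)) ;; comp0 ?A (Fst f) (Fst g) ;; Var) (hom2T (wk 2 ?A) (wk 2 ?r) (wk 2 Y) (Var 1) (Var 0)))"
    using has_comp2[OF G X Y fp gp] by (simp only: nf gd)
  have eq: "hom_comp A (Disc X) (Disc Y) g f = Pair (comp0 ?A (Fst f) (Fst g)) (Pair (comp1 ?A ?E (Fst f) (Fst (Snd f)) (Fst (Snd g)))
     (comp2 ?A ?r X Y (Fst f) (Fst (Snd f)) (Snd (Snd f)) (Fst g) (Fst (Snd g)) (Snd (Snd g))))"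
    unfolding hom_comp_def hom_comp_rfx_def comp0_def comp1_def comp2_def Let_def on_vert_def on_edge_def on_rfx_def vert_def rfx_def edge_def
    by (simp only: nf sub_Disc)
  note T = triple[OF S[unfolded HomT_def] 0 1 2, folded eq HomT_def]
  show "has \<Gamma> (hom_comp A (Disc X) (Disc Y) g f) (HomT (vert A) (Fst (Snd A)) (Snd (Snd A)) Y)" by (rule T(1))
  show "teq \<Gamma> (Fst (hom_comp A (Disc X) (Disc Y) g f)) (comp0 (vert A) (Fst f) (Fst g)) (Pi (vert A) (\<up> Y))"
    using T(2) by (simp only: nf)
  show "teq \<Gamma> (Fst (Snd (hom_comp A (Disc X) (Disc Y) g f))) (comp1 (vert A) (Fst (Snd A)) (Fst f) (Fst (Snd f)) (Fst (Snd g)))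
       (hom1T (vert A) (Fst (Snd A)) Y (comp0 (vert A) (Fst f) (Fst g)))"
    using T(3) by (simp only: nf gd)
qed

text \<open>
  The cocone that a morphism \<open>f\<close> into the discrete graph on \<open>X\<close> and a map \<open>h : X \<rightarrow> Y\<close> induce on \<open>Y\<close>. It is
  the common normal form of the two maps to be compared.
\<close>

definition comp_coc_path :: "tm \<Rightarrow> tm \<Rightarrow> tm \<Rightarrow> tm \<Rightarrow> tm \<Rightarrow> tm \<Rightarrow> tm \<Rightarrow> tm" where
  "comp_coc_path A E X Y h f0 f1 = Lam (edgesT A E) (ap (wk 1 X) (wk 1 Y) (wk 1 h) (App (wk 1 f0) (Fst (Var 0))) (App (wk 1 f0) (Fst (Snd (Var 0))))
     (App3 (wk 1 f1) (Fst (Var 0)) (Fst (Snd (Var 0))) (Snd (Snd (Var 0)))))"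
definition comp_coc :: "tm \<Rightarrow> tm \<Rightarrow> tm \<Rightarrow> tm \<Rightarrow> tm \<Rightarrow> tm \<Rightarrow> tm" where
  "comp_coc A E X Y h f = Pair (comp0 A (Fst f) h) (Pair (comp0 A (Fst f) h) (comp_coc_path A E X Y h (Fst f) (Fst (Snd f))))"

text \<open>
  Restricting after composing. The reflexivity datum of the composite, its only complicated component,
  is forgotten by the restriction, so that this holds judgmentally.
\<close>

lemma coc_of_hom_comp:
  assumes A: "has \<Gamma> A (RGraph i)" and X: "wty \<Gamma> X" and Y: "wty \<Gamma> Y"
    and f: "has \<Gamma> f (HomT (vert A) (Fst (Snd A)) (Snd (Snd A)) X)" and h: "has \<Gamma> h (Pi X (\<up> Y))"
  shows "teq \<Gamma> (comp_coc (vert A) (Fst (Snd A)) X Y h f) (coc_of_hom (vert A) (Fst (Snd A)) (hom_comp A (Disc X) (Disc Y) (Disc_map X Y h) f)) (CocT (vert A) (Fst (Snd A)) Y)"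
proof -
  let ?A = "vert A" and ?E = "Fst (Snd A)" and ?r = "Snd (Snd A)" and ?g = "Disc_map X Y h"
  let ?hc = "hom_comp A (Disc X) (Disc Y) ?g f" and ?S = "edgesT (vert A) (Fst (Snd A))"
  let ?f0 = "Fst f" and ?f1 = "Fst (Snd f)" and ?g0 = "Fst ?g" and ?g1 = "Fst (Snd ?g)"
  note G = graphI[OF A]
  note g = has_Disc_map[OF X Y h] Disc_map_fst[OF X Y h] Disc_map_snd[OF X Y h]
  note fp = hom_proj[OF f] and gp = dm_proj[OF g(1)]
  note hc = hom_comp[OF A X Y f g(1)]
  note d1 = has_dm1[OF X Y h]
  have S: "wty \<Gamma> ?S" by (rule wty_PiD[OF coc2T_wty[OF G X fp(1) fp(1), unfolded coc2T_def]])
  note gS = wty_ctx[OF S]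
  have s: "is_subst \<Gamma> (shift (Suc 0)) (?S # \<Gamma>)" by (rule is_subst_shift_1[OF gS])
  let ?w = "\<up>"
  have v: "has (?S # \<Gamma>) (Var 0) (Sig (?w ?A) (Sig (sub (shift (Suc (Suc 0))) ?A) (App2 (sub (shift (Suc (Suc (Suc 0)))) ?E) (Var (Suc 0)) (Var 0))))"
    by (rule has_Var_0[OF gS]) (simp only: nf gd)
  have pr: "has (?S # \<Gamma>) (Fst (Var 0)) (?w ?A)" "has (?S # \<Gamma>) (Fst (Snd (Var 0))) (?w ?A)"
    "has (?S # \<Gamma>) (Snd (Snd (Var 0))) (App2 (?w ?E) (Fst (Var 0)) (Fst (Snd (Var 0))))"
    by (assumption | rule v tc | simp only: nf | rule refl)+
  note GS = graph_sub[OF G s] and XS = wty_sub[OF X s] and YS = wty_sub[OF Y s]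
  have f0S: "has (?S # \<Gamma>) (?w ?f0) (Pi (?w ?A) (?w (?w X)))" by (rule has_sub[OF fp(1) s]) (simp only: nf)
  have f1S: "has (?S # \<Gamma>) (?w ?f1) (hom1T (?w ?A) (?w ?E) (?w X) (?w ?f0))" by (rule has_sub[OF fp(2) s]) (simp only: nf gd)
  have g0S: "has (?S # \<Gamma>) (?w ?g0) (Pi (?w X) (?w (?w Y)))" by (rule has_sub[OF gp(1) s]) (simp only: nf)
  have g1S: "has (?S # \<Gamma>) (?w ?g1) (dm1T (?w X) (?w Y) (?w ?g0))" by (rule has_sub[OF gp(2) s]) (simp only: nf dmd)
  have hS: "has (?S # \<Gamma>) (?w h) (Pi (?w X) (?w (?w Y)))" by (rule has_sub[OF h s]) (simp only: nf)
  have e0S: "teq (?S # \<Gamma>) (?w ?g0) (?w h) (Pi (?w X) (?w (?w Y)))" by (rule teq_sub[OF g(2) s]) (simp only: nf)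
  have e1S: "teq (?S # \<Gamma>) (?w ?g1) (dm1 (?w X) (?w Y) (?w h)) (dm1T (?w X) (?w Y) (?w h))"
    using teq_sub[OF g(3) s refl] by (simp only: nf dmd dm1_def)
  let ?x = "App (?w ?f0) (Fst (Var 0))" and ?y = "App (?w ?f0) (Fst (Snd (Var 0)))"
  let ?e = "App3 (?w ?f1) (Fst (Var 0)) (Fst (Snd (Var 0))) (Snd (Snd (Var 0)))"
  have x: "has (?S # \<Gamma>) ?x (?w X)" "has (?S # \<Gamma>) ?y (?w X)" and e: "has (?S # \<Gamma>) ?e (Eq (?w X) ?x ?y)"
    by (simp_all only: nf) (assumption | rule f0S[simplified nf] f1S[simplified hom1T_def nf] pr[simplified nf] tc | simp only: nf | rule refl)+
  let ?T = "\<lambda>a b. Eq (?w Y) a b"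
  let ?hx = "App (?w h) ?x" and ?hy = "App (?w h) ?y"
  have gx: "teq (?S # \<Gamma>) (App (?w ?g0) z) (App (?w h) z) (?w Y)" if "has (?S # \<Gamma>) z (?w X)" for z
    by (rule teq_App[OF e0S refl teq_refl[OF that]]) (simp only: nf)
  have cx: "teq (?S # \<Gamma>) (App (?w (comp0 ?A ?f0 ?g0)) z) (App (?w h) (App (?w ?f0) z)) (?w Y)" if z: "has (?S # \<Gamma>) z (?w ?A)" for z
  proof -
    have "has (?S # \<Gamma>) (App (?w ?f0) z) (?w X)" by (rule has_App[OF f0S refl chk_has[OF z refl]]) (simp only: nf)
    then show ?thesis by (rule teq_trans[OF comp0_beta[OF G X Y fp(1,2) gp(1,2) s z] gx])
  qed
  have cx': "teq (?S # \<Gamma>) (App (?w (comp0 ?A ?f0 h)) z) (App (?w h) (App (?w ?f0) z)) (?w Y)" if z: "has (?S # \<Gamma>) z (?w ?A)" for z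
    by (rule comp0_beta[OF G X Y fp(1,2) h d1 s z])
  have "teq (?S # \<Gamma>) (?w (Fst (Snd ?hc))) (?w (comp1 ?A ?E ?f0 ?f1 ?g1)) (?w (hom1T ?A ?E Y (comp0 ?A ?f0 ?g0)))" by (rule teq_sub[OF hc(3) s refl])
  then have 1: "teq (?S # \<Gamma>) (App3 (?w (Fst (Snd ?hc))) (Fst (Var 0)) (Fst (Snd (Var 0))) (Snd (Snd (Var 0))))
      (App3 (?w (comp1 ?A ?E ?f0 ?f1 ?g1)) (Fst (Var 0)) (Fst (Snd (Var 0))) (Snd (Snd (Var 0))))
      (?T (App (?w (comp0 ?A ?f0 ?g0)) (Fst (Var 0))) (App (?w (comp0 ?A ?f0 ?g0)) (Fst (Snd (Var 0)))))"
    apply (simp only: hom1T_def nf)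
    apply (rule teqc_App, rule teqc_App, rule teqc_App, assumption)
    by (assumption | rule teqc_refl pr[simplified nf] tc | simp only: nf | rule refl)+
  have cv1: "tyeq (?S # \<Gamma>) (?T (App (?w (comp0 ?A ?f0 ?g0)) (Fst (Var 0))) (App (?w (comp0 ?A ?f0 ?g0)) (Fst (Snd (Var 0))))) (?T ?hx ?hy)"
    by (rule tyeq_Eq[OF tyeq_refl[OF YS] cx[OF pr(1)] cx[OF pr(2)]])
  have cv2: "tyeq (?S # \<Gamma>) (?T (App (?w ?g0) ?x) (App (?w ?g0) ?y)) (?T ?hx ?hy)"
    by (rule tyeq_Eq[OF tyeq_refl[OF YS] gx[OF x(1)] gx[OF x(2)]])
  have cv3: "tyeq (?S # \<Gamma>) (?T ?hx ?hy) (?T (App (?w (comp0 ?A ?f0 h)) (Fst (Var 0))) (App (?w (comp0 ?A ?f0 h)) (Fst (Snd (Var 0)))))"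
    by (rule tyeq_sym[OF tyeq_Eq[OF tyeq_refl[OF YS] cx'[OF pr(1)] cx'[OF pr(2)]]])
  have "teq (?S # \<Gamma>) (App3 (comp1 (?w ?A) (?w ?E) (?w ?f0) (?w ?f1) (?w ?g1)) (Fst (Var 0)) (Fst (Snd (Var 0))) (Snd (Snd (Var 0)))) (App3 (?w ?g1) ?x ?y ?e) (?T (App (?w ?g0) ?x) (App (?w ?g0) ?y))"
    by (rule comp1_spec(2)[OF GS XS YS f0S f1S g0S g1S pr])
  then have 2: "teq (?S # \<Gamma>) (App3 (?w (comp1 ?A ?E ?f0 ?f1 ?g1)) (Fst (Var 0)) (Fst (Snd (Var 0))) (Snd (Snd (Var 0)))) (App3 (?w ?g1) ?x ?y ?e) (?T (App (?w ?g0) ?x) (App (?w ?g0) ?y))"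
    by (simp only: nf compd)
  have 3: "teq (?S # \<Gamma>) (App3 (?w ?g1) ?x ?y ?e) (App3 (dm1 (?w X) (?w Y) (?w h)) ?x ?y ?e) (?T ?hx ?hy)"
    apply (insert e1S, simp only: dm1T_def nf)
    apply (rule teqc_App, rule teqc_App, rule teqc_App, assumption)
    by (assumption | rule teqc_refl x[simplified nf] e[simplified nf] tc | simp only: nf | rule refl)+
  note 4 = dm1_beta[OF XS YS hS x e]
  note body = teq_trans[OF teq_conv[OF 1 cv1] teq_trans[OF teq_conv[OF 2 cv2] teq_trans[OF 3 4]]]
  have c3: "teq \<Gamma> (comp_coc_path ?A ?E X Y h ?f0 ?f1) (coc_path ?A ?E (Fst (Snd ?hc))) (coc2T ?A ?E Y (comp0 ?A ?f0 h) (comp0 ?A ?f0 h))"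
    unfolding comp_coc_path_def coc_path_def coc2T_def wk_sub One_nat_def
    by (rule teq_Lam[OF S teq_conv[OF teq_sym[OF body] cv3]])
  have gA: "\<turnstile> vert A # \<Gamma>" by (rule graphD(5)[OF G])
  have fx: "has (vert A # \<Gamma>) (App (?w ?f0) (Var 0)) (?w X)"
    by (rule has_App[OF has_sub[OF fp(1) is_subst_shift_1[OF gA] sub.simps(3)] refl chk_has[OF has_Var_0[OF gA refl]]]) (simp_all only: nf)
  have "teq (vert A # \<Gamma>) (App (?w h) (App (?w ?f0) (Var 0))) (App (?w ?g0) (App (?w ?f0) (Var 0))) (?w Y)"
    by (rule teq_App[OF teq_sub[OF teq_sym[OF g(2)] is_subst_shift_1[OF gA] sub.simps(3)] refl teq_refl[OF fx]]) (simp only: nf)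
  from teq_Lam[OF graphD(1)[OF G] this] have "teq \<Gamma> (comp0 ?A ?f0 h) (comp0 ?A ?f0 ?g0) (Pi ?A (?w Y))"
    unfolding comp0_def wk_sub One_nat_def .
  from teq_trans[OF this teq_sym[OF hc(2)]] have c1: "teq \<Gamma> (comp0 ?A ?f0 h) (Fst ?hc) (Pi ?A (?w Y))" .
  have cw: "wty \<Gamma> (CocT ?A ?E Y)" by (rule CocT_wty[OF G Y])
  have "teqc \<Gamma> (comp_coc ?A ?E X Y h f) (coc_of_hom ?A ?E ?hc) (CocT ?A ?E Y)"
    unfolding coc_of_hom_def comp_coc_def CocT_def
    apply (rule teqc_Pair[OF teqcI[OF c1]], simp only: nf, simp only: sub.simps inst_def)
    apply (rule teqc_Pair[OF teqcI[OF c1]], simp only: nf, rule refl)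
    apply (rule teqcI[OF c3], simp only: nf gd)
    done
  then show ?thesis using cw by (rule teqcD)
qed

lemma Cocone_CocT:
  assumes A: "has \<Gamma> A (RGraph i)" and Y: "wty \<Gamma> Y"
  shows "tyeq \<Gamma> (CocT (vert A) (Fst (Snd A)) Y) (Cocone (total_edges A) (vert A) (vert A) (edge_src A) (edge_tgt A) Y)"
proof -
  note w = graphD[OF graphI[OF A], unfolded vert_def] Y A[unfolded RGraph_def, simplified nf]
  show ?thesis
    unfolding Cocone_def CocT_def coc2T_def edgesT_def total_edges_def edge_src_def edge_tgt_def
    apply (simp only: nf vert_def edge_def)
    apply (rule tyeq_Sig[OF tyeq_refl])
     apply (assumption | rule w tc | simp only: nf | rule refl)+
    apply (rule tyeq_Sig[OF tyeq_refl])
     apply (assumption | rule w tc | simp only: nf | rule refl)+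
    apply (rule tyeq_Pi[OF tyeq_refl])
     apply (assumption | rule w tc | simp only: nf | rule refl)+
    apply (rule tyeq_Eq[OF tyeq_refl teq_sym[OF teq_beta_step] teq_sym[OF teq_beta_step]])
                 apply (assumption | rule w ec tc | simp only: nf | rule refl)+
    done
qed

section \<open>Reflexive coequalizers and pushout squares\<close>

text \<open>
  The comparison map of the square, as it appears in the definition of pushout squares.
\<close>

definition square_coc :: "tm \<Rightarrow> tm \<Rightarrow> tm \<Rightarrow> tm \<Rightarrow> tm \<Rightarrow> tm" where
  "square_coc A X Y h f = Pair (compose (vert A) h (Fst f)) (Pair (compose (vert A) h (Fst f))
     (Lam (total_edges A) (ap (wk 1 X) (wk 1 Y) (wk 1 h) (App (wk 1 (Fst f)) (App (wk 1 (edge_src A)) (Var 0)))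
        (App (wk 1 (Fst f)) (App (wk 1 (edge_tgt A)) (Var 0))) (App (wk 1 (edge_htpy A f)) (Var 0)))))"

lemma comp_coc_square:
  assumes A: "has \<Gamma> A (RGraph i)" and X: "wty \<Gamma> X" and Y: "wty \<Gamma> Y"
    and f: "has \<Gamma> f (HomT (vert A) (Fst (Snd A)) (Snd (Snd A)) X)" and h: "has \<Gamma> h (Pi X (\<up> Y))"
  shows "teq \<Gamma> (comp_coc (vert A) (Fst (Snd A)) X Y h f) (square_coc A X Y h f) (CocT (vert A) (Fst (Snd A)) Y)"
proof -
  let ?A = "vert A" and ?E = "Fst (Snd A)" and ?r = "Snd (Snd A)" and ?S = "edgesT (vert A) (Fst (Snd A))"
  let ?f0 = "Fst f" and ?f1 = "Fst (Snd f)"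
  note G = graphI[OF A]
  note fp = hom_proj[OF f]
  note d1 = has_dm1[OF X Y h]
  have S: "wty \<Gamma> ?S" by (rule wty_PiD[OF coc2T_wty[OF G X fp(1) fp(1), unfolded coc2T_def]])
  note gS = wty_ctx[OF S]
  have s: "is_subst \<Gamma> (shift (Suc 0)) (?S # \<Gamma>)" by (rule is_subst_shift_1[OF gS])
  let ?w = "\<up>"
  have v: "has (?S # \<Gamma>) (Var 0) (Sig (?w ?A) (Sig (sub (shift (Suc (Suc 0))) ?A) (App2 (sub (shift (Suc (Suc (Suc 0)))) ?E) (Var (Suc 0)) (Var 0))))"
    by (rule has_Var_0[OF gS]) (simp only: nf gd)
  have pr: "has (?S # \<Gamma>) (Fst (Var 0)) (?w ?A)" "has (?S # \<Gamma>) (Fst (Snd (Var 0))) (?w ?A)"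
    "has (?S # \<Gamma>) (Snd (Snd (Var 0))) (App2 (?w ?E) (Fst (Var 0)) (Fst (Snd (Var 0))))"
    by (assumption | rule v tc | simp only: nf | rule refl)+
  note XS = wty_sub[OF X s] and YS = wty_sub[OF Y s]
  have f0S: "has (?S # \<Gamma>) (?w ?f0) (Pi (?w ?A) (?w (?w X)))" by (rule has_sub[OF fp(1) s]) (simp only: nf)
  have f1S: "has (?S # \<Gamma>) (?w ?f1) (hom1T (?w ?A) (?w ?E) (?w X) (?w ?f0))" by (rule has_sub[OF fp(2) s]) (simp only: nf gd)
  have hS: "has (?S # \<Gamma>) (?w h) (Pi (?w X) (?w (?w Y)))" by (rule has_sub[OF h s]) (simp only: nf)
  let ?e = "App3 (?w ?f1) (Fst (Var 0)) (Fst (Snd (Var 0))) (Snd (Snd (Var 0)))"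
  have e: "has (?S # \<Gamma>) ?e (Eq (?w X) (App (?w ?f0) (Fst (Var 0))) (App (?w ?f0) (Fst (Snd (Var 0)))))"
    by (simp_all only: nf) (assumption | rule f0S[simplified nf] f1S[simplified hom1T_def nf] pr[simplified nf] tc | simp only: nf | rule refl)+
  have cx: "teq (?S # \<Gamma>) (App (?w (comp0 ?A ?f0 h)) z) (App (?w h) (App (?w ?f0) z)) (?w Y)" if z: "has (?S # \<Gamma>) z (?w ?A)" for z
    by (rule comp0_beta[OF G X Y fp(1,2) h d1 s z])
  have cv: "tyeq (?S # \<Gamma>) (Eq (?w Y) (App (?w h) (App (?w ?f0) (Fst (Var 0)))) (App (?w h) (App (?w ?f0) (Fst (Snd (Var 0))))))
     (Eq (?w Y) (App (?w (comp0 ?A ?f0 h)) (Fst (Var 0))) (App (?w (comp0 ?A ?f0 h)) (Fst (Snd (Var 0)))))"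
    by (rule tyeq_sym[OF tyeq_Eq[OF tyeq_refl[OF YS] cx[OF pr(1)] cx[OF pr(2)]]])
  have SE: "total_edges A = ?S" unfolding total_edges_def edgesT_def edge_def vert_def by (simp only: nf)
  have b1: "teq (?S # \<Gamma>) (Fst (Var 0)) (App (?w (edge_src A)) (Var 0)) (?w ?A)"
    unfolding edge_src_def SE by (rule teq_sym[OF teq_wk_beta[OF S pr(1)]])
  have b2: "teq (?S # \<Gamma>) (Fst (Snd (Var 0))) (App (?w (edge_tgt A)) (Var 0)) (?w ?A)"
    unfolding edge_tgt_def SE by (rule teq_sym[OF teq_wk_beta[OF S pr(2)]])
  have H: "Lam ?S ?e = edge_htpy A f" unfolding edge_htpy_def on_edge_def SE by (simp only: nf)
  note b3 = teq_sym[OF teq_wk_beta[OF S e, unfolded H]]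
  have a: "teq (?S # \<Gamma>) (App (?w ?f0) y) (App (?w ?f0) z) (?w X)" if "teq (?S # \<Gamma>) y z (?w ?A)" for y z
    by (rule teq_App[OF teq_refl[OF f0S] refl that]) (simp only: nf)
  note body = teq_conv[OF teq_ap[OF XS YS hS a[OF b1] a[OF b2] b3] cv]
  have c3: "teq \<Gamma> (comp_coc_path ?A ?E X Y h ?f0 ?f1) (Lam (total_edges A) (ap (wk 1 X) (wk 1 Y) (wk 1 h) (App (wk 1 (Fst f)) (App (wk 1 (edge_src A)) (Var 0)))
        (App (wk 1 (Fst f)) (App (wk 1 (edge_tgt A)) (Var 0))) (App (wk 1 (edge_htpy A f)) (Var 0)))) (coc2T ?A ?E Y (comp0 ?A ?f0 h) (comp0 ?A ?f0 h))"
    unfolding comp_coc_path_def coc2T_def wk_sub One_nat_def SE by (rule teq_Lam[OF S body])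
  have c1: "chk \<Gamma> (comp0 ?A ?f0 h) (Pi ?A (?w Y))"
    by (rule chk_has[OF has_comp0[OF G X Y fp(1,2) h d1]]) (simp only: nf)
  have cw: "wty \<Gamma> (CocT ?A ?E Y)" by (rule CocT_wty[OF G Y])
  have co: "compose ?A h ?f0 = comp0 ?A ?f0 h" unfolding compose_def comp0_def ..
  have "teqc \<Gamma> (comp_coc ?A ?E X Y h f) (square_coc A X Y h f) (CocT ?A ?E Y)"
    unfolding square_coc_def comp_coc_def CocT_def co
    apply (rule teqc_Pair[OF teqc_refl], simp only: nf, rule c1[simplified nf], simp only: sub.simps inst_def)
    apply (rule teqc_Pair[OF teqc_refl], simp only: nf, rule c1[simplified nf], rule refl)
    apply (rule teqcI[OF c3], simp only: nf gd)
    done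
  then show ?thesis using cw by (rule teqcD)
qed

text \<open>
  The two universal properties at one fixed type \<open>Y\<close>.
\<close>

definition rcoeq_at :: "tm \<Rightarrow> tm \<Rightarrow> tm \<Rightarrow> tm \<Rightarrow> tm" where
  "rcoeq_at A X Y f = isequiv (arr X Y) (Hom A (Disc Y)) (Lam (arr X Y) (hom_comp (wk 1 A) (Disc (wk 1 X)) (Disc (wk 1 Y)) (Disc_map (wk 1 X) (wk 1 Y) (Var 0)) (wk 1 f)))"
definition pushout_at :: "tm \<Rightarrow> tm \<Rightarrow> tm \<Rightarrow> tm \<Rightarrow> tm" where
  "pushout_at A X Y f = isequiv (arr X Y) (Cocone (total_edges A) (vert A) (vert A) (edge_src A) (edge_tgt A) Y) (Lam (arr X Y) (square_coc (wk 1 A) (wk 1 X) (wk 1 Y) (Var 0) (wk 1 f)))"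

lemmas graph_defs = RGraph_def vert_def edge_def rfx_def on_vert_def on_edge_def on_rfx_def Hom_def hom_comp_def hom_comp_rfx_def Disc_map_def
  Cocone_def total_edges_def edge_src_def edge_tgt_def edge_htpy_def square_coc_def isequiv_def Let_def

lemma is_rcoeq_at: "is_rcoeq k A X f = Pi (U k) (rcoeq_at (wk 1 A) (wk 1 X) (Var 0) (wk 1 f))"
  unfolding is_rcoeq_def rcoeq_at_def by (simp only: nf)
lemma is_edge_pushout_at: "is_edge_pushout k A X f = Pi (U k) (pushout_at (wk 1 A) (wk 1 X) (Var 0) (wk 1 f))"
  unfolding is_edge_pushout_def is_pushout_def pushout_at_def by (simp only: nf graph_defs)
lemma sub_rcoeq_at: "sub \<sigma> (rcoeq_at A X Y f) = rcoeq_at (sub \<sigma> A) (sub \<sigma> X) (sub \<sigma> Y) (sub \<sigma> f)"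
  unfolding rcoeq_at_def by (simp only: nf sub_Disc graph_defs)
lemma sub_pushout_at: "sub \<sigma> (pushout_at A X Y f) = pushout_at (sub \<sigma> A) (sub \<sigma> X) (sub \<sigma> Y) (sub \<sigma> f)"
  unfolding pushout_at_def by (simp only: nf sub_Disc graph_defs)
lemma sub_vert: "sub \<sigma> (vert A) = vert (sub \<sigma> A)" unfolding vert_def by (simp only: nf)

context
  fixes i \<Gamma> A X Y f
  assumes A: "has \<Gamma> A (RGraph i)" and X: "wty \<Gamma> X" and Y: "wty \<Gamma> Y" and f: "has \<Gamma> f (HomT (vert A) (Fst (Snd A)) (Snd (Snd A)) X)"
begin

abbreviation (input) "XY \<equiv> Pi X (\<up> Y)"
abbreviation (input) "HY \<equiv> HomT (vert A) (Fst (Snd A)) (Snd (Snd A)) Y"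
abbreviation (input) "CY \<equiv> CocT (vert A) (Fst (Snd A)) Y"
abbreviation (input) "hom_restr \<equiv> hom_comp (\<up> A) (Disc (\<up> X)) (Disc (\<up> Y)) (Disc_map (\<up> X) (\<up> Y) (Var 0)) (\<up> f)"
abbreviation (input) "coc_restr \<equiv> square_coc (\<up> A) (\<up> X) (\<up> Y) (Var 0) (\<up> f)"

lemma XY: "wty \<Gamma> XY" by (rule arr_wty[OF X Y])
lemma gXY: "\<turnstile> XY # \<Gamma>" by (rule wty_ctx[OF XY])
lemma sXY: "is_subst \<Gamma> (shift (Suc 0)) (XY # \<Gamma>)" by (rule is_subst_shift_1[OF gXY])
lemma hXY: "has (XY # \<Gamma>) (Var 0) (Pi (\<up> X) (\<up> (\<up> Y)))" by (rule has_Var_0[OF gXY]) (simp only: nf)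
lemma AXY: "has (XY # \<Gamma>) (\<up> A) (RGraph i)" by (rule has_sub[OF A sXY]) (simp only: nf RGraph_def)
lemma fXY: "has (XY # \<Gamma>) (\<up> f) (HomT (vert (\<up> A)) (Fst (Snd (\<up> A))) (Snd (Snd (\<up> A))) (\<up> X))"
  by (rule has_sub[OF f sXY]) (simp only: nf gd vert_def)

lemma HY_w: "\<up> HY = HomT (vert (\<up> A)) (Fst (Snd (\<up> A))) (Snd (Snd (\<up> A))) (\<up> Y)"
  and CY_w: "\<up> CY = CocT (vert (\<up> A)) (Fst (Snd (\<up> A))) (\<up> Y)"
  by (simp_all only: nf gd vert_def)

lemma has_hom_restr: "has (XY # \<Gamma>) hom_restr (\<up> HY)"
  unfolding HY_w by (rule has_hom_comp[OF AXY wty_sub[OF X sXY] wty_sub[OF Y sXY] fXY has_Disc_map[OF wty_sub[OF X sXY] wty_sub[OF Y sXY] hXY]])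

lemma coc_of_hom_restr: "inh (XY # \<Gamma>) (Eq (\<up> CY) (sub (hom_restr ;; shift (Suc 0)) (coc_of_hom (wk 1 (vert A)) (wk 1 (Fst (Snd A))) (Var 0))) (comp_coc (vert (\<up> A)) (Fst (Snd (\<up> A))) (\<up> X) (\<up> Y) (Var 0) (\<up> f)))"
proof -
  have "sub (hom_restr ;; shift (Suc 0)) (coc_of_hom (wk 1 (vert A)) (wk 1 (Fst (Snd A))) (Var 0)) = coc_of_hom (vert (\<up> A)) (Fst (Snd (\<up> A))) hom_restr"
    unfolding coc_of_hom_def coc_path_def edgesT_def vert_def by (simp only: nf)
  then show ?thesis unfolding CY_w
    using inh_Eq_refl[OF teq_sym[OF coc_of_hom_comp[OF AXY wty_sub[OF X sXY] wty_sub[OF Y sXY] fXY hXY]]] by simp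
qed

lemma coc_of_hom_restr_square: "inh (XY # \<Gamma>) (Eq (\<up> CY) (sub (hom_restr ;; shift (Suc 0)) (coc_of_hom (wk 1 (vert A)) (wk 1 (Fst (Snd A))) (Var 0))) coc_restr)"
  by (rule inh_trans[OF coc_of_hom_restr inh_Eq_refl[OF comp_coc_square[OF AXY wty_sub[OF X sXY] wty_sub[OF Y sXY] fXY hXY, folded CY_w]]])

lemma has_coc_restr: "has (XY # \<Gamma>) coc_restr (\<up> CY)"
  unfolding CY_w by (rule teqD(2)[OF comp_coc_square[OF AXY wty_sub[OF X sXY] wty_sub[OF Y sXY] fXY hXY]])

lemma rcoeq_at_open_equiv: "inh \<Gamma> (rcoeq_at A X Y f) \<longleftrightarrow> open_equiv \<Gamma> XY HY hom_restr" and rcoeq_at_wty: "wty \<Gamma> (rcoeq_at A X Y f)"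
proof -
  note H = Hom_Disc[OF A Y]
  note wH = tyeq_wty(2)[OF H]
  have F: "has (XY # \<Gamma>) hom_restr (\<up> (Hom A (Disc Y)))" by (rule has_conv[OF has_hom_restr tyeq_sub[OF H sXY]])
  have f: "has \<Gamma> (Lam XY hom_restr) (Pi XY (\<up> (Hom A (Disc Y))))" by (rule has_Lam[OF XY F])
  have b: "teq (XY # \<Gamma>) (App (\<up> (Lam XY hom_restr)) (Var 0)) hom_restr (\<up> (Hom A (Disc Y)))" by (rule teq_wk_beta[OF XY F])
  have eq: "rcoeq_at A X Y f = isequiv XY (Hom A (Disc Y)) (Lam XY hom_restr)" unfolding rcoeq_at_def arr_def wk_sub One_nat_def ..
  show "wty \<Gamma> (rcoeq_at A X Y f)" unfolding eq by (rule isequiv_wty[OF XY wH f])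
  show "inh \<Gamma> (rcoeq_at A X Y f) \<longleftrightarrow> open_equiv \<Gamma> XY HY hom_restr"
    unfolding eq
    using isequivE[OF _ XY wH f b] isequivI[OF _ f b] open_equiv_conv[OF _ H teq_refl[OF has_hom_restr]] open_equiv_conv[OF _ tyeq_sym[OF H] teq_refl[OF F]] by blast
qed

lemma pushout_at_open_equiv: "inh \<Gamma> (pushout_at A X Y f) \<longleftrightarrow> open_equiv \<Gamma> XY CY coc_restr" and pushout_at_wty: "wty \<Gamma> (pushout_at A X Y f)"
proof -
  let ?C = "Cocone (total_edges A) (vert A) (vert A) (edge_src A) (edge_tgt A) Y"
  note H = Cocone_CocT[OF A Y]
  note wH = tyeq_wty(2)[OF H]
  have F: "has (XY # \<Gamma>) coc_restr (\<up> ?C)" by (rule has_conv[OF has_coc_restr tyeq_sub[OF H sXY]])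
  have f: "has \<Gamma> (Lam XY coc_restr) (Pi XY (\<up> ?C))" by (rule has_Lam[OF XY F])
  have b: "teq (XY # \<Gamma>) (App (\<up> (Lam XY coc_restr)) (Var 0)) coc_restr (\<up> ?C)" by (rule teq_wk_beta[OF XY F])
  have eq: "pushout_at A X Y f = isequiv XY ?C (Lam XY coc_restr)" unfolding pushout_at_def arr_def wk_sub One_nat_def ..
  show "wty \<Gamma> (pushout_at A X Y f)" unfolding eq by (rule isequiv_wty[OF XY wH f])
  show "inh \<Gamma> (pushout_at A X Y f) \<longleftrightarrow> open_equiv \<Gamma> XY CY coc_restr"
    unfolding eq
    using isequivE[OF _ XY wH f b] isequivI[OF _ f b] open_equiv_conv[OF _ H teq_refl[OF has_coc_restr]] open_equiv_conv[OF _ tyeq_sym[OF H] teq_refl[OF F]] by blast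
qed

text \<open>
  Both properties say that a map out of \<open>X \<rightarrow> Y\<close> is an equivalence, and the second map is the first one
  followed by the restriction to cocones.
\<close>

lemma rcoeq_iff_pushout_at: "inh \<Gamma> (rcoeq_at A X Y f) \<longleftrightarrow> inh \<Gamma> (pushout_at A X Y f)"
  unfolding rcoeq_at_open_equiv pushout_at_open_equiv
  using open_equiv_comp[OF has_hom_restr has_coc_restr coc_of_hom_restr_square open_equiv_coc_of_hom[OF graphI[OF A] Y] XY]
    open_equiv_cancel[OF has_hom_restr has_coc_restr coc_of_hom_restr_square open_equiv_coc_of_hom[OF graphI[OF A] Y] XY] by blast

end

lemma inh_iffT:
  assumes P: "wty \<Gamma> P" and Q: "wty \<Gamma> Q" and "inh (P # \<Gamma>) (\<up> Q)" and "inh (Q # \<Gamma>) (\<up> P)"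
  shows "inh \<Gamma> (iffT P Q)"
proof -
  have 1: "inh \<Gamma> (Pi P (\<up> Q))" and 2: "inh \<Gamma> (Pi Q (\<up> P))"
    using assms by (blast intro: inh_Pi)+
  obtain t where t: "has \<Gamma> t (Pi P (\<up> Q))" using 1 unfolding inh_def by blast
  have w: "wty (Pi P (\<up> Q) # \<Gamma>) (\<up> (Pi Q (\<up> P)))"
    by (rule wty_sub[OF inh_wty[OF 2] is_subst_shift_1[OF wty_ctx[OF inh_wty[OF 1]]]])
  have "inh \<Gamma> (Sig (Pi P (\<up> Q)) (\<up> (Pi Q (\<up> P))))"
    by (rule inh_Sig[OF w t 2]) (simp only: nf)
  then show ?thesis unfolding iffT_def prodT_def arr_def wk_sub One_nat_def .
qed

lemma rcoeq_iff_pushout: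
  assumes A: "has \<Gamma> A (RGraph i)" and X: "wty \<Gamma> X" and f: "has \<Gamma> f (Hom A (Disc X))"
  shows "inh \<Gamma> (iffT (is_rcoeq k A X f) (is_edge_pushout k A X f))"
proof -
  let ?w = "\<up>" and ?w2 = "sub (shift (Suc (Suc 0)))"
  have fT: "has \<Gamma> f (HomT (vert A) (Fst (Snd A)) (Snd (Snd A)) X)" by (rule has_conv[OF f tyeq_sym[OF Hom_Disc[OF A X]]])
  have lift: "has \<Delta> (sub \<sigma> A) (RGraph i)" "wty \<Delta> (sub \<sigma> X)"
    "has \<Delta> (sub \<sigma> f) (HomT (vert (sub \<sigma> A)) (Fst (Snd (sub \<sigma> A))) (Snd (Snd (sub \<sigma> A))) (sub \<sigma> X))" if "is_subst \<Gamma> \<sigma> \<Delta>" for \<sigma> \<Delta>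
    by (rule has_sub[OF A that], simp only: nf RGraph_def) (rule wty_sub[OF X that], rule has_sub[OF fT that], simp only: nf gd vert_def)
  note g = has_ctx[OF A]
  have U: "wty \<Gamma> (U k)" by (rule wty_U[OF g])
  note gU = wty_ctx[OF U]
  have sU: "is_subst \<Gamma> (shift (Suc 0)) (U k # \<Gamma>)" by (rule is_subst_shift_1[OF gU])
  have v: "wty (U k # \<Delta>) (Var 0)" if "\<turnstile> U k # \<Delta>" for \<Delta>
    by (rule wty_el[OF has_Var_0[OF that refl] sub.simps(2)])
  have P: "wty \<Gamma> (is_rcoeq k A X f)" unfolding is_rcoeq_at wk_sub One_nat_def
    by (rule wty_Pi[OF U rcoeq_at_wty[OF lift(1)[OF sU] lift(2)[OF sU] v[OF gU] lift(3)[OF sU]]])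
  have Q: "wty \<Gamma> (is_edge_pushout k A X f)" unfolding is_edge_pushout_at wk_sub One_nat_def
    by (rule wty_Pi[OF U pushout_at_wty[OF lift(1)[OF sU] lift(2)[OF sU] v[OF gU] lift(3)[OF sU]]])
  have step: "inh (P # \<Gamma>) (Pi (U k) (R2 (?w2 A) (?w2 X) (Var 0) (?w2 f)))"
    if P: "wty \<Gamma> P" and PR: "P = Pi (U k) (R1 (?w A) (?w X) (Var 0) (?w f))"
      and R1: "\<And>\<sigma> A X Y f. sub \<sigma> (R1 A X Y f) = R1 (sub \<sigma> A) (sub \<sigma> X) (sub \<sigma> Y) (sub \<sigma> f)"
      and imp: "\<And>\<Delta> A X Y f. has \<Delta> A (RGraph i) \<Longrightarrow> wty \<Delta> X \<Longrightarrow> wty \<Delta> Y \<Longrightarrow> has \<Delta> f (HomT (vert A) (Fst (Snd A)) (Snd (Snd A)) X) \<Longrightarrow> inh \<Delta> (R1 A X Y f) \<Longrightarrow> inh \<Delta> (R2 A X Y f)"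
    for P R1 R2
  proof (rule inh_Pi)
    show "wty (P # \<Gamma>) (U k)" by (rule wty_U[OF wty_ctx[OF P]])
    assume g2: "\<turnstile> U k # P # \<Gamma>"
    have s2: "is_subst \<Gamma> (shift (Suc (Suc 0))) (U k # P # \<Gamma>)" by (rule is_subst_shift_2[OF g2])
    have "has (U k # P # \<Gamma>) (Var (Suc 0)) (Pi (U k) (R1 (sub (shift 3) A) (sub (shift 3) X) (Var 0) (sub (shift 3) f)))"
      by (rule has_Var_1[OF g2]) (simp only: PR nf R1)
    from has_App[OF this refl chk_has[OF has_Var_0[OF g2 refl] sub.simps(2)] refl]
    have "inh (U k # P # \<Gamma>) (R1 (?w2 A) (?w2 X) (Var 0) (?w2 f))" by (intro inhI) (simp only: nf R1)
    then show "inh (U k # P # \<Gamma>) (R2 (?w2 A) (?w2 X) (Var 0) (?w2 f))" by (rule imp[OF lift(1)[OF s2] lift(2)[OF s2] v[OF g2] lift(3)[OF s2]])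
  qed
  have 1: "inh (is_rcoeq k A X f # \<Gamma>) (?w (is_edge_pushout k A X f))"
    using step[OF P, of rcoeq_at pushout_at] rcoeq_iff_pushout_at unfolding is_rcoeq_at is_edge_pushout_at by (simp only: nf sub_rcoeq_at sub_pushout_at simp_thms; blast)
  have 2: "inh (is_edge_pushout k A X f # \<Gamma>) (?w (is_rcoeq k A X f))"
    using step[OF Q, of pushout_at rcoeq_at] rcoeq_iff_pushout_at unfolding is_rcoeq_at is_edge_pushout_at by (simp only: nf sub_rcoeq_at sub_pushout_at simp_thms; blast)
  show ?thesis by (rule inh_iffT[OF P Q 1 2])
qed

section \<open>Dependent paths over constant families\<close>

text \<open>
  For \<open>w : a = b\<close> in \<open>Y\<close> and a path \<open>e\<close> in \<open>X\<close>, the corresponding path from the transport of \<open>a\<close> along \<open>e\<close> in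
  the constant family \<open>Y\<close> to \<open>b\<close>. This is the shape in which pushout induction takes its path clause.
\<close>

definition const_apd :: "tm \<Rightarrow> tm \<Rightarrow> tm \<Rightarrow> tm \<Rightarrow> tm \<Rightarrow> tm \<Rightarrow> tm \<Rightarrow> tm \<Rightarrow> tm" where
  "const_apd X Y a b x y e w =
     App (J X (arr (Eq (wk 3 Y) (wk 3 a) (wk 3 b)) (Eq (wk 3 Y) (transport (wk 3 X) (wk 4 Y) (Var 2) (Var 1) (Var 0) (wk 3 a)) (wk 3 b)))
            (Lam (Eq (wk 1 Y) (wk 1 a) (wk 1 b)) (Var 0)) x y e) w"

lemma sub_const_apd: "sub \<sigma> (const_apd X Y a b x y e w) = const_apd (sub \<sigma> X) (sub \<sigma> Y) (sub \<sigma> a) (sub \<sigma> b) (sub \<sigma> x) (sub \<sigma> y) (sub \<sigma> e) (sub \<sigma> w)"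
  unfolding const_apd_def by (simp only: nf)

lemmas nft = nf sub_const_apd

lemma transport_const_refl:
  assumes Y: "wty \<Gamma> Y" and x: "has \<Gamma> x X" and a: "has \<Gamma> a Y"
  shows "teq \<Gamma> (transport X (\<up> Y) x x (Refl x) a) a Y"
proof -
  have X: "wty \<Gamma> X" using x hasD by blast
  have P: "wty (X # \<Gamma>) (\<up> Y)" by (rule wty_sub[OF Y is_subst_shift_1[OF wty_ctx[OF X]]])
  show ?thesis by (rule teq_transport_refl[OF P x a]) (simp only: nf)
qed

lemma const_apd_base:
  assumes X: "wty \<Gamma> X" and Y: "wty \<Gamma> Y" and a: "has \<Gamma> a Y" and b: "has \<Gamma> b Y" and x: "has \<Gamma> x X" and w: "has \<Gamma> w (Eq Y a b)"
  shows "has \<Gamma> w (Eq Y (transport X (\<up> Y) x x (Refl x) a) b)"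
  by (rule has_conv[OF w tyeq_Eq[OF tyeq_refl[OF Y] teq_sym[OF transport_const_refl[OF Y x a]] teq_refl[OF b]]])

context
  fixes \<Gamma> X Y a b
  assumes X: "wty \<Gamma> X" and Y: "wty \<Gamma> Y" and a: "has \<Gamma> a Y" and b: "has \<Gamma> b Y"
begin

lemma const_apd_branch: "has (X # \<Gamma>) (Lam (Eq (\<up> Y) (\<up> a) (\<up> b)) (Var 0))
   (Pi (Eq (\<up> Y) (\<up> a) (\<up> b))
     (Eq (sub (shift (Suc (Suc 0))) Y) (transport (sub (shift (Suc (Suc 0))) X) (sub (shift (Suc (Suc (Suc 0)))) Y) (Var (Suc 0)) (Var (Suc 0)) (Refl (Var (Suc 0))) (sub (shift (Suc (Suc 0))) a)) (sub (shift (Suc (Suc 0))) b)))"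
  (is "has _ (Lam ?E _) _")
proof -
  have g1: "\<turnstile> X # \<Gamma>" by (rule wty_ctx[OF X])
  have E: "wty (X # \<Gamma>) ?E" by (assumption | rule X Y a b g1 tc | simp only: nf | rule refl)+
  note g2 = wty_ctx[OF E]
  have s: "is_subst \<Gamma> (shift (Suc (Suc 0))) (?E # X # \<Gamma>)" by (rule is_subst_shift_2[OF g2])
  have x: "has (?E # X # \<Gamma>) (Var (Suc 0)) (sub (shift (Suc (Suc 0))) X)" by (rule has_Var_1[OF g2]) (simp only: nf)
  have w: "has (?E # X # \<Gamma>) (Var 0) (Eq (sub (shift (Suc (Suc 0))) Y) (sub (shift (Suc (Suc 0))) a) (sub (shift (Suc (Suc 0))) b))"
    by (rule has_Var_0[OF g2]) (simp only: nf)
  from has_Lam[OF E const_apd_base[OF wty_sub[OF X s] wty_sub[OF Y s] has_sub[OF a s refl] has_sub[OF b s refl] x w]]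
  show ?thesis by (simp only: nf)
qed

lemma has_const_apd:
  assumes x: "chk \<Gamma> x X" and y: "chk \<Gamma> y X" and e: "chk \<Gamma> e (Eq X x y)" and w: "chk \<Gamma> w (Eq Y a b)"
    and T: "Eq Y (transport X (\<up> Y) x y e a) b = T"
  shows "has \<Gamma> (const_apd X Y a b x y e w) T"
  unfolding const_apd_def T[symmetric] apply (simp only: nf)
  by (assumption | rule X Y a b x y e w const_apd_branch has_ctx[OF a] tc has_transport | simp only: nf | rule refl)+

lemma teq_const_apd_refl:
  assumes x: "has \<Gamma> x X" and w: "has \<Gamma> w (Eq Y a b)"
  shows "teq \<Gamma> (const_apd X Y a b x x (Refl x) w) w (Eq Y a b)"
proof -
  let ?w = "\<up>"
  let ?T = "Eq (?w Y) (transport (?w X) (?w (?w Y)) (?w x) (?w x) (Refl (?w x)) (?w a)) (?w b)"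
  let ?J = "J X (arr (Eq (wk 3 Y) (wk 3 a) (wk 3 b)) (Eq (wk 3 Y) (transport (wk 3 X) (wk 4 Y) (Var 2) (Var 1) (Var 0) (wk 3 a)) (wk 3 b)))
            (Lam (Eq (wk 1 Y) (wk 1 a) (wk 1 b)) (Var 0)) x x (Refl x)"
  have J: "teq \<Gamma> ?J (Lam (Eq Y a b) (Var 0)) (Pi (Eq Y a b) ?T)"
    apply (simp only: nf)
    apply (rule teq_beta_J[unfolded wk_sub nums, THEN teq_rhs])
    by (assumption | rule X Y a b x w const_apd_branch has_ctx[OF a] tc has_transport | simp only: nf | rule refl)+
  have E: "wty \<Gamma> (Eq Y a b)" using w hasD by blast
  note g = wty_ctx[OF E] have s: "is_subst \<Gamma> (shift (Suc 0)) (Eq Y a b # \<Gamma>)" by (rule is_subst_shift_1[OF g])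
  have v: "has (Eq Y a b # \<Gamma>) (Var 0) (Eq (?w Y) (?w a) (?w b))" by (rule has_Var_0[OF g]) (simp only: nf)
  have v': "has (Eq Y a b # \<Gamma>) (Var 0) ?T"
    by (rule const_apd_base[OF wty_sub[OF X s] wty_sub[OF Y s] has_sub[OF a s refl] has_sub[OF b s refl] has_sub[OF x s refl] v])
  have B: "teq \<Gamma> (App (Lam (Eq Y a b) (Var 0)) w) w (Eq Y a b)"
    by (rule teq_beta[OF v w, THEN teq_rhs]) (simp_all only: nf)
  have T: "tyeq \<Gamma> (Eq Y (transport X (?w Y) x x (Refl x) a) b) (Eq Y a b)"
    by (rule tyeq_Eq[OF tyeq_refl[OF Y] transport_const_refl[OF Y x a] teq_refl[OF b]])
  have "teq \<Gamma> (App ?J w) (App (Lam (Eq Y a b) (Var 0)) w) (Eq Y (transport X (?w Y) x x (Refl x) a) b)"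
    by (rule teqc_App[OF J refl teqc_refl[OF chk_has[OF w refl]]]) (simp only: nf)
  from teq_trans[OF teq_conv[OF this T] B] show ?thesis unfolding const_apd_def .
qed

end

lemma teq_const_apd:
  assumes X: "wty \<Gamma> X" and Y: "wty \<Gamma> Y" and a: "teq \<Gamma> a a' Y" and b: "teq \<Gamma> b b' Y"
    and x: "has \<Gamma> x X" and y: "has \<Gamma> y X" and e: "has \<Gamma> e (Eq X x y)" and w: "has \<Gamma> w (Eq Y a b)"
  shows "teq \<Gamma> (const_apd X Y a b x y e w) (const_apd X Y a' b' x y e w) (Eq Y (transport X (\<up> Y) x y e a) b)"
proof -
  let ?\<Delta> = "Eq (wk 2 Y) (Var 1) (Var 0) # wk 1 Y # Y # \<Gamma>"
  have g: "\<turnstile> ?\<Delta>" by (rule path_ctx[OF Y])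
  have v: "has ?\<Delta> (Var 2) (wk 3 Y)" "has ?\<Delta> (Var 1) (wk 3 Y)"
    by (insert g, simp_all only: nf) (assumption | rule Y tc | simp only: nf | rule refl)+
  have s: "is_subst \<Gamma> (shift 3) ?\<Delta>" using is_subst_shift_3[OF g] by (simp only: nums)
  note ht = has_const_apd[OF wty_sub[OF X s] wty_sub[OF Y s] v[unfolded wk_sub[of 3]]]
  have t: "has ?\<Delta> (const_apd (sub (shift 3) X) (sub (shift 3) Y) (Var 2) (Var 1) (sub (shift 3) x) (sub (shift 3) y) (sub (shift 3) e) (Var 0)) (Eq (sub (shift 3) Y) (transport (sub (shift 3) X) (\<up> (sub (shift 3) Y)) (sub (shift 3) x) (sub (shift 3) y) (sub (shift 3) e) (Var 2)) (Var 1))"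
    apply (rule ht[OF _ _ _ _ refl]; insert g; simp only: nf)
    by (assumption | rule X Y x y e tc | simp only: nf | rule refl)+
  have "substeq ?\<Delta> (w ;; b ;; a ;; Var) (w ;; b' ;; a' ;; Var) \<Gamma>"
    apply (insert g, simp only: nf)
    by (assumption | rule substeqc_cons substeq_refl a[THEN teqcI] b[THEN teqcI] teqc_refl w X Y wty_ctx'[OF X] tc | simp only: nf | rule refl)+
  from functional[OF this t refl] show ?thesis by (simp only: nft)
qed

lemma inh_id: assumes "tyeq \<Gamma> P Q" shows "inh \<Gamma> (Pi P (\<up> Q))"
proof (rule inh_Pi[OF tyeq_wty(1)[OF assms]])
  assume g: "\<turnstile> P # \<Gamma>"
  show "inh (P # \<Gamma>) (\<up> Q)"
    by (rule inhI[OF has_conv[OF has_Var_0[OF g refl] tyeq_sub[OF assms is_subst_shift_1[OF g], folded One_nat_def]], unfolded One_nat_def])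
qed

lemma Lam_beta:
  assumes F: "has (X # \<Gamma>) F (\<up> Y)" and s: "is_subst \<Gamma> \<sigma> \<Delta>" and z: "has \<Delta> z (sub \<sigma> X)"
  shows "teq \<Delta> (App (sub \<sigma> (Lam X F)) z) (sub (z ;; \<sigma>) F) (sub \<sigma> Y)"
  using teq_sub[OF teq_wk_beta[OF ctx_wty[OF has_ctx[OF F]] F] is_subst_cons[OF s has_ctx[OF F] refl chk_has[OF z refl]] refl] by (simp only: nf)

lemma ap_of_apd_refl:
  assumes Y: "wty \<Gamma> Y" and F: "has (X # \<Gamma>) F (\<up> Y)" and x: "has \<Gamma> x X"
    and w: "has \<Gamma> w (Eq Y (sub (x ;; Var) F) (sub (x ;; Var) F))"
  shows "tyeq \<Gamma> (Eq (Eq Y (transport X (\<up> Y) x x (Refl x) (sub (x ;; Var) F)) (sub (x ;; Var) F)) (apd X (\<up> Y) F x x (Refl x))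
       (const_apd X Y (sub (x ;; Var) F) (sub (x ;; Var) F) x x (Refl x) w))
     (Eq (Eq Y (sub (x ;; Var) F) (sub (x ;; Var) F)) (ap X Y (Lam X F) x x (Refl x)) w)"
proof -
  let ?a = "sub (x ;; Var) F"
  have X: "wty \<Gamma> X" by (rule ctx_wty[OF has_ctx[OF F]])
  have beta: "teq \<Gamma> (App (Lam X F) x) ?a Y" using Lam_beta[OF F is_subst_Var[OF has_ctx[OF x]]] x by (simp only: sub_Var)
  note a = teqD(2)[OF beta]
  have f: "has \<Gamma> (Lam X F) (Pi X (\<up> Y))" by (rule has_Lam[OF X F])
  have T: "tyeq \<Gamma> (Eq Y (transport X (\<up> Y) x x (Refl x) ?a) ?a) (Eq Y ?a ?a)"
    by (rule tyeq_Eq[OF tyeq_refl[OF Y] transport_const_refl[OF Y x a] teq_refl[OF a]])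
  have T2: "tyeq \<Gamma> (Eq Y (App (Lam X F) x) (App (Lam X F) x)) (Eq Y ?a ?a)" by (rule tyeq_Eq[OF tyeq_refl[OF Y] beta beta])
  have apd: "teq \<Gamma> (apd X (\<up> Y) F x x (Refl x)) (Refl ?a) (Eq Y (transport X (\<up> Y) x x (Refl x) ?a) ?a)"
    using teq_apd_refl[OF F x] by (simp only: nf)
  have "teq \<Gamma> (ap X Y (Lam X F) x x (Refl x)) (Refl ?a) (Eq Y ?a ?a)"
    by (rule teq_trans[OF teq_conv[OF teq_ap_refl[OF Y f x] T2] teq_conv[OF teq_Refl[OF beta] T2]])
  from teq_trans[OF apd teq_conv[OF teq_sym[OF this] tyeq_sym[OF T]]]
    teq_conv[OF teq_const_apd_refl[OF X Y a a x w] tyeq_sym[OF T]]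
  show ?thesis by (rule tyeq_Eq[OF T])
qed

text \<open>
  Converts the computation rule of pushout induction, which speaks of \<open>apd\<close>, into one for recursion,
  which speaks of \<open>ap\<close>. By path induction; at a reflexivity both types are judgmentally the same.
\<close>

lemma ap_of_apd:
  assumes Y: "wty \<Gamma> Y" and F: "has (X # \<Gamma>) F (\<up> Y)"
    and e: "has \<Gamma> e (Eq X x y)" and w: "has \<Gamma> w (Eq Y (sub (x ;; Var) F) (sub (y ;; Var) F))"
    and k: "inh \<Gamma> (Eq (Eq Y (transport X (\<up> Y) x y e (sub (x ;; Var) F)) (sub (y ;; Var) F)) (apd X (\<up> Y) F x y e)
       (const_apd X Y (sub (x ;; Var) F) (sub (y ;; Var) F) x y e w))"
  shows "inh \<Gamma> (Eq (Eq Y (sub (x ;; Var) F) (sub (y ;; Var) F)) (ap X Y (Lam X F) x y e) w)"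
proof -
  note wE = wty_EqD[OF hasD[OF e]]
  note X = wE(1) and x = wE(2)
  note gX = wty_ctx[OF X]
  let ?s1 = "\<up>" and ?s2 = "sub (shift (Suc (Suc 0)))" and ?s3 = "sub (shift (Suc (Suc (Suc 0))))"
  define f where "f = Lam X F"
  have f: "has \<Gamma> f (Pi X (?s1 Y))" unfolding f_def by (rule has_Lam[OF X F])
  have apF: "has \<Delta> (ap (sub \<sigma> X) (sub \<sigma> Y) (sub \<sigma> f) a b p) T"
    if s: "is_subst \<Gamma> \<sigma> \<Delta>" and a: "chk \<Delta> a (sub \<sigma> X)" and b: "chk \<Delta> b (sub \<sigma> X)" and p: "chk \<Delta> p (Eq (sub \<sigma> X) a b)"
      and T: "Eq (sub \<sigma> Y) (sub (a ;; \<sigma>) F) (sub (b ;; \<sigma>) F) = T" for \<sigma> \<Delta> a b p T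
  proof -
    note Xs = wty_sub[OF X s] and Ys = wty_sub[OF Y s]
    have fs: "has \<Delta> (sub \<sigma> f) (Pi (sub \<sigma> X) (?s1 (sub \<sigma> Y)))" by (rule has_sub[OF f s]) (simp only: nf)
    have "tyeq \<Delta> (Eq (sub \<sigma> Y) (App (sub \<sigma> f) a) (App (sub \<sigma> f) b)) (Eq (sub \<sigma> Y) (sub (a ;; \<sigma>) F) (sub (b ;; \<sigma>) F))"
      unfolding f_def by (rule tyeq_Eq[OF tyeq_refl[OF Ys] Lam_beta[OF F s chkD[OF a Xs]] Lam_beta[OF F s chkD[OF b Xs]]])
    from has_conv[OF has_ap[OF Xs Ys chk_has[OF fs refl] a b p refl] this] show ?thesis unfolding T .
  qed
  let ?C = "Pi (Eq (?s2 Y) (?s2 (sub (x ;; Var) F)) (sub (Var 1 ;; shift 2) F))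
     (Pi (Eq (Eq (?s3 Y) (transport (?s3 X) (?s1 (?s3 Y)) (?s3 x) (Var 2) (Var 1) (?s3 (sub (x ;; Var) F))) (sub (Var 2 ;; shift 3) F))
            (apd (?s3 X) (?s1 (?s3 Y)) (sub (Var 0 ;; shift 4) F) (?s3 x) (Var 2) (Var 1))
            (const_apd (?s3 X) (?s3 Y) (?s3 (sub (x ;; Var) F)) (sub (Var 2 ;; shift 3) F) (?s3 x) (Var 2) (Var 1) (Var 0)))
        (Eq (Eq (sub (shift 4) Y) (sub (shift 4) (sub (x ;; Var) F)) (sub (Var 3 ;; shift 4) F)) (ap (sub (shift 4) X) (sub (shift 4) Y) (sub (shift 4) f) (sub (shift 4) x) (Var 3) (Var 2)) (Var 1)))"
  have C: "wty (Eq (?s1 X) (?s1 x) (Var 0) # X # \<Gamma>) ?C"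
    apply (simp only: nft)
    by (assumption | rule X Y x F apF tc has_apd has_const_apd has_transport | simp only: nft | rule refl)+
  have fx: "has \<Gamma> (sub (x ;; Var) F) Y" by (rule has_sub[OF F is_subst_inst[OF gX]]) (use x in \<open>simp_all only: has_def nf\<close>)
  have W: "wty \<Gamma> (Eq Y (sub (x ;; Var) F) (sub (x ;; Var) F))"
    by (rule wty_Eq[OF Y chk_has[OF fx refl] chk_has[OF fx refl]])
  note gW = wty_ctx[OF W] note sW = is_subst_shift_1[OF gW]
  have FW: "has (?s1 X # Eq Y (sub (x ;; Var) F) (sub (x ;; Var) F) # \<Gamma>) (sub (up (shift (Suc 0))) F) (?s1 (?s1 Y))"
  proof -
    have "is_subst (X # \<Gamma>) (up (shift (Suc 0))) (?s1 X # Eq Y (sub (x ;; Var) F) (sub (x ;; Var) F) # \<Gamma>)"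
      using wty_sub[OF X sW] is_subst_up sW unfolding wty_def by blast
    from has_sub[OF F this] show ?thesis by (simp only: nf)
  qed
  have xW: "has (Eq Y (sub (x ;; Var) F) (sub (x ;; Var) F) # \<Gamma>) (?s1 x) (?s1 X)" by (rule has_sub[OF x sW refl])
  have wW: "has (Eq Y (sub (x ;; Var) F) (sub (x ;; Var) F) # \<Gamma>) (Var 0) (Eq (?s1 Y) (sub (?s1 x ;; Var) (sub (up (shift (Suc 0))) F)) (sub (?s1 x ;; Var) (sub (up (shift (Suc 0))) F)))"
    by (rule has_Var_0[OF gW]) (simp only: nf)
  have base: "inh \<Gamma> (sub (Refl x ;; x ;; Var) ?C)"
    using inh_Pi[OF W inh_id[OF ap_of_apd_refl[OF wty_sub[OF Y sW] FW xW wW]]] by (simp only: nft f_def)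
  have "inh \<Gamma> (sub (e ;; y ;; Var) ?C)" by (rule path_induction[OF e C base refl])
  then have "inh \<Gamma> (Pi (Eq Y (sub (x ;; Var) F) (sub (y ;; Var) F)) (Pi (Eq (Eq (?s1 Y) (transport (?s1 X) (?s2 Y) (?s1 x) (?s1 y) (?s1 e) (sub (?s1 x ;; shift 1) F)) (sub (?s1 y ;; shift 1) F))
      (apd (?s1 X) (?s2 Y) (sub (Var 0 ;; shift 2) F) (?s1 x) (?s1 y) (?s1 e))
      (const_apd (?s1 X) (?s1 Y) (sub (?s1 x ;; shift 1) F) (sub (?s1 y ;; shift 1) F) (?s1 x) (?s1 y) (?s1 e) (Var 0)))
     (Eq (Eq (?s2 Y) (sub (?s2 x ;; shift 2) F) (sub (?s2 y ;; shift 2) F)) (ap (?s2 X) (?s2 Y) (?s2 f) (?s2 x) (?s2 y) (?s2 e)) (Var 1))))"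
    by (simp only: nft)
  from inh_App[OF this chk_has[OF w refl] refl]
  have r: "inh \<Gamma> (Pi (Eq (Eq Y (transport X (?s1 Y) x y e (sub (x ;; Var) F)) (sub (y ;; Var) F)) (apd X (?s1 Y) F x y e)
       (const_apd X Y (sub (x ;; Var) F) (sub (y ;; Var) F) x y e w)) (Eq (Eq (?s1 Y) (sub (?s1 x ;; shift 1) F) (sub (?s1 y ;; shift 1) F)) (ap (?s1 X) (?s1 Y) (?s1 f) (?s1 x) (?s1 y) (?s1 e)) (?s1 w)))"
    by (simp only: nft)
  obtain k' where "has \<Gamma> k' (Eq (Eq Y (transport X (?s1 Y) x y e (sub (x ;; Var) F)) (sub (y ;; Var) F)) (apd X (?s1 Y) F x y e)
       (const_apd X Y (sub (x ;; Var) F) (sub (y ;; Var) F) x y e w))" using k unfolding inh_def by blast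
  from inh_App[OF r chk_has[OF this refl] refl] show ?thesis by (simp only: nft f_def)
qed

section \<open>Induction on pushouts\<close>

text \<open>
  The three types share a universe, as the formation rule of pushouts demands.
\<close>

definition span :: "nat \<Rightarrow> ctx \<Rightarrow> tm \<Rightarrow> tm \<Rightarrow> tm \<Rightarrow> tm \<Rightarrow> tm \<Rightarrow> bool" where
  "span i \<Gamma> S A B u v \<longleftrightarrow> has \<Gamma> S (U i) \<and> has \<Gamma> A (U i) \<and> has \<Gamma> B (U i) \<and>
     has \<Gamma> u (Pi S (\<up> A)) \<and> has \<Gamma> v (Pi S (\<up> B))"

lemma span_sub: assumes "span i \<Gamma> S A B u v" "is_subst \<Gamma> \<sigma> \<Delta>"
  shows "span i \<Delta> (sub \<sigma> S) (sub \<sigma> A) (sub \<sigma> B) (sub \<sigma> u) (sub \<sigma> v)"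
  by (insert assms(1), unfold span_def, elim conjE, intro conjI; (rule has_sub[OF _ assms(2)], assumption, simp only: nf))

lemma span_wty: assumes "span i \<Gamma> S A B u v"
  shows "wty \<Gamma> S" "wty \<Gamma> A" "wty \<Gamma> B" "has \<Gamma> u (Pi S (\<up> A))" "has \<Gamma> v (Pi S (\<up> B))"
  using assms wty_el unfolding span_def by blast+

lemma has_Po: assumes "span i \<Gamma> S A B u v" shows "has \<Gamma> (Po S A B u v) (U i)"
  using assms hasD unfolding span_def has_def by (auto intro!: ty_Po simp only: nf)

lemma wty_Po: assumes "span i \<Gamma> S A B u v" shows "wty \<Gamma> (Po S A B u v)"
  by (rule wty_el[OF has_Po[OF assms] refl])

lemma has_PoL: "span i \<Gamma> S A B u v \<Longrightarrow> chk \<Gamma> a A \<Longrightarrow> has \<Gamma> (PoL a) (Po S A B u v)"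
  using has_Po[of i \<Gamma> S A B u v] wty_Po[of i \<Gamma> S A B u v] chkD[of \<Gamma> a A] span_wty(2)[of i \<Gamma> S A B u v]
  unfolding has_def by (auto intro: ty_PoL)
lemma has_PoR: "span i \<Gamma> S A B u v \<Longrightarrow> chk \<Gamma> b B \<Longrightarrow> has \<Gamma> (PoR b) (Po S A B u v)"
  using has_Po[of i \<Gamma> S A B u v] wty_Po[of i \<Gamma> S A B u v] chkD[of \<Gamma> b B] span_wty(3)[of i \<Gamma> S A B u v]
  unfolding has_def by (auto intro: ty_PoR)

lemma has_Glue: assumes s: "span i \<Gamma> S A B u v" and x: "chk \<Gamma> x S" and T: "Eq (Po S A B u v) (PoL (App u x)) (PoR (App v x)) = T"
  shows "has \<Gamma> (Glue x) T"
proof -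
  note w = span_wty[OF s]
  have "wty \<Gamma> (Eq (Po S A B u v) (PoL (App u x)) (PoR (App v x)))"
    by (assumption | rule w x wty_Po[OF s] has_PoL[OF s] has_PoR[OF s] tc | simp only: nf | rule refl)+
  then show ?thesis unfolding T[symmetric] using has_Po[OF s] chkD[OF x w(1)] unfolding has_def by (auto intro: ty_Glue)
qed

text \<open>
  The premises of pushout induction, collected so that they can be weakened together.
\<close>

definition po_data :: "nat \<Rightarrow> ctx \<Rightarrow> tm \<Rightarrow> tm \<Rightarrow> tm \<Rightarrow> tm \<Rightarrow> tm \<Rightarrow> tm \<Rightarrow> tm \<Rightarrow> tm \<Rightarrow> tm \<Rightarrow> bool" where
  "po_data i \<Gamma> S A B u v C l r g \<longleftrightarrow> span i \<Gamma> S A B u v \<and> wty (Po S A B u v # \<Gamma>) C \<and>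
     has (A # \<Gamma>) l (sub (PoL (Var 0) ;; shift 1) C) \<and> has (B # \<Gamma>) r (sub (PoR (Var 0) ;; shift 1) C) \<and>
     has (S # \<Gamma>) g (glue_clause S A B u v C l r)"

lemma is_subst_upT: "is_subst \<Gamma> \<sigma> \<Delta> \<Longrightarrow> wty \<Gamma> A \<Longrightarrow> is_subst (A # \<Gamma>) (up \<sigma>) (sub \<sigma> A # \<Delta>)"
  using wty_sub[of \<Gamma> A \<sigma> \<Delta>] is_subst_up[of \<Gamma> \<sigma> \<Delta>] unfolding wty_def by blast

lemma po_data_sub:
  assumes "po_data i \<Gamma> S A B u v C l r g" and s: "is_subst \<Gamma> \<sigma> \<Delta>"
  shows "po_data i \<Delta> (sub \<sigma> S) (sub \<sigma> A) (sub \<sigma> B) (sub \<sigma> u) (sub \<sigma> v) (sub (up \<sigma>) C) (sub (up \<sigma>) l) (sub (up \<sigma>) r) (sub (up \<sigma>) g)"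
proof -
  from assms have a: "span i \<Gamma> S A B u v" "wty (Po S A B u v # \<Gamma>) C" "has (A # \<Gamma>) l (sub (PoL (Var 0) ;; shift 1) C)"
    "has (B # \<Gamma>) r (sub (PoR (Var 0) ;; shift 1) C)" "has (S # \<Gamma>) g (glue_clause S A B u v C l r)" unfolding po_data_def by auto
  note w = span_wty[OF a(1)]
  have P: "wty (sub \<sigma> (Po S A B u v) # \<Delta>) (sub (up \<sigma>) C)" by (rule wty_sub[OF a(2) is_subst_upT[OF s wty_Po[OF a(1)]]])
  show ?thesis unfolding po_data_def
    apply (intro conjI)
        apply (rule span_sub[OF a(1) s])
       apply (use P in \<open>simp only: sub.simps\<close>)
      apply (rule has_sub[OF a(3) is_subst_upT[OF s w(2)]]) apply (simp only: nf)
     apply (rule has_sub[OF a(4) is_subst_upT[OF s w(3)]]) apply (simp only: nf)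
    by (rule has_sub[OF a(5) is_subst_upT[OF s w(1)] sub_up_glue_clause])
qed

lemma po_levels: assumes "po_data i \<Gamma> S A B u v C l r g" obtains k where
  "\<Gamma> \<turnstile> S \<^bold>: U i" "\<Gamma> \<turnstile> A \<^bold>: U i" "\<Gamma> \<turnstile> B \<^bold>: U i" "\<Gamma> \<turnstile> u \<^bold>: arr S A" "\<Gamma> \<turnstile> v \<^bold>: arr S B" "Po S A B u v # \<Gamma> \<turnstile> C \<^bold>: U k"
  "A # \<Gamma> \<turnstile> l \<^bold>: sub (PoL (Var 0) ;; shift 1) C" "B # \<Gamma> \<turnstile> r \<^bold>: sub (PoR (Var 0) ;; shift 1) C" "S # \<Gamma> \<turnstile> g \<^bold>: glue_clause S A B u v C l r"
  using assms unfolding po_data_def span_def has_def wty_def by (auto simp only: nf)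

lemma has_PoRec: assumes d: "po_data i \<Gamma> S A B u v C l r g" and t: "has \<Gamma> t (Po S A B u v)"
  shows "has \<Gamma> (PoRec S A B u v C l r g t) (inst C t)"
proof -
  have C: "wty (Po S A B u v # \<Gamma>) C" using d unfolding po_data_def by auto
  have "wty \<Gamma> (inst C t)" using wty_sub[OF C is_subst_cons[OF is_subst_Var[OF has_ctx[OF t]] wty_ctx'[OF C] _ chk_has[OF t refl]]]
    by (simp only: nf)
  with d t show ?thesis by (auto simp: has_def elim!: po_levels intro: ty_PoRec)
qed

lemma teq_PoRec_PoL: assumes d: "po_data i \<Gamma> S A B u v C l r g" and a: "has \<Gamma> a A"
  shows "teq \<Gamma> (PoRec S A B u v C l r g (PoL a)) (sub (a ;; Var) l) (inst C (PoL a))"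
proof -
  have s: "span i \<Gamma> S A B u v" and l: "has (A # \<Gamma>) l (sub (PoL (Var 0) ;; shift 1) C)" using d unfolding po_data_def by auto
  have la: "has \<Gamma> (sub (a ;; Var) l) (inst C (PoL a))"
    by (rule has_sub[OF l is_subst_cons[OF is_subst_Var[OF has_ctx[OF a]] has_ctx[OF l] _ chk_has[OF a refl]]]) (simp_all only: nf)
  show ?thesis using has_PoRec[OF d has_PoL[OF s chk_has[OF a refl]]] la d a
    unfolding teq_def by (auto simp: has_def inst_def elim!: po_levels intro: beta_PoL[unfolded inst_def])
qed

lemma teq_PoRec_PoR: assumes d: "po_data i \<Gamma> S A B u v C l r g" and a: "has \<Gamma> a B"
  shows "teq \<Gamma> (PoRec S A B u v C l r g (PoR a)) (sub (a ;; Var) r) (inst C (PoR a))"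
proof -
  have s: "span i \<Gamma> S A B u v" and l: "has (B # \<Gamma>) r (sub (PoR (Var 0) ;; shift 1) C)" using d unfolding po_data_def by auto
  have la: "has \<Gamma> (sub (a ;; Var) r) (inst C (PoR a))"
    by (rule has_sub[OF l is_subst_cons[OF is_subst_Var[OF has_ctx[OF a]] has_ctx[OF l] _ chk_has[OF a refl]]]) (simp_all only: nf)
  show ?thesis using has_PoRec[OF d has_PoR[OF s chk_has[OF a refl]]] la d a
    unfolding teq_def by (auto simp: has_def inst_def elim!: po_levels intro: beta_PoR[unfolded inst_def])
qed

lemma teq_transport_arg:
  assumes C: "wty (X # \<Gamma>) C" and p: "has \<Gamma> p (Eq X a b)" and t: "teq \<Gamma> t t' (sub (a ;; Var) C)"
  shows "teq \<Gamma> (transport X C a b p t) (transport X C a b p t') (sub (b ;; Var) C)"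
proof -
  note E = wty_EqD[OF hasD[OF p]]
  have g: "\<turnstile> sub (a ;; Var) C # \<Gamma>" by (rule wty_ctx[OF hasD[OF teqD(1)[OF t]]])
  note gX = wty_ctx[OF E(1)]
  have C': "wty (\<up> X # sub (a ;; Var) C # \<Gamma>) (sub (up (shift (Suc 0))) C)"
    by (rule wty_sub[OF C is_subst_upT[OF is_subst_shift_1[OF g] E(1)]])
  have tr: "has (sub (a ;; Var) C # \<Gamma>) (transport (\<up> X) (sub (up (shift (Suc 0))) C) (\<up> a) (\<up> b) (\<up> p) (Var 0))
     (\<up> (sub (b ;; Var) C))"
    by (insert C' g, simp only: nf) (assumption | rule E p tc has_transport | simp only: nf | rule refl)+
  show ?thesis using functional1[OF t tr] by (simp only: nf simp_thms)
qed

lemma has_PoBeta: assumes d: "po_data i \<Gamma> S A B u v C l r g" and s: "has \<Gamma> s S"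
  shows "inh \<Gamma> (Eq (inst (glue_clause S A B u v C l r) s)
         (apd (Po S A B u v) C
            (PoRec (wk 1 S) (wk 1 A) (wk 1 B) (wk 1 u) (wk 1 v) (wk1 1 C) (wk1 1 l) (wk1 1 r)
               (wk1 1 g) (Var 0))
            (PoL (App u s)) (PoR (App v s)) (Glue s))
         (inst g s))"
proof -
  from d have sp: "span i \<Gamma> S A B u v" and C: "wty (Po S A B u v # \<Gamma>) C" and g: "has (S # \<Gamma>) g (glue_clause S A B u v C l r)"
    unfolding po_data_def by auto
  note w = span_wty[OF sp] wty_Po[OF sp] wty_ctx[OF wty_Po[OF sp]]
  have ss: "is_subst (S # \<Gamma>) (s ;; Var) \<Gamma>" by (rule is_subst_cons[OF is_subst_Var[OF has_ctx[OF s]] has_ctx[OF g] _ chk_has[OF s refl]]) (simp only: nf)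
  let ?w = "\<up>" and ?u = "sub (up (shift (Suc 0)))"
  have R: "has (Po S A B u v # \<Gamma>) (PoRec (?w S) (?w A) (?w B) (?w u) (?w v) (?u C) (?u l) (?u r) (?u g) (Var 0)) C"
    using has_PoRec[OF po_data_sub[OF d is_subst_shift_1[OF w(7)]] has_Var_0[OF w(7)]] by (simp only: nf simp_thms)
  have gl: "has \<Gamma> (sub (s ;; Var) g) (sub (s ;; Var) (glue_clause S A B u v C l r))" by (rule has_sub[OF g ss refl])
  let ?R = "PoRec (?w S) (?w A) (?w B) (?w u) (?w v) (?u C) (?u l) (?u r) (?u g) (Var 0)"
  let ?P = "Po S A B u v" and ?a = "PoL (App u s)" and ?b = "PoR (App v s)" and ?C = "\<lambda>t. sub (t ;; Var) C"
  have us: "has \<Gamma> (App u s) A" and vs: "has \<Gamma> (App v s) B"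
    by (assumption | rule w s tc | simp only: nf | rule refl)+
  have ab: "has \<Gamma> ?a ?P" "has \<Gamma> ?b ?P" by (rule has_PoL[OF sp chk_has[OF us refl]] has_PoR[OF sp chk_has[OF vs refl]])+
  have gs: "has \<Gamma> (Glue s) (Eq ?P ?a ?b)" by (rule has_Glue[OF sp chk_has[OF s refl] refl])
  have Ra: "teq \<Gamma> (sub (?a ;; Var) ?R) (sub (App u s ;; Var) l) (?C ?a)"
    using teq_PoRec_PoL[OF d us] by (simp only: nf)
  have Rb: "teq \<Gamma> (sub (?b ;; Var) ?R) (sub (App v s ;; Var) r) (?C ?b)"
    using teq_PoRec_PoR[OF d vs] by (simp only: nf)
  have Cs: "wty \<Gamma> (?C ?b)" using hasD[OF teqD(1)[OF Rb]] .
  have T: "tyeq \<Gamma> (Eq (?C ?b) (transport ?P C ?a ?b (Glue s) (sub (?a ;; Var) ?R)) (sub (?b ;; Var) ?R))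
     (Eq (?C ?b) (transport ?P C ?a ?b (Glue s) (sub (App u s ;; Var) l)) (sub (App v s ;; Var) r))"
    using tyeq_Eq[OF tyeq_refl[OF Cs] teq_transport_arg[OF C gs Ra] Rb] .
  have apd: "has \<Gamma> (apd ?P C ?R ?a ?b (Glue s)) (sub (s ;; Var) (glue_clause S A B u v C l r))"
    using has_conv[OF has_apd[OF w(6) R chk_has[OF ab(1) refl] chk_has[OF ab(2) refl] chk_has[OF gs refl] refl] T]
    by (simp only: nf glue_clause_def Let_def)
  have "wty \<Gamma> (Eq (sub (s ;; Var) (glue_clause S A B u v C l r)) (apd ?P C ?R ?a ?b (Glue s)) (sub (s ;; Var) g))"
    by (rule wty_Eq[OF hasD[OF gl] chk_has[OF apd refl] chk_has[OF gl refl]])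
  with d s show ?thesis unfolding inh_def
    by (auto elim!: po_levels intro!: exI ty_PoBeta[simplified nf] simp only: has_def nf)
qed

text \<open>
  Induction as the existence of an open term \<open>R\<close> over the pushout with its computation rules: judgmental on
  points, and up to a path on \<open>Glue\<close>. Everything below uses the eliminator only through this lemma.
\<close>

lemma pushout_induction:
  assumes sp: "span i \<Gamma> S A B u v" and C: "wty (Po S A B u v # \<Gamma>) C"
    and l: "has (A # \<Gamma>) l (sub (PoL (Var 0) ;; shift 1) C)" and r: "has (B # \<Gamma>) r (sub (PoR (Var 0) ;; shift 1) C)"
    and g: "has (S # \<Gamma>) g (glue_clause S A B u v C l r)"
  obtains R where "has (Po S A B u v # \<Gamma>) R C"
    "teq (A # \<Gamma>) (sub (PoL (Var 0) ;; shift (Suc 0)) R) l (sub (PoL (Var 0) ;; shift (Suc 0)) C)"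
    "teq (B # \<Gamma>) (sub (PoR (Var 0) ;; shift (Suc 0)) R) r (sub (PoR (Var 0) ;; shift (Suc 0)) C)"
    "inh (S # \<Gamma>) (Eq (glue_clause S A B u v C l r)
       (apd (wk 1 (Po S A B u v)) (wk1 1 C) (wk1 1 R) (PoL (App (wk 1 u) (Var 0))) (PoR (App (wk 1 v) (Var 0))) (Glue (Var 0))) g)"
proof -
  have d: "po_data i \<Gamma> S A B u v C l r g" using assms unfolding po_data_def by auto
  note w = span_wty[OF sp]
  let ?w = "\<up>" and ?u = "sub (up (shift (Suc 0)))"
  let ?R = "PoRec (?w S) (?w A) (?w B) (?w u) (?w v) (?u C) (?u l) (?u r) (?u g) (Var 0)"
  have dw: "po_data i (Q # \<Gamma>) (?w S) (?w A) (?w B) (?w u) (?w v) (?u C) (?u l) (?u r) (?u g)" if "wty \<Gamma> Q" for Q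
    by (rule po_data_sub[OF d is_subst_shift_1[OF wty_ctx[OF that]]])
  show thesis
  proof
    show "has (Po S A B u v # \<Gamma>) ?R C"
      using has_PoRec[OF dw[OF wty_Po[OF sp]] has_Var_0[OF wty_ctx[OF wty_Po[OF sp]]]] by (simp only: nf simp_thms)
    show "teq (A # \<Gamma>) (sub (PoL (Var 0) ;; shift (Suc 0)) ?R) l (sub (PoL (Var 0) ;; shift (Suc 0)) C)"
      using teq_PoRec_PoL[OF dw[OF w(2)] has_Var_0[OF wty_ctx[OF w(2)] refl, simplified nf]] by (simp only: nf)
    show "teq (B # \<Gamma>) (sub (PoR (Var 0) ;; shift (Suc 0)) ?R) r (sub (PoR (Var 0) ;; shift (Suc 0)) C)"
      using teq_PoRec_PoR[OF dw[OF w(3)] has_Var_0[OF wty_ctx[OF w(3)] refl, simplified nf]] by (simp only: nf)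
    show "inh (S # \<Gamma>) (Eq (glue_clause S A B u v C l r)
       (apd (wk 1 (Po S A B u v)) (wk1 1 C) (wk1 1 ?R) (PoL (App (wk 1 u) (Var 0))) (PoR (App (wk 1 v) (Var 0))) (Glue (Var 0))) g)"
      using has_PoBeta[OF dw[OF w(1)] has_Var_0[OF wty_ctx[OF w(1)] refl, simplified nf]] by (simp only: nf glue_clause_def Let_def)
  qed
qed

text \<open>
  Recursion is induction into a constant family, with \<open>const_apd\<close> as path clause.
\<close>

lemma pushout_recursion:
  assumes sp: "span i \<Gamma> S A B u v" and Y: "wty \<Gamma> Y"
    and p: "has (A # \<Gamma>) p (\<up> Y)" and q: "has (B # \<Gamma>) q (\<up> Y)"
    and H: "has (S # \<Gamma>) H (Eq (\<up> Y) (sub (App (\<up> u) (Var 0) ;; shift (Suc 0)) p) (sub (App (\<up> v) (Var 0) ;; shift (Suc 0)) q))"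
  obtains R where "has (Po S A B u v # \<Gamma>) R (\<up> Y)"
    "teq (A # \<Gamma>) (sub (PoL (Var 0) ;; shift (Suc 0)) R) p (\<up> Y)"
    "teq (B # \<Gamma>) (sub (PoR (Var 0) ;; shift (Suc 0)) R) q (\<up> Y)"
    "inh (S # \<Gamma>) (Eq (Eq (\<up> Y) (sub (App (\<up> u) (Var 0) ;; shift (Suc 0)) p) (sub (App (\<up> v) (Var 0) ;; shift (Suc 0)) q))
       (ap (\<up> (Po S A B u v)) (\<up> Y) (\<up> (Lam (Po S A B u v) R))
          (PoL (App (\<up> u) (Var 0))) (PoR (App (\<up> v) (Var 0))) (Glue (Var 0))) H)"
proof -
  let ?w = "\<up>" let ?P = "Po S A B u v"
  let ?us = "App (?w u) (Var 0)" and ?vs = "App (?w v) (Var 0)"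
  let ?pu = "sub (?us ;; shift (Suc 0)) p" and ?qv = "sub (?vs ;; shift (Suc 0)) q"
  note w = span_wty[OF sp] wty_Po[OF sp]
  note g = wty_ctx[OF w(1)] wty_ctx[OF w(2)] wty_ctx[OF w(3)] wty_ctx[OF w(6)]
  note s1 = is_subst_shift_1[OF g(1)]
  note spS = span_sub[OF sp s1]
  have P': "wty (S # \<Gamma>) (?w ?P)" and Y': "wty (S # \<Gamma>) (?w Y)" using wty_sub[OF _ s1] w(6) Y by blast+
  have v0: "has (S # \<Gamma>) (Var 0) (?w S)" by (rule has_Var_0[OF g(1) refl, unfolded One_nat_def])
  have us: "has (S # \<Gamma>) ?us (?w A)" by (rule has_App[OF span_wty(4)[OF spS] refl chk_has[OF v0 refl]]) (simp only: nf)
  have vs: "has (S # \<Gamma>) ?vs (?w B)" by (rule has_App[OF span_wty(5)[OF spS] refl chk_has[OF v0 refl]]) (simp only: nf)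
  have x: "has (S # \<Gamma>) (PoL ?us) (?w ?P)" using has_PoL[OF spS chk_has[OF us refl]] by (simp only: sub.simps)
  have y: "has (S # \<Gamma>) (PoR ?vs) (?w ?P)" using has_PoR[OF spS chk_has[OF vs refl]] by (simp only: sub.simps)
  have e: "has (S # \<Gamma>) (Glue (Var 0)) (Eq (?w ?P) (PoL ?us) (PoR ?vs))"
    using has_Glue[OF spS chk_has[OF v0 refl] refl] by (simp only: sub.simps)
  note E = wty_EqD[OF hasD[OF H]]
  have C: "wty (?P # \<Gamma>) (?w Y)" by (rule wty_sub[OF Y is_subst_shift_1[OF g(4)]])
  have l: "has (A # \<Gamma>) p (sub (PoL (Var 0) ;; shift 1) (?w Y))" and r: "has (B # \<Gamma>) q (sub (PoR (Var 0) ;; shift 1) (?w Y))"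
    using p q by (simp_all only: nf)
  let ?g = "const_apd (?w ?P) (?w Y) ?pu ?qv (PoL ?us) (PoR ?vs) (Glue (Var 0)) H"
  have G: "has (S # \<Gamma>) ?g (glue_clause S A B u v (?w Y) p q)"
    apply (rule has_const_apd[OF P' Y' E(2,3) chk_has[OF x refl] chk_has[OF y refl] chk_has[OF e refl] chk_has[OF H refl]])
    by (simp only: nf glue_clause_def Let_def)
  obtain R where R: "has (?P # \<Gamma>) R (?w Y)"
    "teq (A # \<Gamma>) (sub (PoL (Var 0) ;; shift (Suc 0)) R) p (sub (PoL (Var 0) ;; shift (Suc 0)) (?w Y))"
    "teq (B # \<Gamma>) (sub (PoR (Var 0) ;; shift (Suc 0)) R) q (sub (PoR (Var 0) ;; shift (Suc 0)) (?w Y))"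
    and b: "inh (S # \<Gamma>) (Eq (glue_clause S A B u v (?w Y) p q)
       (apd (wk 1 ?P) (wk1 1 (?w Y)) (wk1 1 R) (PoL (App (wk 1 u) (Var 0))) (PoR (App (wk 1 v) (Var 0))) (Glue (Var 0))) ?g)"
    by (rule pushout_induction[OF sp C l r G])
  have RL: "teq (A # \<Gamma>) (sub (PoL (Var 0) ;; shift (Suc 0)) R) p (?w Y)" and RR: "teq (B # \<Gamma>) (sub (PoR (Var 0) ;; shift (Suc 0)) R) q (?w Y)"
    using R(2,3) by (simp_all only: nf)
  let ?F = "sub (up (shift (Suc 0))) R"
  have F: "has (?w ?P # S # \<Gamma>) ?F (?w (?w Y))" by (rule has_sub[OF R(1) is_subst_upT[OF s1 w(6)]]) (simp only: nf)
  let ?a = "sub (PoL ?us ;; Var) ?F" and ?b = "sub (PoR ?vs ;; Var) ?F"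
  have sA: "is_subst (A # \<Gamma>) (?us ;; shift (Suc 0)) (S # \<Gamma>)" by (rule is_subst_cons[OF s1 g(2) refl chk_has[OF us refl]])
  have sB: "is_subst (B # \<Gamma>) (?vs ;; shift (Suc 0)) (S # \<Gamma>)" by (rule is_subst_cons[OF s1 g(3) refl chk_has[OF vs refl]])
  have a: "teq (S # \<Gamma>) ?a ?pu (?w Y)" and b': "teq (S # \<Gamma>) ?b ?qv (?w Y)"
    using teq_sub[OF RL sA refl] teq_sub[OF RR sB refl] by (simp_all only: nf)
  have T: "tyeq (S # \<Gamma>) (Eq (?w Y) ?a ?b) (Eq (?w Y) ?pu ?qv)" by (rule tyeq_Eq[OF tyeq_refl[OF Y'] a b'])
  have H': "has (S # \<Gamma>) H (Eq (?w Y) ?a ?b)" by (rule has_conv[OF H tyeq_sym[OF T]])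
  have CC: "wty (?w ?P # S # \<Gamma>) (?w (?w Y))" by (rule hasD[OF F])
  have a2: "teq (S # \<Gamma>) ?a ?pu (sub (PoL ?us ;; Var) (?w (?w Y)))" using a by (simp only: nf)
  have tr: "teq (S # \<Gamma>) (transport (?w ?P) (?w (?w Y)) (PoL ?us) (PoR ?vs) (Glue (Var 0)) ?a)
     (transport (?w ?P) (?w (?w Y)) (PoL ?us) (PoR ?vs) (Glue (Var 0)) ?pu) (?w Y)"
    using teq_transport_arg[OF CC e a2] by (simp only: nf)
  have T2: "tyeq (S # \<Gamma>) (Eq (?w Y) (transport (?w ?P) (?w (?w Y)) (PoL ?us) (PoR ?vs) (Glue (Var 0)) ?a) ?b)
     (Eq (?w Y) (transport (?w ?P) (?w (?w Y)) (PoL ?us) (PoR ?vs) (Glue (Var 0)) ?pu) ?qv)"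
    by (rule tyeq_Eq[OF tyeq_refl[OF Y'] tr b'])
  have ad: "has (S # \<Gamma>) (apd (?w ?P) (?w (?w Y)) ?F (PoL ?us) (PoR ?vs) (Glue (Var 0)))
      (Eq (?w Y) (transport (?w ?P) (?w (?w Y)) (PoL ?us) (PoR ?vs) (Glue (Var 0)) ?a) ?b)"
    by (rule has_apd[OF P' F chk_has[OF x refl] chk_has[OF y refl] chk_has[OF e refl]]) (simp only: nf)
  have tc: "teq (S # \<Gamma>) (const_apd (?w ?P) (?w Y) ?a ?b (PoL ?us) (PoR ?vs) (Glue (Var 0)) H) ?g
      (Eq (?w Y) (transport (?w ?P) (?w (?w Y)) (PoL ?us) (PoR ?vs) (Glue (Var 0)) ?a) ?b)"
    by (rule teq_const_apd[OF P' Y' a b' x y e H'])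
  have "tyeq (S # \<Gamma>) (Eq (Eq (?w Y) (transport (?w ?P) (?w (?w Y)) (PoL ?us) (PoR ?vs) (Glue (Var 0)) ?a) ?b)
       (apd (?w ?P) (?w (?w Y)) ?F (PoL ?us) (PoR ?vs) (Glue (Var 0))) (const_apd (?w ?P) (?w Y) ?a ?b (PoL ?us) (PoR ?vs) (Glue (Var 0)) H))
    (Eq (glue_clause S A B u v (?w Y) p q)
       (apd (wk 1 ?P) (wk1 1 (?w Y)) (wk1 1 R) (PoL (App (wk 1 u) (Var 0))) (PoR (App (wk 1 v) (Var 0))) (Glue (Var 0))) ?g)"
    using tyeq_Eq[OF T2 teq_refl[OF ad] tc] by (simp only: nf glue_clause_def Let_def)
  from ap_of_apd[OF Y' F e H' inh_conv[OF b tyeq_sym[OF this]]]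
  have 1: "inh (S # \<Gamma>) (Eq (Eq (?w Y) ?a ?b) (ap (?w ?P) (?w Y) (Lam (?w ?P) ?F) (PoL ?us) (PoR ?vs) (Glue (Var 0))) H)" .
  note E1 = wty_EqD[OF inh_wty[OF 1]]
  have "inh (S # \<Gamma>) (Eq (Eq (?w Y) ?pu ?qv) (ap (?w ?P) (?w Y) (?w (Lam ?P R)) (PoL ?us) (PoR ?vs) (Glue (Var 0))) H)"
    using inh_conv[OF 1 tyeq_Eq[OF T teq_refl[OF E1(2)] teq_refl[OF E1(3)]]] by (simp only: nf)
  from that[OF R(1) RL RR this] show thesis .
qed

section \<open>Uniqueness of maps out of a pushout\<close>

lemma teq_concat_refl: assumes "has \<Gamma> p (Eq Y a b)" shows "teq \<Gamma> (concat_path Y a b b p (Refl b)) p (Eq Y a b)"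
proof -
  note w = wty_EqD[OF hasD[OF assms]]
  have "wty (Y # \<Gamma>) (Eq (\<up> Y) (\<up> a) (Var 0))"
    by (assumption | rule w wty_ctx[OF w(1)] tc | simp only: nf | rule refl)+
  from teq_transport_refl[OF this w(3) assms] show ?thesis unfolding concat_path_def by (simp only: nf simp_thms)
qed

lemma teq_concat_right: assumes p: "has \<Gamma> p (Eq Y a b)" and q: "teq \<Gamma> q q' (Eq Y b c)"
  shows "teq \<Gamma> (concat_path Y a b c p q) (concat_path Y a b c p q') (Eq Y a c)"
proof -
  note w = wty_EqD[OF hasD[OF p]] wty_EqD[OF hasD[OF teqD(1)[OF q]]] wty_ctx[OF hasD[OF teqD(1)[OF q]]]
  have t: "has (Eq Y b c # \<Gamma>) (concat_path (\<up> Y) (\<up> a) (\<up> b) (\<up> c) (\<up> p) (Var 0))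
     (Eq (\<up> Y) (\<up> a) (\<up> c))"
    by (assumption | rule w p tc has_concat_path | simp only: nf | rule refl)+
  show ?thesis using functional1[OF q t refl] by (simp only: nf simp_thms)
qed

lemma teq_concat_left: assumes p: "teq \<Gamma> p p' (Eq Y a b)" and q: "has \<Gamma> q (Eq Y b c)"
  shows "teq \<Gamma> (concat_path Y a b c p q) (concat_path Y a b c p' q) (Eq Y a c)"
proof -
  note w = wty_EqD[OF hasD[OF q]] wty_EqD[OF hasD[OF teqD(1)[OF p]]] wty_ctx[OF hasD[OF teqD(1)[OF p]]]
  have t: "has (Eq Y a b # \<Gamma>) (concat_path (\<up> Y) (\<up> a) (\<up> b) (\<up> c) (Var 0) (\<up> q))
     (Eq (\<up> Y) (\<up> a) (\<up> c))"
    by (assumption | rule w q tc has_concat_path | simp only: nf | rule refl)+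
  show ?thesis using functional1[OF p t refl] by (simp only: nf simp_thms)
qed

lemma concat_refl_left: assumes q: "has \<Gamma> q (Eq Y a b)"
  shows "inh \<Gamma> (Eq (Eq Y a b) (concat_path Y a a b (Refl a) q) q)"
proof -
  note w = wty_EqD[OF hasD[OF q]]
  let ?w2 = "sub (shift (Suc (Suc 0)))"
  let ?C = "Eq (Eq (?w2 Y) (?w2 a) (Var (Suc 0))) (concat_path (?w2 Y) (?w2 a) (?w2 a) (Var (Suc 0)) (Refl (?w2 a)) (Var 0)) (Var 0)"
  have g: "\<turnstile> Y # \<Gamma>" by (rule wty_ctx[OF w(1)])
  have C: "wty (Eq (\<up> Y) (\<up> a) (Var 0) # Y # \<Gamma>) ?C"
    by (assumption | rule w g tc has_concat_path | simp only: nf | rule refl)+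
  have "inh \<Gamma> (Eq (Eq Y a a) (concat_path Y a a a (Refl a) (Refl a)) (Refl a))"
    by (rule inh_Eq_refl[OF teq_concat_refl[OF has_Refl[OF w(2)]]])
  then have base: "inh \<Gamma> (sub (Refl a ;; a ;; Var) ?C)" by (simp only: nf)
  show ?thesis by (rule path_induction[OF q C base]) (simp only: nf)
qed

lemma concat_refl_ends:
  assumes q: "has \<Gamma> q (Eq Y b c)" and e: "teq \<Gamma> a b Y"
  shows "teq \<Gamma> (concat_path Y a b c (Refl a) q) (concat_path Y a a c (Refl a) q) (Eq Y a c)"
proof -
  note w = wty_EqD[OF hasD[OF q]]
  note a = teqD(1)[OF e] and Ec = tyeq_sym[OF tyeq_Eq[OF tyeq_refl[OF w(1)] e teq_refl[OF w(3)]]]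
  note q' = has_conv[OF q Ec]
  let ?s2 = "sub (shift (Suc (Suc 0)))"
  have g: "\<turnstile> Y # \<Gamma>" by (rule wty_ctx[OF w(1)])
  have E: "wty (Y # \<Gamma>) (Eq (\<up> Y) (Var 0) (\<up> c))"
    by (assumption | rule w g tc | simp only: nf | rule refl)+
  note gE = wty_ctx[OF E]
  have E3: "wty (Eq (\<up> Y) (Var 0) (\<up> c) # Y # \<Gamma>) (Eq (?s2 Y) (?s2 a) (Var (Suc 0)))"
    by (assumption | rule w a gE tc | simp only: nf | rule refl)+
  let ?\<Delta> = "Eq (?s2 Y) (?s2 a) (Var (Suc 0)) # Eq (\<up> Y) (Var 0) (\<up> c) # Y # \<Gamma>"
  note g3 = wty_ctx[OF E3]
  let ?s3 = "sub (shift (Suc (Suc (Suc 0))))"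
  have t: "has ?\<Delta> (concat_path (?s3 Y) (?s3 a) (Var (Suc (Suc 0))) (?s3 c) (Var 0) (Var (Suc 0))) (Eq (?s3 Y) (?s3 a) (?s3 c))"
    by (assumption | rule w a g3 tc has_concat_path | simp only: nf | rule refl)+
  have Ea: "tyeq \<Gamma> (Eq Y a a) (Eq Y a b)" by (rule tyeq_Eq[OF tyeq_refl[OF w(1)] teq_refl[OF a] e])
  have "substeq ?\<Delta> (Refl a ;; q ;; b ;; Var) (Refl a ;; q ;; a ;; Var) \<Gamma>"
    by (rule substeqc_cons[OF substeqc_cons[OF substeqc_cons[OF substeq_refl[OF is_subst_Var[OF has_ctx[OF a]]] g _ teqcI[OF teq_sym[OF e]]] gE _ teqcI[OF teq_refl[OF q]]] g3 _
        teqcI[OF teq_conv[OF teq_refl[OF has_Refl[OF a]] Ea]]]) (simp_all only: nf)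
  from functional[OF this t] show ?thesis by (simp only: nf simp_thms)
qed

lemma teq_concat_refl_end:
  assumes p: "has \<Gamma> p (Eq Y a b)" and e: "teq \<Gamma> b c Y"
  shows "teq \<Gamma> (concat_path Y a b c p (Refl b)) p (Eq Y a c)"
proof -
  note w = wty_EqD[OF hasD[OF p]]
  have Ec: "tyeq \<Gamma> (Eq Y a b) (Eq Y a c)" by (rule tyeq_Eq[OF tyeq_refl[OF w(1)] teq_refl[OF w(2)] e])
  have g: "\<turnstile> Y # \<Gamma>" by (rule wty_ctx[OF w(1)])
  have E: "wty (Y # \<Gamma>) (Eq (\<up> Y) (\<up> b) (Var 0))"
    by (assumption | rule w g tc | simp only: nf | rule refl)+
  note gE = wty_ctx[OF E]
  let ?\<Delta> = "Eq (\<up> Y) (\<up> b) (Var 0) # Y # \<Gamma>"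
  let ?s2 = "sub (shift (Suc (Suc 0)))"
  have t: "has ?\<Delta> (concat_path (?s2 Y) (?s2 a) (?s2 b) (Var (Suc 0)) (?s2 p) (Var 0)) (Eq (?s2 Y) (?s2 a) (Var (Suc 0)))"
    by (assumption | rule w p gE tc has_concat_path | simp only: nf | rule refl)+
  have Eb: "tyeq \<Gamma> (Eq Y b b) (Eq Y b c)" by (rule tyeq_Eq[OF tyeq_refl[OF w(1)] teq_refl[OF w(3)] e])
  have "substeq ?\<Delta> (Refl b ;; c ;; Var) (Refl b ;; b ;; Var) \<Gamma>"
    by (rule substeqc_cons[OF substeqc_cons[OF substeq_refl[OF is_subst_Var[OF has_ctx[OF p]]] g _ teqcI[OF teq_sym[OF e]]] gE _
        teqcI[OF teq_conv[OF teq_refl[OF has_Refl[OF w(3)]] Eb]]]) (simp_all only: nf)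
  from functional[OF this t] have "teq \<Gamma> (concat_path Y a b c p (Refl b)) (concat_path Y a b b p (Refl b)) (Eq Y a c)" by (simp only: nf simp_thms)
  from teq_trans[OF this teq_conv[OF teq_concat_refl[OF p] Ec]] show ?thesis .
qed

lemma inh_mp: "inh \<Gamma> (Pi P (\<up> Q)) \<Longrightarrow> inh \<Gamma> P \<Longrightarrow> inh \<Gamma> Q"
  unfolding inh_def[of _ P] by (elim exE, erule inh_App, rule chk_has, assumption) (simp_all only: nf)

lemma transport_htpy_refl:
  assumes Y: "wty \<Gamma> Y" and h: "has \<Gamma> h (Pi X (\<up> Y))" and k: "has \<Gamma> k (Pi X (\<up> Y))"
    and x: "has \<Gamma> x X" and a: "has \<Gamma> a (Eq Y (App h x) (App k x))" and b: "has \<Gamma> b (Eq Y (App h x) (App k x))"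
    and sq: "inh \<Gamma> (Eq (Eq Y (App h x) (App k x)) (concat_path Y (App h x) (App k x) (App k x) a (ap X Y k x x (Refl x)))
        (concat_path Y (App h x) (App h x) (App k x) (ap X Y h x x (Refl x)) b))"
  shows "inh \<Gamma> (Eq (Eq Y (App h x) (App k x)) (transport X (Eq (\<up> Y) (App (\<up> h) (Var 0)) (App (\<up> k) (Var 0))) x x (Refl x) a) b)"
proof -
  have X: "wty \<Gamma> X" using x hasD by blast
  have g: "\<turnstile> X # \<Gamma>" by (rule wty_ctx[OF X])
  have D: "wty (X # \<Gamma>) (Eq (\<up> Y) (App (\<up> h) (Var 0)) (App (\<up> k) (Var 0)))"
    by (assumption | rule g Y h k tc | simp only: nf | rule refl)+
  have 1: "teq \<Gamma> (transport X (Eq (\<up> Y) (App (\<up> h) (Var 0)) (App (\<up> k) (Var 0))) x x (Refl x) a) a (Eq Y (App h x) (App k x))"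
    by (rule teq_transport_refl[OF D x a]) (simp only: nf)
  have 2: "teq \<Gamma> (concat_path Y (App h x) (App k x) (App k x) a (ap X Y k x x (Refl x))) a (Eq Y (App h x) (App k x))"
    by (rule teq_trans[OF teq_concat_right[OF a teq_ap_refl[OF Y k x]] teq_concat_refl[OF a]])
  note 3 = teq_concat_left[OF teq_ap_refl[OF Y h x] b]
  show ?thesis
    by (rule inh_trans[OF inh_Eq_refl[OF 1] inh_trans[OF inh_sym[OF inh_Eq_refl[OF 2]] inh_trans[OF sq inh_trans[OF inh_Eq_refl[OF 3] concat_refl_left[OF b]]]]])
qed

text \<open>
  By path induction on \<open>e\<close>, for all \<open>b\<close> at once: at a reflexivity the square
  \<open>a \<cdot> ap k e = ap h e \<cdot> b\<close> has the side \<open>a\<close> judgmentally, and the side \<open>b\<close> by the unit law.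
\<close>

lemma transport_htpy:
  assumes Y: "wty \<Gamma> Y" and h: "has \<Gamma> h (Pi X (\<up> Y))" and k: "has \<Gamma> k (Pi X (\<up> Y))"
    and e: "has \<Gamma> e (Eq X x y)" and a: "has \<Gamma> a (Eq Y (App h x) (App k x))" and b: "has \<Gamma> b (Eq Y (App h y) (App k y))"
    and sq0: "inh \<Gamma> (Eq (Eq Y (App h x) (App k y)) (concat_path Y (App h x) (App k x) (App k y) a (ap X Y k x y e))
        (concat_path Y (App h x) (App h y) (App k y) (ap X Y h x y e) b))"
  shows "inh \<Gamma> (Eq (Eq Y (App h y) (App k y)) (transport X (Eq (\<up> Y) (App (\<up> h) (Var 0)) (App (\<up> k) (Var 0))) x y e a) b)"
proof -
  note wE = wty_EqD[OF hasD[OF e]]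
  note X = wE(1) and x = wE(2) and y = wE(3)
  let ?s1 = "\<up>" and ?s2 = "sub (shift (Suc (Suc 0)))" and ?s3 = "sub (shift (Suc (Suc (Suc 0))))" and ?s4 = "sub (shift (Suc (Suc (Suc (Suc 0)))))"
    and ?s5 = "sub (shift (Suc (Suc (Suc (Suc (Suc 0))))))"
  let ?C = "Pi (Eq (?s2 Y) (App (?s2 h) (Var 1)) (App (?s2 k) (Var 1)))
    (Pi (Eq (Eq (?s3 Y) (App (?s3 h) (?s3 x)) (App (?s3 k) (Var 2)))
         (concat_path (?s3 Y) (App (?s3 h) (?s3 x)) (App (?s3 k) (?s3 x)) (App (?s3 k) (Var 2)) (?s3 a) (ap (?s3 X) (?s3 Y) (?s3 k) (?s3 x) (Var 2) (Var 1)))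
         (concat_path (?s3 Y) (App (?s3 h) (?s3 x)) (App (?s3 h) (Var 2)) (App (?s3 k) (Var 2)) (ap (?s3 X) (?s3 Y) (?s3 h) (?s3 x) (Var 2) (Var 1)) (Var 0)))
      (Eq (Eq (?s4 Y) (App (?s4 h) (Var 3)) (App (?s4 k) (Var 3)))
         (transport (?s4 X) (Eq (?s5 Y) (App (?s5 h) (Var 0)) (App (?s5 k) (Var 0))) (?s4 x) (Var 3) (Var 2) (?s4 a)) (Var 1)))"
  have g: "\<turnstile> X # \<Gamma>" by (rule wty_ctx[OF X])
  have C: "wty (Eq (?s1 X) (?s1 x) (Var 0) # X # \<Gamma>) ?C"
    apply (simp only: nf)
    by (assumption | rule g X Y x a h k tc has_concat_path has_ap has_transport | simp only: nf | rule refl)+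
  let ?W = "Eq Y (App h x) (App k x)"
  let ?H = "Eq (Eq (?s1 Y) (App (?s1 h) (?s1 x)) (App (?s1 k) (?s1 x)))
         (concat_path (?s1 Y) (App (?s1 h) (?s1 x)) (App (?s1 k) (?s1 x)) (App (?s1 k) (?s1 x)) (?s1 a) (ap (?s1 X) (?s1 Y) (?s1 k) (?s1 x) (?s1 x) (Refl (?s1 x))))
         (concat_path (?s1 Y) (App (?s1 h) (?s1 x)) (App (?s1 h) (?s1 x)) (App (?s1 k) (?s1 x)) (ap (?s1 X) (?s1 Y) (?s1 h) (?s1 x) (?s1 x) (Refl (?s1 x))) (Var 0))"
  have W: "wty \<Gamma> ?W" by (rule hasD[OF a])
  have gW: "\<turnstile> ?W # \<Gamma>" by (rule wty_ctx[OF W])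
  have H: "wty (?W # \<Gamma>) ?H"
    by (assumption | rule gW X Y x a h k tc has_concat_path has_ap | simp only: nf | rule refl)+
  have gH: "\<turnstile> ?H # ?W # \<Gamma>" by (rule wty_ctx[OF H])
  have s: "is_subst \<Gamma> (shift (Suc (Suc 0))) (?H # ?W # \<Gamma>)" by (rule is_subst_shift_2[OF gH])
  have hs: "has (?H # ?W # \<Gamma>) (?s2 h) (Pi (?s2 X) (?s1 (?s2 Y)))" by (rule has_sub[OF h s]) (simp only: nf)
  have ks: "has (?H # ?W # \<Gamma>) (?s2 k) (Pi (?s2 X) (?s1 (?s2 Y)))" by (rule has_sub[OF k s]) (simp only: nf)
  have as: "has (?H # ?W # \<Gamma>) (?s2 a) (Eq (?s2 Y) (App (?s2 h) (?s2 x)) (App (?s2 k) (?s2 x)))" by (rule has_sub[OF a s]) (simp only: nf)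
  have bs: "has (?H # ?W # \<Gamma>) (Var 1) (Eq (?s2 Y) (App (?s2 h) (?s2 x)) (App (?s2 k) (?s2 x)))"
    unfolding One_nat_def by (rule has_Var_1[OF gH]) (simp only: nf)
  have sq: "inh (?H # ?W # \<Gamma>) (Eq (Eq (?s2 Y) (App (?s2 h) (?s2 x)) (App (?s2 k) (?s2 x)))
     (concat_path (?s2 Y) (App (?s2 h) (?s2 x)) (App (?s2 k) (?s2 x)) (App (?s2 k) (?s2 x)) (?s2 a) (ap (?s2 X) (?s2 Y) (?s2 k) (?s2 x) (?s2 x) (Refl (?s2 x))))
         (concat_path (?s2 Y) (App (?s2 h) (?s2 x)) (App (?s2 h) (?s2 x)) (App (?s2 k) (?s2 x)) (ap (?s2 X) (?s2 Y) (?s2 h) (?s2 x) (?s2 x) (Refl (?s2 x))) (Var 1)))"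
    by (rule inhI[OF has_Var_0[OF gH]]) (simp only: nf)
  note r = transport_htpy_refl[OF wty_sub[OF Y s] hs ks has_sub[OF x s refl] as bs sq]
  have base: "inh \<Gamma> (sub (Refl x ;; x ;; Var) ?C)"
    using inh_Pi[OF W inh_Pi[OF H r]] by (simp only: nf)
  have "inh \<Gamma> (sub (e ;; y ;; Var) ?C)" by (rule path_induction[OF e C base refl])
  from this[simplified nf, THEN inh_App, OF chk_has[OF b refl] refl]
  have "inh \<Gamma> (Pi (Eq (Eq Y (App h x) (App k y)) (concat_path Y (App h x) (App k x) (App k y) a (ap X Y k x y e))
        (concat_path Y (App h x) (App h y) (App k y) (ap X Y h x y e) b))
     (?s1 (Eq (Eq Y (App h y) (App k y)) (transport X (Eq (\<up> Y) (App (\<up> h) (Var 0)) (App (\<up> k) (Var 0))) x y e a) b)))"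
    by (simp only: nf)
  from inh_mp[OF this sq0] show ?thesis .
qed

text \<open>
  Pushout induction into the family \<open>h x = k x\<close> with reflexivities as point clauses, followed by function
  extensionality. Since the maps agree judgmentally on points, the square to be filled over \<open>Glue\<close> has two
  trivial sides.
\<close>

lemma pushout_uniqueness:
  assumes sp: "span i \<Gamma> S A B u v" and Y: "wty \<Gamma> Y"
    and h: "has \<Gamma> h (Pi (Po S A B u v) (\<up> Y))" and k: "has \<Gamma> k (Pi (Po S A B u v) (\<up> Y))"
    and L: "teq (A # \<Gamma>) (App (\<up> h) (PoL (Var 0))) (App (\<up> k) (PoL (Var 0))) (\<up> Y)"
    and R: "teq (B # \<Gamma>) (App (\<up> h) (PoR (Var 0))) (App (\<up> k) (PoR (Var 0))) (\<up> Y)"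
    and G: "inh (S # \<Gamma>) (Eq (Eq (\<up> Y) (App (\<up> h) (PoL (App (\<up> u) (Var 0)))) (App (\<up> h) (PoR (App (\<up> v) (Var 0)))))
       (ap (\<up> (Po S A B u v)) (\<up> Y) (\<up> h)
          (PoL (App (\<up> u) (Var 0))) (PoR (App (\<up> v) (Var 0))) (Glue (Var 0)))
       (ap (\<up> (Po S A B u v)) (\<up> Y) (\<up> k)
          (PoL (App (\<up> u) (Var 0))) (PoR (App (\<up> v) (Var 0))) (Glue (Var 0))))"
  shows "inh \<Gamma> (Eq (Pi (Po S A B u v) (\<up> Y)) h k)"
proof -
  let ?w = "\<up>" let ?P = "Po S A B u v"
  let ?us = "App (?w u) (Var 0)" and ?vs = "App (?w v) (Var 0)"
  let ?C = "Eq (?w Y) (App (?w h) (Var 0)) (App (?w k) (Var 0))"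
  note w = span_wty[OF sp] wty_Po[OF sp]
  note g = wty_ctx[OF w(1)] wty_ctx[OF w(2)] wty_ctx[OF w(3)] wty_ctx[OF w(6)]
  note s1 = is_subst_shift_1[OF g(1)]
  note spS = span_sub[OF sp s1]
  have P': "wty (S # \<Gamma>) (?w ?P)" and Y': "wty (S # \<Gamma>) (?w Y)" using wty_sub[OF _ s1] w(6) Y by blast+
  have v0: "has (S # \<Gamma>) (Var 0) (?w S)" by (rule has_Var_0[OF g(1) refl, unfolded One_nat_def])
  have us: "has (S # \<Gamma>) ?us (?w A)" by (rule has_App[OF span_wty(4)[OF spS] refl chk_has[OF v0 refl]]) (simp only: nf)
  have vs: "has (S # \<Gamma>) ?vs (?w B)" by (rule has_App[OF span_wty(5)[OF spS] refl chk_has[OF v0 refl]]) (simp only: nf)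
  have e: "has (S # \<Gamma>) (Glue (Var 0)) (Eq (?w ?P) (PoL ?us) (PoR ?vs))"
    using has_Glue[OF spS chk_has[OF v0 refl] refl] by (simp only: sub.simps)
  have hs: "has (S # \<Gamma>) (?w h) (Pi (?w ?P) (?w (?w Y)))" by (rule has_sub[OF h s1]) (simp only: nf)
  have ks: "has (S # \<Gamma>) (?w k) (Pi (?w ?P) (?w (?w Y)))" by (rule has_sub[OF k s1]) (simp only: nf)
  have C: "wty (?P # \<Gamma>) ?C"
  proof -
    note s = is_subst_shift_1[OF g(4)]
    have "has (?P # \<Gamma>) (App (?w f) (Var 0)) (?w Y)" if "has \<Gamma> f (Pi ?P (?w Y))" for f
    proof -
      have f: "has (?P # \<Gamma>) (?w f) (Pi (?w ?P) (?w (?w Y)))" by (rule has_sub[OF that s]) (simp only: nf)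
      have v: "has (?P # \<Gamma>) (Var 0) (?w ?P)" by (rule has_Var_0[OF g(4) refl, unfolded One_nat_def])
      show ?thesis by (rule has_App[OF f refl chk_has[OF v refl]]) (simp only: nf)
    qed
    from wty_Eq[OF wty_sub[OF Y s] chk_has[OF this[OF h] refl] chk_has[OF this[OF k] refl]] show ?thesis .
  qed
  have sA: "is_subst (A # \<Gamma>) (?us ;; shift (Suc 0)) (S # \<Gamma>)" by (rule is_subst_cons[OF s1 g(2) refl chk_has[OF us refl]])
  have sB: "is_subst (B # \<Gamma>) (?vs ;; shift (Suc 0)) (S # \<Gamma>)" by (rule is_subst_cons[OF s1 g(3) refl chk_has[OF vs refl]])
  have Lu: "teq (S # \<Gamma>) (App (?w h) (PoL ?us)) (App (?w k) (PoL ?us)) (?w Y)" using teq_sub[OF L sA refl] by (simp only: nf)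
  have Rv: "teq (S # \<Gamma>) (App (?w h) (PoR ?vs)) (App (?w k) (PoR ?vs)) (?w Y)" using teq_sub[OF R sB refl] by (simp only: nf)
  have refl_conv: "has \<Delta> (Refl a) (Eq Z a b)" if "teq \<Delta> a b Z" for \<Delta> a b Z
    by (rule has_conv[OF has_Refl[OF teqD(1)[OF that]] tyeq_Eq[OF tyeq_refl[OF hasD[OF teqD(1)[OF that]]] teq_refl[OF teqD(1)[OF that]] that]])
  let ?l = "Refl (App (?w h) (PoL (Var 0)))" and ?r = "Refl (App (?w h) (PoR (Var 0)))"
  have l: "has (A # \<Gamma>) ?l (sub (PoL (Var 0) ;; shift 1) ?C)" and r: "has (B # \<Gamma>) ?r (sub (PoR (Var 0) ;; shift 1) ?C)"
    using refl_conv[OF L] refl_conv[OF R] by (simp_all only: nf)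
  let ?a = "App (?w h) (PoL ?us)" and ?b = "App (?w h) (PoR ?vs)" and ?a' = "App (?w k) (PoL ?us)" and ?b' = "App (?w k) (PoR ?vs)"
  let ?p = "ap (?w ?P) (?w Y) (?w h) (PoL ?us) (PoR ?vs) (Glue (Var 0))" and ?q = "ap (?w ?P) (?w Y) (?w k) (PoL ?us) (PoR ?vs) (Glue (Var 0))"
  note E = wty_EqD[OF inh_wty[OF G]]
  \<comment> \<open>Since \<open>h\<close> and \<open>k\<close> agree judgmentally on points, the square to fill has reflexivities as two of its sides.\<close>
  have q: "has (S # \<Gamma>) ?q (Eq (?w Y) ?a' ?b')"
    by (rule has_conv[OF E(3) tyeq_Eq[OF tyeq_refl[OF Y'] Lu Rv]])
  have q2: "has (S # \<Gamma>) ?q (Eq (?w Y) ?a ?b')"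
    by (rule has_conv[OF E(3) tyeq_Eq[OF tyeq_refl[OF Y'] teq_refl[OF teqD(1)[OF Lu]] Rv]])
  have T: "tyeq (S # \<Gamma>) (Eq (?w Y) ?a ?b) (Eq (?w Y) ?a ?b')"
    by (rule tyeq_Eq[OF tyeq_refl[OF Y'] teq_refl[OF teqD(1)[OF Lu]] Rv])
  have c1: "inh (S # \<Gamma>) (Eq (Eq (?w Y) ?a ?b') (concat_path (?w Y) ?a ?a' ?b' (Refl ?a) ?q) ?q)"
    by (rule inh_trans[OF inh_Eq_refl[OF concat_refl_ends[OF q Lu]] concat_refl_left[OF q2]])
  have c2: "teq (S # \<Gamma>) (concat_path (?w Y) ?a ?b ?b' ?p (Refl ?b)) ?p (Eq (?w Y) ?a ?b')"
    by (rule teq_concat_refl_end[OF E(2) Rv])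
  have G': "inh (S # \<Gamma>) (Eq (Eq (?w Y) ?a ?b') ?p ?q)"
    by (rule inh_conv[OF G tyeq_Eq[OF T teq_refl[OF E(2)] teq_refl[OF E(3)]]])
  have sq: "inh (S # \<Gamma>) (Eq (Eq (?w Y) ?a ?b') (concat_path (?w Y) ?a ?a' ?b' (Refl ?a) ?q) (concat_path (?w Y) ?a ?b ?b' ?p (Refl ?b)))"
    by (rule inh_trans[OF c1 inh_trans[OF inh_sym[OF G'] inh_sym[OF inh_Eq_refl[OF c2]]]])
  obtain gg where gg: "has (S # \<Gamma>) gg (glue_clause S A B u v ?C ?l ?r)"
    using transport_htpy[OF Y' hs ks e refl_conv[OF Lu] refl_conv[OF Rv] sq]
    unfolding inh_def glue_clause_def Let_def by (elim exE) (simp only: nf)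
  obtain t where "has (?P # \<Gamma>) t ?C" by (rule pushout_induction[OF sp C l r gg])
  then show ?thesis by (intro inh_funext[OF h k] inhI)
qed

section \<open>The universal property of pushouts\<close>

text \<open>
  Cocones under a general span, without the \<open>\<beta>\<close>-redexes that compositions of terms introduce.
\<close>

definition coconeT :: "tm \<Rightarrow> tm \<Rightarrow> tm \<Rightarrow> tm \<Rightarrow> tm \<Rightarrow> tm \<Rightarrow> tm" where
  "coconeT S A B u v Y = Sig (arr A Y) (Sig (wk 1 (arr B Y))
     (Pi (wk 2 S) (Eq (wk 3 Y) (App (Var 2) (App (wk 3 u) (Var 0))) (App (Var 1) (App (wk 3 v) (Var 0))))))"

definition glueT :: "tm \<Rightarrow> tm \<Rightarrow> tm \<Rightarrow> tm \<Rightarrow> tm \<Rightarrow> tm \<Rightarrow> tm" where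
  "glueT S u v Y p q = Pi S (Eq (wk 1 Y) (App (wk 1 p) (App (wk 1 u) (Var 0))) (App (wk 1 q) (App (wk 1 v) (Var 0))))"

text \<open>
  The cocone on \<open>Y\<close> induced by a map \<open>h\<close> out of the pushout.
\<close>

definition po_restrict :: "tm \<Rightarrow> tm \<Rightarrow> tm \<Rightarrow> tm \<Rightarrow> tm \<Rightarrow> tm \<Rightarrow> tm \<Rightarrow> tm" where
  "po_restrict S A B u v Y h = Pair (Lam A (App (wk 1 h) (PoL (Var 0)))) (Pair (Lam B (App (wk 1 h) (PoR (Var 0))))
     (Lam S (ap (wk 1 (Po S A B u v)) (wk 1 Y) (wk 1 h) (PoL (App (wk 1 u) (Var 0))) (PoR (App (wk 1 v) (Var 0))) (Glue (Var 0)))))"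

lemmas glueT_unfold = glueT_def[unfolded wk_sub One_nat_def]
lemmas po_restrict_unfold = po_restrict_def[unfolded wk_sub One_nat_def]

lemma sub_coconeT: "sub \<sigma> (coconeT S A B u v Y) = coconeT (sub \<sigma> S) (sub \<sigma> A) (sub \<sigma> B) (sub \<sigma> u) (sub \<sigma> v) (sub \<sigma> Y)"
  unfolding coconeT_def by (simp only: nf)
lemma sub_po_restrict: "sub \<sigma> (po_restrict S A B u v Y h) = po_restrict (sub \<sigma> S) (sub \<sigma> A) (sub \<sigma> B) (sub \<sigma> u) (sub \<sigma> v) (sub \<sigma> Y) (sub \<sigma> h)"
  unfolding po_restrict_def by (simp only: nf)

lemma coconeT_wty: assumes sp: "span i \<Gamma> S A B u v" and Y: "wty \<Gamma> Y" shows "wty \<Gamma> (coconeT S A B u v Y)"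
  unfolding coconeT_def apply (simp only: nf)
  by (assumption | rule span_wty[OF sp] Y wty_ctx'[OF Y] tc | simp only: nf | rule refl)+

lemma coconeT_proj: assumes c: "has \<Gamma> c (coconeT S A B u v Y)"
  shows "has \<Gamma> (Fst c) (Pi A (\<up> Y))" "has \<Gamma> (Fst (Snd c)) (Pi B (\<up> Y))" "has \<Gamma> (Snd (Snd c)) (glueT S u v Y (Fst c) (Fst (Snd c)))"
  by (insert c[simplified coconeT_def nf], simp_all only: glueT_def nf) (assumption | rule tc | simp only: nf)+

text \<open>
  Used for cocones whose vertex maps agree judgmentally, so that only their last components remain to be
  compared up to a path.
\<close>

lemma inh_Pair3:
  assumes W: "wty \<Gamma> (Sig A (Sig B C))" and c: "has \<Gamma> c (Sig A (Sig B C))"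
    and a: "teq \<Gamma> a (Fst c) A" and b: "teq \<Gamma> b (Fst (Snd c)) (sub (Fst c ;; Var) B)"
    and d: "inh \<Gamma> (Eq (sub (Fst (Snd c) ;; Fst c ;; Var) C) d (Snd (Snd c)))"
  shows "inh \<Gamma> (Eq (Sig A (Sig B C)) (Pair a (Pair b d)) c)"
proof -
  let ?w = "\<up>" and ?D = "sub (Fst (Snd c) ;; Fst c ;; Var) C" and ?T = "sub (Fst c ;; Var) (Sig B C)"
  note w = wty_SigD[OF W] note w2 = wty_SigD[OF w(2)]
  have c1: "has \<Gamma> (Fst c) A" by (rule has_Fst[OF c refl])
  have c2: "has \<Gamma> (Snd c) (Sig (sub (Fst c ;; Var) B) (sub (Var 0 ;; \<up> (Fst c) ;; shift (Suc 0)) C))"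
    by (rule has_Snd[OF c refl]) (simp only: nf)
  have c21: "has \<Gamma> (Fst (Snd c)) (sub (Fst c ;; Var) B)" by (rule has_Fst[OF c2 refl])
  have T: "wty \<Gamma> (Sig (sub (Fst c ;; Var) B) (sub (Var 0 ;; \<up> (Fst c) ;; shift (Suc 0)) C))" by (rule hasD[OF c2])
  note E = wty_EqD[OF inh_wty[OF d]]
  have gD: "\<turnstile> ?D # \<Gamma>" by (rule wty_ctx[OF E(1)])
  note s = is_subst_shift_1[OF gD]
  have Tw: "wty (?D # \<Gamma>) (?w (Sig A (Sig B C)))" by (rule wty_sub[OF W s])
  have v: "chk (?D # \<Gamma>) (Var 0) (?w ?D)" by (rule chk_has[OF has_Var_0[OF gD refl, unfolded One_nat_def] refl])
  have tw: "has (?D # \<Gamma>) (Pair (?w (Fst c)) (Pair (?w (Fst (Snd c))) (Var 0))) (?w (Sig A (Sig B C)))"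
  proof (rule chkD[OF _ Tw], simp only: sub.simps, rule chk_Pair)
    show "chk (?D # \<Gamma>) (Fst (?w c)) (?w A)" using chk_has[OF has_sub[OF c1 s refl] refl] by (simp only: sub.simps)
    show "inst (Sig (sub (up (shift (Suc 0))) B) (sub (up (up (shift (Suc 0)))) C)) (Fst (?w c)) = ?w (Sig (sub (Fst c ;; Var) B) (sub (Var 0 ;; \<up> (Fst c) ;; shift (Suc 0)) C))"
      by (simp only: nf)
    show "chk (?D # \<Gamma>) (Pair (Fst (Snd (?w c))) (Var 0)) (?w (Sig (sub (Fst c ;; Var) B) (sub (Var 0 ;; \<up> (Fst c) ;; shift (Suc 0)) C)))"
      apply (simp only: sub.simps, rule chk_Pair)
      using chk_has[OF has_sub[OF c21 s refl] refl] apply (simp only: sub.simps)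
       apply (rule refl)
      using v by (simp only: nf)
  qed
  have 1: "inh \<Gamma> (Eq (Sig A (Sig B C)) (Pair (Fst c) (Pair (Fst (Snd c)) d)) (Pair (Fst c) (Pair (Fst (Snd c)) (Snd (Snd c)))))"
    using inh_ap[OF d tw W] by (simp only: nf simp_thms)
  note e1 = triple_eta[OF c]
  have d1: "teq \<Gamma> (Pair (Fst (Snd c)) d) (Pair b d) (Sig (sub (Fst c ;; Var) B) (sub (Var 0 ;; \<up> (Fst c) ;; shift (Suc 0)) C))"
    by (rule teq_Pair[OF T teq_sym[OF b] _ teq_refl[OF E(2)]]) (simp only: nf)
  have d2: "teq \<Gamma> (Pair (Fst c) (Pair (Fst (Snd c)) d)) (Pair a (Pair b d)) (Sig A (Sig B C))"
    by (rule teq_Pair[OF W teq_sym[OF a] _ d1]) (simp only: nf)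
  show ?thesis
    by (rule inh_trans[OF inh_sym[OF inh_Eq_refl[OF d2]] inh_trans[OF 1 inh_Eq_refl[OF e1]]])
qed

lemma has_open_app: assumes f: "has \<Gamma> f (Pi Q T)" shows "has (Q # \<Gamma>) (App (\<up> f) (Var 0)) T"
proof -
  note gQ = wty_ctx[OF wty_PiD(1)[OF hasD[OF f]]]
  have f: "has (Q # \<Gamma>) (\<up> f) (Pi (\<up> Q) (sub (up (shift (Suc 0))) T))" by (rule has_sub[OF f is_subst_shift_1[OF gQ]]) (simp only: nf)
  show ?thesis by (rule has_App[OF f refl chk_has[OF has_Var_0[OF gQ refl]]]) (simp_all only: nf)
qed

lemma pushout_map:
  assumes sp: "span i \<Gamma> S A B u v" and Y: "wty \<Gamma> Y" and c: "has \<Gamma> c (coconeT S A B u v Y)"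
  obtains G where "has \<Gamma> G (Pi (Po S A B u v) (\<up> Y))"
    "teq (A # \<Gamma>) (App (\<up> G) (PoL (Var 0))) (App (\<up> (Fst c)) (Var 0)) (\<up> Y)"
    "teq (B # \<Gamma>) (App (\<up> G) (PoR (Var 0))) (App (\<up> (Fst (Snd c))) (Var 0)) (\<up> Y)"
    "inh (S # \<Gamma>) (Eq (Eq (\<up> Y) (App (\<up> (Fst c)) (App (\<up> u) (Var 0))) (App (\<up> (Fst (Snd c))) (App (\<up> v) (Var 0))))
       (ap (\<up> (Po S A B u v)) (\<up> Y) (\<up> G)
          (PoL (App (\<up> u) (Var 0))) (PoR (App (\<up> v) (Var 0))) (Glue (Var 0))) (App (\<up> (Snd (Snd c))) (Var 0)))"
proof -
  let ?w = "\<up>" and ?P = "Po S A B u v"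
  note w = span_wty[OF sp] wty_Po[OF sp]
  note g = wty_ctx[OF w(1)] wty_ctx[OF w(2)] wty_ctx[OF w(3)] wty_ctx[OF w(6)]
  note cp = coconeT_proj[OF c]
  have p: "has (A # \<Gamma>) (App (?w (Fst c)) (Var 0)) (?w Y)" and q: "has (B # \<Gamma>) (App (?w (Fst (Snd c))) (Var 0)) (?w Y)"
    and H: "has (S # \<Gamma>) (App (?w (Snd (Snd c))) (Var 0)) (Eq (?w Y) (App (?w (Fst c)) (App (?w u) (Var 0))) (App (?w (Fst (Snd c))) (App (?w v) (Var 0))))"
    using has_open_app[OF cp(1)] has_open_app[OF cp(2)] has_open_app[OF cp(3)[simplified glueT_def nf]] by (simp_all only: nf)
  have H': "has (S # \<Gamma>) (App (?w (Snd (Snd c))) (Var 0)) (Eq (?w Y) (sub (App (?w u) (Var 0) ;; shift (Suc 0)) (App (?w (Fst c)) (Var 0)))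
      (sub (App (?w v) (Var 0) ;; shift (Suc 0)) (App (?w (Fst (Snd c))) (Var 0))))" using H by (simp only: nf)
  obtain R where R: "has (?P # \<Gamma>) R (?w Y)"
    "teq (A # \<Gamma>) (sub (PoL (Var 0) ;; shift (Suc 0)) R) (App (?w (Fst c)) (Var 0)) (?w Y)"
    "teq (B # \<Gamma>) (sub (PoR (Var 0) ;; shift (Suc 0)) R) (App (?w (Fst (Snd c))) (Var 0)) (?w Y)"
    and b: "inh (S # \<Gamma>) (Eq (Eq (?w Y) (sub (App (?w u) (Var 0) ;; shift (Suc 0)) (App (?w (Fst c)) (Var 0))) (sub (App (?w v) (Var 0) ;; shift (Suc 0)) (App (?w (Fst (Snd c))) (Var 0))))
       (ap (?w ?P) (?w Y) (?w (Lam ?P R)) (PoL (App (?w u) (Var 0))) (PoR (App (?w v) (Var 0))) (Glue (Var 0))) (App (?w (Snd (Snd c))) (Var 0)))"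
    by (rule pushout_recursion[OF sp Y p q H'])
  show thesis
  proof (rule that[of "Lam ?P R"])
    show "has \<Gamma> (Lam ?P R) (Pi ?P (?w Y))" by (rule has_Lam[OF w(6) R(1)])
    have vA: "has (A # \<Gamma>) (Var 0) (?w A)" and vB: "has (B # \<Gamma>) (Var 0) (?w B)"
      using has_Var_0[OF g(2) refl] has_Var_0[OF g(3) refl] by (simp_all only: nf)
    have xA: "has (A # \<Gamma>) (PoL (Var 0)) (?w ?P)"
      using has_PoL[OF span_sub[OF sp is_subst_shift_1[OF g(2)]] chk_has[OF vA refl]] by (simp only: sub.simps)
    have xB: "has (B # \<Gamma>) (PoR (Var 0)) (?w ?P)"
      using has_PoR[OF span_sub[OF sp is_subst_shift_1[OF g(3)]] chk_has[OF vB refl]] by (simp only: sub.simps)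
    show "teq (A # \<Gamma>) (App (?w (Lam ?P R)) (PoL (Var 0))) (App (?w (Fst c)) (Var 0)) (?w Y)"
      by (rule teq_trans[OF Lam_beta[OF R(1) is_subst_shift_1[OF g(2)] xA] R(2)])
    show "teq (B # \<Gamma>) (App (?w (Lam ?P R)) (PoR (Var 0))) (App (?w (Fst (Snd c))) (Var 0)) (?w Y)"
      by (rule teq_trans[OF Lam_beta[OF R(1) is_subst_shift_1[OF g(3)] xB] R(3)])
  qed (use b in \<open>simp only: nf\<close>)
qed

lemma has_coconeT:
  assumes sp: "span i \<Gamma> S A B u v" and Y: "wty \<Gamma> Y" and a: "has \<Gamma> a (Pi A (\<up> Y))" and b: "has \<Gamma> b (Pi B (\<up> Y))"
    and d: "has \<Gamma> d (glueT S u v Y a b)"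
  shows "has \<Gamma> (Pair a (Pair b d)) (coconeT S A B u v Y)"
proof -
  note W = coconeT_wty[OF sp Y, unfolded coconeT_def]
  show ?thesis unfolding coconeT_def
    by (rule has_triple[OF W]) (use a b d in \<open>simp_all only: glueT_def nf\<close>)
qed

lemma inh_Eq_coconeT:
  assumes sp: "span i \<Gamma> S A B u v" and Y: "wty \<Gamma> Y" and c: "has \<Gamma> c (coconeT S A B u v Y)"
    and a: "teq \<Gamma> a (Fst c) (Pi A (\<up> Y))" and b: "teq \<Gamma> b (Fst (Snd c)) (Pi B (\<up> Y))"
    and d: "inh \<Gamma> (Eq (glueT S u v Y (Fst c) (Fst (Snd c))) d (Snd (Snd c)))"
  shows "inh \<Gamma> (Eq (coconeT S A B u v Y) (Pair a (Pair b d)) c)"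
proof -
  note W = coconeT_wty[OF sp Y, unfolded coconeT_def]
  show ?thesis unfolding coconeT_def
    by (rule inh_Pair3[OF W c[unfolded coconeT_def]]) (use a b d in \<open>simp_all only: glueT_def nf\<close>)
qed

context
  fixes i \<Gamma> S A B u v Y h
  assumes sp: "span i \<Gamma> S A B u v" and Y: "wty \<Gamma> Y" and h: "has \<Gamma> h (Pi (Po S A B u v) (\<up> Y))"
begin

abbreviation (input) "l1 \<equiv> Lam A (App (\<up> h) (PoL (Var 0)))"
abbreviation (input) "l2 \<equiv> Lam B (App (\<up> h) (PoR (Var 0)))"
abbreviation (input) "us \<equiv> App (\<up> u) (Var 0)"
abbreviation (input) "vs \<equiv> App (\<up> v) (Var 0)"
abbreviation (input) "aph \<equiv> ap (\<up> (Po S A B u v)) (\<up> Y) (\<up> h) (PoL us) (PoR vs) (Glue (Var 0))"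

lemma po_restrict_parts:
  shows l1: "has (A # \<Gamma>) (App (\<up> h) (PoL (Var 0))) (\<up> Y)"
    and l2: "has (B # \<Gamma>) (App (\<up> h) (PoR (Var 0))) (\<up> Y)"
    and aph: "has (S # \<Gamma>) aph (Eq (\<up> Y) (App (\<up> h) (PoL us)) (App (\<up> h) (PoR vs)))"
    and l3T: "tyeq (S # \<Gamma>) (Eq (\<up> Y) (App (\<up> h) (PoL us)) (App (\<up> h) (PoR vs)))
         (Eq (\<up> Y) (App (\<up> l1) us) (App (\<up> l2) vs))"
proof -
  let ?w = "\<up>" and ?P = "Po S A B u v"
  note w = span_wty[OF sp] wty_Po[OF sp]
  note g = wty_ctx[OF w(1)] wty_ctx[OF w(2)] wty_ctx[OF w(3)]
  have vA: "has (A # \<Gamma>) (Var 0) (?w A)" and vB: "has (B # \<Gamma>) (Var 0) (?w B)" and vS: "has (S # \<Gamma>) (Var 0) (?w S)"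
    using has_Var_0[OF g(2) refl] has_Var_0[OF g(3) refl] has_Var_0[OF g(1) refl] by (simp_all only: nf)
  note s = is_subst_shift_1[OF g(1)] note spS = span_sub[OF sp s]
  have us: "has (S # \<Gamma>) us (?w A)" by (rule has_App[OF span_wty(4)[OF spS] refl chk_has[OF vS refl]]) (simp only: nf)
  have vs: "has (S # \<Gamma>) vs (?w B)" by (rule has_App[OF span_wty(5)[OF spS] refl chk_has[OF vS refl]]) (simp only: nf)
  have x: "has (S # \<Gamma>) (PoL us) (?w ?P)" using has_PoL[OF spS chk_has[OF us refl]] by (simp only: sub.simps)
  have y: "has (S # \<Gamma>) (PoR vs) (?w ?P)" using has_PoR[OF spS chk_has[OF vs refl]] by (simp only: sub.simps)
  have e: "has (S # \<Gamma>) (Glue (Var 0)) (Eq (?w ?P) (PoL us) (PoR vs))"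
    using has_Glue[OF spS chk_has[OF vS refl] refl] by (simp only: sub.simps)
  have xA: "has (A # \<Gamma>) (PoL (Var 0)) (?w ?P)"
    using has_PoL[OF span_sub[OF sp is_subst_shift_1[OF g(2)]] chk_has[OF vA refl]] by (simp only: sub.simps)
  have xB: "has (B # \<Gamma>) (PoR (Var 0)) (?w ?P)"
    using has_PoR[OF span_sub[OF sp is_subst_shift_1[OF g(3)]] chk_has[OF vB refl]] by (simp only: sub.simps)
  have hw: "has (Q # \<Gamma>) (?w h) (Pi (?w ?P) (?w (?w Y)))" if "\<turnstile> Q # \<Gamma>" for Q
    by (rule has_sub[OF h is_subst_shift_1[OF that]]) (simp only: nf)
  show 1: "has (A # \<Gamma>) (App (?w h) (PoL (Var 0))) (?w Y)" by (rule has_App[OF hw[OF g(2)] refl chk_has[OF xA refl]]) (simp only: nf)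
  show 2: "has (B # \<Gamma>) (App (?w h) (PoR (Var 0))) (?w Y)" by (rule has_App[OF hw[OF g(3)] refl chk_has[OF xB refl]]) (simp only: nf)
  show "has (S # \<Gamma>) aph (Eq (?w Y) (App (?w h) (PoL us)) (App (?w h) (PoR vs)))"
    by (rule has_ap[OF wty_sub[OF w(6) s] wty_sub[OF Y s] chk_has[OF hw[OF g(1)] refl] chk_has[OF x refl] chk_has[OF y refl] chk_has[OF e refl] refl])
  have b1: "teq (S # \<Gamma>) (App (?w l1) us) (App (?w h) (PoL us)) (?w Y)"
    using Lam_beta[OF 1 s us] by (simp only: nf)
  have b2: "teq (S # \<Gamma>) (App (?w l2) vs) (App (?w h) (PoR vs)) (?w Y)"
    using Lam_beta[OF 2 s vs] by (simp only: nf)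
  show "tyeq (S # \<Gamma>) (Eq (?w Y) (App (?w h) (PoL us)) (App (?w h) (PoR vs))) (Eq (?w Y) (App (?w l1) us) (App (?w l2) vs))"
    by (rule tyeq_Eq[OF tyeq_refl[OF wty_sub[OF Y s]] teq_sym[OF b1] teq_sym[OF b2]])
qed

lemma has_po_restrict: "has \<Gamma> (po_restrict S A B u v Y h) (coconeT S A B u v Y)"
proof -
  note w = span_wty[OF sp]
  have W: "wty \<Gamma> (coconeT S A B u v Y)" by (rule coconeT_wty[OF sp Y])
  have 3: "has \<Gamma> (Lam S aph) (glueT S u v Y l1 l2)"
    unfolding glueT_def wk_sub One_nat_def by (rule has_Lam[OF w(1) has_conv[OF aph l3T]])
  show ?thesis unfolding po_restrict_def wk_sub One_nat_def
    by (rule has_coconeT[OF sp Y has_Lam[OF w(2) l1] has_Lam[OF w(3) l2] 3])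
qed

end

lemma coconeT_beta:
  assumes sp: "span i \<Gamma> S A B u v" and Y: "wty \<Gamma> Y" and a: "has \<Gamma> a (Pi A (\<up> Y))" and b: "has \<Gamma> b (Pi B (\<up> Y))"
    and d: "has \<Gamma> d (glueT S u v Y a b)"
  shows "teq \<Gamma> (Fst (Pair a (Pair b d))) a (Pi A (\<up> Y))"
    and "teq \<Gamma> (Fst (Snd (Pair a (Pair b d)))) b (Pi B (\<up> Y))"
    and "teq \<Gamma> (Snd (Snd (Pair a (Pair b d)))) d (glueT S u v Y a b)"
proof -
  note W = coconeT_wty[OF sp Y, unfolded coconeT_def]
  have a': "has \<Gamma> a (arr A Y)" and b': "has \<Gamma> b (sub (a ;; Var) (wk 1 (arr B Y)))"
    and d': "has \<Gamma> d (sub (b ;; a ;; Var) (Pi (wk 2 S) (Eq (wk 3 Y) (App (Var 2) (App (wk 3 u) (Var 0))) (App (Var 1) (App (wk 3 v) (Var 0))))))"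
    using a b d by (simp_all only: nf glueT_def)
  note T = triple_fst[OF W a' b' d'] triple_snd[OF W a' b' d'] triple_trd[OF W a' b' d']
  show "teq \<Gamma> (Fst (Pair a (Pair b d))) a (Pi A (\<up> Y))"
    "teq \<Gamma> (Fst (Snd (Pair a (Pair b d)))) b (Pi B (\<up> Y))"
    "teq \<Gamma> (Snd (Snd (Pair a (Pair b d)))) d (glueT S u v Y a b)"
    using T by (simp_all only: nf glueT_def)
qed

lemma teq_open_beta:
  assumes f: "teq \<Gamma> f (Lam Q t) (Pi Q T)" and t: "has (Q # \<Gamma>) t T"
  shows "teq (Q # \<Gamma>) (App (\<up> f) (Var 0)) t T"
proof -
  note Q = wty_PiD(1)[OF hasD[OF teqD(1)[OF f]]] note g = wty_ctx[OF Q]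
  have f': "teq (Q # \<Gamma>) (\<up> f) (\<up> (Lam Q t)) (Pi (\<up> Q) (sub (up (shift (Suc 0))) T))"
    by (rule teq_sub[OF f is_subst_shift_1[OF g]]) (simp only: sub.simps)
  have v: "teq (Q # \<Gamma>) (Var 0) (Var 0) (\<up> Q)" by (rule teq_refl[OF has_Var_0[OF g refl, unfolded One_nat_def]])
  have "teq (Q # \<Gamma>) (App (\<up> f) (Var 0)) (App (\<up> (Lam Q t)) (Var 0)) T"
    by (rule teq_App[OF f' refl v]) (simp only: nf)
  from teq_trans[OF this teq_wk_beta[OF Q t]] show ?thesis .
qed

text \<open>
  The map given by recursion is a right inverse by the computation rules. It is also a left inverse: the
  recursion applied to the cocone of \<open>h\<close> agrees with \<open>h\<close> on points and on \<open>Glue\<close>, so uniqueness applies.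
\<close>

lemma pushout_open_equiv:
  assumes sp: "span i \<Gamma> S A B u v" and Y: "wty \<Gamma> Y"
  shows "open_equiv \<Gamma> (Pi (Po S A B u v) (\<up> Y)) (coconeT S A B u v Y)
     (po_restrict (\<up> S) (\<up> A) (\<up> B) (\<up> u) (\<up> v) (\<up> Y) (Var 0))"
proof -
  let ?w = "\<up>" and ?P = "Po S A B u v" and ?K = "coconeT S A B u v Y"
  let ?XY = "Pi ?P (?w Y)"
  let ?F = "po_restrict (?w S) (?w A) (?w B) (?w u) (?w v) (?w Y) (Var 0)"
  note P = wty_Po[OF sp]
  have K: "wty \<Gamma> ?K" by (rule coconeT_wty[OF sp Y])
  have XY: "wty \<Gamma> ?XY" by (rule arr_wty[OF P Y])
  note gK = wty_ctx[OF K] and gX = wty_ctx[OF XY]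
  note sK = is_subst_shift_1[OF gK] and sX = is_subst_shift_1[OF gX]
  note spK = span_sub[OF sp sK] and spX = span_sub[OF sp sX] and YK = wty_sub[OF Y sK] and YX = wty_sub[OF Y sX]
  have hX: "has (?XY # \<Gamma>) (Var 0) (Pi (Po (?w S) (?w A) (?w B) (?w u) (?w v)) (?w (?w Y)))" by (rule has_Var_0[OF gX]) (simp only: nf)
  have F: "has (?XY # \<Gamma>) ?F (coconeT (?w S) (?w A) (?w B) (?w u) (?w v) (?w Y))" by (rule has_po_restrict[OF spX YX hX])
  have FK: "has (?XY # \<Gamma>) ?F (?w ?K)" using F by (simp only: sub_coconeT)
  have cK: "has (?K # \<Gamma>) (Var 0) (coconeT (?w S) (?w A) (?w B) (?w u) (?w v) (?w Y))" by (rule has_Var_0[OF gK]) (simp only: sub_coconeT nums)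
  obtain G where G: "has (?K # \<Gamma>) G (Pi (Po (?w S) (?w A) (?w B) (?w u) (?w v)) (?w (?w Y)))"
    and GL: "teq (?w A # ?K # \<Gamma>) (App (?w G) (PoL (Var 0))) (App (?w (Fst (Var 0))) (Var 0)) (?w (?w Y))"
    and GR: "teq (?w B # ?K # \<Gamma>) (App (?w G) (PoR (Var 0))) (App (?w (Fst (Snd (Var 0)))) (Var 0)) (?w (?w Y))"
    and GG: "inh (?w S # ?K # \<Gamma>) (Eq (Eq (?w (?w Y)) (App (?w (Fst (Var 0))) (App (?w (?w u)) (Var 0))) (App (?w (Fst (Snd (Var 0)))) (App (?w (?w v)) (Var 0))))
       (ap (?w (Po (?w S) (?w A) (?w B) (?w u) (?w v))) (?w (?w Y)) (?w G)
          (PoL (App (?w (?w u)) (Var 0))) (PoR (App (?w (?w v)) (Var 0))) (Glue (Var 0))) (App (?w (Snd (Snd (Var 0)))) (Var 0)))"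
    by (rule pushout_map[OF spK YK cK])
  have GX: "has (?K # \<Gamma>) G (?w ?XY)" using G by (simp only: nf)
  note wK = span_wty[OF spK] note wX = span_wty[OF spX]
  have eq_c: "inh (?K # \<Gamma>) (Eq (?w ?K) (po_restrict (?w S) (?w A) (?w B) (?w u) (?w v) (?w Y) G) (Var 0))"
  proof -
    note cp = coconeT_proj[OF cK]
    have 1: "teq (?K # \<Gamma>) (Lam (?w A) (App (?w G) (PoL (Var 0)))) (Fst (Var 0)) (Pi (?w A) (?w (?w Y)))"
      by (rule teq_trans[OF teq_Lam[OF wK(2) GL] teq_eta_Pi[OF cp(1)]])
    have 2: "teq (?K # \<Gamma>) (Lam (?w B) (App (?w G) (PoR (Var 0)))) (Fst (Snd (Var 0))) (Pi (?w B) (?w (?w Y)))"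
      by (rule teq_trans[OF teq_Lam[OF wK(3) GR] teq_eta_Pi[OF cp(2)]])
    note E = wty_EqD[OF inh_wty[OF GG]]
    have 3: "inh (?K # \<Gamma>) (Eq (glueT (?w S) (?w u) (?w v) (?w Y) (Fst (Var 0)) (Fst (Snd (Var 0))))
       (Lam (?w S) (ap (?w (Po (?w S) (?w A) (?w B) (?w u) (?w v))) (?w (?w Y)) (?w G)
          (PoL (App (?w (?w u)) (Var 0))) (PoR (App (?w (?w v)) (Var 0))) (Glue (Var 0)))) (Snd (Snd (Var 0))))"
      unfolding glueT_def wk_sub One_nat_def
      by (rule inh_trans[OF inh_funext_Lam[OF wK(1) E(2,3) GG] inh_Eq_refl[OF teq_eta_Pi[OF cp(3)[unfolded glueT_def wk_sub One_nat_def]]]])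
    show ?thesis unfolding sub_coconeT po_restrict_def wk_sub One_nat_def
      by (rule inh_Eq_coconeT[OF spK YK cK 1 2 3])
  qed
  have sec: "inh (?K # \<Gamma>) (Eq (?w ?K) (sub (G ;; shift (Suc 0)) ?F) (Var 0))"
    using eq_c by (simp only: sub_po_restrict nf)
  let ?s = "?F ;; shift (Suc 0)"
  have ss: "is_subst (?K # \<Gamma>) ?s (?XY # \<Gamma>)" by (rule is_subst_cons[OF sX gK refl chk_has[OF FK refl]])
  let ?G = "sub ?s G"
  have "inh (?XY # \<Gamma>) (Eq (Pi (Po (?w S) (?w A) (?w B) (?w u) (?w v)) (?w (?w Y))) ?G (Var 0))"
  proof (rule pushout_uniqueness[OF spX YX _ hX])
    show "has (?XY # \<Gamma>) ?G (Pi (Po (?w S) (?w A) (?w B) (?w u) (?w v)) (?w (?w Y)))"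
      by (rule has_sub[OF G ss]) (simp only: nf)
    note p = po_restrict_parts[OF spX YX hX]
    note l3 = has_Lam[OF wX(1) has_conv[OF p(3,4)]]
    note beta = coconeT_beta[OF spX YX has_Lam[OF wX(2) p(1)] has_Lam[OF wX(3) p(2)] l3[folded glueT_unfold], folded po_restrict_unfold]
    have 1: "teq (?w A # ?XY # \<Gamma>) (App (?w ?G) (PoL (Var 0))) (App (?w (Fst ?F)) (Var 0)) (?w (?w Y))"
      using teq_sub[OF GL is_subst_upT[OF ss wK(2)] refl] by (simp only: nf)
    have 2: "teq (?w B # ?XY # \<Gamma>) (App (?w ?G) (PoR (Var 0))) (App (?w (Fst (Snd ?F))) (Var 0)) (?w (?w Y))"
      using teq_sub[OF GR is_subst_upT[OF ss wK(3)] refl] by (simp only: nf)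
    show L: "teq (?w A # ?XY # \<Gamma>) (App (?w ?G) (PoL (Var 0))) (App (?w (Var 0)) (PoL (Var 0))) (?w (?w Y))"
      by (rule teq_trans[OF 1 teq_open_beta[OF beta(1) p(1)]])
    show R: "teq (?w B # ?XY # \<Gamma>) (App (?w ?G) (PoR (Var 0))) (App (?w (Var 0)) (PoR (Var 0))) (?w (?w Y))"
      by (rule teq_trans[OF 2 teq_open_beta[OF beta(2) p(2)]])
    let ?us = "App (?w (?w u)) (Var 0)" and ?vs = "App (?w (?w v)) (Var 0)" and ?\<Delta> = "?w S # ?XY # \<Gamma>"
    note gS = wty_ctx[OF wX(1)] and gA = wty_ctx[OF wX(2)] and gB = wty_ctx[OF wX(3)] note sS = is_subst_shift_1[OF gS] note spS = span_sub[OF spX sS]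
    have vS: "has ?\<Delta> (Var 0) (?w (?w S))" by (rule has_Var_0[OF gS refl, unfolded One_nat_def])
    have us: "has ?\<Delta> ?us (?w (?w A))" by (rule has_App[OF span_wty(4)[OF spS] refl chk_has[OF vS refl]]) (simp only: nf)
    have vs: "has ?\<Delta> ?vs (?w (?w B))" by (rule has_App[OF span_wty(5)[OF spS] refl chk_has[OF vS refl]]) (simp only: nf)
    have sA: "is_subst (?w A # ?XY # \<Gamma>) (?us ;; shift (Suc 0)) ?\<Delta>" by (rule is_subst_cons[OF sS gA refl chk_has[OF us refl]])
    have sB: "is_subst (?w B # ?XY # \<Gamma>) (?vs ;; shift (Suc 0)) ?\<Delta>" by (rule is_subst_cons[OF sS gB refl chk_has[OF vs refl]])
    have 1: "teq ?\<Delta> (App (?w ?G) (PoL ?us)) (App (?w (Fst ?F)) ?us) (?w (?w Y))" using teq_sub[OF 1 sA refl] by (simp only: nf)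
    have 2: "teq ?\<Delta> (App (?w ?G) (PoR ?vs)) (App (?w (Fst (Snd ?F))) ?vs) (?w (?w Y))" using teq_sub[OF 2 sB refl] by (simp only: nf)
    have L: "teq ?\<Delta> (App (?w ?G) (PoL ?us)) (App (?w (Var 0)) (PoL ?us)) (?w (?w Y))" using teq_sub[OF L sA refl] by (simp only: nf)
    have R: "teq ?\<Delta> (App (?w ?G) (PoR ?vs)) (App (?w (Var 0)) (PoR ?vs)) (?w (?w Y))" using teq_sub[OF R sB refl] by (simp only: nf)
    have Y2: "tyeq ?\<Delta> (?w (?w Y)) (?w (?w Y))" by (rule tyeq_refl[OF wty_sub[OF YX sS]])
    let ?T0 = "Eq (?w (?w Y)) (App (?w ?G) (PoL ?us)) (App (?w ?G) (PoR ?vs))"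
    have T1: "tyeq ?\<Delta> (Eq (?w (?w Y)) (App (?w (Fst ?F)) ?us) (App (?w (Fst (Snd ?F))) ?vs)) ?T0" by (rule tyeq_sym[OF tyeq_Eq[OF Y2 1 2]])
    have T2: "tyeq ?\<Delta> (Eq (?w (?w Y)) (App (?w (Var 0)) (PoL ?us)) (App (?w (Var 0)) (PoR ?vs))) ?T0" by (rule tyeq_sym[OF tyeq_Eq[OF Y2 L R]])
    have ap3: "teq ?\<Delta> (App (?w (Snd (Snd ?F))) (Var 0)) (ap (?w (Po (?w S) (?w A) (?w B) (?w u) (?w v))) (?w (?w Y)) (?w (Var 0)) (PoL ?us) (PoR ?vs) (Glue (Var 0))) ?T0"
      by (rule teq_conv[OF teq_conv[OF teq_open_beta[OF beta(3)[unfolded glueT_unfold] has_conv[OF p(3,4)]] tyeq_sym[OF p(4)]] T2])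
    have gl: "inh ?\<Delta> (Eq (Eq (?w (?w Y)) (App (?w (Fst ?F)) ?us) (App (?w (Fst (Snd ?F))) ?vs))
       (ap (?w (Po (?w S) (?w A) (?w B) (?w u) (?w v))) (?w (?w Y)) (?w ?G) (PoL ?us) (PoR ?vs) (Glue (Var 0))) (App (?w (Snd (Snd ?F))) (Var 0)))"
      using inh_sub[OF GG is_subst_upT[OF ss wK(1)] refl] by (simp only: nf)
    note E = wty_EqD[OF inh_wty[OF gl]]
    show "inh ?\<Delta> (Eq ?T0
       (ap (?w (Po (?w S) (?w A) (?w B) (?w u) (?w v))) (?w (?w Y)) (?w ?G) (PoL ?us) (PoR ?vs) (Glue (Var 0)))
       (ap (?w (Po (?w S) (?w A) (?w B) (?w u) (?w v))) (?w (?w Y)) (?w (Var 0)) (PoL ?us) (PoR ?vs) (Glue (Var 0))))"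
      by (rule inh_conv[OF gl tyeq_Eq[OF T1 teq_refl[OF E(2)] teq_conv[OF ap3 tyeq_sym[OF T1]]]])
  qed
  then have ret: "inh (?XY # \<Gamma>) (Eq (?w ?XY) (sub ?s G) (Var 0))" by (simp only: nf)
  show ?thesis unfolding open_equiv_def using K XY FK GX sec ret by blast
qed

section \<open>Postcomposition of cocones\<close>

text \<open>
  Postcomposition of a cocone on \<open>X\<close> with \<open>h : X \<rightarrow> Y\<close>. As an operation on cocones it preserves paths, which
  transfers the universal property from the cocone of the pushout to any cocone that is equal to it.
\<close>

definition post :: "tm \<Rightarrow> tm \<Rightarrow> tm \<Rightarrow> tm \<Rightarrow> tm \<Rightarrow> tm \<Rightarrow> tm \<Rightarrow> tm \<Rightarrow> tm \<Rightarrow> tm" where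
  "post S A B u v X Y h c = Pair (Lam A (App (wk 1 h) (App (wk 1 (Fst c)) (Var 0)))) (Pair (Lam B (App (wk 1 h) (App (wk 1 (Fst (Snd c))) (Var 0))))
     (Lam S (ap (wk 1 X) (wk 1 Y) (wk 1 h) (App (wk 1 (Fst c)) (App (wk 1 u) (Var 0))) (App (wk 1 (Fst (Snd c))) (App (wk 1 v) (Var 0)))
        (App (wk 1 (Snd (Snd c))) (Var 0)))))"

lemma sub_post: "sub \<sigma> (post S A B u v X Y h c) = post (sub \<sigma> S) (sub \<sigma> A) (sub \<sigma> B) (sub \<sigma> u) (sub \<sigma> v) (sub \<sigma> X) (sub \<sigma> Y) (sub \<sigma> h) (sub \<sigma> c)"
  unfolding post_def by (simp only: nf)

lemmas arr_unfold = arr_def[unfolded wk_sub One_nat_def]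

lemma teq_open_app: assumes f: "teq \<Gamma> f f' (Pi Q T)"
  shows "teq (Q # \<Gamma>) (App (\<up> f) (Var 0)) (App (\<up> f') (Var 0)) T"
proof -
  note g = wty_ctx[OF wty_PiD(1)[OF hasD[OF teqD(1)[OF f]]]]
  show ?thesis
    by (rule teq_App[OF teq_sub[OF f is_subst_shift_1[OF g] sub.simps(3)] refl teq_refl[OF has_Var_0[OF g refl, unfolded One_nat_def]]]) (simp only: nf)
qed

lemma teq_post:
  assumes sp: "span i \<Gamma> S A B u v" and X: "wty \<Gamma> X" and Y: "wty \<Gamma> Y" and h: "has \<Gamma> h (Pi X (\<up> Y))"
    and c: "has \<Gamma> c (coconeT S A B u v X)"
    and a: "teq (A # \<Gamma>) (App (\<up> (Fst c)) (Var 0)) a (\<up> X)"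
    and b: "teq (B # \<Gamma>) (App (\<up> (Fst (Snd c))) (Var 0)) b (\<up> X)"
    and x: "teq (S # \<Gamma>) (App (\<up> (Fst c)) (App (\<up> u) (Var 0))) x (\<up> X)"
    and y: "teq (S # \<Gamma>) (App (\<up> (Fst (Snd c))) (App (\<up> v) (Var 0))) y (\<up> X)"
    and e: "teq (S # \<Gamma>) (App (\<up> (Snd (Snd c))) (Var 0)) e
      (Eq (\<up> X) (App (\<up> (Fst c)) (App (\<up> u) (Var 0))) (App (\<up> (Fst (Snd c))) (App (\<up> v) (Var 0))))"
  shows "teq \<Gamma> (post S A B u v X Y h c) (Pair (Lam A (App (\<up> h) a)) (Pair (Lam B (App (\<up> h) b))
     (Lam S (ap (\<up> X) (\<up> Y) (\<up> h) x y e)))) (coconeT S A B u v Y)"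
proof -
  let ?w = "\<up>"
  let ?us = "App (?w u) (Var 0)" and ?vs = "App (?w v) (Var 0)" and ?p = "App (?w (Fst c)) (Var 0)" and ?q = "App (?w (Fst (Snd c))) (Var 0)"
  note w = span_wty[OF sp] note g = wty_ctx[OF w(1)] wty_ctx[OF w(2)] wty_ctx[OF w(3)]
  note sS = is_subst_shift_1[OF g(1)]
  have hw: "has (Q # \<Gamma>) (?w h) (Pi (?w X) (?w (?w Y)))" if "\<turnstile> Q # \<Gamma>" for Q
    by (rule has_sub[OF h is_subst_shift_1[OF that]]) (simp only: nf)
  have happ: "teq (Q # \<Gamma>) (App (?w h) z) (App (?w h) z') (?w Y)" if "teq (Q # \<Gamma>) z z' (?w X)" for Q z z'
    by (rule teq_App[OF teq_refl[OF hw[OF has_ctx[OF teqD(1)[OF that]]]] refl that]) (simp only: nf)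
  note W = coconeT_wty[OF sp Y, unfolded coconeT_def]
  have us: "has (S # \<Gamma>) ?us (?w A)" using has_open_app[OF w(4)] . have vs: "has (S # \<Gamma>) ?vs (?w B)" using has_open_app[OF w(5)] .
  let ?a0 = "Lam A (App (?w h) ?p)" and ?b0 = "Lam B (App (?w h) ?q)"
  have 1: "teq \<Gamma> ?a0 (Lam A (App (?w h) a)) (Pi A (?w Y))" by (rule teq_Lam[OF w(2) happ[OF a]])
  have 2: "teq \<Gamma> ?b0 (Lam B (App (?w h) b)) (Pi B (?w Y))" by (rule teq_Lam[OF w(3) happ[OF b]])
  have B1: "teq (S # \<Gamma>) (App (?w ?a0) ?us) (App (?w h) (App (?w (Fst c)) ?us)) (?w Y)"
    using Lam_beta[OF teqD(1)[OF happ[OF a]] sS us] by (simp only: nf)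
  have B2: "teq (S # \<Gamma>) (App (?w ?b0) ?vs) (App (?w h) (App (?w (Fst (Snd c))) ?vs)) (?w Y)"
    using Lam_beta[OF teqD(1)[OF happ[OF b]] sS vs] by (simp only: nf)
  note Xw = wty_sub[OF X sS] and Yw = wty_sub[OF Y sS]
  have T: "tyeq (S # \<Gamma>) (Eq (?w Y) (App (?w h) (App (?w (Fst c)) ?us)) (App (?w h) (App (?w (Fst (Snd c))) ?vs))) (Eq (?w Y) (App (?w ?a0) ?us) (App (?w ?b0) ?vs))"
    by (rule tyeq_sym[OF tyeq_Eq[OF tyeq_refl[OF Yw] B1 B2]])
  have 3: "teq \<Gamma> (Lam S (ap (?w X) (?w Y) (?w h) (App (?w (Fst c)) ?us) (App (?w (Fst (Snd c))) ?vs) (App (?w (Snd (Snd c))) (Var 0))))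
     (Lam S (ap (?w X) (?w Y) (?w h) x y e)) (glueT S u v Y ?a0 ?b0)"
    unfolding glueT_def wk_sub One_nat_def by (rule teq_Lam[OF w(1) teq_conv[OF teq_ap[OF Xw Yw hw[OF g(1)] x y e] T]])
  let ?T = "Sig (Pi B (\<up> Y)) (Pi (\<up> S) (Eq (sub (shift (Suc (Suc 0))) Y) (App (sub (shift (Suc (Suc 0))) ?a0) (App (sub (shift (Suc (Suc 0))) u) (Var 0)))
     (App (Var (Suc 0)) (App (sub (shift (Suc (Suc 0))) v) (Var 0)))))"
  have Ti: "inst (Sig (wk 1 (arr B Y)) (Pi (wk 2 S) (Eq (wk 3 Y) (App (Var 2) (App (wk 3 u) (Var 0))) (App (Var 1) (App (wk 3 v) (Var 0)))))) ?a0 = ?T"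
    by (simp only: nf)
  have T: "wty \<Gamma> ?T"
    using wty_sub[OF wty_SigD(2)[OF W] is_subst_cons[OF is_subst_Var[OF has_ctx[OF h]] wty_ctx[OF wty_SigD(1)[OF W]] _ chk_has[OF teqD(1)[OF 1]]]] Ti
    by (simp only: nf simp_thms)
  have 23: "teq \<Gamma> (Pair ?b0 (Lam S (ap (?w X) (?w Y) (?w h) (App (?w (Fst c)) ?us) (App (?w (Fst (Snd c))) ?vs) (App (?w (Snd (Snd c))) (Var 0)))))
      (Pair (Lam B (App (?w h) b)) (Lam S (ap (?w X) (?w Y) (?w h) x y e))) ?T"
    by (rule teq_Pair[OF T 2 _ 3]) (simp only: nf glueT_def)
  show ?thesis unfolding post_def coconeT_def wk_sub[of "Suc 0"] One_nat_def
    by (rule teq_Pair[OF W[unfolded wk_sub[of "Suc 0"] One_nat_def] 1[folded arr_unfold] Ti[unfolded wk_sub[of "Suc 0"] One_nat_def] 23])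
qed

lemma inh_post:
  assumes sp: "span i \<Gamma> S A B u v" and X: "wty \<Gamma> X" and Y: "wty \<Gamma> Y" and h: "has \<Gamma> h (Pi X (\<up> Y))"
    and e: "inh \<Gamma> (Eq (coconeT S A B u v X) c d)"
  shows "inh \<Gamma> (Eq (coconeT S A B u v Y) (post S A B u v X Y h c) (post S A B u v X Y h d))"
proof -
  let ?w = "\<up>"
  note K = wty_EqD(1)[OF inh_wty[OF e]] note g = wty_ctx[OF K] note s = is_subst_shift_1[OF g]
  note spK = span_sub[OF sp s]
  have cK: "has (coconeT S A B u v X # \<Gamma>) (Var 0) (coconeT (?w S) (?w A) (?w B) (?w u) (?w v) (?w X))"
    by (rule has_Var_0[OF g]) (simp only: sub_coconeT nums)
  have hK: "has (coconeT S A B u v X # \<Gamma>) (?w h) (Pi (?w X) (?w (?w Y)))" by (rule has_sub[OF h s]) (simp only: nf)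
  note cp = coconeT_proj[OF cK] and sw = span_wty[OF spK]
  note op = has_open_app[OF cp(1)] has_open_app[OF cp(2)] has_open_app[OF cp(3)[unfolded glueT_unfold]]
  note E = wty_EqD[OF hasD[OF op(3)]]
  have t: "has (coconeT S A B u v X # \<Gamma>) (post (?w S) (?w A) (?w B) (?w u) (?w v) (?w X) (?w Y) (?w h) (Var 0)) (?w (coconeT S A B u v Y))"
    unfolding sub_coconeT
    by (rule teqD(1)[OF teq_post[OF spK wty_sub[OF X s] wty_sub[OF Y s] hK cK teq_refl[OF op(1)] teq_refl[OF op(2)] teq_refl[OF E(2)] teq_refl[OF E(3)] teq_refl[OF op(3)]]])
  show ?thesis using inh_ap[OF e t coconeT_wty[OF sp Y]] by (simp only: sub_post nf simp_thms)
qed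

definition po_cocone :: "tm \<Rightarrow> tm \<Rightarrow> tm \<Rightarrow> tm" where
  "po_cocone S A B = Pair (Lam A (PoL (Var 0))) (Pair (Lam B (PoR (Var 0))) (Lam S (Glue (Var 0))))"

lemma po_cocone:
  assumes sp: "span i \<Gamma> S A B u v"
  shows has_po_cocone: "has \<Gamma> (po_cocone S A B) (coconeT S A B u v (Po S A B u v))"
    and post_po_cocone: "wty \<Gamma> Y \<Longrightarrow> has \<Gamma> h (Pi (Po S A B u v) (\<up> Y)) \<Longrightarrow>
      teq \<Gamma> (post S A B u v (Po S A B u v) Y h (po_cocone S A B)) (po_restrict S A B u v Y h) (coconeT S A B u v Y)"
proof -
  let ?w = "\<up>" and ?P = "Po S A B u v"
  let ?us = "App (?w u) (Var 0)" and ?vs = "App (?w v) (Var 0)"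
  note w = span_wty[OF sp] wty_Po[OF sp]
  note g = wty_ctx[OF w(1)] wty_ctx[OF w(2)] wty_ctx[OF w(3)]
  have vA: "has (A # \<Gamma>) (Var 0) (?w A)" and vB: "has (B # \<Gamma>) (Var 0) (?w B)" and vS: "has (S # \<Gamma>) (Var 0) (?w S)"
    using has_Var_0[OF g(2) refl] has_Var_0[OF g(3) refl] has_Var_0[OF g(1) refl] by (simp_all only: nf)
  note s = is_subst_shift_1[OF g(1)] note spS = span_sub[OF sp s]
  have us: "has (S # \<Gamma>) ?us (?w A)" using has_open_app[OF w(4)] . have vs: "has (S # \<Gamma>) ?vs (?w B)" using has_open_app[OF w(5)] .
  have e: "has (S # \<Gamma>) (Glue (Var 0)) (Eq (?w ?P) (PoL ?us) (PoR ?vs))"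
    using has_Glue[OF spS chk_has[OF vS refl] refl] by (simp only: sub.simps)
  have xA: "has (A # \<Gamma>) (PoL (Var 0)) (?w ?P)"
    using has_PoL[OF span_sub[OF sp is_subst_shift_1[OF g(2)]] chk_has[OF vA refl]] by (simp only: sub.simps)
  have xB: "has (B # \<Gamma>) (PoR (Var 0)) (?w ?P)"
    using has_PoR[OF span_sub[OF sp is_subst_shift_1[OF g(3)]] chk_has[OF vB refl]] by (simp only: sub.simps)
  note p = has_Lam[OF w(2) xA] and q = has_Lam[OF w(3) xB]
  have b1: "teq (S # \<Gamma>) (App (?w (Lam A (PoL (Var 0)))) ?us) (PoL ?us) (?w ?P)" using Lam_beta[OF xA s us] by (simp only: nf)
  have b2: "teq (S # \<Gamma>) (App (?w (Lam B (PoR (Var 0)))) ?vs) (PoR ?vs) (?w ?P)" using Lam_beta[OF xB s vs] by (simp only: nf)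
  have T: "tyeq (S # \<Gamma>) (Eq (?w ?P) (App (?w (Lam A (PoL (Var 0)))) ?us) (App (?w (Lam B (PoR (Var 0)))) ?vs)) (Eq (?w ?P) (PoL ?us) (PoR ?vs))"
    by (rule tyeq_Eq[OF tyeq_refl[OF wty_sub[OF w(6) s]] b1 b2])
  have e': "has (S # \<Gamma>) (Glue (Var 0)) (Eq (?w ?P) (App (?w (Lam A (PoL (Var 0)))) ?us) (App (?w (Lam B (PoR (Var 0)))) ?vs))"
    by (rule has_conv[OF e tyeq_sym[OF T]])
  have r: "has \<Gamma> (Lam S (Glue (Var 0))) (glueT S u v ?P (Lam A (PoL (Var 0))) (Lam B (PoR (Var 0))))"
    unfolding glueT_unfold by (rule has_Lam[OF w(1) e'])
  show c: "has \<Gamma> (po_cocone S A B) (coconeT S A B u v ?P)" unfolding po_cocone_def by (rule has_coconeT[OF sp w(6) p q r])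
  note beta = coconeT_beta[OF sp w(6) p q r, folded po_cocone_def]
  assume Y: "wty \<Gamma> Y" and h: "has \<Gamma> h (Pi ?P (?w Y))"
  have s1: "teq (S # \<Gamma>) (?w (Fst (po_cocone S A B))) (?w (Lam A (PoL (Var 0)))) (Pi (?w A) (?w (?w ?P)))"
    and s2: "teq (S # \<Gamma>) (?w (Fst (Snd (po_cocone S A B)))) (?w (Lam B (PoR (Var 0)))) (Pi (?w B) (?w (?w ?P)))"
    by (rule teq_sub[OF beta(1) s] teq_sub[OF beta(2) s], simp only: nf)+
  have a1: "teq (S # \<Gamma>) (App (?w (Fst (po_cocone S A B))) ?us) (App (?w (Lam A (PoL (Var 0)))) ?us) (?w ?P)"
    by (rule teq_App[OF s1 refl teq_refl[OF us]]) (simp only: nf)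
  have a2: "teq (S # \<Gamma>) (App (?w (Fst (Snd (po_cocone S A B)))) ?vs) (App (?w (Lam B (PoR (Var 0)))) ?vs) (?w ?P)"
    by (rule teq_App[OF s2 refl teq_refl[OF vs]]) (simp only: nf)
  have T2: "tyeq (S # \<Gamma>) (Eq (?w ?P) (App (?w (Lam A (PoL (Var 0)))) ?us) (App (?w (Lam B (PoR (Var 0)))) ?vs))
     (Eq (?w ?P) (App (?w (Fst (po_cocone S A B))) ?us) (App (?w (Fst (Snd (po_cocone S A B)))) ?vs))"
    by (rule tyeq_sym[OF tyeq_Eq[OF tyeq_refl[OF wty_sub[OF w(6) s]] a1 a2]])
  show "teq \<Gamma> (post S A B u v ?P Y h (po_cocone S A B)) (po_restrict S A B u v Y h) (coconeT S A B u v Y)"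
    unfolding po_restrict_unfold
    by (rule teq_post[OF sp w(6) Y h c teq_open_beta[OF beta(1) xA] teq_open_beta[OF beta(2) xB] teq_trans[OF a1 b1] teq_trans[OF a2 b2]
        teq_conv[OF teq_open_beta[OF beta(3)[unfolded glueT_unfold] e'] T2]])
qed

text \<open>
  The span of a reflexive graph. Its legs are \<open>\<lambda>\<close>-terms, so the general cocones over it and the specific
  type \<open>CocT\<close> agree up to \<open>\<beta>\<close>.
\<close>

definition srcT :: "tm \<Rightarrow> tm \<Rightarrow> tm" where "srcT A E = Lam (edgesT A E) (Fst (Var 0))"
definition tgtT :: "tm \<Rightarrow> tm \<Rightarrow> tm" where "tgtT A E = Lam (edgesT A E) (Fst (Snd (Var 0)))"

lemma has_Sig_U: "has \<Gamma> A (U i) \<Longrightarrow> has (A # \<Gamma>) B (U i) \<Longrightarrow> has \<Gamma> (Sig A B) (U i)"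
  unfolding has_def by (auto intro: ty_Sig)

lemma edge_span: assumes G: "graph i \<Gamma> A E r" shows "span i \<Gamma> (edgesT A E) A A (srcT A E) (tgtT A E)"
proof -
  note w = graphD[OF G]
  have A: "has \<Gamma> A (U i)" using G by (simp add: graph_def)
  have A': "has (A # \<Gamma>) (\<up> A) (U i)" by (rule has_sub[OF A is_subst_shift_1[OF w(5)]]) (simp only: nf)
  note g2 = wty_ctx[OF wty_el[OF A' refl]]
  have e: "has (\<up> A # A # \<Gamma>) (App2 (sub (shift (Suc (Suc 0))) E) (Var (Suc 0)) (Var 0)) (U i)"
    by (assumption | rule w g2 tc | simp only: nf | rule refl)+
  have S: "has \<Gamma> (edgesT A E) (U i)" unfolding edgesT_def using has_Sig_U[OF A has_Sig_U[OF A' e]] by (simp only: nf)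
  note gS = wty_ctx[OF wty_el[OF S refl]]
  have "has \<Gamma> (srcT A E) (Pi (edgesT A E) (\<up> A))" "has \<Gamma> (tgtT A E) (Pi (edgesT A E) (\<up> A))"
    unfolding srcT_def tgtT_def using gS unfolding edgesT_def
    by (simp_all only: nf) (assumption | rule w e tc | simp only: nf | rule refl)+
  then show ?thesis unfolding span_def using A S by blast
qed

lemma coconeT_CocT: assumes G: "graph i \<Gamma> A E r" and Y: "wty \<Gamma> Y"
  shows "tyeq \<Gamma> (CocT A E Y) (coconeT (edgesT A E) A A (srcT A E) (tgtT A E) Y)"
proof -
  note w = graphD[OF G] Y
  show ?thesis unfolding coconeT_def CocT_def coc2T_def edgesT_def srcT_def tgtT_def
    apply (simp only: nf)
    apply (rule tyeq_Sig[OF tyeq_refl])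
     apply (assumption | rule w tc | simp only: nf | rule refl)+
    apply (rule tyeq_Sig[OF tyeq_refl])
     apply (assumption | rule w tc | simp only: nf | rule refl)+
    apply (rule tyeq_Pi[OF tyeq_refl])
     apply (assumption | rule w tc | simp only: nf | rule refl)+
    apply (rule tyeq_Eq[OF tyeq_refl teq_sym[OF teqc_App] teq_sym[OF teqc_App]])
                 apply (assumption | rule w ec tc | simp only: nf | rule refl)+
    done
qed

lemma coc2T_glueT: assumes G: "graph i \<Gamma> A E r" and Y: "wty \<Gamma> Y"
    and p: "has \<Gamma> p (Pi A (\<up> Y))" and q: "has \<Gamma> q (Pi A (\<up> Y))"
  shows "tyeq \<Gamma> (coc2T A E Y p q) (glueT (edgesT A E) (srcT A E) (tgtT A E) Y p q)"
proof -
  note w = graphD[OF G] Y p q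
  show ?thesis unfolding glueT_def coc2T_def edgesT_def srcT_def tgtT_def
    apply (simp only: nf)
    apply (rule tyeq_Pi[OF tyeq_refl])
     apply (assumption | rule w tc | simp only: nf | rule refl)+
    apply (rule tyeq_Eq[OF tyeq_refl teq_sym[OF teqc_App] teq_sym[OF teqc_App]])
                 apply (assumption | rule w ec tc | simp only: nf | rule refl)+
    done
qed

lemma has_coc_path_body:
  assumes G: "graph i \<Gamma> A E r" and Y: "wty \<Gamma> Y"
    and f0: "has \<Gamma> f0 (Pi A (\<up> Y))" and f1: "has \<Gamma> f1 (hom1T A E Y f0)"
  shows "has (edgesT A E # \<Gamma>) (App3 (\<up> f1) (Fst (Var 0)) (Fst (Snd (Var 0))) (Snd (Snd (Var 0))))
     (Eq (\<up> Y) (App (\<up> f0) (Fst (Var 0))) (App (\<up> f0) (Fst (Snd (Var 0)))))"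
  by (insert wty_ctx[OF span_wty(1)[OF edge_span[OF G]]], simp only: nfd gd)
    (assumption | rule graphD[OF G] Y f0 f1[simplified nfd gd] tcd | simp only: nfd | rule refl)+

lemma post_coc_of_hom:
  assumes G: "graph i \<Gamma> A E r" and X: "wty \<Gamma> X" and Y: "wty \<Gamma> Y" and h: "has \<Gamma> h (Pi X (\<up> Y))"
    and f: "has \<Gamma> f (HomT A E r X)"
  shows "teq \<Gamma> (post (edgesT A E) A A (srcT A E) (tgtT A E) X Y h (coc_of_hom A E f)) (comp_coc A E X Y h f) (coconeT (edgesT A E) A A (srcT A E) (tgtT A E) Y)"
proof -
  let ?S = "edgesT A E" and ?w = "\<up>" and ?u = "srcT A E" and ?v = "tgtT A E"
  note sp = edge_span[OF G] note w = span_wty[OF sp] note m = hom_proj[OF f]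
  note g = wty_ctx[OF w(1)] note s = is_subst_shift_1[OF g]
  have r: "has \<Gamma> (coc_path A E (Fst (Snd f))) (glueT ?S ?u ?v X (Fst f) (Fst f))"
    by (rule has_conv[OF has_coc_path[OF G X m(1,2)] coc2T_glueT[OF G X m(1) m(1)]])
  have c: "has \<Gamma> (coc_of_hom A E f) (coconeT ?S A A ?u ?v X)" unfolding coc_of_hom_def by (rule has_coconeT[OF sp X m(1) m(1) r])
  note beta = coconeT_beta[OF sp X m(1) m(1) r, folded coc_of_hom_def]
  have b: "teq (A # \<Gamma>) (App (?w k) (Var 0)) (App (?w (Fst f)) (Var 0)) (?w X)" if "teq \<Gamma> k (Fst f) (Pi A (?w X))" for k
    by (rule teq_open_app[OF that])
  have us: "has (?S # \<Gamma>) (App (?w ?u) (Var 0)) (?w A)" and vs: "has (?S # \<Gamma>) (App (?w ?v) (Var 0)) (?w A)"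
    using has_open_app[OF w(4)] has_open_app[OF w(5)] .
  have pr: "has (?S # \<Gamma>) (Fst (Var 0)) (?w A)" "has (?S # \<Gamma>) (Fst (Snd (Var 0))) (?w A)"
    by (insert g graphD[OF G], simp_all only: edgesT_def nf) (assumption | rule tc | simp only: nf | rule refl)+
  have ub: "teq (?S # \<Gamma>) (App (?w ?u) (Var 0)) (Fst (Var 0)) (?w A)" unfolding srcT_def by (rule teq_wk_beta[OF w(1) pr(1)])
  have vb: "teq (?S # \<Gamma>) (App (?w ?v) (Var 0)) (Fst (Snd (Var 0))) (?w A)" unfolding tgtT_def by (rule teq_wk_beta[OF w(1) pr(2)])
  have x: "teq (?S # \<Gamma>) (App (?w k) z) (App (?w (Fst f)) z') (?w X)" if "teq \<Gamma> k (Fst f) (Pi A (?w X))" "teq (?S # \<Gamma>) z z' (?w A)" for k z z'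
    by (rule teq_App[OF teq_sub[OF that(1) s sub.simps(3)] refl that(2)]) (simp only: nf)
  have p3: "has (?S # \<Gamma>) (App3 (?w (Fst (Snd f))) (Fst (Var 0)) (Fst (Snd (Var 0))) (Snd (Snd (Var 0))))
     (Eq (?w X) (App (?w (Fst f)) (Fst (Var 0))) (App (?w (Fst f)) (Fst (Snd (Var 0)))))"
    by (rule has_coc_path_body[OF G X m(1,2)])
  have T: "tyeq (?S # \<Gamma>) (Eq (?w X) (App (?w (Fst f)) (Fst (Var 0))) (App (?w (Fst f)) (Fst (Snd (Var 0)))))
      (Eq (?w X) (App (?w (Fst (coc_of_hom A E f))) (App (?w ?u) (Var 0))) (App (?w (Fst (Snd (coc_of_hom A E f)))) (App (?w ?v) (Var 0))))"
    by (rule tyeq_sym[OF tyeq_Eq[OF tyeq_refl[OF wty_sub[OF X s]] x[OF beta(1) ub] x[OF beta(2) vb]]])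
  have T2: "tyeq (?S # \<Gamma>) (Eq (?w X) (App (?w (Fst f)) (App (?w ?u) (Var 0))) (App (?w (Fst f)) (App (?w ?v) (Var 0))))
      (Eq (?w X) (App (?w (Fst (coc_of_hom A E f))) (App (?w ?u) (Var 0))) (App (?w (Fst (Snd (coc_of_hom A E f)))) (App (?w ?v) (Var 0))))"
    by (rule tyeq_sym[OF tyeq_Eq[OF tyeq_refl[OF wty_sub[OF X s]] x[OF beta(1) teq_refl[OF us]] x[OF beta(2) teq_refl[OF vs]]]])
  have T3: "tyeq (?S # \<Gamma>) (Eq (?w X) (App (?w (Fst f)) (Fst (Var 0))) (App (?w (Fst f)) (Fst (Snd (Var 0)))))
     (Eq (?w X) (App (?w (Fst f)) (App (?w ?u) (Var 0))) (App (?w (Fst f)) (App (?w ?v) (Var 0))))"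
    by (rule tyeq_trans[OF T tyeq_sym[OF T2]])
  have e: "teq (?S # \<Gamma>) (App (?w (Snd (Snd (coc_of_hom A E f)))) (Var 0)) (App3 (?w (Fst (Snd f))) (Fst (Var 0)) (Fst (Snd (Var 0))) (Snd (Snd (Var 0))))
      (Eq (?w X) (App (?w (Fst (coc_of_hom A E f))) (App (?w ?u) (Var 0))) (App (?w (Fst (Snd (coc_of_hom A E f)))) (App (?w ?v) (Var 0))))"
    by (rule teq_conv[OF teq_open_beta[OF beta(3)[unfolded glueT_unfold coc_path_def wk_sub One_nat_def] has_conv[OF p3 T3]] T2])
  show ?thesis unfolding comp_coc_def comp0_def comp_coc_path_def wk_sub One_nat_def
    by (rule teq_post[OF sp X Y h c b[OF beta(1)] b[OF beta(2)] x[OF beta(1) ub] x[OF beta(2) vb] e])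
qed

section \<open>Existence of reflexive coequalizers\<close>

text \<open>
  The pushout that serves as reflexive coequalizer, and its universal cocone.
\<close>

definition glued :: "tm \<Rightarrow> tm" where
  "glued A = Po (edgesT (vert A) (Fst (Snd A))) (vert A) (vert A) (srcT (vert A) (Fst (Snd A))) (tgtT (vert A) (Fst (Snd A)))"

definition glued_cocone :: "tm \<Rightarrow> tm" where
  "glued_cocone A = po_cocone (edgesT (vert A) (Fst (Snd A))) (vert A) (vert A)"

lemma sub_glued: "sub \<sigma> (glued A) = glued (sub \<sigma> A)"
  unfolding glued_def edgesT_def srcT_def tgtT_def vert_def by (simp only: nf)
lemma sub_glued_cocone: "sub \<sigma> (glued_cocone A) = glued_cocone (sub \<sigma> A)"
  unfolding glued_cocone_def po_cocone_def edgesT_def vert_def by (simp only: nf)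
lemma sub_coc_of_hom: "sub \<sigma> (coc_of_hom A E f) = coc_of_hom (sub \<sigma> A) (sub \<sigma> E) (sub \<sigma> f)"
  unfolding coc_of_hom_def coc_path_def edgesT_def by (simp only: nf)
lemma sub_CocT: "sub \<sigma> (CocT A E Y) = CocT (sub \<sigma> A) (sub \<sigma> E) (sub \<sigma> Y)"
  by (simp only: gd nf)
lemma sub_HomT: "sub \<sigma> (HomT A E r Y) = HomT (sub \<sigma> A) (sub \<sigma> E) (sub \<sigma> r) (sub \<sigma> Y)"
  by (simp only: gd nf)

text \<open>
  Precomposition with \<open>f\<close> followed by the restriction sends \<open>h\<close> to the postcomposition of the cocone of \<open>f\<close>
  with \<open>h\<close>. That cocone is equal to the universal one, so the composite is homotopic to an equivalence, and
  the restriction can be cancelled.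
\<close>

lemma rcoeq_at_glued:
  assumes A: "has \<Gamma> A (RGraph i)" and Y: "wty \<Gamma> Y" and f: "has \<Gamma> f (HomT (vert A) (Fst (Snd A)) (Snd (Snd A)) (glued A))"
    and e: "inh \<Gamma> (Eq (CocT (vert A) (Fst (Snd A)) (glued A)) (coc_of_hom (vert A) (Fst (Snd A)) f) (glued_cocone A))"
  shows "inh \<Gamma> (rcoeq_at A (glued A) Y f)"
proof -
  let ?w = "\<up>" and ?X = "glued A" and ?V = "vert A" and ?E = "Fst (Snd A)" and ?r = "Snd (Snd A)"
  let ?XY = "Pi ?X (?w Y)"
  note G = graphI[OF A] note sp = edge_span[OF G]
  have X: "wty \<Gamma> ?X" unfolding glued_def by (rule wty_Po[OF sp])
  note XY = XY[OF A X Y f] and s = sXY[OF A X Y f] and A' = AXY[OF A X Y f] and f' = fXY[OF A X Y f] and h = hXY[OF A X Y f]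
  note X' = wty_sub[OF X s] and Y' = wty_sub[OF Y s]
  note G' = graphI[OF A'] note sp' = edge_span[OF G'] note K = coconeT_CocT[OF G' Y'] and KX = coconeT_CocT[OF G' X']
  let ?\<Delta> = "?XY # \<Gamma>" and ?V' = "vert (?w A)" and ?E' = "Fst (Snd (?w A))"
  let ?S' = "edgesT ?V' ?E'" and ?u' = "srcT ?V' ?E'" and ?v' = "tgtT ?V' ?E'"
  have e': "inh ?\<Delta> (Eq (CocT ?V' ?E' (?w ?X)) (coc_of_hom ?V' ?E' (?w f)) (glued_cocone (?w A)))"
    by (rule inh_sub[OF e s]) (simp only: sub.simps sub_CocT sub_coc_of_hom sub_glued_cocone sub_vert)
  note E = wty_EqD[OF inh_wty[OF e']]
  have e'': "inh ?\<Delta> (Eq (coconeT ?S' ?V' ?V' ?u' ?v' (?w ?X)) (coc_of_hom ?V' ?E' (?w f)) (glued_cocone (?w A)))"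
    by (rule inh_conv[OF e' tyeq_Eq[OF KX teq_refl[OF E(2)] teq_refl[OF E(3)]]])
  have wX: "?w ?X = Po ?S' ?V' ?V' ?u' ?v'" using sub_glued[of "shift (Suc 0)" A] unfolding glued_def .
  have post: "inh ?\<Delta> (Eq (coconeT ?S' ?V' ?V' ?u' ?v' (?w Y)) (comp_coc ?V' ?E' (?w ?X) (?w Y) (Var 0) (?w f)) (po_restrict ?S' ?V' ?V' ?u' ?v' (?w Y) (Var 0)))"
    by (rule inh_trans[OF inh_sym[OF inh_Eq_refl[OF post_coc_of_hom[OF G' X' Y' h f']]] inh_trans[OF inh_post[OF sp' X' Y' h e'']
         inh_Eq_refl[OF post_po_cocone[OF sp' Y' h[unfolded wX], folded wX glued_cocone_def]]]])
  note P = wty_EqD[OF inh_wty[OF post]]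
  have post': "inh ?\<Delta> (Eq (CocT ?V' ?E' (?w Y)) (comp_coc ?V' ?E' (?w ?X) (?w Y) (Var 0) (?w f)) (po_restrict ?S' ?V' ?V' ?u' ?v' (?w Y) (Var 0)))"
    by (rule inh_conv[OF post tyeq_Eq[OF tyeq_sym[OF K] teq_refl[OF P(2)] teq_refl[OF P(3)]]])
  have CYw: "?w (CocT ?V ?E Y) = CocT ?V' ?E' (?w Y)" by (simp only: sub_CocT sub_vert sub.simps)
  note hom = inh_trans[OF coc_of_hom_restr[OF A X Y f] post'[folded CYw]]
  have F: "has ?\<Delta> (po_restrict ?S' ?V' ?V' ?u' ?v' (?w Y) (Var 0)) (?w (CocT ?V ?E Y))"
    using wty_EqD(3)[OF inh_wty[OF hom]] .
  have eq0: "open_equiv \<Gamma> ?XY (coconeT (edgesT ?V ?E) ?V ?V (srcT ?V ?E) (tgtT ?V ?E) Y) (po_restrict ?S' ?V' ?V' ?u' ?v' (?w Y) (Var 0))"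
    using pushout_open_equiv[OF sp Y] unfolding glued_def
    by (simp only: nf edgesT_def srcT_def tgtT_def vert_def)
  have F0: "has ?\<Delta> (po_restrict ?S' ?V' ?V' ?u' ?v' (?w Y) (Var 0)) (?w (coconeT (edgesT ?V ?E) ?V ?V (srcT ?V ?E) (tgtT ?V ?E) Y))"
    using eq0 unfolding open_equiv_def by blast
  have eq: "open_equiv \<Gamma> ?XY (CocT ?V ?E Y) (po_restrict ?S' ?V' ?V' ?u' ?v' (?w Y) (Var 0))"
    by (rule open_equiv_conv[OF eq0 tyeq_sym[OF coconeT_CocT[OF G Y]] teq_refl[OF F0]])
  show ?thesis unfolding rcoeq_at_open_equiv[OF A X Y f]
    by (rule open_equiv_cancel[OF has_hom_restr[OF A X Y f] F hom open_equiv_coc_of_hom[OF G Y] XY eq])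
qed

text \<open>
  The morphism \<open>f\<close> comes from the universal cocone by the inverse of the restriction. It does not depend
  on the universe level \<open>k\<close> of the types against which the universal property is tested.
\<close>

lemma rcoeq_exists:
  assumes A: "has \<Gamma> A (RGraph i)"
  obtains f where "has \<Gamma> (glued A) (U i)" "has \<Gamma> f (Hom A (Disc (glued A)))" "\<And>k. inh \<Gamma> (is_rcoeq k A (glued A) f)"
proof -
  let ?w = "\<up>" and ?X = "glued A" and ?V = "vert A" and ?E = "Fst (Snd A)" and ?r = "Snd (Snd A)"
  note G = graphI[OF A] note sp = edge_span[OF G] note g = has_ctx[OF A]
  have XU: "has \<Gamma> ?X (U i)" unfolding glued_def by (rule has_Po[OF sp])
  have X: "wty \<Gamma> ?X" unfolding glued_def by (rule wty_Po[OF sp])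
  have c: "has \<Gamma> (glued_cocone A) (CocT ?V ?E ?X)"
    by (rule has_conv[OF has_po_cocone[OF sp, folded glued_def glued_cocone_def] tyeq_sym[OF coconeT_CocT[OF G X]]])
  obtain s where s: "has (CocT ?V ?E ?X # \<Gamma>) s (?w (HomT ?V ?E ?r ?X))"
    and e: "inh (CocT ?V ?E ?X # \<Gamma>) (Eq (?w (CocT ?V ?E ?X)) (sub (s ;; shift (Suc 0)) (coc_of_hom (wk 1 ?V) (wk 1 ?E) (Var 0))) (Var 0))"
    using open_equiv_coc_of_hom[OF G X] unfolding open_equiv_def by blast
  have i: "is_subst (CocT ?V ?E ?X # \<Gamma>) (glued_cocone A ;; Var) \<Gamma>"
    by (rule is_subst_cons[OF is_subst_Var[OF g] has_ctx[OF s] _ chk_has[OF c refl]]) (simp only: nf)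
  let ?f = "sub (glued_cocone A ;; Var) s"
  have f: "has \<Gamma> ?f (HomT ?V ?E ?r ?X)" by (rule has_sub[OF s i]) (simp only: nf)
  have e: "inh \<Gamma> (Eq (CocT ?V ?E ?X) (coc_of_hom ?V ?E ?f) (glued_cocone A))"
    by (rule inh_sub[OF e i]) (simp only: nf sub_coc_of_hom)
  have "inh \<Gamma> (is_rcoeq k A ?X ?f)" for k
    unfolding is_rcoeq_at
  proof (rule inh_Pi[OF wty_U[OF g]])
    assume gU: "\<turnstile> U k # \<Gamma>"
    note sU = is_subst_shift_1[OF gU]
    have Y: "wty (U k # \<Gamma>) (Var 0)" by (rule wty_el[OF has_Var_0[OF gU refl] sub.simps(2)])
    have A': "has (U k # \<Gamma>) (?w A) (RGraph i)" by (rule has_sub[OF A sU]) (simp only: nf RGraph_def)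
    have f': "has (U k # \<Gamma>) (?w ?f) (HomT (vert (?w A)) (Fst (Snd (?w A))) (Snd (Snd (?w A))) (glued (?w A)))"
      by (rule has_sub[OF f sU]) (simp only: sub_HomT sub_vert sub_glued sub.simps)
    have e': "inh (U k # \<Gamma>) (Eq (CocT (vert (?w A)) (Fst (Snd (?w A))) (glued (?w A))) (coc_of_hom (vert (?w A)) (Fst (Snd (?w A))) (?w ?f)) (glued_cocone (?w A)))"
      by (rule inh_sub[OF e sU]) (simp only: sub.simps sub_CocT sub_coc_of_hom sub_glued_cocone sub_vert sub_glued)
    show "inh (U k # \<Gamma>) (rcoeq_at (wk 1 A) (wk 1 ?X) (Var 0) (wk 1 ?f))"
      unfolding wk_sub One_nat_def sub_glued by (rule rcoeq_at_glued[OF A' Y f' e'])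
  qed
  then show thesis by (rule that[OF XU has_conv[OF f Hom_Disc[OF A X]]])
qed

lemma sub_is_rcoeq: "sub \<sigma> (is_rcoeq k A X f) = is_rcoeq k (sub \<sigma> A) (sub \<sigma> X) (sub \<sigma> f)"
  unfolding is_rcoeq_at by (simp only: nf sub_rcoeq_at)
lemma sub_Hom: "sub \<sigma> (Hom A B) = Hom (sub \<sigma> A) (sub \<sigma> B)"
  by (simp only: nf graph_defs)

lemma RGraph_wty: assumes g: "\<turnstile> \<Gamma>" shows "wty \<Gamma> (RGraph i)"
  unfolding RGraph_def apply (simp only: nf)
  by (assumption | rule g tc | simp only: nf | rule refl)+

lemma Hom_ctx:
  assumes g: "\<turnstile> \<Gamma>"
  shows "wty (U j # RGraph i # \<Gamma>) (Hom (Var 1) (Disc (Var 0)))"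
proof -
  note R = RGraph_wty[OF g, of i] note gR = wty_ctx[OF R] note U = wty_U[OF gR, of j] note gU = wty_ctx[OF U]
  have A: "has (U j # RGraph i # \<Gamma>) (Var 1) (RGraph i)" unfolding One_nat_def by (rule has_Var_1[OF gU]) (simp only: nf RGraph_def)
  have X: "wty (U j # RGraph i # \<Gamma>) (Var 0)" by (rule wty_el[OF has_Var_0[OF gU refl] sub.simps(2)])
  show ?thesis by (rule tyeq_wty(2)[OF Hom_Disc[OF A X]])
qed

lemma rcoeq_iff_pushout_closed: "inh [] (Pi (RGraph i) (Pi (U j) (Pi (Hom (Var 1) (Disc (Var 0)))
                 (iffT (is_rcoeq k (Var 2) (Var 1) (Var 0))
                       (is_edge_pushout k (Var 2) (Var 1) (Var 0))))))"
proof (rule inh_Pi[OF RGraph_wty[OF ctx_empty]], rule inh_Pi, rule wty_U, assumption, rule inh_Pi[OF Hom_ctx[OF ctx_empty]])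
  assume g: "\<turnstile> Hom (Var 1) (Disc (Var 0)) # U j # RGraph i # []"
  have A: "has (Hom (Var 1) (Disc (Var 0)) # U j # RGraph i # []) (Var 2) (RGraph i)"
    unfolding nums by (rule has_Var_2[OF g[unfolded nums]]) (simp only: nf RGraph_def)
  have X: "wty (Hom (Var 1) (Disc (Var 0)) # U j # RGraph i # []) (Var 1)"
    unfolding nums by (rule wty_el[OF has_Var_1[OF g[unfolded nums] refl] sub.simps(2)])
  have f: "has (Hom (Var 1) (Disc (Var 0)) # U j # RGraph i # []) (Var 0) (Hom (Var 2) (Disc (Var 1)))"
    by (rule has_Var_0[OF g]) (simp only: nf sub_Hom sub_Disc)
  show "inh (Hom (Var 1) (Disc (Var 0)) # U j # RGraph i # []) (iffT (is_rcoeq k (Var 2) (Var 1) (Var 0)) (is_edge_pushout k (Var 2) (Var 1) (Var 0)))"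
    by (rule rcoeq_iff_pushout[OF A X f])
qed

lemma is_rcoeq_wty:
  assumes A: "has \<Gamma> A (RGraph i)" and X: "wty \<Gamma> X" and f: "has \<Gamma> f (Hom A (Disc X))"
  shows "wty \<Gamma> (is_rcoeq k A X f)"
proof -
  note g = has_ctx[OF A] and U = wty_U[OF has_ctx[OF A], of k]
  note gU = wty_ctx[OF U] note s = is_subst_shift_1[OF gU]
  have fT: "has \<Gamma> f (HomT (vert A) (Fst (Snd A)) (Snd (Snd A)) X)" by (rule has_conv[OF f tyeq_sym[OF Hom_Disc[OF A X]]])
  have Y: "wty (U k # \<Gamma>) (Var 0)" by (rule wty_el[OF has_Var_0[OF gU refl] sub.simps(2)])
  have A': "has (U k # \<Gamma>) (\<up> A) (RGraph i)" by (rule has_sub[OF A s]) (simp only: nf RGraph_def)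
  have f': "has (U k # \<Gamma>) (\<up> f) (HomT (vert (\<up> A)) (Fst (Snd (\<up> A))) (Snd (Snd (\<up> A))) (\<up> X))"
    by (rule has_sub[OF fT s]) (simp only: sub_HomT sub_vert sub.simps)
  show ?thesis unfolding is_rcoeq_at wk_sub One_nat_def by (rule wty_Pi[OF U rcoeq_at_wty[OF A' wty_sub[OF X s] Y f']])
qed

text \<open>
  The closed statement speaks of the two projections of an applied \<open>\<lambda>\<close>-term, which have to be reduced.
\<close>

lemma is_rcoeq_cong:
  assumes A: "has \<Gamma> A (RGraph i)" and X: "teq \<Gamma> X X' (U j)" and f: "teq \<Gamma> f f' (Hom A (Disc X))"
  shows "tyeq \<Gamma> (is_rcoeq k A X f) (is_rcoeq k A X' f')"
proof -
  let ?w = "\<up>"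
  note g = has_ctx[OF A] note gU = wty_ctx[OF wty_U[OF g, of j]]
  have A1: "has (U j # \<Gamma>) (?w A) (RGraph i)" by (rule has_sub[OF A is_subst_shift_1[OF gU]]) (simp only: nf RGraph_def)
  have X1: "wty (U j # \<Gamma>) (Var 0)" by (rule wty_el[OF has_Var_0[OF gU refl] sub.simps(2)])
  have H: "wty (U j # \<Gamma>) (Hom (?w A) (Disc (Var 0)))" by (rule tyeq_wty(2)[OF Hom_Disc[OF A1 X1]])
  note g2 = wty_ctx[OF H] note s = is_subst_shift_1[OF g2]
  have A2: "has (Hom (?w A) (Disc (Var 0)) # U j # \<Gamma>) (?w (?w A)) (RGraph i)" by (rule has_sub[OF A1 s]) (simp only: nf RGraph_def)
  have X2: "wty (Hom (?w A) (Disc (Var 0)) # U j # \<Gamma>) (Var (Suc 0))" using wty_sub[OF X1 s] by (simp only: nf)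
  have f2: "has (Hom (?w A) (Disc (Var 0)) # U j # \<Gamma>) (Var 0) (Hom (?w (?w A)) (Disc (Var (Suc 0))))"
    by (rule has_Var_0[OF g2]) (simp only: nf sub_Hom sub_Disc)
  have W: "wty (Hom (?w A) (Disc (Var 0)) # U j # \<Gamma>) (is_rcoeq k (?w (?w A)) (Var (Suc 0)) (Var 0))"
    by (rule is_rcoeq_wty[OF A2 X2 f2])
  have "substeq (Hom (?w A) (Disc (Var 0)) # U j # \<Gamma>) (f ;; X ;; Var) (f' ;; X' ;; Var) \<Gamma>"
    by (rule substeqc_cons[OF substeqc_cons[OF substeq_refl[OF is_subst_Var[OF g]] gU _ teqcI[OF X]] g2 _ teqcI[OF f]]) (simp_all only: nf sub_Hom sub_Disc)
  from functional_wty[OF this W] show ?thesis by (simp only: sub_is_rcoeq nf)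
qed

lemma rcoeq_exists_closed: "\<exists>c. has [] c (Pi (RGraph i) (Sig (U i) (Hom (Var 1) (Disc (Var 0))))) \<and>
   (\<forall>k. inh [] (Pi (RGraph i) (is_rcoeq k (Var 0) (Fst (App (wk 1 c) (Var 0))) (Snd (App (wk 1 c) (Var 0))))))"
proof -
  let ?G = "RGraph i # []" and ?w = "\<up>"
  note R = RGraph_wty[OF ctx_empty, of i] note g = wty_ctx[OF R]
  have A: "has ?G (Var 0) (RGraph i)" by (rule has_Var_0[OF g]) (simp only: nf RGraph_def)
  obtain f where XU: "has ?G (glued (Var 0)) (U i)" and f: "has ?G f (Hom (Var 0) (Disc (glued (Var 0))))"
    and e: "\<And>k. inh ?G (is_rcoeq k (Var 0) (glued (Var 0)) f)" by (rule rcoeq_exists[OF A]) blast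
  let ?X = "glued (Var 0)" and ?S = "Sig (U i) (Hom (Var 1) (Disc (Var 0)))"
  have S: "wty ?G ?S" by (rule wty_Sig[OF wty_U[OF g] Hom_ctx[OF ctx_empty]])
  have I: "inst (Hom (Var 1) (Disc (Var 0))) ?X = Hom (Var 0) (Disc ?X)" by (simp only: inst_def sub_Hom sub_Disc nf)
  have P: "has ?G (Pair ?X f) ?S" by (rule chkD[OF chk_Pair[OF chk_has[OF XU refl] I chk_has[OF f refl]] S])
  let ?c = "Lam (RGraph i) (Pair ?X f)"
  have c: "has [] ?c (Pi (RGraph i) ?S)" by (rule has_Lam[OF R P])
  have b: "teq ?G (Pair ?X f) (App (wk 1 ?c) (Var 0)) ?S" using teq_sym[OF teq_wk_beta[OF R P]] by (simp only: wk_sub One_nat_def)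
  note bp = teq_beta_pair[OF S chk_has[OF XU refl] I chk_has[OF f refl]]
  have bX: "teq ?G ?X (Fst (App (wk 1 ?c) (Var 0))) (U i)" by (rule teq_trans[OF teq_sym[OF bp(1)] teq_Fst[OF b refl]])
  have T: "tyeq ?G (inst (Hom (Var 1) (Disc (Var 0))) (Fst (Pair ?X f))) (Hom (Var 0) (Disc ?X))"
    using functional_type[OF Hom_ctx[OF ctx_empty] bp(1)] unfolding I .
  have bf: "teq ?G f (Snd (App (wk 1 ?c) (Var 0))) (Hom (Var 0) (Disc ?X))"
    by (rule teq_trans[OF teq_sym[OF bp(2)] teq_conv[OF teq_Snd[OF b refl refl] T]])
  have "inh [] (Pi (RGraph i) (is_rcoeq k (Var 0) (Fst (App (wk 1 ?c) (Var 0))) (Snd (App (wk 1 ?c) (Var 0)))))" for k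
    by (rule inh_Pi[OF R inh_conv[OF e is_rcoeq_cong[OF A bX bf]]])
  with c show ?thesis by blast
qed

lemma inhD: "inh \<Gamma> T \<Longrightarrow> \<exists>t. \<Gamma> \<turnstile> t \<^bold>: T" unfolding inh_def has_def by blast

theorem mainTheorem2:
  shows
    "(\<forall>i j k. \<exists>t.
        [] \<turnstile> t \<^bold>: Pi (RGraph i) (Pi (U j) (Pi (Hom (Var 1) (Disc (Var 0)))
                 (iffT (is_rcoeq k (Var 2) (Var 1) (Var 0))
                       (is_edge_pushout k (Var 2) (Var 1) (Var 0))))))
     \<and> (\<forall>i. \<exists>c.
        [] \<turnstile> c \<^bold>: Pi (RGraph i) (Sig (U i) (Hom (Var 1) (Disc (Var 0)))) \<and>
        (\<forall>k. \<exists>t.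
          [] \<turnstile> t \<^bold>: Pi (RGraph i)
                 (is_rcoeq k (Var 0) (Fst (App (wk 1 c) (Var 0))) (Snd (App (wk 1 c) (Var 0))))))"
  using inhD[OF rcoeq_iff_pushout_closed] rcoeq_exists_closed unfolding has_def by (blast dest: inhD)

end
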